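(* Let $M$ be a II$_1$ factor and let $\mathcal{U}$ be a free ultrafilter on $\mathbb{N}$. If $M$ is generated (as a von Neumann algebra) by a countable set of unitaries $\{u_i\}_{i\in\mathbb{N}}$ such that $u_i\sim^{\mathcal{U}}u_j$ for all $i\neq j$, then $M$ is singly generated.
   Context: Here $M$ carries its faithful normal tracial state $\tau$. A unitary $w$ in a tracial von Neumann algebra is called Haar if $\tau(w^m)=0$ for all non-zero integers $m$. $M^{\mathcal{U}}$ denotes the tracial ultrapower of $M$ over $\mathcal{U}$, with $M$ embedded in $M^{\mathcal{U}}$ by constant sequences. For unitaries $u,v\in M$, write $u\sim^{\mathcal{U}}v$ if there exist an integer $k>0$ and Haar unitaries $u=w_0,w_1,\ldots,w_k=v$ such that $w_i\in M^{\mathcal{U}}$ for each $i$ and $[w_i,w_{i+1}]=w_iw_{i+1}-w_{i+1}w_i=0$ for $i=0,\ldots,k-1$. (In particular $u\sim^{\mathcal{U}} v$ requires $u$ and $v$ to be Haar.) A von Neumann algebra $M$ is singly generated if there is $x\in M$ such that $M$ is the von Neumann algebra generated by $x$. *)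

theory Defs
  imports "HOL-Analysis.Analysis"
begin

section \<open>Complex Hilbert spaces and their bounded operators\<close>

text \<open>The inner product is linear in the first argument.\<close>

class complex_hilbert = banach +
  fixes scaleC :: "complex \<Rightarrow> 'a \<Rightarrow> 'a"  (infixr \<open>*\<^sub>C\<close> 75)
    and cinner :: "'a \<Rightarrow> 'a \<Rightarrow> complex"
  assumes scaleC_add_right: "a *\<^sub>C (x + y) = a *\<^sub>C x + a *\<^sub>C y"
    and scaleC_add_left: "(a + b) *\<^sub>C x = a *\<^sub>C x + b *\<^sub>C x"
    and scaleC_scaleC: "a *\<^sub>C b *\<^sub>C x = (a * b) *\<^sub>C x"
    and scaleC_of_real: "complex_of_real r *\<^sub>C x = r *\<^sub>R x"
    and cinner_commute: "cinner x y = cnj (cinner y x)"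
    and cinner_add_left: "cinner (x + y) z = cinner x z + cinner y z"
    and cinner_scaleC_left: "cinner (a *\<^sub>C x) y = a * cinner x y"
    and cinner_self: "cinner x x = complex_of_real ((norm x)\<^sup>2)"

instantiation complex :: complex_hilbert
begin
definition scaleC_complex :: "complex \<Rightarrow> complex \<Rightarrow> complex"
  where "scaleC_complex a x = a * x"
definition cinner_complex :: "complex \<Rightarrow> complex \<Rightarrow> complex"
  where "cinner_complex x y = x * cnj y"
instance
  by standard
    (auto simp: scaleC_complex_def cinner_complex_def algebra_simps scaleR_conv_of_real
      simp flip: complex_norm_square)
end

lemma cinner_scaleC_right:
  fixes x y :: "'h::complex_hilbert"
  shows "cinner x (a *\<^sub>C y) = cnj a * cinner x y"
  by (metis cinner_commute cinner_scaleC_left complex_cnj_mult)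

lemma norm_scaleC:
  fixes x :: "'h::complex_hilbert"
  shows "norm (a *\<^sub>C x) = cmod a * norm x"
proof -
  have "complex_of_real ((norm (a *\<^sub>C x))\<^sup>2) = (a * cnj a) * cinner x x"
    by (simp only: cinner_self [symmetric] cinner_scaleC_left cinner_scaleC_right mult.assoc mult.left_commute)
  also have "\<dots> = complex_of_real ((cmod a * norm x)\<^sup>2)"
    by (simp only: cinner_self complex_norm_square [symmetric] of_real_mult power_mult_distrib)
  finally show ?thesis
    by (simp only: of_real_eq_iff) (simp add: power2_eq_iff_nonneg)
qed

lemma bounded_linear_scaleC: "bounded_linear (scaleC a :: 'h::complex_hilbert \<Rightarrow> 'h)"
proof (rule bounded_linear_intro [where K = "cmod a"])
  fix r :: real and x :: 'h
  show "a *\<^sub>C r *\<^sub>R x = r *\<^sub>R a *\<^sub>C x"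
    by (simp add: scaleC_of_real [symmetric] scaleC_scaleC mult.commute)
qed (simp_all add: scaleC_add_right norm_scaleC mult.commute)

text \<open>Operators are real-linear \<open>blinfun\<close>s; \<open>B(H)\<close> is the set of the complex-linear ones.\<close>

type_synonym 'h op = "'h \<Rightarrow>\<^sub>L 'h"

definition bounded_operators :: "'h::complex_hilbert op set" where
  "bounded_operators = {T :: 'h op. \<forall>a x. T (a *\<^sub>C x) = a *\<^sub>C T x}"

definition scalar_op :: "complex \<Rightarrow> 'h::complex_hilbert op" where
  "scalar_op a = Blinfun (scaleC a)"

lemma scalar_op_apply: "scalar_op a x = a *\<^sub>C x"
  by (simp add: scalar_op_def bounded_linear_Blinfun_apply bounded_linear_scaleC)

text \<open>On \<open>B(H)\<close> existence and uniqueness of the adjoint are the Riesz representation theorem;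
  outside \<open>B(H)\<close> the value is unspecified.\<close>

definition adj :: "'h::complex_hilbert op \<Rightarrow> 'h op" where
  "adj T = (THE S :: 'h op. \<forall>x y. cinner (T x) y = cinner x (S y))"

definition op_le :: "'h::complex_hilbert op \<Rightarrow> 'h op \<Rightarrow> bool" where
  "op_le S T \<longleftrightarrow> (\<forall>x. cinner ((T - S) x) x \<in> \<real>\<^sub>\<ge>\<^sub>0)"

definition unitary_op :: "'h::complex_hilbert op \<Rightarrow> bool" where
  "unitary_op u \<longleftrightarrow> u \<in> bounded_operators \<and> adj u o\<^sub>L u = id_blinfun \<and> u o\<^sub>L adj u = id_blinfun"


section \<open>Von Neumann algebras\<close>

definition commutant :: "'h::complex_hilbert op set \<Rightarrow> 'h op set" where
  "commutant S = {T \<in> bounded_operators. \<forall>s\<in>S. T o\<^sub>L s = s o\<^sub>L T}"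

text \<open>A commutant is automatically a unital subalgebra, so a self-adjoint set that equals its
  bicommutant is a unital \<open>*\<close>-subalgebra of \<open>B(H)\<close>.\<close>

definition von_neumann_algebra :: "'h::complex_hilbert op set \<Rightarrow> bool" where
  "von_neumann_algebra M \<longleftrightarrow>
     M \<subseteq> bounded_operators \<and> (\<forall>x\<in>M. adj x \<in> M) \<and> commutant (commutant M) = M"

definition vn_generated :: "'h::complex_hilbert op set \<Rightarrow> 'h op set" where
  "vn_generated S = \<Inter>{N. von_neumann_algebra N \<and> S \<subseteq> N}"

definition singly_generated :: "'h::complex_hilbert op set \<Rightarrow> bool" where
  "singly_generated M \<longleftrightarrow> (\<exists>x\<in>M. M = vn_generated {x})"

definition factor :: "'h::complex_hilbert op set \<Rightarrow> bool" where
  "factor M \<longleftrightarrow> von_neumann_algebra M \<and> M \<inter> commutant M = range scalar_op"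

definition op_lub_in :: "'h::complex_hilbert op set \<Rightarrow> 'h op set \<Rightarrow> 'h op \<Rightarrow> bool" where
  "op_lub_in M D x \<longleftrightarrow>
     x \<in> M \<and> (\<forall>d\<in>D. op_le d x) \<and> (\<forall>y\<in>M. (\<forall>d\<in>D. op_le d y) \<longrightarrow> op_le x y)"

definition normal_on :: "'h::complex_hilbert op set \<Rightarrow> ('h op \<Rightarrow> complex) \<Rightarrow> bool" where
  "normal_on M \<tau> \<longleftrightarrow>
     (\<forall>D x. D \<subseteq> {d\<in>M. op_le 0 d} \<and> D \<noteq> {} \<and> (\<forall>a\<in>D. \<forall>b\<in>D. \<exists>c\<in>D. op_le a c \<and> op_le b c)
        \<and> op_lub_in M D x \<longrightarrow> Re (\<tau> x) = (SUP d\<in>D. Re (\<tau> d)))"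

definition faithful_normal_tracial_state ::
    "'h::complex_hilbert op set \<Rightarrow> ('h op \<Rightarrow> complex) \<Rightarrow> bool" where
  "faithful_normal_tracial_state M \<tau> \<longleftrightarrow>
     (\<forall>x\<in>M. \<forall>y\<in>M. \<tau> (x + y) = \<tau> x + \<tau> y) \<and>
     (\<forall>a. \<forall>x\<in>M. \<tau> (scalar_op a o\<^sub>L x) = a * \<tau> x) \<and>
     (\<forall>x\<in>M. \<tau> (adj x o\<^sub>L x) \<in> \<real>\<^sub>\<ge>\<^sub>0) \<and>
     \<tau> id_blinfun = 1 \<and>
     (\<forall>x\<in>M. \<forall>y\<in>M. \<tau> (x o\<^sub>L y) = \<tau> (y o\<^sub>L x)) \<and>
     (\<forall>x\<in>M. \<tau> (adj x o\<^sub>L x) = 0 \<longrightarrow> x = 0) \<and>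
     normal_on M \<tau>"

text \<open>A II\<open>\<^sub>1\<close> factor is an infinite-dimensional factor with a faithful normal tracial state, which
  is then unique. The span is the real one; a complex vector space is infinite-dimensional over
  the complex numbers iff it is so over the reals.\<close>

definition II1_factor :: "'h::complex_hilbert op set \<Rightarrow> ('h op \<Rightarrow> complex) \<Rightarrow> bool" where
  "II1_factor M \<tau> \<longleftrightarrow>
     factor M \<and> \<not> (\<exists>B. finite B \<and> M \<subseteq> span B) \<and> faithful_normal_tracial_state M \<tau>"


section \<open>Tracial ultrapowers\<close>

definition free_ultrafilter :: "nat filter \<Rightarrow> bool" where
  "free_ultrafilter U \<longleftrightarrow>
     U \<noteq> bot \<and> (\<forall>P. eventually P U \<or> eventually (\<lambda>n. \<not> P n) U) \<and> (\<forall>m. eventually (\<lambda>n. n \<noteq> m) U)"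

definition norm2 :: "('h::complex_hilbert op \<Rightarrow> complex) \<Rightarrow> 'h op \<Rightarrow> real" where
  "norm2 \<tau> x = sqrt (Re (\<tau> (adj x o\<^sub>L x)))"

definition bounded_seqs :: "'h::complex_hilbert op set \<Rightarrow> (nat \<Rightarrow> 'h op) set" where
  "bounded_seqs M = {x. range x \<subseteq> M \<and> bounded (range x)}"

locale tracial_ultrapower =
  fixes M :: "'h::complex_hilbert op set" and \<tau> :: "'h op \<Rightarrow> complex" and U :: "nat filter"
begin

definition up_rel :: "((nat \<Rightarrow> 'h op) \<times> (nat \<Rightarrow> 'h op)) set" where
  "up_rel = {(x, y). x \<in> bounded_seqs M \<and> y \<in> bounded_seqs M \<and>
     ((\<lambda>n. norm2 \<tau> (x n - y n)) \<longlongrightarrow> 0) U}"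

definition up_carrier :: "(nat \<Rightarrow> 'h op) set set" where
  "up_carrier = bounded_seqs M // up_rel"

definition up_class :: "(nat \<Rightarrow> 'h op) \<Rightarrow> (nat \<Rightarrow> 'h op) set" where
  "up_class x = up_rel `` {x}"

definition up_embed :: "'h op \<Rightarrow> (nat \<Rightarrow> 'h op) set" where
  "up_embed a = up_class (\<lambda>_. a)"

definition up_adj :: "(nat \<Rightarrow> 'h op) set \<Rightarrow> (nat \<Rightarrow> 'h op) set" where
  "up_adj X = (\<Union>x\<in>X. up_class (\<lambda>n. adj (x n)))"

definition up_mult :: "(nat \<Rightarrow> 'h op) set \<Rightarrow> (nat \<Rightarrow> 'h op) set \<Rightarrow> (nat \<Rightarrow> 'h op) set" where
  "up_mult X Y = (\<Union>x\<in>X. \<Union>y\<in>Y. up_class (\<lambda>n. x n o\<^sub>L y n))"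

definition up_diff :: "(nat \<Rightarrow> 'h op) set \<Rightarrow> (nat \<Rightarrow> 'h op) set \<Rightarrow> (nat \<Rightarrow> 'h op) set" where
  "up_diff X Y = (\<Union>x\<in>X. \<Union>y\<in>Y. up_class (\<lambda>n. x n - y n))"

definition up_trace :: "(nat \<Rightarrow> 'h op) set \<Rightarrow> complex" where
  "up_trace X = (THE l. \<forall>x\<in>X. ((\<lambda>n. \<tau> (x n)) \<longlongrightarrow> l) U)"

definition up_unitary :: "(nat \<Rightarrow> 'h op) set \<Rightarrow> bool" where
  "up_unitary X \<longleftrightarrow> X \<in> up_carrier \<and>
     up_mult (up_adj X) X = up_embed id_blinfun \<and> up_mult X (up_adj X) = up_embed id_blinfun"

primrec up_power :: "(nat \<Rightarrow> 'h op) set \<Rightarrow> nat \<Rightarrow> (nat \<Rightarrow> 'h op) set" where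
  "up_power X 0 = up_embed id_blinfun"
| "up_power X (Suc n) = up_mult X (up_power X n)"

text \<open>Only used for unitaries, whose inverse is the adjoint.\<close>

definition up_int_power :: "(nat \<Rightarrow> 'h op) set \<Rightarrow> int \<Rightarrow> (nat \<Rightarrow> 'h op) set" where
  "up_int_power X m = (if m \<ge> 0 then up_power X (nat m) else up_power (up_adj X) (nat (- m)))"

definition up_haar :: "(nat \<Rightarrow> 'h op) set \<Rightarrow> bool" where
  "up_haar X \<longleftrightarrow> up_unitary X \<and> (\<forall>m::int. m \<noteq> 0 \<longrightarrow> up_trace (up_int_power X m) = 0)"

definition up_commutator :: "(nat \<Rightarrow> 'h op) set \<Rightarrow> (nat \<Rightarrow> 'h op) set \<Rightarrow> (nat \<Rightarrow> 'h op) set" where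
  "up_commutator X Y = up_diff (up_mult X Y) (up_mult Y X)"

definition haar_connected :: "'h op \<Rightarrow> 'h op \<Rightarrow> bool" where
  "haar_connected u v \<longleftrightarrow>
     (\<exists>(k::nat) w. k > 0 \<and> w 0 = up_embed u \<and> w k = up_embed v \<and>
        (\<forall>i\<le>k. up_haar (w i)) \<and> (\<forall>i<k. up_commutator (w i) (w (Suc i)) = up_embed 0))"

end

end

theory Submission
  imports Defs
begin

text \<open>Fix the Haar unitary \<open>u = u\<^sub>0\<close>. Halving spectral projections of \<open>u\<close> gives partitions of unity \<open>atom m i\<close>
  with traces \<open>2\<^sup>-\<^sup>m\<close>, and partial isometries between a few of them generate matrix units \<open>e m i\<close> for all dyadic
  levels. A finite set of elements of \<open>M\<close> with few non-zero entries with respect to a fine level fits into a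
  corner \<open>f r\<close>, and one operator \<open>a + i b\<close> remembers all the \<open>s r\<close> together with one element in each of the
  orthogonal corners \<open>f r\<close>.

  It remains to determine each \<open>u\<^sub>j\<close> by countably many sparse elements. Represent a chain in the ultrapower from
  \<open>u\<close> to \<open>u\<^sub>j\<close> by sequences of unitaries \<open>v\<^sub>0, \<dots>, v\<^sub>k\<^sub>+\<^sub>1\<close> that asymptotically are Haar and commute successively.
  Since the \<open>*\<close>-moments of \<open>v\<^sub>l\<close> tend to those of \<open>u\<close>, the atoms of \<open>u\<close> have counterparts near the algebra of
  \<open>v\<^sub>l\<close>; asymptotic commutation lets one perturb them so that successive partitions have a common dyadic refinement,
  and the last partition almost commutes with \<open>u\<^sub>j\<close>, which is therefore 2-norm close to a block diagonal \<open>x\<close>.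
  Diagonalise the partitions successively in the \<open>e m i\<close>, by unitaries \<open>T\<^sub>l\<close>: then all \<open>T\<^sub>l\<^sub>+\<^sub>1 T\<^sub>l\<^sup>*\<close> and \<open>T x T\<^sup>*\<close> are block diagonal with blocks of trace at
  most \<open>4 / 2\<^sup>m\<close>, hence sparse. An operator commuting with all stored elements commutes, after conjugation by
  a fixed unitary of \<open>M\<close>, with every \<open>x\<close> and hence with every \<open>u\<^sub>j\<close>.\<close>

section \<open>Inner products\<close>

text \<open>Sparsity is what makes one operator enough. At level \<open>n\<close> an operator has
  \<open>4 ^ n\<close> entries, and a corner \<open>f r\<close> offers a fixed fraction of that
  number as slots, whereas an operator whose blocks have trace at most \<open>4 / 2 ^ m\<close> has
  at most the fraction \<open>4 / 2 ^ m\<close> of its entries non-zero at every fine level. Since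
  \<open>m\<close> may be chosen after \<open>r\<close> and after the length of the chain, the
  elements of one run always fit. The obstacle is that a generator is reached only through unitaries
  known by their moments, so exact spectral projections and a common diagonalisation are not at hand
  along the chain. Each step therefore works with *-polynomials, whose traces converge, and repairs
  the result to exact projections. These are given dyadic traces, since otherwise they could not be
  rotated onto sums of the \<open>e m i\<close>. One run determines a generator only up to a 2-norm
  error, so there is a run for each pair of a generator and a precision. The runs use different
  \<open>m\<close>; the quotients of their tower unitaries are sparse as well and are stored
  too.\<close>

lemma cinner_add_right: "cinner x (y + z) = cinner x y + cinner x (z::'h::complex_hilbert)"
  by (metis cinner_add_left cinner_commute complex_cnj_add)

lemma scaleC_zero_left [simp]: "0 *\<^sub>C x = (0::'h::complex_hilbert)"
  by (metis of_real_0 scaleC_of_real scaleR_zero_left)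

lemma scaleC_one [simp]: "1 *\<^sub>C x = (x::'h::complex_hilbert)"
  by (metis of_real_1 scaleC_of_real scaleR_one)

lemma scaleC_zero_right [simp]: "a *\<^sub>C 0 = (0::'h::complex_hilbert)"
  by (metis add_cancel_right_right add_0 scaleC_add_right)

lemma scaleC_minus_right: "a *\<^sub>C (- x) = - (a *\<^sub>C (x::'h::complex_hilbert))"
  by (metis add.right_inverse add_eq_0_iff scaleC_add_right scaleC_zero_right)

lemma scaleC_diff_right: "a *\<^sub>C (x - y) = a *\<^sub>C x - a *\<^sub>C (y::'h::complex_hilbert)"
  using scaleC_add_right[of a x "- y"] by (simp add: scaleC_minus_right)

lemma cinner_zero_left [simp]: "cinner 0 y = (0::complex)" for y :: "'h::complex_hilbert"
  by (metis add_cancel_right_right add_0 cinner_add_left)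

lemma cinner_zero_right [simp]: "cinner y 0 = (0::complex)" for y :: "'h::complex_hilbert"
  by (metis cinner_commute cinner_zero_left complex_cnj_zero)

lemma cinner_minus_left: "cinner (- x) y = - cinner x (y::'h::complex_hilbert)"
  by (metis add.right_inverse add_eq_0_iff cinner_add_left cinner_zero_left)

lemma cinner_minus_right: "cinner y (- x) = - cinner y (x::'h::complex_hilbert)"
  by (metis cinner_commute cinner_minus_left complex_cnj_minus)

lemma cinner_diff_left: "cinner (x - z) y = cinner x y - cinner z (y::'h::complex_hilbert)"
  using cinner_add_left[of x "- z" y] by (simp add: cinner_minus_left)

lemma cinner_diff_right: "cinner y (x - z) = cinner y x - cinner y (z::'h::complex_hilbert)"
  using cinner_add_right[of y x "- z"] by (simp add: cinner_minus_right)

lemmas cinner_linear = cinner_add_left cinner_add_right cinner_diff_left cinner_diff_right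
  cinner_minus_left cinner_minus_right cinner_scaleC_left cinner_scaleC_right

lemma cinner_scaleR_left: "cinner (r *\<^sub>R x) y = complex_of_real r * cinner x (y::'h::complex_hilbert)"
  by (metis cinner_scaleC_left scaleC_of_real)

lemma cinner_scaleR_right: "cinner x (r *\<^sub>R y) = complex_of_real r * cinner x (y::'h::complex_hilbert)"
  by (metis cinner_scaleC_right complex_cnj_complex_of_real scaleC_of_real)

lemma Re_cinner_commute: "Re (cinner y x) = Re (cinner x (y::'h::complex_hilbert))"
  by (subst cinner_commute) simp

lemma Re_cinner_self [simp]: "Re (cinner x x) = (norm (x::'h::complex_hilbert))\<^sup>2"
  by (simp add: cinner_self)

lemma norm_add_sq: "(norm (x + y))\<^sup>2 = (norm x)\<^sup>2 + (norm y)\<^sup>2 + 2 * Re (cinner x (y::'h::complex_hilbert))"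
proof -
  have "Re (cinner (x + y) (x + y)) = (norm x)\<^sup>2 + (norm y)\<^sup>2 + 2 * Re (cinner x y)"
    using Re_cinner_commute[of x y] by (simp add: cinner_add_left cinner_add_right)
  then show ?thesis by simp
qed

lemma norm_diff_sq: "(norm (x - y))\<^sup>2 = (norm x)\<^sup>2 + (norm y)\<^sup>2 - 2 * Re (cinner x (y::'h::complex_hilbert))"
  using norm_add_sq[of x "- y"] by (simp add: cinner_minus_right)

text \<open>The first-order condition at a minimum. The shifted denominator in
  \<open>- A / (B + 1)\<close> avoids a separate case \<open>B = 0\<close>.\<close>

lemma linear_le_quadratic_zero:
  fixes A B :: real
  assumes "\<And>t. 0 \<le> 2 * t * A + t\<^sup>2 * B" and "0 \<le> B"
  shows "A = 0"
proof (rule ccontr)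
  assume "A \<noteq> 0"
  have "0 \<le> 2 * (- A / (B + 1)) * A + (- A / (B + 1))\<^sup>2 * B" by (rule assms(1))
  also have "\<dots> = - (A\<^sup>2 * (B + 2)) / (B + 1)\<^sup>2"
    using assms(2) by (simp add: divide_simps power2_eq_square) (simp add: algebra_simps)
  also have "\<dots> < 0" using assms(2) \<open>A \<noteq> 0\<close> by (simp add: divide_neg_pos mult_pos_pos)
  finally show False by simp
qed

lemma Re_cinner_le: "\<bar>Re (cinner x y)\<bar> \<le> norm x * norm (y::'h::complex_hilbert)"
proof (cases "y = 0")
  case False
  then have ny: "norm y > 0" by simp
  have key: "s * Re (cinner x y) \<le> norm x * norm y" if "s = 1 \<or> s = -1" for s :: real
  proof -
    have ss: "s * s = 1" using that by auto
    have "0 \<le> (norm ((norm y) *\<^sub>R x - (s * norm x) *\<^sub>R y))\<^sup>2" by simp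
    also have "\<dots> = 2 * (norm x)\<^sup>2 * (norm y)\<^sup>2 - 2 * norm x * norm y * (s * Re (cinner x y))"
      by (simp add: norm_diff_sq cinner_scaleR_left cinner_scaleR_right power_mult_distrib abs_mult algebra_simps)
        (use ss in \<open>auto simp: power2_eq_square abs_if algebra_simps\<close>)
    finally have "norm x * norm y * (s * Re (cinner x y)) \<le> norm x * norm y * (norm x * norm y)"
      by (simp add: power2_eq_square algebra_simps)
    then show ?thesis
      by (cases "x = 0") (use ny in \<open>auto simp: mult_le_cancel_left\<close>)
  qed
  show ?thesis using key[of 1] key[of "-1"] by auto
qed simp

text \<open>A phase \<open>u\<close> that makes \<open>u * cinner x y\<close> equal to its modulus
  reduces the complex estimate to \<open>Re_cinner_le\<close>.\<close>

lemma norm_cinner_le: "cmod (cinner x y) \<le> norm x * norm (y::'h::complex_hilbert)"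
proof -
  define c where "c = cinner x y"
  define u where "u = (if c = 0 then 1 else cnj c / cmod c)"
  have u: "cmod u = 1" by (auto simp: u_def norm_divide)
  have "u * c = cmod c"
    by (auto simp: u_def complex_norm_square[symmetric] power2_eq_square divide_simps)
      (metis complex_norm_square mult.commute of_real_mult power2_eq_square)
  then have "Re (cinner (u *\<^sub>C x) y) = cmod c" by (simp add: cinner_scaleC_left c_def)
  then show ?thesis
    using Re_cinner_le[of "u *\<^sub>C x" y] by (simp add: norm_scaleC u c_def)
qed

lemma cinner_eq_zero_all: "(\<And>y. cinner x y = 0) \<Longrightarrow> x = (0::'h::complex_hilbert)"
  by (metis Re_cinner_self norm_eq_zero power_eq_0_iff zero_complex.sel(1))

lemma bounded_bilinear_cinner: "bounded_bilinear (cinner :: 'h::complex_hilbert \<Rightarrow> 'h \<Rightarrow> complex)"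
proof
  show "\<exists>K. \<forall>(a::'h) b. norm (cinner a b) \<le> norm a * norm b * K"
    by (rule exI[of _ 1]) (simp add: norm_cinner_le)
qed (auto simp: cinner_add_left cinner_add_right cinner_scaleR_left cinner_scaleR_right scaleR_conv_of_real)

lemmas tendsto_cinner = bounded_bilinear.tendsto[OF bounded_bilinear_cinner]

text \<open>The functional \<open>J x = (norm x)^2 - 2 Re (\<phi> x)\<close> is bounded below, and
  the parallelogram identity makes a minimising sequence in \<open>L\<close> Cauchy. The first
  variation at the minimiser gives the real part of the claim, and replacing \<open>h\<close> by
  \<open>\<i> *\<^sub>C h\<close> the imaginary part. The case \<open>L = UNIV\<close> yields
  adjoints, the general case orthogonal projections.\<close>

lemma riesz_on_closed_subspace:
  fixes L :: "'h::complex_hilbert set" and \<phi> :: "'h \<Rightarrow> complex"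
  assumes cl: "closed L" and L0: "0 \<in> L" and Ladd: "\<And>x y. x \<in> L \<Longrightarrow> y \<in> L \<Longrightarrow> x + y \<in> L"
    and Lsc: "\<And>a x. x \<in> L \<Longrightarrow> a *\<^sub>C x \<in> L"
    and add: "\<And>x y. \<phi> (x + y) = \<phi> x + \<phi> y" and sc: "\<And>a x. \<phi> (a *\<^sub>C x) = a * \<phi> x"
    and bd: "\<And>x. cmod (\<phi> x) \<le> K * norm x"
  shows "\<exists>z\<in>L. \<forall>h\<in>L. \<phi> h = cinner h z"
proof -
  have Lr: "r *\<^sub>R x \<in> L" if "x \<in> L" for r x using Lsc[OF that, of "complex_of_real r"] by (simp add: scaleC_of_real)
  have scr: "\<phi> (r *\<^sub>R x) = complex_of_real r * \<phi> x" for r x by (metis sc scaleC_of_real)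
  define J where "J x = (norm x)\<^sup>2 - 2 * Re (\<phi> x)" for x
  have Jlow: "J x \<ge> - K\<^sup>2" for x
  proof -
    have "Re (\<phi> x) \<le> K * norm x" using bd[of x] complex_Re_le_cmod[of "\<phi> x"] by linarith
    moreover have "0 \<le> (norm x - K)\<^sup>2" by simp
    ultimately show ?thesis by (simp add: J_def power2_eq_square algebra_simps)
  qed
  define d where "d = Inf (J ` L)"
  have bdd: "bdd_below (J ` L)" by (rule bdd_belowI[of _ "- K\<^sup>2"]) (auto simp: Jlow)
  have dle: "d \<le> J x" if "x \<in> L" for x unfolding d_def using bdd that by (auto intro: cInf_lower)
  have "\<exists>x\<in>L. J x < d + 1 / real (Suc n)" for n
  proof -
    have "Inf (J ` L) < d + 1 / real (Suc n)" by (simp add: d_def)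
    then show ?thesis using cInf_less_iff[OF _ bdd] L0 by blast
  qed
  then obtain X where XL: "\<And>n. X n \<in> L" and XJ: "\<And>n. J (X n) < d + 1 / real (Suc n)" by metis
  have par: "(norm (x - y))\<^sup>2 = 2 * J x + 2 * J y - 4 * J ((1/2) *\<^sub>R (x + y))" for x y
    by (simp add: J_def norm_diff_sq norm_add_sq scr add cinner_scaleR_left cinner_scaleR_right power_mult_distrib power_divide algebra_simps)
  have diff: "(norm (X n - X m))\<^sup>2 \<le> 2 / real (Suc n) + 2 / real (Suc m)" for n m
  proof -
    have "d \<le> J ((1/2) *\<^sub>R (X n + X m))" by (intro dle Lr Ladd XL)
    then show ?thesis using par[of "X n" "X m"] XJ[of n] XJ[of m] by simp
  qed
  have "Cauchy X"
  proof (rule metric_CauchyI)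
    fix e :: real assume e: "0 < e"
    obtain N where N: "4 / e\<^sup>2 < real N" using reals_Archimedean2 by blast
    show "\<exists>M. \<forall>m\<ge>M. \<forall>n\<ge>M. dist (X m) (X n) < e"
    proof (intro exI allI impI)
      fix m n assume mn: "N \<le> m" "N \<le> n"
      have N0: "0 < real N" using N e by (smt (verit) divide_nonneg_nonneg zero_le_power2)
      have "2 / real (Suc m) \<le> 2 / real N" "2 / real (Suc n) \<le> 2 / real N"
        using mn N0 by (auto intro!: divide_left_mono)
      then have "(norm (X m - X n))\<^sup>2 \<le> 4 / real N" using diff[of m n] by simp
      also have "\<dots> < e\<^sup>2" using N N0 e by (simp add: divide_simps mult.commute)
      finally show "dist (X m) (X n) < e" using e by (simp add: dist_norm power_less_imp_less_base)
    qed
  qed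
  then obtain z where z: "X \<longlonglongrightarrow> z" using Cauchy_convergent convergent_def by blast
  have zL: "z \<in> L" using closed_sequentially[OF cl] XL z by blast
  have lin: "bounded_linear \<phi>"
    by (rule bounded_linear_intro[where K=K]) (auto simp: add scr scaleR_conv_of_real bd mult.commute)
  have "(\<lambda>n. J (X n)) \<longlonglongrightarrow> J z" unfolding J_def
    by (intro tendsto_intros z bounded_linear.tendsto[OF lin])
  moreover have "(\<lambda>n. d + 1 / real (Suc n)) \<longlonglongrightarrow> d + 0"
    by (intro tendsto_intros LIMSEQ_Suc lim_1_over_n)
  ultimately have "J z \<le> d + 0"
    by (rule LIMSEQ_le) (use XJ less_imp_le in blast)
  then have Jz: "J z \<le> J x" if "x \<in> L" for x using dle[OF that] by simp
  have re: "Re (\<phi> h) = Re (cinner h z)" if h: "h \<in> L" for h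
  proof -
    have "0 \<le> 2 * t * (Re (cinner h z) - Re (\<phi> h)) + t\<^sup>2 * (norm h)\<^sup>2" for t
    proof -
      have "J z \<le> J (z + t *\<^sub>R h)" by (intro Jz Ladd zL Lr h)
      then show ?thesis
        by (simp add: J_def norm_add_sq add scr cinner_scaleR_right Re_cinner_commute[of z h] power_mult_distrib algebra_simps)
    qed
    from linear_le_quadratic_zero[OF this] show ?thesis by simp
  qed
  have "\<phi> h = cinner h z" if h: "h \<in> L" for h
  proof (rule complex_eqI)
    show "Re (\<phi> h) = Re (cinner h z)" by (rule re[OF h])
    have "Re (\<phi> (\<i> *\<^sub>C h)) = Re (cinner (\<i> *\<^sub>C h) z)" by (intro re Lsc h)
    then show "Im (\<phi> h) = Im (cinner h z)" by (simp add: sc cinner_scaleC_left)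
  qed
  with zL show ?thesis by blast
qed

section \<open>The algebra of bounded operators\<close>

text \<open>As a type of its own, B(H) can be made an instance of the algebra classes, and complex
  linearity no longer has to be carried along as a side condition.\<close>

typedef (overloaded) 'h bop = "bounded_operators :: 'h::complex_hilbert op set"
  morphisms op_of bop_of
  by (rule exI[of _ 0]) (simp add: bounded_operators_def)

setup_lifting type_definition_bop

lift_definition ap :: "'h::complex_hilbert bop \<Rightarrow> 'h \<Rightarrow> 'h" (infixr \<open>\<triangleright>\<close> 72) is blinfun_apply .

lemma bop_eqI: "(\<And>\<xi>. x \<triangleright> \<xi> = y \<triangleright> \<xi>) \<Longrightarrow> x = y"
  by transfer (rule blinfun_eqI)

text \<open>The unit is only that of \<open>monoid_mult\<close>: on the zero space
  \<open>1 = 0\<close>, so neither \<open>norm 1 = 1\<close> nor \<open>0 \<noteq> 1\<close> holds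
  in general. Later estimates use \<open>norm_one_le\<close> instead.\<close>

instantiation bop :: (complex_hilbert) "{real_normed_algebra, monoid_mult}"
begin
lift_definition zero_bop :: "'a bop" is 0 by (simp add: bounded_operators_def)
lift_definition one_bop :: "'a bop" is id_blinfun by (simp add: bounded_operators_def)
lift_definition plus_bop :: "'a bop \<Rightarrow> 'a bop \<Rightarrow> 'a bop" is "(+)"
  by (auto simp: bounded_operators_def blinfun.add_left scaleC_add_right)
lift_definition minus_bop :: "'a bop \<Rightarrow> 'a bop \<Rightarrow> 'a bop" is "(-)"
  by (auto simp: bounded_operators_def blinfun.diff_left scaleC_diff_right)
lift_definition uminus_bop :: "'a bop \<Rightarrow> 'a bop" is "uminus"
  by (auto simp: bounded_operators_def blinfun.minus_left scaleC_minus_right)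
lift_definition times_bop :: "'a bop \<Rightarrow> 'a bop \<Rightarrow> 'a bop" is "(o\<^sub>L)"
  by (auto simp: bounded_operators_def)
lift_definition scaleR_bop :: "real \<Rightarrow> 'a bop \<Rightarrow> 'a bop" is "scaleR"
  by (auto simp: bounded_operators_def blinfun.scaleR_left scaleC_scaleC mult.commute simp flip: scaleC_of_real)
lift_definition norm_bop :: "'a bop \<Rightarrow> real" is norm .
lift_definition dist_bop :: "'a bop \<Rightarrow> 'a bop \<Rightarrow> real" is dist .
definition sgn_bop :: "'a bop \<Rightarrow> 'a bop" where "sgn_bop x = inverse (norm x) *\<^sub>R x"
definition uniformity_bop :: "('a bop \<times> 'a bop) filter" where
  "uniformity_bop = (INF e\<in>{0<..}. principal {(x, y). dist x y < e})"
definition open_bop :: "'a bop set \<Rightarrow> bool" where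
  "open_bop S = (\<forall>x\<in>S. \<forall>\<^sub>F (x', y) in uniformity. x' = x \<longrightarrow> y \<in> S)"

instance
proof
  fix x y z :: "'a bop" and r s :: real
  show "x + y + z = x + (y + z)" by transfer simp
  show "x + y = y + x" by transfer simp
  show "0 + x = x" by transfer simp
  show "- x + x = 0" by transfer simp
  show "x - y = x + - y" by transfer simp
  show "r *\<^sub>R (x + y) = r *\<^sub>R x + r *\<^sub>R y" by transfer (simp add: scaleR_add_right)
  show "(r + s) *\<^sub>R x = r *\<^sub>R x + s *\<^sub>R x" by transfer (simp add: scaleR_add_left)
  show "r *\<^sub>R s *\<^sub>R x = (r * s) *\<^sub>R x" by transfer simp
  show "1 *\<^sub>R x = x" by transfer simp
  show "x * y * z = x * (y * z)" by transfer (rule blinfun_eqI, simp)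
  show "(x + y) * z = x * z + y * z" by transfer (rule blinfun_eqI, simp add: blinfun.add_left)
  show "x * (y + z) = x * y + x * z" by transfer (rule blinfun_eqI, simp add: blinfun.add_left blinfun.add_right)
  show "r *\<^sub>R x * y = r *\<^sub>R (x * y)" by transfer (rule blinfun_eqI, simp add: blinfun.scaleR_left)
  show "x * r *\<^sub>R y = r *\<^sub>R (x * y)" by transfer (rule blinfun_eqI, simp add: blinfun.scaleR_left blinfun.scaleR_right)
  show "1 * x = x" by transfer (rule blinfun_eqI, simp)
  show "x * 1 = x" by transfer (rule blinfun_eqI, simp)
  show "dist x y = norm (x - y)" by transfer (rule dist_norm)
  show "sgn x = inverse (norm x) *\<^sub>R x" by (rule sgn_bop_def)
  show "uniformity = (INF e\<in>{0<..}. principal {(x::'a bop, y). dist x y < e})" by (rule uniformity_bop_def)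
  show "open U = (\<forall>x\<in>U. \<forall>\<^sub>F (x', y) in uniformity. x' = x \<longrightarrow> y \<in> U)" for U :: "'a bop set" by (rule open_bop_def)
  show "(norm x = 0) = (x = 0)" by transfer simp
  show "norm (x + y) \<le> norm x + norm y" by transfer (rule norm_triangle_ineq)
  show "norm (r *\<^sub>R x) = \<bar>r\<bar> * norm x" by transfer simp
  show "norm (x * y) \<le> norm x * norm y" by transfer (rule norm_blinfun_compose)
qed
end

instance bop :: (complex_hilbert) banach
proof
  fix X :: "nat \<Rightarrow> 'a bop" assume "Cauchy X"
  then have "Cauchy (\<lambda>n. op_of (X n))" unfolding Cauchy_def dist_bop.rep_eq .
  then obtain T where T: "(\<lambda>n. op_of (X n)) \<longlonglongrightarrow> T" using Cauchy_convergent convergent_def by blast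
  have "T \<in> bounded_operators" unfolding bounded_operators_def
  proof (intro CollectI allI)
    fix a x
    have "(\<lambda>n. op_of (X n) (a *\<^sub>C x)) \<longlonglongrightarrow> T (a *\<^sub>C x)"
      by (intro blinfun.tendsto T tendsto_const)
    moreover have "(\<lambda>n. a *\<^sub>C op_of (X n) x) \<longlonglongrightarrow> a *\<^sub>C T x"
      by (intro bounded_linear.tendsto[OF bounded_linear_scaleC] blinfun.tendsto T tendsto_const)
    moreover have "op_of (X n) (a *\<^sub>C x) = a *\<^sub>C op_of (X n) x" for n
      using op_of[of "X n"] by (simp add: bounded_operators_def)
    ultimately show "T (a *\<^sub>C x) = a *\<^sub>C T x" using LIMSEQ_unique by simp
  qed
  then have TT: "op_of (bop_of T) = T" by (rule bop_of_inverse)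
  have "(\<lambda>n. dist (op_of (X n)) T) \<longlonglongrightarrow> 0" using T by (simp only: tendsto_dist_iff[symmetric])
  then have "(\<lambda>n. dist (X n) (bop_of T)) \<longlonglongrightarrow> 0" by (simp only: dist_bop.rep_eq TT)
  then have "X \<longlonglongrightarrow> bop_of T" by (simp only: tendsto_dist_iff[symmetric])
  then show "convergent X" unfolding convergent_def by blast
qed

lemma ap_add_left: "(x + y) \<triangleright> \<xi> = x \<triangleright> \<xi> + y \<triangleright> \<xi>" by transfer (simp add: blinfun.add_left)
lemma ap_diff_left: "(x - y) \<triangleright> \<xi> = x \<triangleright> \<xi> - y \<triangleright> \<xi>" by transfer (simp add: blinfun.diff_left)
lemma ap_minus_left: "(- x) \<triangleright> \<xi> = - (x \<triangleright> \<xi>)" by transfer (simp add: blinfun.minus_left)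
lemma ap_zero_left [simp]: "0 \<triangleright> \<xi> = 0" by transfer simp
lemma ap_one [simp]: "1 \<triangleright> \<xi> = \<xi>" by transfer simp
lemma ap_mult [simp]: "(x * y) \<triangleright> \<xi> = x \<triangleright> y \<triangleright> \<xi>" by transfer simp
lemma ap_scaleR_left: "(r *\<^sub>R x) \<triangleright> \<xi> = r *\<^sub>R (x \<triangleright> \<xi>)" by transfer (simp add: blinfun.scaleR_left)
lemma ap_add_right: "x \<triangleright> (\<xi> + \<eta>) = x \<triangleright> \<xi> + x \<triangleright> \<eta>" by transfer (simp add: blinfun.add_right)
lemma ap_diff_right: "x \<triangleright> (\<xi> - \<eta>) = x \<triangleright> \<xi> - x \<triangleright> \<eta>" by transfer (simp add: blinfun.diff_right)
lemma ap_minus_right: "x \<triangleright> (- \<xi>) = - (x \<triangleright> \<xi>)" by transfer (simp add: blinfun.minus_right)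
lemma ap_zero_right [simp]: "x \<triangleright> 0 = 0" by transfer simp
lemma ap_scaleR_right: "x \<triangleright> (r *\<^sub>R \<xi>) = r *\<^sub>R (x \<triangleright> \<xi>)" by transfer (simp add: blinfun.scaleR_right)
lemma ap_scaleC_right: "x \<triangleright> (a *\<^sub>C \<xi>) = a *\<^sub>C (x \<triangleright> \<xi>)" by transfer (simp add: bounded_operators_def)
lemma norm_ap: "norm (x \<triangleright> \<xi>) \<le> norm x * norm \<xi>" by transfer (rule norm_blinfun)

lemmas ap_linear = ap_add_left ap_diff_left ap_minus_left ap_scaleR_left
  ap_add_right ap_diff_right ap_minus_right ap_scaleR_right ap_scaleC_right

lemma norm_bop_bound: "0 \<le> b \<Longrightarrow> (\<And>\<xi>. norm (x \<triangleright> \<xi>) \<le> b * norm \<xi>) \<Longrightarrow> norm x \<le> b"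
  by transfer (rule norm_blinfun_bound)

lemma bounded_bilinear_ap: "bounded_bilinear ap"
proof
  show "\<exists>K. \<forall>(a::'a bop) b. norm (a \<triangleright> b) \<le> norm a * norm b * K"
    by (rule exI[of _ 1]) (simp add: norm_ap)
qed (auto simp: ap_linear)

lemmas tendsto_ap = bounded_bilinear.tendsto[OF bounded_bilinear_ap]

lemma bop_exists:
  fixes f :: "'h::complex_hilbert \<Rightarrow> 'h"
  assumes "\<And>x y. f (x + y) = f x + f y" "\<And>a x. f (a *\<^sub>C x) = a *\<^sub>C f x" "\<And>x. norm (f x) \<le> K * norm x"
  shows "\<exists>T. \<forall>\<xi>. T \<triangleright> \<xi> = f \<xi>"
proof -
  have bl: "bounded_linear f"
    by (rule bounded_linear_intro[where K=K]) (use assms in \<open>auto simp: mult.commute simp flip: scaleC_of_real\<close>)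
  have "Blinfun f \<in> bounded_operators"
    by (simp add: bounded_operators_def bounded_linear_Blinfun_apply[OF bl] assms)
  then have "bop_of (Blinfun f) \<triangleright> \<xi> = f \<xi>" for \<xi>
    by (simp add: ap.rep_eq bop_of_inverse bounded_linear_Blinfun_apply[OF bl])
  then show ?thesis by blast
qed

text \<open>The algebra classes provide only real scalars; complex ones act as central
  operators.\<close>

lift_definition cop :: "complex \<Rightarrow> 'h::complex_hilbert bop" is scalar_op
  by (simp add: bounded_operators_def scalar_op_apply scaleC_scaleC mult.commute)

lemma ap_cop [simp]: "cop a \<triangleright> \<xi> = a *\<^sub>C \<xi>" by transfer (rule scalar_op_apply)

lemma cop_commute: "x * cop a = cop a * x"
  by (rule bop_eqI) (simp add: ap_scaleC_right)

lemma cop_mult: "cop a * cop b = cop (a * b)"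
  by (rule bop_eqI) (simp add: scaleC_scaleC)
lemma cop_add: "cop a + cop b = cop (a + b)"
  by (rule bop_eqI) (simp add: ap_add_left scaleC_add_left)
lemma cop_of_real: "cop (complex_of_real r) = r *\<^sub>R 1"
  by (rule bop_eqI) (simp add: ap_scaleR_left scaleC_of_real)
lemma cop_1 [simp]: "cop 1 = 1" by (rule bop_eqI) simp
lemma cop_0 [simp]: "cop 0 = 0" by (rule bop_eqI) simp
lemma cop_of_real_mult: "cop (complex_of_real r) * x = r *\<^sub>R x"
  by (simp add: cop_of_real)

subsection \<open>Adjoints\<close>

lemma adjoint_exists: "\<exists>y. \<forall>\<xi> \<eta>. cinner (x \<triangleright> \<xi>) \<eta> = cinner \<xi> (y \<triangleright> \<eta>)"
proof -
  have bd: "cmod (cinner (x \<triangleright> \<xi>) \<eta>) \<le> norm x * norm \<eta> * norm \<xi>" for \<xi> \<eta>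
    using norm_cinner_le[of "x \<triangleright> \<xi>" \<eta>] mult_right_mono[OF norm_ap[of x \<xi>], of "norm \<eta>"]
    by (simp add: mult_ac)
  have "\<exists>z. \<forall>\<xi>. cinner (x \<triangleright> \<xi>) \<eta> = cinner \<xi> z" for \<eta>
    using riesz_on_closed_subspace[of UNIV "\<lambda>\<xi>. cinner (x \<triangleright> \<xi>) \<eta>" "norm x * norm \<eta>"] bd
    by (auto simp: ap_linear cinner_linear)
  then obtain g where g: "\<And>\<xi> \<eta>. cinner (x \<triangleright> \<xi>) \<eta> = cinner \<xi> (g \<eta>)" by metis
  have eq: "a = b" if "\<And>\<xi>. cinner \<xi> a = cinner \<xi> b" for a b :: 'a
    using cinner_eq_zero_all[of "a - b"] that
    by (metis cinner_commute cinner_diff_right complex_cnj_zero eq_iff_diff_eq_0)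
  have "\<exists>T. \<forall>\<xi>. T \<triangleright> \<xi> = g \<xi>"
  proof (rule bop_exists)
    show "g (a + b) = g a + g b" for a b by (rule eq) (simp add: g[symmetric] cinner_linear)
    show "g (a *\<^sub>C b) = a *\<^sub>C g b" for a b by (rule eq) (simp add: g[symmetric] cinner_linear)
    show "norm (g a) \<le> norm x * norm a" for a
    proof -
      have "(norm (g a))\<^sup>2 = Re (cinner (x \<triangleright> g a) a)" by (simp add: g)
      also have "\<dots> \<le> norm (x \<triangleright> g a) * norm a" using Re_cinner_le[of "x \<triangleright> g a" a] by linarith
      also have "\<dots> \<le> norm x * norm (g a) * norm a" by (intro mult_right_mono norm_ap) simp
      finally show ?thesis by (cases "g a = 0") (auto simp: power2_eq_square algebra_simps)
    qed
  qed
  with g show ?thesis by metis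
qed

definition star :: "'h::complex_hilbert bop \<Rightarrow> 'h bop" where
  "star x = (SOME y. \<forall>\<xi> \<eta>. cinner (x \<triangleright> \<xi>) \<eta> = cinner \<xi> (y \<triangleright> \<eta>))"

lemma cinner_star: "cinner (x \<triangleright> \<xi>) \<eta> = cinner \<xi> (star x \<triangleright> \<eta>)"
  unfolding star_def using someI_ex[OF adjoint_exists[of x]] by blast

lemma cinner_star_right: "cinner \<xi> (x \<triangleright> \<eta>) = cinner (star x \<triangleright> \<xi>) \<eta>"
  by (metis cinner_commute cinner_star)

lemma cinner_ext: "(\<And>\<xi>. cinner \<xi> a = cinner \<xi> b) \<Longrightarrow> a = (b::'h::complex_hilbert)"
  using cinner_eq_zero_all[of "a - b"]
  by (metis cinner_commute cinner_diff_right complex_cnj_zero eq_iff_diff_eq_0)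

lemma starI: "(\<And>\<xi> \<eta>. cinner (x \<triangleright> \<xi>) \<eta> = cinner \<xi> (y \<triangleright> \<eta>)) \<Longrightarrow> star x = y"
  by (rule bop_eqI, rule cinner_ext) (simp add: cinner_star[symmetric])

lemma star_star [simp]: "star (star x) = x" by (rule starI) (simp add: cinner_star_right)
lemma star_add: "star (x + y) = star x + star y" by (rule starI) (simp add: ap_linear cinner_linear cinner_star)
lemma star_diff: "star (x - y) = star x - star y" by (rule starI) (simp add: ap_linear cinner_linear cinner_star)
lemma star_minus: "star (- x) = - star x" by (rule starI) (simp add: ap_linear cinner_linear cinner_star)
lemma star_mult: "star (x * y) = star y * star x" by (rule starI) (simp add: cinner_star)
lemma star_scaleR: "star (r *\<^sub>R x) = r *\<^sub>R star x"
  by (rule starI) (simp add: ap_linear cinner_scaleR_left cinner_scaleR_right cinner_star)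
lemma star_one [simp]: "star 1 = 1" by (rule starI) simp
lemma star_zero [simp]: "star 0 = 0" by (rule starI) simp
lemma star_cop: "star (cop a) = cop (cnj a)" by (rule starI) (simp add: cinner_linear)
lemma star_power: "star (x ^ n) = star x ^ n"
  by (induction n) (simp_all add: star_mult power_commutes)
lemma star_sum: "star (sum f A) = (\<Sum>i\<in>A. star (f i))"
  by (induction A rule: infinite_finite_induct) (auto simp: star_add)

lemmas star_simps = star_add star_diff star_minus star_mult star_scaleR star_cop star_power star_sum

lemma star_cop_mult: "star (cop a * x) = cop (cnj a) * star x"
  by (simp add: star_mult star_cop cop_commute)

lemma cop_mult_mult: "(cop a * x) * (cop b * y) = cop (a * b) * (x * y)"
  by (metis cop_commute cop_mult mult.assoc)

lemma norm_star_le: "norm (star x) \<le> norm x"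
proof (rule norm_bop_bound)
  fix \<xi>
  have "(norm (star x \<triangleright> \<xi>))\<^sup>2 = Re (cinner (x \<triangleright> star x \<triangleright> \<xi>) \<xi>)"
    using cinner_star[of x "star x \<triangleright> \<xi>" \<xi>] by simp
  also have "\<dots> \<le> norm (x \<triangleright> star x \<triangleright> \<xi>) * norm \<xi>"
    using Re_cinner_le[of "x \<triangleright> star x \<triangleright> \<xi>" \<xi>] by linarith
  also have "\<dots> \<le> norm x * norm (star x \<triangleright> \<xi>) * norm \<xi>" by (intro mult_right_mono norm_ap) simp
  finally show "norm (star x \<triangleright> \<xi>) \<le> norm x * norm \<xi>"
    by (cases "star x \<triangleright> \<xi> = 0") (auto simp: power2_eq_square algebra_simps)
qed simp

lemma norm_star [simp]: "norm (star x) = norm x"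
  using norm_star_le[of x] norm_star_le[of "star x"] by simp

lemma bounded_linear_star: "bounded_linear star"
  by (rule bounded_linear_intro[where K=1]) (auto simp: star_simps)

text \<open>Evaluates the \<open>THE\<close> in \<open>adj\<close>: existence is
  \<open>adjoint_exists\<close>, uniqueness is \<open>cinner_ext\<close>.\<close>

lemma op_of_star: "op_of (star x) = adj (op_of x)"
  unfolding adj_def
proof (rule the_equality[symmetric])
  show "\<forall>\<xi> \<eta>. cinner (blinfun_apply (op_of x) \<xi>) \<eta> = cinner \<xi> (blinfun_apply (op_of (star x)) \<eta>)"
    using cinner_star unfolding ap.rep_eq by blast
  fix S :: "'a op" assume S: "\<forall>\<xi> \<eta>. cinner (blinfun_apply (op_of x) \<xi>) \<eta> = cinner \<xi> (blinfun_apply S \<eta>)"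
  show "S = op_of (star x)"
    by (rule blinfun_eqI, rule cinner_ext) (use S cinner_star in \<open>metis ap.rep_eq\<close>)
qed

text \<open>The projection of \<open>y\<close> is the vector of \<open>L\<close> that represents the
  functional \<open>\<lambda>h. cinner h y\<close> on \<open>L\<close>.\<close>

lemma projection_exists:
  fixes L :: "'h::complex_hilbert set"
  assumes cl: "closed L" and L0: "0 \<in> L" and Ladd: "\<And>x y. x \<in> L \<Longrightarrow> y \<in> L \<Longrightarrow> x + y \<in> L"
    and Lsc: "\<And>a x. x \<in> L \<Longrightarrow> a *\<^sub>C x \<in> L"
  shows "\<exists>e. star e = e \<and> e * e = e \<and> (\<forall>\<xi>. e \<triangleright> \<xi> \<in> L) \<and> (\<forall>\<xi>\<in>L. e \<triangleright> \<xi> = \<xi>)"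
proof -
  have "\<exists>z\<in>L. \<forall>h\<in>L. cinner h y = cinner h z" for y
    using riesz_on_closed_subspace[OF cl L0 Ladd Lsc, of "\<lambda>h. cinner h y" "norm y"]
    by (auto simp: cinner_linear norm_cinner_le mult.commute)
  then obtain g where gL: "\<And>y. g y \<in> L" and g: "\<And>y h. h \<in> L \<Longrightarrow> cinner h y = cinner h (g y)" by metis
  have uniq: "a = b" if "a \<in> L" "b \<in> L" "\<And>h. h \<in> L \<Longrightarrow> cinner h a = cinner h b" for a b
  proof -
    have "a - b \<in> L" using Ladd[OF that(1) Lsc[OF that(2), of "-1"]]
      by (metis diff_conv_add_uminus of_real_1 of_real_minus scaleC_of_real scaleR_minus1_left)
    then have "cinner (a - b) (a - b) = 0" using that(3)[of "a - b"] by (simp add: cinner_diff_right)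
    then show ?thesis by (simp add: cinner_self)
  qed
  have "\<exists>T. \<forall>\<xi>. T \<triangleright> \<xi> = g \<xi>"
  proof (rule bop_exists)
    show "g (a + b) = g a + g b" for a b by (rule uniq) (auto simp: g[symmetric] cinner_linear gL Ladd)
    show "g (a *\<^sub>C b) = a *\<^sub>C g b" for a b by (rule uniq) (auto simp: g[symmetric] cinner_linear gL Lsc)
    show "norm (g a) \<le> 1 * norm a" for a
    proof -
      have "(norm (g a))\<^sup>2 = Re (cinner (g a) a)" by (simp only: g[OF gL, of a a] Re_cinner_self)
      also have "\<dots> \<le> norm (g a) * norm a" using Re_cinner_le[of "g a" a] by linarith
      finally show ?thesis by (cases "g a = 0") (auto simp: power2_eq_square algebra_simps)
    qed
  qed
  then obtain e where e: "\<And>\<xi>. e \<triangleright> \<xi> = g \<xi>" by blast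
  have id: "g \<xi> = \<xi>" if "\<xi> \<in> L" for \<xi> by (rule uniq) (auto simp: gL that g[symmetric])
  have "star e = e"
  proof (rule starI)
    fix \<xi> \<eta>
    have "cinner (g \<xi>) \<eta> = cinner (g \<xi>) (g \<eta>)" by (rule g[OF gL])
    also have "\<dots> = cnj (cinner (g \<eta>) (g \<xi>))" by (rule cinner_commute)
    also have "\<dots> = cnj (cinner (g \<eta>) \<xi>)" by (simp only: g[OF gL, of \<eta> \<xi>])
    also have "\<dots> = cinner \<xi> (g \<eta>)" by (rule cinner_commute[symmetric])
    finally show "cinner (e \<triangleright> \<xi>) \<eta> = cinner \<xi> (e \<triangleright> \<eta>)" by (simp add: e)
  qed
  moreover have "e * e = e" by (rule bop_eqI) (simp add: e id gL)
  ultimately show ?thesis using e gL id by metis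
qed

subsection \<open>Positive operators\<close>

text \<open>With self-adjointness built in, only real parts have to be checked.
  \<open>pos_iff_form\<close> reconciles this with the complex form used in
  \<open>op_le\<close>.\<close>

definition pos :: "'h::complex_hilbert bop \<Rightarrow> bool" where
  "pos x \<longleftrightarrow> star x = x \<and> (\<forall>\<xi>. 0 \<le> Re (cinner (x \<triangleright> \<xi>) \<xi>))"

lemma posD: "pos x \<Longrightarrow> star x = x" "pos x \<Longrightarrow> 0 \<le> Re (cinner (x \<triangleright> \<xi>) \<xi>)"
  by (auto simp: pos_def)

lemma posI: "star x = x \<Longrightarrow> (\<And>\<xi>. 0 \<le> Re (cinner (x \<triangleright> \<xi>) \<xi>)) \<Longrightarrow> pos x"
  by (auto simp: pos_def)

lemma pos_add: "pos x \<Longrightarrow> pos y \<Longrightarrow> pos (x + y)"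
  by (auto simp: pos_def star_simps ap_linear cinner_linear)

lemma pos_scaleR: "pos x \<Longrightarrow> 0 \<le> r \<Longrightarrow> pos (r *\<^sub>R x)"
  by (auto simp: pos_def star_simps ap_linear cinner_scaleR_left)

lemma pos_zero [simp]: "pos 0" and pos_one [simp]: "pos 1"
  by (auto simp: pos_def)

lemma pos_conj: "pos x \<Longrightarrow> pos (star y * x * y)"
  by (auto simp: pos_def star_simps mult.assoc simp flip: cinner_star_right)

lemma pos_star_mult: "pos (star x * x)"
  using pos_conj[of 1 x] by simp

lemma pos_sq: "star x = x \<Longrightarrow> pos (x * x)"
  using pos_star_mult[of x] by simp

lemma pos_sum: "(\<And>i. i \<in> A \<Longrightarrow> pos (f i)) \<Longrightarrow> pos (sum f A)"
  by (induction A rule: infinite_finite_induct) (auto intro: pos_add)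

lemma Re_cinner_ap_le: "Re (cinner (x \<triangleright> \<xi>) \<xi>) \<le> norm x * (norm \<xi>)\<^sup>2"
proof -
  have "Re (cinner (x \<triangleright> \<xi>) \<xi>) \<le> norm (x \<triangleright> \<xi>) * norm \<xi>" using Re_cinner_le[of "x \<triangleright> \<xi>" \<xi>] by linarith
  also have "\<dots> \<le> norm x * norm \<xi> * norm \<xi>" by (intro mult_right_mono norm_ap) simp
  finally show ?thesis by (simp add: power2_eq_square mult.assoc)
qed

lemma pos_norm_bound_diff: "star x = x \<Longrightarrow> norm x \<le> K \<Longrightarrow> pos (K *\<^sub>R 1 - x)"
  using Re_cinner_ap_le[of x]
  by (auto intro!: posI simp: star_simps ap_linear cinner_linear cinner_scaleR_left)
    (meson mult_right_mono order_trans zero_le_power2)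

lemma discriminant_le:
  fixes a b c :: real
  assumes "\<And>t. 0 \<le> a + 2 * t * b + t\<^sup>2 * c" and "0 \<le> c"
  shows "b\<^sup>2 \<le> a * c"
proof (cases "c = 0")
  case True
  have "b = 0"
  proof (rule ccontr)
    assume "b \<noteq> 0"
    then have "a + 2 * (- (a + 1) / (2 * b)) * b = - 1" by (simp add: field_simps)
    with assms(1)[of "- (a + 1) / (2 * b)"] True show False by simp
  qed
  with True show ?thesis by simp
next
  case False
  then have c: "0 < c" using assms(2) by simp
  have "0 \<le> a + 2 * (- b / c) * b + (- b / c)\<^sup>2 * c" by (rule assms(1))
  also have "\<dots> = a - b\<^sup>2 / c" using c by (simp add: power2_eq_square)
  finally show ?thesis using c by (simp add: field_simps)
qed

lemma pos_cauchy_schwarz: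
  assumes "pos x"
  shows "(Re (cinner (x \<triangleright> \<xi>) \<eta>))\<^sup>2 \<le> Re (cinner (x \<triangleright> \<xi>) \<xi>) * Re (cinner (x \<triangleright> \<eta>) \<eta>)"
proof (rule discriminant_le)
  have sym: "Re (cinner (x \<triangleright> \<eta>) \<xi>) = Re (cinner (x \<triangleright> \<xi>) \<eta>)"
    by (metis Re_cinner_commute assms cinner_star posD(1))
  show "0 \<le> Re (cinner (x \<triangleright> \<xi>) \<xi>) + 2 * t * Re (cinner (x \<triangleright> \<xi>) \<eta>) + t\<^sup>2 * Re (cinner (x \<triangleright> \<eta>) \<eta>)" for t
    using posD(2)[OF assms, of "\<xi> + t *\<^sub>R \<eta>"] sym
    by (simp add: ap_linear cinner_linear cinner_scaleR_left cinner_scaleR_right power2_eq_square algebra_simps)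
qed (rule posD(2)[OF assms])

text \<open>The inequality x^2 \<le> K x for 0 \<le> x \<le> K, proved by Cauchy-Schwarz for the
  form of \<open>x\<close> at the vectors \<open>\<xi>\<close> and
  \<open>x \<triangleright> \<xi>\<close>, hence before square roots are available.\<close>

lemma pos_norm_ap_sq:
  assumes "pos x" "pos (K *\<^sub>R 1 - x)"
  shows "(norm (x \<triangleright> \<xi>))\<^sup>2 \<le> K * Re (cinner (x \<triangleright> \<xi>) \<xi>)"
proof -
  have le: "Re (cinner (x \<triangleright> \<eta>) \<eta>) \<le> K * (norm \<eta>)\<^sup>2" for \<eta>
    using posD(2)[OF assms(2), of \<eta>] by (simp add: ap_linear cinner_linear cinner_scaleR_left)
  have "((norm (x \<triangleright> \<xi>))\<^sup>2)\<^sup>2 \<le> Re (cinner (x \<triangleright> \<xi>) \<xi>) * Re (cinner (x \<triangleright> x \<triangleright> \<xi>) (x \<triangleright> \<xi>))"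
    using pos_cauchy_schwarz[OF assms(1), of \<xi> "x \<triangleright> \<xi>"] by simp
  also have "\<dots> \<le> Re (cinner (x \<triangleright> \<xi>) \<xi>) * (K * (norm (x \<triangleright> \<xi>))\<^sup>2)"
    by (intro mult_left_mono le posD(2)[OF assms(1)])
  finally have "((norm (x \<triangleright> \<xi>))\<^sup>2)\<^sup>2 \<le> (norm (x \<triangleright> \<xi>))\<^sup>2 * (K * Re (cinner (x \<triangleright> \<xi>) \<xi>))"
    by (simp only: mult_ac)
  then have *: "(norm (x \<triangleright> \<xi>))\<^sup>2 * (norm (x \<triangleright> \<xi>))\<^sup>2 \<le> (norm (x \<triangleright> \<xi>))\<^sup>2 * (K * Re (cinner (x \<triangleright> \<xi>) \<xi>))"
    by (simp only: power2_eq_square[of "(norm (x \<triangleright> \<xi>))\<^sup>2"])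
  show ?thesis
  proof (cases "x \<triangleright> \<xi> = 0")
    case False
    then have "0 < (norm (x \<triangleright> \<xi>))\<^sup>2" by simp
    then show ?thesis using * mult_le_cancel_left_pos by blast
  qed simp
qed

lemma pos_norm_le:
  assumes "pos x" "pos (K *\<^sub>R 1 - x)" "0 \<le> K"
  shows "norm x \<le> K"
proof (rule norm_bop_bound)
  fix \<xi>
  have "(norm (x \<triangleright> \<xi>))\<^sup>2 \<le> K * Re (cinner (x \<triangleright> \<xi>) \<xi>)" by (rule pos_norm_ap_sq[OF assms(1,2)])
  also have "\<dots> \<le> K * (K * (norm \<xi>)\<^sup>2)"
    using posD(2)[OF assms(2), of \<xi>] assms(3)
    by (intro mult_left_mono) (simp_all add: ap_linear cinner_linear cinner_scaleR_left)
  finally have "(norm (x \<triangleright> \<xi>))\<^sup>2 \<le> (K * norm \<xi>)\<^sup>2" by (simp add: power2_eq_square mult_ac)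
  then show "norm (x \<triangleright> \<xi>) \<le> K * norm \<xi>" using assms(3) by (simp add: power2_le_iff_abs_le)
qed (rule assms)

lemma pos_antisym: assumes "pos x" "pos (- x)" shows "x = 0"
  using pos_norm_le[of x 0] assms by simp

lemma norm_one_le: "norm (1::'h::complex_hilbert bop) \<le> 1"
  by (rule norm_bop_bound) simp_all

lemma star_mult_eq_zero: assumes "star x * x = 0" shows "x = (0::'h::complex_hilbert bop)"
proof (rule bop_eqI)
  fix \<xi>
  have "cinner (x \<triangleright> \<xi>) (x \<triangleright> \<xi>) = cinner \<xi> ((star x * x) \<triangleright> \<xi>)" by (simp add: cinner_star)
  then show "x \<triangleright> \<xi> = 0 \<triangleright> \<xi>" using assms by (simp add: cinner_self)
qed

lemma norm_ap_eq_of_star_mult: "star x * x = star y * y \<Longrightarrow> norm (x \<triangleright> \<xi>) = norm (y \<triangleright> \<xi>)"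
proof -
  assume eq: "star x * x = star y * y"
  have "cinner (x \<triangleright> \<xi>) (x \<triangleright> \<xi>) = cinner \<xi> ((star x * x) \<triangleright> \<xi>)" by (simp add: cinner_star)
  also have "\<dots> = cinner (y \<triangleright> \<xi>) (y \<triangleright> \<xi>)" by (simp add: eq cinner_star)
  finally have "(norm (x \<triangleright> \<xi>))\<^sup>2 = (norm (y \<triangleright> \<xi>))\<^sup>2" by (metis Re_cinner_self)
  then show ?thesis by (simp add: power2_eq_iff_nonneg)
qed

text \<open>Equality of \<open>star x * x\<close> and \<open>star y * y\<close> gives equal norms on
  every vector, hence equal kernels.\<close>

lemma zero_of_star_mult: "star x * x = star y * y \<Longrightarrow> y * z = 0 \<Longrightarrow> x * z = 0"
  by (rule bop_eqI) (metis ap_mult ap_zero_left norm_ap_eq_of_star_mult norm_eq_zero)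

lemma norm_power_le: "norm x \<le> 1 \<Longrightarrow> norm (x ^ n) \<le> (1::real)" for x :: "'h::complex_hilbert bop"
proof (induction n)
  case (Suc n)
  have "norm (x ^ Suc n) \<le> norm x * norm (x ^ n)" by (simp add: norm_mult_ineq)
  also have "\<dots> \<le> 1 * 1" using Suc by (intro mult_mono) auto
  finally show ?case by simp
qed (simp add: norm_one_le)

lemma commute_power: "x * y = y * (x::'a::monoid_mult) \<Longrightarrow> x ^ n * y = y * x ^ n"
  by (induction n) (auto simp: mult.assoc, metis mult.assoc)

lemma pos_power: assumes "pos x" shows "pos (x ^ n)"
proof -
  have "\<exists>k. n = 2 * k \<or> n = Suc (2 * k)" by presburger
  then obtain k where "n = 2 * k \<or> n = Suc (2 * k)" by blast
  moreover have s: "star (x ^ k) = x ^ k" using posD(1)[OF assms] by (simp add: star_power)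
  moreover have "x ^ (2 * k) = star (x ^ k) * 1 * x ^ k" using s by (simp add: power_add mult_2)
  moreover have "x ^ Suc (2 * k) = star (x ^ k) * x * x ^ k"
    using s by (simp add: power_add mult_2 mult.assoc power_commutes)
  ultimately show ?thesis using pos_conj[OF assms] pos_conj[OF pos_one] by metis
qed

text \<open>\<open>d * (1 - d)\<close> is a sum of two conjugates of positive operators. Conjugating
  \<open>1 - d\<close> or \<open>d * (1 - d)\<close> by a power of \<open>d\<close> settles even and
  odd \<open>n\<close>.\<close>

lemma pos_power_diff:
  assumes d: "pos d" and d1: "pos (1 - d)"
  shows "pos (d ^ n - d ^ Suc n)"
proof -
  have sd: "star d = d" by (rule posD[OF d])
  have *: "pos (d * (1 - d))"
  proof -
    have "d * (1 - d) = star (1 - d) * d * (1 - d) + star d * (1 - d) * d"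
      by (simp add: star_simps sd algebra_simps)
    then show ?thesis using pos_add[OF pos_conj[OF d] pos_conj[OF d1]] by metis
  qed
  have "\<exists>k. n = 2 * k \<or> n = Suc (2 * k)" by presburger
  then obtain k where "n = 2 * k \<or> n = Suc (2 * k)" by blast
  moreover have s: "star (d ^ k) = d ^ k" using sd by (simp add: star_power)
  moreover have "d ^ (2 * k) - d ^ Suc (2 * k) = star (d ^ k) * (1 - d) * d ^ k"
    "d ^ Suc (2 * k) - d ^ Suc (Suc (2 * k)) = star (d ^ k) * (d * (1 - d)) * d ^ k"
  proof -
    define e where "e = d ^ k"
    have c: "e * d = d * e" "\<And>z. e * (d * z) = d * (e * z)"
      by (simp_all add: e_def power_commutes flip: mult.assoc)
    have p: "d ^ (2 * k) = e * e" by (simp add: e_def mult_2 power_add)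
    show "d ^ (2 * k) - d ^ Suc (2 * k) = star (d ^ k) * (1 - d) * d ^ k"
      "d ^ Suc (2 * k) - d ^ Suc (Suc (2 * k)) = star (d ^ k) * (d * (1 - d)) * d ^ k"
      unfolding s power_Suc p unfolding e_def[symmetric] by (simp_all add: algebra_simps c)
  qed
  ultimately show ?thesis using pos_conj[OF d1] pos_conj[OF *] by metis
qed

subsection \<open>Square roots\<close>

text \<open>Visser's iteration for square roots: a limit \<open>l\<close> satisfies
  \<open>(1 - l) * (1 - l) = 1 - a\<close>. Since the recursion has non-negative coefficients, the
  scalar sequence \<open>visc\<close>, which is the case \<open>a = 1\<close>, dominates both the
  norms and the increments.\<close>

primrec vis :: "nat \<Rightarrow> 'h::complex_hilbert bop \<Rightarrow> 'h bop" where
  "vis 0 a = 0"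
| "vis (Suc n) a = (1/2) *\<^sub>R (a + vis n a * vis n a)"

primrec visc :: "nat \<Rightarrow> real" where
  "visc 0 = 0"
| "visc (Suc n) = (1 + visc n * visc n) / 2"

lemma visc_bounds: "0 \<le> visc n \<and> visc n \<le> 1"
proof (induction n)
  case (Suc n)
  then have "visc n * visc n \<le> 1 * 1" by (intro mult_mono) auto
  then show ?case by simp
qed simp

lemma visc_mono: "visc n \<le> visc (Suc n)"
  using zero_le_power2[of "1 - visc n"] by (simp add: power2_eq_square algebra_simps)

lemma visc_tendsto: "visc \<longlonglongrightarrow> 1"
proof -
  have inc: "incseq visc" by (rule incseq_SucI) (rule visc_mono)
  obtain l where l: "visc \<longlonglongrightarrow> l" using incseq_convergent[OF inc, of 1] visc_bounds by blast
  have "(\<lambda>n. visc (Suc n)) \<longlonglongrightarrow> (1 + l * l) / 2" by (auto intro!: tendsto_intros l)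
  moreover have "(\<lambda>n. visc (Suc n)) \<longlonglongrightarrow> l" using l by (rule LIMSEQ_Suc)
  ultimately have "l = (1 + l * l) / 2" by (rule LIMSEQ_unique[symmetric])
  then have "(l - 1) * (l - 1) = 0" by (simp add: algebra_simps)
  then show ?thesis using l by simp
qed

lemma norm_vis_le: "norm a \<le> 1 \<Longrightarrow> norm (vis n a) \<le> visc n"
proof (induction n)
  case (Suc n)
  have "norm (a + vis n a * vis n a) \<le> norm a + norm (vis n a * vis n a)" by (rule norm_triangle_ineq)
  also have "\<dots> \<le> 1 + visc n * visc n"
    using Suc visc_bounds[of n] by (intro add_mono order_trans[OF norm_mult_ineq] mult_mono) auto
  finally show ?case by simp
qed simp

lemma norm_vis_Suc_diff: "norm a \<le> 1 \<Longrightarrow> norm (vis (Suc n) a - vis n a) \<le> visc (Suc n) - visc n"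
proof (induction n)
  case (Suc n)
  define x y where "x = vis (Suc n) a" and "y = vis n a"
  define p q where "p = visc (Suc n)" and "q = visc n"
  have nx: "norm x \<le> p" "norm y \<le> q" using norm_vis_le[OF Suc.prems] by (simp_all only: x_def y_def p_def q_def)
  have pq: "0 \<le> q" "q \<le> p" using visc_bounds visc_mono by (simp_all only: p_def q_def)
  have d: "norm (x - y) \<le> p - q" using Suc by (simp only: x_def y_def p_def q_def)
  have "norm (x * (x - y) + (x - y) * y) \<le> norm (x * (x - y)) + norm ((x - y) * y)"
    by (rule norm_triangle_ineq)
  also have "\<dots> \<le> p * (p - q) + (p - q) * q"
    using nx pq d by (intro add_mono order_trans[OF norm_mult_ineq] mult_mono) auto
  finally have "norm (x * x - y * y) \<le> p * p - q * q" by (simp add: algebra_simps)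
  moreover have "vis (Suc (Suc n)) a - x = (1/2) *\<^sub>R (x * x - y * y)"
  proof -
    have "x = (1/2) *\<^sub>R (a + y * y)" "vis (Suc (Suc n)) a = (1/2) *\<^sub>R (a + x * x)"
      by (simp_all only: x_def y_def vis.simps(2))
    then show ?thesis by (metis (no_types, lifting) add_diff_cancel_left scaleR_diff_right)
  qed
  moreover have "visc (Suc (Suc n)) - p = (p * p - q * q) / 2"
    by (simp add: p_def q_def field_simps)
  ultimately show ?case by (simp add: x_def[symmetric] p_def[symmetric] del: vis.simps visc.simps)
qed simp

lemma norm_vis_diff:
  assumes "norm a \<le> 1"
  shows "n \<le> m \<Longrightarrow> norm (vis m a - vis n a) \<le> visc m - visc n"
proof (induction m rule: dec_induct)
  case (step m)
  have "norm (vis (Suc m) a - vis n a) \<le> norm (vis (Suc m) a - vis m a) + norm (vis m a - vis n a)"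
    using norm_triangle_ineq[of "vis (Suc m) a - vis m a" "vis m a - vis n a"] by simp
  then show ?case using step.IH norm_vis_Suc_diff[OF assms, of m] by linarith
qed simp

lemma vis_star: "star a = a \<Longrightarrow> star (vis n a) = vis n a"
  by (induction n) (auto simp: star_simps)

lemma vis_commute: "a * y = y * a \<Longrightarrow> vis n a * y = y * vis n a"
proof (induction n)
  case (Suc n)
  have "vis n a * vis n a * y = y * (vis n a * vis n a)"
    using Suc by (metis mult.assoc)
  then show ?case using Suc.prems by (simp add: algebra_simps)
qed simp

text \<open>The bound \<open>R\<close> is a parameter and not computed from \<open>x\<close>: for
  fixed \<open>R\<close> and \<open>n\<close>, \<open>sqrt_approx R n\<close> is one polynomial for
  all operators of norm at most \<open>R\<close>, with a uniform error. This is needed when the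
  operator varies along a filter.\<close>

definition sqrtc :: "real \<Rightarrow> 'h::complex_hilbert bop \<Rightarrow> 'h bop" where
  "sqrtc R x = sqrt R *\<^sub>R (1 - lim (\<lambda>n. vis n (1 - (1 / R) *\<^sub>R x)))"

definition sqrt_approx :: "real \<Rightarrow> nat \<Rightarrow> 'h::complex_hilbert bop \<Rightarrow> 'h bop" where
  "sqrt_approx R n x = sqrt R *\<^sub>R (1 - vis n (1 - (1 / R) *\<^sub>R x))"

lemma sqrtc:
  assumes x: "pos x" "norm x \<le> R" and R: "0 < R"
  shows norm_sqrt_approx: "norm (sqrt_approx R n x - sqrtc R x) \<le> sqrt R * (1 - visc n)"
    and sqrtc_tendsto: "(\<lambda>n. sqrt_approx R n x) \<longlonglongrightarrow> sqrtc R x"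
    and sqrtc_sq: "sqrtc R x * sqrtc R x = x"
    and pos_sqrtc: "pos (sqrtc R x)"
    and sqrtc_commute: "\<And>y. x * y = y * x \<Longrightarrow> sqrtc R x * y = y * sqrtc R x"
proof -
  define a where "a = 1 - (1 / R) *\<^sub>R x"
  have sx: "star x = x" by (rule posD[OF x(1)])
  have sa: "star a = a" by (simp add: a_def star_simps sx)
  have "pos (R *\<^sub>R 1 - x)" by (rule pos_norm_bound_diff[OF sx x(2)])
  then have "pos ((1/R) *\<^sub>R (R *\<^sub>R 1 - x))" by (rule pos_scaleR) (use R in simp)
  then have pa: "pos a" using R by (simp add: a_def scaleR_diff_right)
  have "pos (1 *\<^sub>R 1 - a)" using pos_scaleR[OF x(1), of "1/R"] R by (simp add: a_def)
  then have na: "norm a \<le> 1" by (rule pos_norm_le[OF pa]) simp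
  have "Cauchy (\<lambda>n. vis n a)"
  proof (rule metric_CauchyI)
    fix e :: real assume e: "0 < e"
    obtain N where N: "\<And>n. N \<le> n \<Longrightarrow> norm (visc n - 1) < e / 2"
      using visc_tendsto e unfolding LIMSEQ_iff by (meson half_gt_zero)
    have close: "norm (vis m a - vis N a) < e / 2" if "N \<le> m" for m
    proof -
      have "norm (vis m a - vis N a) \<le> visc m - visc N" by (rule norm_vis_diff[OF na that])
      also have "\<dots> < e / 2" using N[of N] visc_bounds[of m] visc_bounds[of N] by auto
      finally show ?thesis .
    qed
    show "\<exists>M. \<forall>m\<ge>M. \<forall>n\<ge>M. dist (vis m a) (vis n a) < e"
    proof (intro exI allI impI)
      fix m n assume "N \<le> m" "N \<le> n"
      have "norm (vis m a - vis n a) \<le> norm (vis m a - vis N a) + norm (vis n a - vis N a)"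
        using norm_triangle_ineq4[of "vis m a - vis N a" "vis n a - vis N a"] by simp
      then show "dist (vis m a) (vis n a) < e"
        using close[OF \<open>N \<le> m\<close>] close[OF \<open>N \<le> n\<close>] by (simp add: dist_norm)
    qed
  qed
  then obtain l where l: "(\<lambda>n. vis n a) \<longlonglongrightarrow> l" using Cauchy_convergent convergent_def by blast
  then have lim: "lim (\<lambda>n. vis n a) = l" by (rule limI)
  have S: "sqrtc R x = sqrt R *\<^sub>R (1 - l)" by (simp add: sqrtc_def lim a_def[symmetric])
  have A: "sqrt_approx R n x = sqrt R *\<^sub>R (1 - vis n a)" for n by (simp add: sqrt_approx_def a_def)
  have "(\<lambda>n. vis (Suc n) a) \<longlonglongrightarrow> (1/2) *\<^sub>R (a + l * l)" by (auto intro!: tendsto_intros l)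
  moreover have "(\<lambda>n. vis (Suc n) a) \<longlonglongrightarrow> l" using l by (rule LIMSEQ_Suc)
  ultimately have "l = (1/2) *\<^sub>R (a + l * l)" by (rule LIMSEQ_unique[symmetric])
  then have "2 *\<^sub>R l = a + l * l"
    by (metis scaleR_half_double scaleR_2 scaleR_scaleR mult_2 nonzero_mult_div_cancel_left scaleR_one times_divide_eq_right mult.right_neutral zero_neq_numeral)
  then have ll: "(1 - l) * (1 - l) = 1 - a" by (simp add: algebra_simps scaleR_2)
  have nl: "norm l \<le> 1"
    by (rule LIMSEQ_le_const2[OF tendsto_norm[OF l]])
      (use norm_vis_le[OF na] visc_bounds order_trans in blast)
  have sl: "star l = l"
    using LIMSEQ_unique[OF bounded_linear.tendsto[OF bounded_linear_star l]] l by (simp add: vis_star[OF sa])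
  show "sqrtc R x * sqrtc R x = x" using R by (simp add: S ll a_def)
  show "pos (sqrtc R x)" unfolding S
    by (rule pos_scaleR) (use pos_norm_bound_diff[OF sl nl] R in auto)
  show "(\<lambda>n. sqrt_approx R n x) \<longlonglongrightarrow> sqrtc R x" unfolding A S by (intro tendsto_intros l)
  show "sqrtc R x * y = y * sqrtc R x" if xy: "x * y = y * x" for y
  proof -
    have "a * y = y * a" using xy by (simp add: a_def algebra_simps)
    then have eq: "vis n a * y = y * vis n a" for n by (rule vis_commute)
    have "(\<lambda>n. vis n a * y) \<longlonglongrightarrow> l * y" "(\<lambda>n. y * vis n a) \<longlonglongrightarrow> y * l" by (intro tendsto_intros l)+
    then have "l * y = y * l" unfolding eq by (rule LIMSEQ_unique)
    then show ?thesis by (simp add: S algebra_simps)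
  qed
  have "norm (vis n a - l) \<le> 1 - visc n"
  proof -
    have "(\<lambda>m. norm (vis n a - vis m a)) \<longlonglongrightarrow> norm (vis n a - l)" by (intro tendsto_intros l)
    moreover have "\<exists>N. \<forall>m\<ge>N. norm (vis n a - vis m a) \<le> 1 - visc n"
      using norm_vis_diff[OF na, of n] visc_bounds
      by (intro exI[of _ n]) (smt (verit, ccfv_threshold) norm_minus_commute)
    ultimately show ?thesis by (rule LIMSEQ_le_const2)
  qed
  moreover have "sqrt_approx R n x - sqrtc R x = sqrt R *\<^sub>R (l - vis n a)"
    unfolding A S by (simp add: algebra_simps)
  ultimately show "norm (sqrt_approx R n x - sqrtc R x) \<le> sqrt R * (1 - visc n)"
    using R by (simp add: norm_minus_commute)
qed

subsection \<open>Strong limits\<close>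

definition sot :: "(nat \<Rightarrow> 'h::complex_hilbert bop) \<Rightarrow> 'h bop \<Rightarrow> bool" where
  "sot X x \<longleftrightarrow> (\<forall>\<xi>. (\<lambda>n. X n \<triangleright> \<xi>) \<longlonglongrightarrow> x \<triangleright> \<xi>)"

lemma sot_unique: "sot X x \<Longrightarrow> sot X y \<Longrightarrow> x = y"
  unfolding sot_def by (rule bop_eqI) (metis LIMSEQ_unique)

lemma sot_const: "sot (\<lambda>n. x) x" by (simp add: sot_def)

lemma sot_add: "sot X x \<Longrightarrow> sot Y y \<Longrightarrow> sot (\<lambda>n. X n + Y n) (x + y)"
  by (auto simp: sot_def ap_linear intro!: tendsto_add)

lemma sot_diff: "sot X x \<Longrightarrow> sot Y y \<Longrightarrow> sot (\<lambda>n. X n - Y n) (x - y)"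
  by (auto simp: sot_def ap_linear intro!: tendsto_diff)

lemma sot_mult_left: "sot X x \<Longrightarrow> sot (\<lambda>n. y * X n) (y * x)"
  unfolding sot_def ap_mult using tendsto_ap[OF tendsto_const] by blast

lemma sot_mult_right: "sot X x \<Longrightarrow> sot (\<lambda>n. X n * y) (x * y)"
  by (auto simp: sot_def)

lemma sot_mult:
  assumes X: "sot X x" and Y: "sot Y y" and bd: "\<And>n. norm (X n) \<le> K"
  shows "sot (\<lambda>n. X n * Y n) (x * y)"
  unfolding sot_def
proof
  fix \<xi>
  have "(\<lambda>n. norm (X n \<triangleright> (Y n \<triangleright> \<xi> - y \<triangleright> \<xi>))) \<longlonglongrightarrow> 0"
  proof (rule tendsto_sandwich[of "\<lambda>n. 0" _ _ "\<lambda>n. K * norm (Y n \<triangleright> \<xi> - y \<triangleright> \<xi>)"])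
    have "(\<lambda>n. Y n \<triangleright> \<xi> - y \<triangleright> \<xi>) \<longlonglongrightarrow> y \<triangleright> \<xi> - y \<triangleright> \<xi>"
      using Y unfolding sot_def by (intro tendsto_intros) blast
    then show "(\<lambda>n. K * norm (Y n \<triangleright> \<xi> - y \<triangleright> \<xi>)) \<longlonglongrightarrow> 0"
      using tendsto_mult_right_zero tendsto_norm_zero by fastforce
    show "\<forall>\<^sub>F n in sequentially. norm (X n \<triangleright> (Y n \<triangleright> \<xi> - y \<triangleright> \<xi>)) \<le> K * norm (Y n \<triangleright> \<xi> - y \<triangleright> \<xi>)"
      by (intro always_eventually allI order_trans[OF norm_ap] mult_right_mono bd) simp
  qed auto
  then have "(\<lambda>n. X n \<triangleright> (Y n \<triangleright> \<xi> - y \<triangleright> \<xi>)) \<longlonglongrightarrow> 0" by (rule tendsto_norm_zero_cancel)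
  moreover have "(\<lambda>n. X n \<triangleright> y \<triangleright> \<xi>) \<longlonglongrightarrow> x \<triangleright> y \<triangleright> \<xi>" using X by (simp add: sot_def)
  ultimately have "(\<lambda>n. X n \<triangleright> (Y n \<triangleright> \<xi> - y \<triangleright> \<xi>) + X n \<triangleright> y \<triangleright> \<xi>) \<longlonglongrightarrow> 0 + x \<triangleright> y \<triangleright> \<xi>"
    by (rule tendsto_add)
  then show "(\<lambda>n. (X n * Y n) \<triangleright> \<xi>) \<longlonglongrightarrow> (x * y) \<triangleright> \<xi>" by (simp add: ap_diff_right)
qed

lemma sot_Suc: "sot X x \<Longrightarrow> sot (\<lambda>n. X (Suc n)) x"
  unfolding sot_def using LIMSEQ_Suc[of "\<lambda>n. X n \<triangleright> \<xi>" for \<xi>] by blast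

lemma sot_cinner: "sot X x \<Longrightarrow> (\<lambda>n. cinner (X n \<triangleright> \<xi>) \<eta>) \<longlonglongrightarrow> cinner (x \<triangleright> \<xi>) \<eta>"
  unfolding sot_def using tendsto_cinner[OF _ tendsto_const] by blast

lemma sot_star: "sot X x \<Longrightarrow> sot (\<lambda>n. star (X n)) y \<Longrightarrow> star x = y"
proof (rule starI)
  fix \<xi> \<eta> assume X: "sot X x" and Y: "sot (\<lambda>n. star (X n)) y"
  have "(\<lambda>n. cinner (X n \<triangleright> \<xi>) \<eta>) \<longlonglongrightarrow> cinner (x \<triangleright> \<xi>) \<eta>" by (rule sot_cinner[OF X])
  moreover have "(\<lambda>n. cinner \<xi> (star (X n) \<triangleright> \<eta>)) \<longlonglongrightarrow> cinner \<xi> (y \<triangleright> \<eta>)"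
    using Y tendsto_cinner[OF tendsto_const] unfolding sot_def by blast
  ultimately show "cinner (x \<triangleright> \<xi>) \<eta> = cinner \<xi> (y \<triangleright> \<eta>)"
    unfolding cinner_star by (rule LIMSEQ_unique)
qed

lemma sot_commute:
  assumes "sot X x" "\<And>n. X n * y = y * X n" shows "x * y = y * x"
  using sot_unique[OF sot_mult_right[OF assms(1), of y], of "y * x"] sot_mult_left[OF assms(1), of y]
  by (simp add: assms(2))

lemma sot_pos:
  assumes "sot X x" "\<And>n. pos (X n)" shows "pos x"
proof (rule posI)
  have "star (X n) = X n" for n using assms(2) posD by blast
  then show "star x = x" using sot_star[OF assms(1), of x] assms(1) by simp
  fix \<xi>
  have "(\<lambda>n. Re (cinner (X n \<triangleright> \<xi>) \<xi>)) \<longlonglongrightarrow> Re (cinner (x \<triangleright> \<xi>) \<xi>)"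
    by (intro tendsto_Re sot_cinner assms)
  then show "0 \<le> Re (cinner (x \<triangleright> \<xi>) \<xi>)"
    by (rule LIMSEQ_le_const) (use posD(2)[OF assms(2)] in blast)
qed

lemma sot_exists:
  assumes bd: "\<And>n. norm (X n) \<le> K" and conv: "\<And>\<xi>. Cauchy (\<lambda>n. X n \<triangleright> \<xi>)"
  shows "\<exists>x. sot X x \<and> norm x \<le> K"
proof -
  have "\<exists>l. (\<lambda>n. X n \<triangleright> \<xi>) \<longlonglongrightarrow> l" for \<xi>
    using conv Cauchy_convergent convergent_def by blast
  then obtain f where f: "\<And>\<xi>. (\<lambda>n. X n \<triangleright> \<xi>) \<longlonglongrightarrow> f \<xi>" by metis
  have K: "0 \<le> K" using bd[of 0] norm_ge_zero order_trans by blast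
  have nf: "norm (f \<xi>) \<le> K * norm \<xi>" for \<xi>
    by (rule LIMSEQ_le_const2[OF tendsto_norm[OF f]])
      (use order_trans[OF norm_ap mult_right_mono[OF bd norm_ge_zero]] in blast)
  have "\<exists>T. \<forall>\<xi>. T \<triangleright> \<xi> = f \<xi>"
  proof (rule bop_exists[OF _ _ nf])
    show "f (a + b) = f a + f b" for a b
      by (rule LIMSEQ_unique[OF f]) (auto simp: ap_linear intro!: tendsto_add f)
    show "f (a *\<^sub>C b) = a *\<^sub>C f b" for a b
      by (rule LIMSEQ_unique[OF f])
        (auto simp: ap_linear intro!: bounded_linear.tendsto[OF bounded_linear_scaleC] f)
  qed
  then obtain T where T: "\<And>\<xi>. T \<triangleright> \<xi> = f \<xi>" by blast
  show ?thesis by (rule exI[of _ T]) (auto simp: sot_def T f intro!: norm_bop_bound K nf)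
qed

lemma Cauchy_of_sq_bound:
  fixes v :: "nat \<Rightarrow> 'a::real_normed_vector" and q :: "nat \<Rightarrow> real"
  assumes q: "Cauchy q" and K: "0 \<le> K"
    and le: "\<And>m n. n \<le> m \<Longrightarrow> (norm (v m - v n))\<^sup>2 \<le> K * \<bar>q m - q n\<bar>"
  shows "Cauchy v"
proof (rule metric_CauchyI)
  fix e :: real assume e: "0 < e"
  obtain N where N: "\<And>m n. N \<le> m \<Longrightarrow> N \<le> n \<Longrightarrow> dist (q m) (q n) < e\<^sup>2 / (K + 1)"
    using metric_CauchyD[OF q, of "e\<^sup>2 / (K + 1)"] e K by auto
  have *: "norm (v m - v n) < e" if "N \<le> n" "n \<le> m" for m n
  proof -
    have "(norm (v m - v n))\<^sup>2 \<le> K * \<bar>q m - q n\<bar>" by (rule le[OF that(2)])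
    also have "\<dots> \<le> K * (e\<^sup>2 / (K + 1))"
      using N[of m n] that K by (intro mult_left_mono) (auto simp: dist_real_def)
    also have "\<dots> < e\<^sup>2" using K e by (simp add: field_simps)
    finally show ?thesis using e by (simp add: power_less_imp_less_base)
  qed
  show "\<exists>M. \<forall>m\<ge>M. \<forall>n\<ge>M. dist (v m) (v n) < e"
    by (rule exI[of _ N]) (metis * dist_norm dist_commute nat_le_linear)
qed

text \<open>For \<open>n \<le> m\<close> the difference \<open>X m - X n\<close> lies between 0 and
  \<open>K\<close>, so \<open>pos_norm_ap_sq\<close> bounds the squared length of its value at
  \<open>\<xi>\<close> by \<open>K\<close> times the increment of a bounded increasing sequence of
  numbers.\<close>

lemma vigier:
  assumes p: "\<And>n. pos (X n)" and inc: "\<And>n. pos (X (Suc n) - X n)" and bd: "\<And>n. pos (K *\<^sub>R 1 - X n)" and K: "0 \<le> K"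
  shows "\<exists>x. sot X x \<and> norm x \<le> K"
proof (rule sot_exists)
  show "norm (X n) \<le> K" for n by (rule pos_norm_le[OF p bd K])
  fix \<xi>
  define q where "q n = Re (cinner (X n \<triangleright> \<xi>) \<xi>)" for n
  have incD: "pos (X m - X n)" if "n \<le> m" for n m using that
  proof (induction m rule: dec_induct)
    case (step m)
    show ?case using pos_add[OF inc[of m] step.IH] by simp
  qed simp
  have diff: "q m - q n = Re (cinner ((X m - X n) \<triangleright> \<xi>) \<xi>)" for m n by (simp add: q_def ap_linear cinner_linear)
  have "incseq q" unfolding incseq_def using diff posD(2)[OF incD] by (metis diff_ge_0_iff_ge)
  moreover have "q n \<le> K * (norm \<xi>)\<^sup>2" for n
    using posD(2)[OF bd[of n], of \<xi>] by (simp add: q_def ap_linear cinner_linear cinner_scaleR_left)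
  ultimately obtain L where "q \<longlonglongrightarrow> L" using incseq_convergent by blast
  then have "Cauchy q" by (rule LIMSEQ_imp_Cauchy)
  then show "Cauchy (\<lambda>n. X n \<triangleright> \<xi>)"
  proof (rule Cauchy_of_sq_bound[OF _ K])
    fix m n :: nat assume nm: "n \<le> m"
    have "pos (K *\<^sub>R 1 - (X m - X n))" using pos_add[OF bd[of m] p[of n]] by (simp add: algebra_simps)
    from pos_norm_ap_sq[OF incD[OF nm] this, of \<xi>]
    have "(norm (X m \<triangleright> \<xi> - X n \<triangleright> \<xi>))\<^sup>2 \<le> K * (q m - q n)" by (simp add: diff ap_linear)
    also have "\<dots> \<le> K * \<bar>q m - q n\<bar>" by (intro mult_left_mono K) simp
    finally show "(norm (X m \<triangleright> \<xi> - X n \<triangleright> \<xi>))\<^sup>2 \<le> K * \<bar>q m - q n\<bar>" .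
  qed
qed

definition proj :: "'h::complex_hilbert bop \<Rightarrow> bool" where
  "proj e \<longleftrightarrow> star e = e \<and> e * e = e"

lemma projD: "proj e \<Longrightarrow> star e = e" "proj e \<Longrightarrow> e * e = e" by (auto simp: proj_def)

lemma proj_pos: "proj e \<Longrightarrow> pos e" using pos_sq[of e] by (simp add: proj_def)

lemma proj_compl: "proj e \<Longrightarrow> proj (1 - e)" by (auto simp: proj_def star_simps algebra_simps)

lemma proj_norm: "proj e \<Longrightarrow> norm e \<le> 1"
  using pos_norm_le[of e 1] proj_pos proj_compl by (metis scaleR_one zero_le_one)

text \<open>The powers of 0 \<le> d \<le> 1 decrease to the projection onto the fixed vectors of
  \<open>d\<close>. Kernel projections come from this: the fixed vectors of
  \<open>1 - c * c\<close>, for a self-adjoint contraction \<open>c\<close>, are the kernel of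
  \<open>c\<close>, and those of \<open>1 - s\<close> are the kernel of \<open>s\<close>.\<close>

lemma power_limit:
  assumes d: "pos d" and d1: "pos (1 - d)"
  obtains E where "proj E" "d * E = E" "E * d = E" "sot (\<lambda>n. d ^ n) E"
    "\<And>y. d * y = y * d \<Longrightarrow> E * y = y * E" "\<And>y. d * y = y \<Longrightarrow> E * y = y"
proof -
  have dec: "pos (d ^ n - d ^ Suc n)" for n by (rule pos_power_diff[OF d d1])
  have le1: "pos (1 - d ^ n)" for n
  proof (induction n)
    case (Suc n)
    show ?case using pos_add[OF Suc dec[of n]] by simp
  qed simp
  have "\<exists>x. sot (\<lambda>n. 1 - d ^ n) x \<and> norm x \<le> 1"
  proof (rule vigier)
    show "pos (1 - d ^ n)" for n by (rule le1)
    show "pos (1 - d ^ Suc n - (1 - d ^ n))" for n using dec[of n] by simp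
    show "pos (1 *\<^sub>R 1 - (1 - d ^ n))" for n using pos_power[OF d, of n] by simp
  qed simp
  then obtain x where x: "sot (\<lambda>n. 1 - d ^ n) x" by blast
  define E where "E = 1 - x"
  have E: "sot (\<lambda>n. d ^ n) E" using sot_diff[OF sot_const[of 1] x] by (simp add: E_def)
  have dE: "d * E = E" using sot_unique[OF sot_Suc[OF E], of "d * E"] sot_mult_left[OF E, of d] by simp
  have Ed: "E * y = y * E" if "d * y = y * d" for y
    by (rule sot_commute[OF E]) (rule commute_power[OF that])
  have Ey: "E * y = y" if "d * y = y" for y
  proof -
    have "d ^ n * y = y" for n by (induction n) (auto simp: mult.assoc that)
    then show ?thesis using sot_unique[OF sot_mult_right[OF E, of y], of y] sot_const[of y] by simp
  qed
  have "star (d ^ n) = d ^ n" for n using posD(1)[OF d] by (simp add: star_power)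
  then have "star E = E" using sot_star[OF E, of E] E by simp
  moreover have "E * E = E" by (rule Ey[OF dE])
  moreover have "E * d = E" using Ed[of d] dE by simp
  ultimately have "proj E" "E * d = E" by (simp_all add: proj_def)
  then show ?thesis by (rule that[OF _ dE _ E Ed Ey])
qed

text \<open>With \<open>R = 1 + norm s\<close> the operator
  \<open>d = 1 - (1 / R) *\<^sub>R (1 + s)\<close> has norm at most \<open>1 - 1 / R\<close>, and
  the equation \<open>r = (1 / R) *\<^sub>R 1 + d * r\<close> says \<open>(1 + s) * r = 1\<close>.
  Banach's fixed point theorem solves it.\<close>

lemma resolvent:
  assumes s: "pos s"
  obtains r where "(1 + s) * r = 1" "r * (1 + s) = 1" "pos r" "pos (1 - r)"
    "\<And>y. s * y = y * s \<Longrightarrow> r * y = y * r"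
proof -
  define R where "R = 1 + norm s"
  have R: "1 \<le> R" by (simp add: R_def)
  define d where "d = 1 - (1 / R) *\<^sub>R (1 + s)"
  have ss: "star s = s" by (rule posD[OF s])
  have "pos (norm s *\<^sub>R 1 - s)" by (rule pos_norm_bound_diff[OF ss]) simp
  then have "pos ((1/R) *\<^sub>R (norm s *\<^sub>R 1 - s))" by (rule pos_scaleR) (use R in simp)
  moreover have "(1/R) *\<^sub>R (norm s *\<^sub>R 1 - s) = d"
  proof -
    have "(norm s / R) *\<^sub>R (1::'a bop) = 1 - (1 / R) *\<^sub>R 1"
    proof -
      have "norm s = R - 1" by (simp add: R_def)
      then have "norm s / R = 1 - 1 / R" using R by (simp add: diff_divide_distrib)
      then show ?thesis by (simp only: scaleR_diff_left scaleR_one)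
    qed
    then show ?thesis by (simp add: d_def algebra_simps)
  qed
  ultimately have pd: "pos d" by simp
  have "pos ((1/R) *\<^sub>R s)" using pos_scaleR[OF s] R by simp
  then have "pos ((1 - 1/R) *\<^sub>R 1 - d)" by (simp add: d_def algebra_simps)
  then have nd: "norm d \<le> 1 - 1 / R" by (rule pos_norm_le[OF pd]) (use R in simp)
  have "\<exists>!X. (1/R) *\<^sub>R 1 + d * X = X"
  proof (rule banach_fix_type[of "1 - 1/R"])
    show "\<forall>x y. dist ((1/R) *\<^sub>R 1 + d * x) ((1/R) *\<^sub>R 1 + d * y) \<le> (1 - 1 / R) * dist x y"
      using nd by (auto simp: dist_norm right_diff_distrib[symmetric] intro!: order_trans[OF norm_mult_ineq] mult_right_mono)
  qed (use R in auto)
  then obtain r where r: "(1/R) *\<^sub>R 1 + d * r = r" by blast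
  then have "(1/R) *\<^sub>R ((1 + s) * r) = (1/R) *\<^sub>R 1" by (simp add: d_def algebra_simps)
  then have 1: "(1 + s) * r = 1" using R by simp
  have "star ((1 + s) * r) = star r * (1 + s)" by (simp add: star_simps ss)
  then have "star r * (1 + s) = 1" unfolding 1 by simp
  moreover from this have sr: "star r = r" by (metis 1 mult.assoc mult_1 mult_1_right)
  ultimately have 2: "r * (1 + s) = 1" by simp
  have pr: "pos r"
  proof -
    have "pos (star r * (1 + s) * r)" by (rule pos_conj[OF pos_add[OF pos_one s]])
    then show ?thesis by (simp add: sr 2)
  qed
  have "pos (1 - r)"
  proof -
    have rs: "1 - r = s * r" using 1 by (simp add: algebra_simps)
    have "s * r = star r * s * r + star (s * r) * (s * r)"
      using 2 by (simp add: sr star_simps ss) (metis (no_types, lifting) distrib_left distrib_right mult.assoc mult_1 mult_1_right)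
    then show ?thesis unfolding rs using pos_add[OF pos_conj[OF s] pos_star_mult] by metis
  qed
  moreover have "r * y = y * r" if "s * y = y * s" for y
  proof -
    have "r * y = r * y * ((1 + s) * r)" by (simp add: 1)
    also have "\<dots> = r * ((1 + s) * y) * r" using that by (simp add: algebra_simps)
    also have "\<dots> = (r * (1 + s)) * y * r" by (simp only: mult.assoc)
    also have "\<dots> = y * r" by (simp add: 2)
    finally show ?thesis .
  qed
  ultimately show ?thesis using that[of r] 1 2 pr by blast
qed

text \<open>Put \<open>\<eta> = r \<triangleright> \<xi>\<close> and
  \<open>\<eta>' = r' \<triangleright> \<xi>\<close>. Expand the non-negative form of
  \<open>1 + s\<close> at \<open>\<eta> - \<eta>'\<close> and enlarge its last term by replacing
  \<open>s\<close> by \<open>s'\<close>; all terms then become inner products with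
  \<open>\<xi>\<close>.\<close>

lemma resolvent_antimono:
  assumes s: "pos s" and le: "pos (s' - s)"
    and r: "(1 + s) * r = 1" "star r = r" and r': "(1 + s') * r' = 1" "star r' = r'"
  shows "pos (r - r')"
proof (rule posI)
  show "star (r - r') = r - r'" by (simp add: star_simps r r')
  fix \<xi>
  define \<eta> \<eta>' where "\<eta> = r \<triangleright> \<xi>" and "\<eta>' = r' \<triangleright> \<xi>"
  have e: "(1 + s) \<triangleright> \<eta> = \<xi>" "(1 + s') \<triangleright> \<eta>' = \<xi>"
    using r(1) r'(1) by (metis \<eta>_def ap_mult ap_one, metis \<eta>'_def ap_mult ap_one)
  have "star (1 + s) = 1 + s" using posD(1)[OF s] by (simp add: star_simps)
  then have sym: "cinner ((1 + s) \<triangleright> \<eta>') \<eta> = cinner \<eta>' \<xi>" by (metis cinner_star e(1))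
  have "0 \<le> Re (cinner ((1 + s) \<triangleright> (\<eta> - \<eta>')) (\<eta> - \<eta>'))"
    by (intro posD(2) pos_add pos_one s)
  also have "\<dots> = Re (cinner \<xi> \<eta>) - 2 * Re (cinner \<xi> \<eta>') + Re (cinner ((1 + s) \<triangleright> \<eta>') \<eta>')"
    unfolding ap_diff_right[of "1 + s"] e using sym Re_cinner_commute[of \<eta>' \<xi>] by (simp add: cinner_linear)
  also have "Re (cinner ((1 + s) \<triangleright> \<eta>') \<eta>') \<le> Re (cinner ((1 + s') \<triangleright> \<eta>') \<eta>')"
    using posD(2)[OF le, of \<eta>'] by (simp add: ap_linear cinner_linear)
  finally have "Re (cinner \<xi> \<eta>') \<le> Re (cinner \<xi> \<eta>)" unfolding e by simp
  then show "0 \<le> Re (cinner ((r - r') \<triangleright> \<xi>) \<xi>)"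
    using Re_cinner_commute[of \<xi>] by (simp add: ap_linear cinner_linear \<eta>_def \<eta>'_def)
qed

subsection \<open>Spectral projections and the polar decomposition\<close>

text \<open>With \<open>b = 2 h - 1\<close> and \<open>a = |b|\<close>, the projection \<open>e\<close> onto the kernel of \<open>a - b\<close> is the spectral
  projection of \<open>h\<close> for \<open>[1/2, \<infinity>)\<close>.\<close>

lemma spectral_projection_op:
  assumes h: "star h = h" and b: "b = 2 *\<^sub>R h - 1" and R: "0 < R" "norm (b * b) \<le> R"
    and a: "a = sqrtc R (b * b)"
  obtains e r where "proj e" "b * e = a * e" "e - h = (1/2) *\<^sub>R ((1 - a) * (2 *\<^sub>R e - 1))"
    "\<And>y. h * y = y * h \<Longrightarrow> e * y = y * e"
    "\<And>p. proj p \<Longrightarrow> p * h = h \<Longrightarrow> p * e = e"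
    "star (r *\<^sub>R (a - b)) = r *\<^sub>R (a - b)" "norm (r *\<^sub>R (a - b)) \<le> 1"
    "sot (\<lambda>n. (1 - r *\<^sub>R (a - b) * r *\<^sub>R (a - b)) ^ n) e"
proof -
  have sb: "star b = b" by (simp add: b star_simps h)
  have pb: "pos (b * b)" by (rule pos_sq[OF sb])
  have aa: "a * a = b * b" and pa: "pos a" and ac: "\<And>y. b * b * y = y * (b * b) \<Longrightarrow> a * y = y * a"
    unfolding a by (fact sqrtc_sq[OF pb R(2,1)] pos_sqrtc[OF pb R(2,1)] sqrtc_commute[OF pb R(2,1)])+
  have sa: "star a = a" by (rule posD[OF pa])
  have ab: "a * b = b * a" by (rule ac) (simp add: mult.assoc)
  define r where "r = 1 / (norm (a - b) + 1)"
  have r0: "0 < r" by (simp add: r_def add_nonneg_pos)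
  define c where "c = r *\<^sub>R (a - b)"
  have sc: "star c = c" by (simp add: c_def star_simps sa sb)
  have nc: "norm c \<le> 1" by (simp add: c_def r_def divide_simps add_nonneg_pos)
  define d where "d = 1 - c * c"
  have ncc: "norm (c * c) \<le> 1"
    using nc norm_mult_ineq[of c c] mult_mono[OF nc nc] by simp
  have pd: "pos d"
    using pos_norm_bound_diff[OF _ ncc] posD(1)[OF pos_sq[OF sc]] by (simp add: d_def)
  have pd1: "pos (1 - d)" using pos_sq[OF sc] by (simp add: d_def)
  obtain E where E: "proj E" "d * E = E" "E * d = E" "sot (\<lambda>n. d ^ n) E"
    and Ec: "\<And>y. d * y = y * d \<Longrightarrow> E * y = y * E" and Ey: "\<And>y. d * y = y \<Longrightarrow> E * y = y"
    by (rule power_limit[OF pd pd1], rule that)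
  have bc: "b * y = y * b \<Longrightarrow> E * y = y * E" for y
  proof -
    assume yb: "b * y = y * b"
    then have "b * b * y = y * (b * b)" by (metis mult.assoc)
    then have ay: "a * y = y * a" by (rule ac)
    have "c * y = y * c" using ay yb by (simp add: c_def algebra_simps)
    then have "c * c * y = y * (c * c)" by (metis mult.assoc)
    then have "d * y = y * d" by (simp add: d_def algebra_simps)
    then show ?thesis by (rule Ec)
  qed
  have "c * c * E = 0" using E(2) by (simp add: d_def algebra_simps)
  then have "star (c * E) * (c * E) = 0" using projD(1)[OF E(1)] sc by (simp add: star_simps mult.assoc)
  then have "c * E = 0" by (rule star_mult_eq_zero)
  then have beE: "b * E = a * E" using r0 by (simp add: c_def algebra_simps)
  \<comment> \<open>\<open>c * (a + b)\<close> is a multiple of \<open>a * a - b * b\<close>. So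
    \<open>a + b\<close> is fixed by \<open>d\<close> and hence by \<open>E\<close>; together with
    \<open>b * E = a * E\<close> this gives the sign decomposition \<open>b2\<close>.\<close>
  have "c * (a + b) = 0" using aa ab by (simp add: c_def algebra_simps)
  then have "d * (a + b) = a + b" by (simp add: d_def left_diff_distrib mult.assoc)
  then have "E * (a + b) = a + b" by (rule Ey)
  moreover have "E * (a + b) = (a + b) * E" by (rule bc) (simp add: algebra_simps ab)
  ultimately have "a + b = (a + b) * E" by simp
  then have "a + b = a * E + a * E" by (simp only: distrib_right beE)
  then have b2: "b = a * (2 *\<^sub>R E - 1)"
    by (simp add: right_diff_distrib scaleR_2 distrib_left) (metis add_diff_cancel_left')
  show ?thesis
  proof (rule that[of E r])
    show "proj E" "b * E = a * E" by (fact E beE)+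
    show "E - h = (1/2) *\<^sub>R ((1 - a) * (2 *\<^sub>R E - 1))"
    proof -
      have "(1 - a) * (2 *\<^sub>R E - 1) = 2 *\<^sub>R E - 1 - b" unfolding left_diff_distrib by (subst b2) simp
      also have "\<dots> = 2 *\<^sub>R (E - h)" by (simp add: b algebra_simps)
      finally show ?thesis by simp
    qed
    show "E * y = y * E" if "h * y = y * h" for y
      by (rule bc) (use that in \<open>simp add: b algebra_simps\<close>)
    show "star (r *\<^sub>R (a - b)) = r *\<^sub>R (a - b)" "norm (r *\<^sub>R (a - b)) \<le> 1"
      using sc nc by (simp_all add: c_def)
    show "sot (\<lambda>n. (1 - r *\<^sub>R (a - b) * r *\<^sub>R (a - b)) ^ n) E" using E(4) by (simp only: d_def c_def)
    fix p :: "'a bop" assume p: "proj p" "p * h = h"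
    have hp: "h * p = h" using arg_cong[OF p(2), of star] projD[OF p(1)] h by (simp add: star_simps)
    have bp: "b * (1 - p) = (1 - p) * b" by (simp add: b algebra_simps hp p(2))
    have Ep: "E * (1 - p) = (1 - p) * E" by (rule bc[OF bp])
    have "b * b * (1 - p) = (1 - p) * (b * b)" using bp by (metis mult.assoc)
    then have ap: "a * (1 - p) = (1 - p) * a" by (rule ac)
    \<comment> \<open>On the range of \<open>1 - p\<close> the operator \<open>h\<close> vanishes
      and \<open>b\<close> acts as -1, whereas on the range of \<open>E\<close> it agrees with the
      positive \<open>a\<close>. The overlap \<open>f\<close> is therefore zero.\<close>
    define f where "f = (1 - p) * E"
    have "b * (1 - p) = - (1 - p)" by (simp add: b algebra_simps hp scaleR_2)
    then have "b * f = - f" unfolding f_def mult.assoc[symmetric] by (simp only: mult_minus_left)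
    moreover have "b * f = a * f"
      unfolding f_def by (metis beE bp ap mult.assoc)
    ultimately have af: "a * f = - f" by simp
    have "pos (star f * a * f)" by (rule pos_conj[OF pa])
    then have "pos (- (star f * f))" by (simp add: mult.assoc af)
    then have "star f * f = 0" using pos_antisym[OF pos_star_mult] by blast
    then have "f = 0" by (rule star_mult_eq_zero)
    then show "p * E = E" by (simp add: f_def algebra_simps)
  qed
qed

text \<open>\<open>k n\<close> is a truncated geometric series in \<open>d = 1 - s\<close>, so
  \<open>s * k n = 1 - d ^ n\<close> tends to \<open>1 - E\<close>, where \<open>E\<close> is the
  kernel projection of \<open>s\<close>. Since \<open>x\<close> and \<open>s\<close> have equal
  norms on every vector, \<open>x * k n\<close> converges strongly too, even if the
  \<open>k n\<close> are unbounded; its limit is \<open>v\<close>. As a limit of products of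
  \<open>x\<close> with polynomials in \<open>s\<close>, \<open>v\<close> inherits the commutation
  and support properties of \<open>x\<close>.\<close>

lemma polar_decomposition_op:
  fixes x :: "'h::complex_hilbert bop"
  assumes x: "norm x \<le> 1"
  obtains v E s where "s = sqrtc 1 (star x * x)" "pos s" "s * s = star x * x" "x = v * s"
    "star v * v = 1 - E" "proj E" "s * E = 0"
    "\<And>T. T * x = x * T \<Longrightarrow> T * star x = star x * T \<Longrightarrow> T * v = v * T"
    "\<And>y. x * y = 0 \<Longrightarrow> v * y = 0" "\<And>q. q * x = x \<Longrightarrow> q * v = v"
proof -
  have n1: "norm (star x * x) \<le> 1"
    using norm_mult_ineq[of "star x" x] mult_mono[OF x x] by simp
  define s where "s = sqrtc 1 (star x * x)"
  have ss: "s * s = star x * x" and ps: "pos s"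
    and sc: "\<And>y. star x * x * y = y * (star x * x) \<Longrightarrow> s * y = y * s"
    unfolding s_def by (fact sqrtc_sq[OF pos_star_mult n1 zero_less_one] pos_sqrtc[OF pos_star_mult n1 zero_less_one]
        sqrtc_commute[OF pos_star_mult n1 zero_less_one])+
  have sts: "star s = s" by (rule posD[OF ps])
  have eqn: "norm (x \<triangleright> \<xi>) = norm (s \<triangleright> \<xi>)" for \<xi>
    by (rule norm_ap_eq_of_star_mult) (simp add: sts ss)
  have ns: "norm s \<le> 1"
    by (rule norm_bop_bound) (simp_all only: eqn[symmetric] zero_le_one order_trans[OF norm_ap mult_right_mono[OF x norm_ge_zero]])
  define d where "d = 1 - s"
  have pd: "pos d" using pos_norm_bound_diff[OF sts ns] by (simp add: d_def)
  have pd1: "pos (1 - d)" using ps by (simp add: d_def)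
  have nd: "norm d \<le> 1" using pos_norm_le[OF pd, of 1] pd1 by simp
  obtain E where E: "proj E" "d * E = E" "E * d = E" "sot (\<lambda>n. d ^ n) E"
    and Ec: "\<And>y. d * y = y * d \<Longrightarrow> E * y = y * E" and Ey: "\<And>y. d * y = y \<Longrightarrow> E * y = y"
    by (rule power_limit[OF pd pd1], rule that)
  have sE: "s * E = 0" using E(2) by (simp add: d_def algebra_simps)
  define k where "k n = (\<Sum>j<n. d ^ j)" for n
  have kk: "k n * y = y * k n" if "s * y = y * s" for n y
  proof -
    have "d * y = y * d" using that by (simp add: d_def algebra_simps)
    then show ?thesis by (simp add: k_def sum_distrib_left sum_distrib_right commute_power)
  qed
  have sk: "s * k n = 1 - d ^ n" for n
    by (induction n) (simp_all add: k_def distrib_left, simp add: d_def algebra_simps)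
  have ks: "star (k n) = k n" for n using posD(1)[OF pd] by (simp add: k_def star_sum star_power)
  define X where "X n = x * k n" for n
  have Xn: "norm (X n \<triangleright> \<xi> - X m \<triangleright> \<xi>) = norm (d ^ n \<triangleright> \<xi> - d ^ m \<triangleright> \<xi>)" for n m \<xi>
  proof -
    have "norm (X n \<triangleright> \<xi> - X m \<triangleright> \<xi>) = norm (x \<triangleright> (k n - k m) \<triangleright> \<xi>)" by (simp add: X_def ap_linear)
    also have "\<dots> = norm (s \<triangleright> (k n - k m) \<triangleright> \<xi>)" by (simp only: eqn)
    also have "\<dots> = norm ((s * k n - s * k m) \<triangleright> \<xi>)" by (simp add: ap_linear)
    also have "\<dots> = norm (d ^ n \<triangleright> \<xi> - d ^ m \<triangleright> \<xi>)"
      unfolding sk by (simp add: ap_linear norm_minus_commute)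
    finally show ?thesis .
  qed
  have ndn: "norm (1 - d ^ n) \<le> 2" for n
    using norm_triangle_ineq4[of 1 "d ^ n"] norm_power_le[OF nd, of n] norm_one_le[where 'h='h] by linarith
  have "\<exists>v. sot X v \<and> norm v \<le> 2"
  proof (rule sot_exists)
    show "norm (X n) \<le> 2" for n
    proof (rule norm_bop_bound)
      fix \<xi>
      have "norm (X n \<triangleright> \<xi>) = norm ((s * k n) \<triangleright> \<xi>)" by (simp add: X_def eqn)
      also have "\<dots> \<le> 2 * norm \<xi>" unfolding sk by (rule order_trans[OF norm_ap mult_right_mono[OF ndn]]) simp
      finally show "norm (X n \<triangleright> \<xi>) \<le> 2 * norm \<xi>" .
    qed simp
    fix \<xi>
    have "Cauchy (\<lambda>n. d ^ n \<triangleright> \<xi>)" using E(4) unfolding sot_def by (blast intro: LIMSEQ_imp_Cauchy)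
    then show "Cauchy (\<lambda>n. X n \<triangleright> \<xi>)" unfolding Cauchy_def dist_norm Xn .
  qed
  then obtain v where v: "sot X v" by blast
  have one: "sot (\<lambda>n. 1 - d ^ n) (1 - E)" by (intro sot_diff sot_const E)
  have XX: "star (X n) * X n = (1 - d ^ n) * (1 - d ^ n)" for n
  proof -
    have "star (X n) * X n = k n * (s * s) * k n" by (simp add: X_def star_simps ks ss mult.assoc)
    also have "\<dots> = (k n * s) * (s * k n)" by (simp only: mult.assoc)
    also have "k n * s = s * k n" by (rule kk) simp
    finally show ?thesis by (simp only: sk)
  qed
  have vv: "star v * v = 1 - E"
  proof (rule bop_eqI, rule cinner_ext)
    fix \<xi> \<eta>
    have "(\<lambda>n. cinner (X n \<triangleright> \<eta>) (X n \<triangleright> \<xi>)) \<longlonglongrightarrow> cinner (v \<triangleright> \<eta>) (v \<triangleright> \<xi>)"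
      by (intro tendsto_cinner) (use v in \<open>simp_all add: sot_def\<close>)
    moreover have "cinner (X n \<triangleright> \<eta>) (X n \<triangleright> \<xi>) = cinner \<eta> (((1 - d ^ n) * (1 - d ^ n)) \<triangleright> \<xi>)" for n
      unfolding XX[symmetric] by (simp add: cinner_star)
    moreover have "(\<lambda>n. cinner \<eta> (((1 - d ^ n) * (1 - d ^ n)) \<triangleright> \<xi>)) \<longlonglongrightarrow> cinner \<eta> (((1 - E) * (1 - E)) \<triangleright> \<xi>)"
      using sot_mult[OF one one ndn] tendsto_cinner[OF tendsto_const] unfolding sot_def by blast
    ultimately have "cinner (v \<triangleright> \<eta>) (v \<triangleright> \<xi>) = cinner \<eta> (((1 - E) * (1 - E)) \<triangleright> \<xi>)"
      by (simp only:) (rule LIMSEQ_unique)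
    then show "cinner \<eta> ((star v * v) \<triangleright> \<xi>) = cinner \<eta> ((1 - E) \<triangleright> \<xi>)"
      using projD(2)[OF proj_compl[OF E(1)]] by (simp add: cinner_star)
  qed
  have vs: "x = v * s"
  proof (rule sot_unique)
    have "star x * x = star s * s" by (simp add: sts ss)
    then have xE: "x * E = 0" using sE by (rule zero_of_star_mult)
    have "X n * s = x * (1 - d ^ n)" for n
      using kk[of s n] sk[of n] by (simp add: X_def mult.assoc)
    moreover have "sot (\<lambda>n. x * (1 - d ^ n)) (x * (1 - E))" by (rule sot_mult_left[OF one])
    ultimately show "sot (\<lambda>n. X n * s) x" using xE by (simp add: right_diff_distrib)
    show "sot (\<lambda>n. X n * s) (v * s)" by (rule sot_mult_right[OF v])
  qed
  show ?thesis
  proof (rule that[of s v E])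
    show "s = sqrtc 1 (star x * x)" "pos s" "s * s = star x * x" "x = v * s" "star v * v = 1 - E" "proj E" "s * E = 0"
      by (fact s_def ps ss vs vv E(1) sE)+
    show "T * v = v * T" if T: "T * x = x * T" "T * star x = star x * T" for T
    proof -
      have "star x * x * T = T * (star x * x)" using T by (metis mult.assoc)
      then have "k n * T = T * k n" for n using kk sc by blast
      then have "X n * T = T * X n" for n using T(1) by (simp add: X_def) (metis mult.assoc)
      from sot_commute[OF v this] show ?thesis by simp
    qed
    show "q * v = v" if "q * x = x" for q
    proof -
      have "q * X n = X n" for n using that by (simp add: X_def flip: mult.assoc)
      then show ?thesis using sot_unique[OF sot_mult_left[OF v, of q]] v by simp
    qed
    show "v * y = 0" if "x * y = 0" for y
    proof -
      have "s * y = 0" by (rule zero_of_star_mult[of s x]) (simp_all add: sts ss that)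
      then have "d * y = y" by (simp add: d_def algebra_simps)
      then have "E * y = y" by (rule Ey)
      then have "star v * v * y = 0" by (simp add: vv algebra_simps)
      then have "star (v * y) * (v * y) = 0" by (simp add: star_simps mult.assoc)
      then show ?thesis by (rule star_mult_eq_zero)
    qed
  qed
qed

section \<open>Von Neumann algebras\<close>

definition comm :: "'h::complex_hilbert bop set \<Rightarrow> 'h bop set" where
  "comm S = {T. \<forall>s\<in>S. T * s = s * T}"

locale vn =
  fixes M :: "'h::complex_hilbert bop set"
  assumes M_star: "x \<in> M \<Longrightarrow> star x \<in> M" and bicomm: "comm (comm M) = M"
begin

lemma M_I: "(\<And>T. T \<in> comm M \<Longrightarrow> x * T = T * x) \<Longrightarrow> x \<in> M"
  using bicomm by (auto simp: comm_def)

lemma M_D: "x \<in> M \<Longrightarrow> T \<in> comm M \<Longrightarrow> x * T = T * x"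
  by (auto simp: comm_def)

lemma comm_star: "T \<in> comm M \<Longrightarrow> star T \<in> comm M"
  unfolding comm_def by (clarsimp, metis M_star star_mult star_star)

lemma M_mult: "x \<in> M \<Longrightarrow> y \<in> M \<Longrightarrow> x * y \<in> M"
  by (rule M_I) (metis M_D mult.assoc)

lemma M_add: "x \<in> M \<Longrightarrow> y \<in> M \<Longrightarrow> x + y \<in> M"
  by (rule M_I) (simp add: algebra_simps M_D)

lemma M_diff: "x \<in> M \<Longrightarrow> y \<in> M \<Longrightarrow> x - y \<in> M"
  by (rule M_I) (simp add: algebra_simps M_D)

lemma M_cop: "cop a \<in> M"
  by (rule M_I) (simp add: cop_commute)

lemma M_one: "1 \<in> M" and M_zero: "0 \<in> M"
  by (auto intro: M_I)

lemma M_scaleR: "x \<in> M \<Longrightarrow> r *\<^sub>R x \<in> M"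
  by (rule M_I) (simp add: M_D)

lemma M_minus: "x \<in> M \<Longrightarrow> - x \<in> M"
  by (rule M_I) (simp add: M_D)

lemma M_sum: "(\<And>i. i \<in> A \<Longrightarrow> f i \<in> M) \<Longrightarrow> sum f A \<in> M"
  by (induction A rule: infinite_finite_induct) (auto intro: M_add M_zero)

lemma M_power: "x \<in> M \<Longrightarrow> x ^ n \<in> M"
  by (induction n) (auto intro: M_mult M_one)

lemmas M_closed = M_star M_mult M_add M_diff M_cop M_one M_zero M_scaleR M_minus M_sum M_power

lemma M_sot: "(\<And>n. X n \<in> M) \<Longrightarrow> sot X x \<Longrightarrow> x \<in> M"
  by (rule M_I) (use sot_commute M_D in blast)

lemma M_tendsto: "(\<And>n. X n \<in> M) \<Longrightarrow> X \<longlonglongrightarrow> x \<Longrightarrow> x \<in> M"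
  by (rule M_sot[of X]) (auto simp: sot_def intro: tendsto_ap)

lemma M_sqrtc: "x \<in> M \<Longrightarrow> pos x \<Longrightarrow> norm x \<le> R \<Longrightarrow> 0 < R \<Longrightarrow> sqrtc R x \<in> M"
  by (rule M_I) (simp add: sqrtc_commute M_D)

end

section \<open>Traces and the 2-norm\<close>

locale tracial = vn M for M :: "'h::complex_hilbert bop set" +
  fixes \<tau> :: "'h bop \<Rightarrow> complex"
  assumes tau_add: "x \<in> M \<Longrightarrow> y \<in> M \<Longrightarrow> \<tau> (x + y) = \<tau> x + \<tau> y"
    and tau_cop: "x \<in> M \<Longrightarrow> \<tau> (cop a * x) = a * \<tau> x"
    and tau_pos: "x \<in> M \<Longrightarrow> \<tau> (star x * x) \<in> \<real>\<^sub>\<ge>\<^sub>0"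
    and tau_one: "\<tau> 1 = 1"
    and tau_comm: "x \<in> M \<Longrightarrow> y \<in> M \<Longrightarrow> \<tau> (x * y) = \<tau> (y * x)"
    and tau_faithful: "x \<in> M \<Longrightarrow> \<tau> (star x * x) = 0 \<Longrightarrow> x = 0"
    and tau_normal: "(\<And>n. X n \<in> M) \<Longrightarrow> (\<And>n. pos (X n)) \<Longrightarrow> (\<And>n. pos (X (Suc n) - X n)) \<Longrightarrow> sot X x
      \<Longrightarrow> (\<lambda>n. Re (\<tau> (X n))) \<longlonglongrightarrow> Re (\<tau> x)"
begin

definition tr :: "'h bop \<Rightarrow> real" where "tr x = Re (\<tau> x)"

text \<open>The absolute value makes \<open>n2\<close> non-negative on all operators, without a
  membership condition; on \<open>M\<close> it changes nothing, see \<open>n2_sq\<close>.\<close>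

definition n2 :: "'h bop \<Rightarrow> real" where "n2 x = sqrt \<bar>tr (star x * x)\<bar>"

lemma tau_scaleR: "x \<in> M \<Longrightarrow> \<tau> (r *\<^sub>R x) = r *\<^sub>R \<tau> x"
  using tau_cop[of x "complex_of_real r"] by (simp add: cop_of_real_mult scaleR_conv_of_real)

lemma tr_add: "x \<in> M \<Longrightarrow> y \<in> M \<Longrightarrow> tr (x + y) = tr x + tr y"
  by (simp add: tr_def tau_add)

lemma tr_scaleR: "x \<in> M \<Longrightarrow> tr (r *\<^sub>R x) = r * tr x"
  by (simp add: tr_def tau_scaleR)

lemma tr_minus: "x \<in> M \<Longrightarrow> tr (- x) = - tr x"
  using tr_scaleR[of x "-1"] by simp

lemma tr_diff: "x \<in> M \<Longrightarrow> y \<in> M \<Longrightarrow> tr (x - y) = tr x - tr y"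
  using tr_add[of x "- y"] tr_minus[of y] M_minus by simp

lemma tr_zero [simp]: "tr 0 = 0"
  using tr_scaleR[OF M_zero, of 0] by simp

lemma tr_one [simp]: "tr 1 = 1" by (simp add: tr_def tau_one)

lemma tr_sum: "(\<And>i. i \<in> A \<Longrightarrow> f i \<in> M) \<Longrightarrow> tr (sum f A) = (\<Sum>i\<in>A. tr (f i))"
  by (induction A rule: infinite_finite_induct) (auto simp: tr_add M_sum)

lemma tr_comm: "x \<in> M \<Longrightarrow> y \<in> M \<Longrightarrow> tr (x * y) = tr (y * x)"
  by (simp add: tr_def tau_comm)

text \<open>The trace of \<open>star y * y\<close> is real for \<open>y = 1 + cop \<i> * x\<close>;
  its imaginary part is the difference of the real parts of \<open>\<tau> x\<close> and
  \<open>\<tau> (star x)\<close>.\<close>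

lemma tr_star: assumes x: "x \<in> M" shows "tr (star x) = tr x"
proof -
  let ?y = "1 + cop \<i> * x"
  have "star ?y * ?y = 1 + cop \<i> * x + (cop (- \<i>) * star x + star x * x)"
    by (simp add: star_add star_cop_mult distrib_left distrib_right cop_mult_mult)
  then have "\<tau> (star ?y * ?y) = 1 + \<i> * \<tau> x + (- \<i> * \<tau> (star x) + \<tau> (star x * x))"
    using x by (simp add: tau_add tau_cop tau_one M_closed)
  moreover have "Im (\<tau> (star ?y * ?y)) = 0"
    using tau_pos[of ?y] x by (auto simp: M_closed complex_nonneg_Reals_iff)
  moreover have "Im (\<tau> (star x * x)) = 0" using tau_pos[OF x] by (auto simp: complex_nonneg_Reals_iff)
  ultimately show ?thesis by (simp add: tr_def)
qed

lemma M_pos_root: assumes "x \<in> M" "pos x" obtains y where "y \<in> M" "star y = y" "x = y * y"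
proof -
  define R where "R = norm x + 1"
  have R: "norm x \<le> R" "0 < R" by (simp_all add: R_def add_nonneg_pos)
  show ?thesis
    by (rule that[OF M_sqrtc[OF assms R] posD(1)[OF pos_sqrtc[OF assms(2) R]] sqrtc_sq[OF assms(2) R, symmetric]])
qed

lemma tr_pos: assumes "x \<in> M" "pos x" shows "0 \<le> tr x"
proof -
  obtain y where "y \<in> M" "star y = y" "x = y * y" using M_pos_root[OF assms] .
  then show ?thesis using tau_pos[of y] by (simp add: tr_def complex_nonneg_Reals_iff)
qed

lemma tr_mono: "x \<in> M \<Longrightarrow> y \<in> M \<Longrightarrow> pos (y - x) \<Longrightarrow> tr x \<le> tr y"
  using tr_pos[of "y - x"] by (simp add: tr_diff M_diff)

lemma tr_faithful: assumes "x \<in> M" "pos x" "tr x \<le> 0" shows "x = 0"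
proof -
  obtain y where y: "y \<in> M" "star y = y" "x = y * y" using M_pos_root[OF assms(1,2)] .
  have "\<tau> (star y * y) = 0"
    using tau_pos[OF y(1)] assms(3) y by (auto simp: tr_def complex_nonneg_Reals_iff complex_eq_iff)
  then show ?thesis using tau_faithful[OF y(1)] y by simp
qed

lemma tr_star_mult_nonneg: "x \<in> M \<Longrightarrow> 0 \<le> tr (star x * x)"
  by (intro tr_pos M_closed pos_star_mult)

lemma n2_sq: "x \<in> M \<Longrightarrow> (n2 x)\<^sup>2 = tr (star x * x)"
  by (simp add: n2_def tr_star_mult_nonneg)

lemma n2_nonneg [simp]: "0 \<le> n2 x"
  by (simp add: n2_def)

lemma n2_zero [simp]: "n2 0 = 0" by (simp add: n2_def)

lemma n2_eq_zero: "x \<in> M \<Longrightarrow> n2 x = 0 \<Longrightarrow> x = 0"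
  using tr_faithful[of "star x * x"] n2_sq[of x] by (auto simp: M_closed pos_star_mult intro: star_mult_eq_zero)

lemma n2_scaleR: "x \<in> M \<Longrightarrow> n2 (r *\<^sub>R x) = \<bar>r\<bar> * n2 x"
proof -
  assume x: "x \<in> M"
  have "star (r *\<^sub>R x) * (r *\<^sub>R x) = r\<^sup>2 *\<^sub>R (star x * x)" by (simp add: star_simps power2_eq_square)
  then show ?thesis using x by (simp add: n2_def tr_scaleR M_closed real_sqrt_mult abs_mult)
qed

lemma n2_cop: "x \<in> M \<Longrightarrow> n2 (cop a * x) = cmod a * n2 x"
proof -
  assume x: "x \<in> M"
  have "star (cop a * x) * (cop a * x) = cop (cnj a * a) * (star x * x)"
    by (simp only: star_cop_mult cop_mult_mult)
  also have "cnj a * a = complex_of_real ((cmod a)\<^sup>2)" by (metis complex_norm_square mult.commute of_real_power)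
  also have "cop \<dots> * (star x * x) = (cmod a)\<^sup>2 *\<^sub>R (star x * x)" by (rule cop_of_real_mult)
  finally show ?thesis using x by (simp add: n2_def tr_scaleR M_closed real_sqrt_mult abs_mult)
qed

lemma n2_star: "x \<in> M \<Longrightarrow> n2 (star x) = n2 x"
  by (simp add: n2_def tr_comm M_star)

lemma n2_minus: "x \<in> M \<Longrightarrow> n2 (- x) = n2 x"
  using n2_scaleR[of x "-1"] by simp

lemma n2_minus_commute: "x \<in> M \<Longrightarrow> y \<in> M \<Longrightarrow> n2 (x - y) = n2 (y - x)"
  using n2_minus[of "x - y"] by (simp add: M_diff)

lemma tr_star_mult_comm: "x \<in> M \<Longrightarrow> y \<in> M \<Longrightarrow> tr (star y * x) = tr (star x * y)"
  using tr_star[of "star x * y"] by (simp add: star_mult M_closed)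

lemma tr_cauchy_schwarz:
  assumes x: "x \<in> M" and y: "y \<in> M"
  shows "\<bar>tr (star x * y)\<bar> \<le> n2 x * n2 y"
proof -
  have "(tr (star x * y))\<^sup>2 \<le> tr (star x * x) * tr (star y * y)"
  proof (rule discriminant_le)
    show "0 \<le> tr (star x * x) + 2 * t * tr (star x * y) + t\<^sup>2 * tr (star y * y)" for t
    proof -
      have "star (x + t *\<^sub>R y) * (x + t *\<^sub>R y) = star x * x + t *\<^sub>R (star x * y) + t *\<^sub>R (star y * x) + (t\<^sup>2) *\<^sub>R (star y * y)"
        by (simp add: star_simps algebra_simps power2_eq_square)
      then have "tr (star (x + t *\<^sub>R y) * (x + t *\<^sub>R y)) = tr (star x * x) + 2 * t * tr (star x * y) + t\<^sup>2 * tr (star y * y)"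
        using x y by (simp add: tr_add tr_scaleR M_closed tr_star_mult_comm)
      then show ?thesis using tr_star_mult_nonneg[of "x + t *\<^sub>R y"] x y by (simp add: M_closed)
    qed
  qed (rule tr_star_mult_nonneg[OF y])
  then have "(tr (star x * y))\<^sup>2 \<le> (n2 x * n2 y)\<^sup>2" by (simp add: power_mult_distrib n2_sq x y)
  then show ?thesis by (simp add: abs_le_square_iff[symmetric] abs_mult)
qed

lemma n2_triangle:
  assumes x: "x \<in> M" and y: "y \<in> M"
  shows "n2 (x + y) \<le> n2 x + n2 y"
proof -
  have "star (x + y) * (x + y) = star x * x + star x * y + star y * x + star y * y"
    by (simp add: star_simps algebra_simps)
  then have "(n2 (x + y))\<^sup>2 = (n2 x)\<^sup>2 + 2 * tr (star x * y) + (n2 y)\<^sup>2"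
    using x y by (simp add: n2_sq tr_add M_closed tr_star_mult_comm)
  also have "\<dots> \<le> (n2 x + n2 y)\<^sup>2"
    using tr_cauchy_schwarz[OF x y] by (simp add: power2_sum)
  finally show ?thesis by (rule power2_le_imp_le) simp
qed

lemma n2_triangle_diff: "x \<in> M \<Longrightarrow> y \<in> M \<Longrightarrow> n2 (x - y) \<le> n2 x + n2 y"
  using n2_triangle[of x "- y"] by (simp add: M_closed n2_minus)

lemma n2_dist_triangle: "x \<in> M \<Longrightarrow> y \<in> M \<Longrightarrow> z \<in> M \<Longrightarrow> n2 (x - z) \<le> n2 (x - y) + n2 (y - z)"
  using n2_triangle[of "x - y" "y - z"] by (simp add: M_diff)

lemma n2_sum: "finite A \<Longrightarrow> (\<And>i. i \<in> A \<Longrightarrow> f i \<in> M) \<Longrightarrow> n2 (sum f A) \<le> (\<Sum>i\<in>A. n2 (f i))"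
proof (induction A rule: finite_induct)
  case (insert i A)
  then show ?case using n2_triangle[of "f i" "sum f A"] M_sum[of A f] by simp
qed simp

lemma n2_mult_left:
  assumes x: "x \<in> M" and y: "y \<in> M"
  shows "n2 (x * y) \<le> norm x * n2 y"
proof -
  have nn: "norm (star x * x) \<le> (norm x)\<^sup>2" using norm_mult_ineq[of "star x" x] by (simp add: power2_eq_square)
  have "pos ((norm x)\<^sup>2 *\<^sub>R 1 - star x * x)"
    by (rule pos_norm_bound_diff[OF _ nn]) (simp add: star_simps)
  then have "pos (star y * ((norm x)\<^sup>2 *\<^sub>R 1 - star x * x) * y)" by (rule pos_conj)
  moreover have "star y * ((norm x)\<^sup>2 *\<^sub>R 1 - star x * x) * y = (norm x)\<^sup>2 *\<^sub>R (star y * y) - star (x * y) * (x * y)"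
    by (simp add: star_simps algebra_simps)
  ultimately have "tr (star (x * y) * (x * y)) \<le> (norm x)\<^sup>2 * tr (star y * y)"
    using tr_mono[of "star (x * y) * (x * y)" "(norm x)\<^sup>2 *\<^sub>R (star y * y)"] x y by (simp add: M_closed tr_scaleR)
  then have "(n2 (x * y))\<^sup>2 \<le> (norm x * n2 y)\<^sup>2" using x y by (simp add: n2_sq M_closed power_mult_distrib)
  then show ?thesis by (rule power2_le_imp_le) simp
qed

lemma n2_mult_right: "x \<in> M \<Longrightarrow> y \<in> M \<Longrightarrow> n2 (x * y) \<le> n2 x * norm y"
  using n2_mult_left[of "star y" "star x"] n2_star[of "x * y"] n2_star[of x]
  by (simp add: star_mult M_closed mult.commute)

lemma n2_mult_left_le: "x \<in> M \<Longrightarrow> y \<in> M \<Longrightarrow> norm x \<le> 1 \<Longrightarrow> n2 (x * y) \<le> n2 y"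
  by (rule order_trans[OF n2_mult_left]) (auto intro: mult_left_le_one_le)

lemma n2_mult_right_le: "x \<in> M \<Longrightarrow> y \<in> M \<Longrightarrow> norm y \<le> 1 \<Longrightarrow> n2 (x * y) \<le> n2 x"
  by (rule order_trans[OF n2_mult_right]) (auto intro: mult_left_le)

lemma n2_one [simp]: "n2 1 = 1" by (simp add: n2_def)

lemma n2_le_norm: "x \<in> M \<Longrightarrow> n2 x \<le> norm x"
  using n2_mult_left[of x 1] by (simp add: M_one)

lemma tr_le_n2: "x \<in> M \<Longrightarrow> \<bar>tr x\<bar> \<le> n2 x"
  using tr_cauchy_schwarz[of 1 x] by (simp add: M_one)

lemma n2_sot_zero:
  assumes z: "\<And>n. z n \<in> M" "\<And>n. norm (z n) \<le> 1" and sm: "summable (\<lambda>n. (n2 (z n))\<^sup>2)"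
  shows "sot z 0"
proof -
  text \<open>For \<open>y n = star (z n) * z n\<close>, the increasing operators \<open>s (1 + s)\<^sup>-\<^sup>1\<close> with \<open>s\<close> a partial sum of
    the \<open>y i\<close>, \<open>i \<ge> k\<close>, have a supremum \<open>Z k\<close> whose trace is at most the tail of the series; the \<open>Z k\<close>
    decrease to an operator of trace \<open>0\<close> and dominate \<open>y k / 2\<close>.\<close>
  define y where "y n = star (z n) * z n" for n
  have yM: "y n \<in> M" and py: "pos (y n)" for n by (auto simp: y_def z M_closed pos_star_mult)
  have ty: "tr (y n) = (n2 (z n))\<^sup>2" for n by (simp add: y_def n2_sq z)
  define s where "s k m = (\<Sum>i<m. y (k + i))" for k m
  have sM: "s k m \<in> M" and ps: "pos (s k m)" for k m
    by (auto simp: s_def intro: M_sum yM pos_sum py)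
  have "\<exists>r. (1 + s k m) * r = 1 \<and> pos r \<and> pos (1 - r) \<and> (\<forall>y. s k m * y = y * s k m \<longrightarrow> r * y = y * r)" for k m
    using resolvent[OF ps[of k m]] by metis
  then obtain r where r: "\<And>k m. (1 + s k m) * r k m = 1" "\<And>k m. pos (r k m)" "\<And>k m. pos (1 - r k m)"
    "\<And>k m y. s k m * y = y * s k m \<Longrightarrow> r k m * y = y * r k m" by metis
  have rM: "r k m \<in> M" for k m by (rule M_I) (use r(4) M_D sM in blast)
  define Y where "Y k m = 1 - r k m" for k m
  have YM: "Y k m \<in> M" for k m by (simp add: Y_def M_closed rM)
  have mono: "pos (s k' m' - s k m) \<Longrightarrow> pos (Y k' m' - Y k m)" for k m k' m'
    using resolvent_antimono[OF ps[of k m] _ r(1) posD(1)[OF r(2)] r(1) posD(1)[OF r(2)], of k' m'] by (simp add: Y_def)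
  have Ys: "pos (s k m - Y k m)" for k m
  proof -
    have rs: "star (r k m) = r k m" "star (s k m) = s k m" using posD(1) r(2) ps by blast+
    have 1: "Y k m = s k m * r k m" using r(1)[of k m] by (simp add: Y_def algebra_simps)
    have "r k m * s k m = s k m * r k m" by (rule r(4)) simp
    then have "s k m - Y k m = star (s k m) * r k m * s k m"
      using r(1)[of k m] unfolding 1 rs
      by (metis (no_types, lifting) "1" Y_def mult.assoc mult.right_neutral right_diff_distrib)
    then show ?thesis using pos_conj[OF r(2)] by metis
  qed
  have pY: "pos (Y k n)" for k n by (simp add: Y_def r(3))
  have incY: "pos (Y k (Suc n) - Y k n)" for k n by (rule mono) (simp add: s_def py)
  have "\<exists>x. sot (Y k) x \<and> norm x \<le> 1" for k
  proof (rule vigier)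
    show "pos (Y k n)" "pos (Y k (Suc n) - Y k n)" for n by (rule pY incY)+
    show "pos (1 *\<^sub>R 1 - Y k n)" for n by (simp add: Y_def r(2))
  qed simp
  then obtain Z where Z: "\<And>k. sot (Y k) (Z k)" by metis
  have ZM: "Z k \<in> M" for k by (rule M_sot[OF YM Z])
  define t where "t k = (\<Sum>i. (n2 (z (k + i)))\<^sup>2)" for k
  have trZ: "tr (Z k) \<le> t k" for k
  proof -
    have "(\<lambda>m. tr (Y k m)) \<longlonglongrightarrow> tr (Z k)" unfolding tr_def
      by (rule tau_normal) (rule YM pY incY Z)+
    moreover have "tr (Y k m) \<le> t k" for m
    proof -
      have "tr (Y k m) \<le> tr (s k m)" by (rule tr_mono[OF YM sM Ys])
      also have "\<dots> = (\<Sum>i<m. (n2 (z (k + i)))\<^sup>2)" by (simp add: s_def tr_sum yM ty)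
      also have "\<dots> \<le> t k" unfolding t_def
        by (rule sum_le_suminf) (use summable_ignore_initial_segment[OF sm, of k] in \<open>auto simp: add.commute\<close>)
      finally show ?thesis .
    qed
    ultimately show ?thesis by (meson LIMSEQ_le_const2)
  qed
  have t0: "t \<longlonglongrightarrow> 0"
    using suminf_exist_split2[OF sm] unfolding t_def by (simp add: add.commute)
  have Zdec: "pos (Z k - Z (Suc k))" for k
  proof (rule sot_pos[OF sot_diff[OF sot_Suc[OF Z] Z]])
    show "pos (Y k (Suc n) - Y (Suc k) n)" for n
      by (rule mono) (simp add: s_def sum.lessThan_Suc_shift py del: sum.lessThan_Suc)
  qed
  have pZ: "pos (Z k)" for k by (rule sot_pos[OF Z]) (rule pY)
  have pZ1: "pos (1 - Z k)" for k
    by (rule sot_pos[OF sot_diff[OF sot_const Z]]) (simp add: Y_def r(2))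
  have "\<exists>x. sot (\<lambda>k. 1 - Z k) x \<and> norm x \<le> 1"
    by (rule vigier) (use pZ pZ1 Zdec in auto)
  then obtain W where W: "sot (\<lambda>k. 1 - Z k) W" by blast
  have Zl: "sot Z (1 - W)" using sot_diff[OF sot_const[of 1] W] by simp
  have ZlM: "1 - W \<in> M" by (rule M_sot[OF ZM Zl])
  have "(\<lambda>k. tr (1 - Z k)) \<longlonglongrightarrow> tr W" unfolding tr_def
    by (rule tau_normal[OF _ _ _ W]) (use pZ1 Zdec ZM in \<open>auto intro: M_closed\<close>)
  moreover have "tr (1 - Z k) \<ge> 1 - t k" for k using trZ[of k] ZM by (simp add: tr_diff M_one)
  ultimately have "1 - 0 \<le> tr W"
    using LIMSEQ_le[OF tendsto_diff[OF tendsto_const[of 1] t0]] by blast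
  then have "tr (1 - W) \<le> 0" using ZlM M_diff[OF M_one ZlM] by (simp add: tr_diff M_one)
  then have "1 - W = 0" by (rule tr_faithful[OF ZlM sot_pos[OF Zl pZ]])
  then have Z0: "sot Z 0" using Zl by simp
  have yZ: "Re (cinner (y k \<triangleright> \<xi>) \<xi>) \<le> 2 * Re (cinner (Z k \<triangleright> \<xi>) \<xi>)" for k \<xi>
  proof -
    have s1: "s k 1 = y k" "s k (Suc 0) = y k" by (simp_all add: s_def)
    have YZ: "Re (cinner (Y k 1 \<triangleright> \<xi>) \<xi>) \<le> Re (cinner (Z k \<triangleright> \<xi>) \<xi>)"
    proof (rule LIMSEQ_le_const)
      show "(\<lambda>m. Re (cinner (Y k m \<triangleright> \<xi>) \<xi>)) \<longlonglongrightarrow> Re (cinner (Z k \<triangleright> \<xi>) \<xi>)" by (intro tendsto_Re sot_cinner Z)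
      have "pos (Y k m - Y k 1)" if "1 \<le> m" for m
      proof (rule mono)
        have "s k m - s k 1 = (\<Sum>i\<in>{1..<m}. y (k + i))"
          using that by (simp add: s_def lessThan_atLeast0 sum.atLeast_Suc_lessThan)
        then show "pos (s k m - s k 1)" by (auto intro: pos_sum py)
      qed
      then have "Re (cinner (Y k 1 \<triangleright> \<xi>) \<xi>) \<le> Re (cinner (Y k m \<triangleright> \<xi>) \<xi>)" if "1 \<le> m" for m
        using posD(2)[of "Y k m - Y k 1" \<xi>] that by (simp add: ap_linear cinner_linear)
      then show "\<exists>N. \<forall>m\<ge>N. Re (cinner (Y k 1 \<triangleright> \<xi>) \<xi>) \<le> Re (cinner (Y k m \<triangleright> \<xi>) \<xi>)" by blast
    qed
    \<comment> \<open>With \<open>\<xi> = \<eta> + y k \<triangleright> \<eta>\<close> the claim y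
      \<le> 2 y (1 + y)^-1 turns into y + 2 y^2 + y^3 \<le> 2 (y + y^2), which follows from 0 \<le>
      y \<le> 1.\<close>
    define \<eta> where "\<eta> = r k 1 \<triangleright> \<xi>"
    have "\<xi> = ((1 + s k 1) * r k 1) \<triangleright> \<xi>" by (simp only: r ap_one)
    then have xe: "\<xi> = \<eta> + y k \<triangleright> \<eta>" by (simp add: s1 ap_linear \<eta>_def del: r)
    have "Y k 1 \<triangleright> \<xi> = \<xi> - \<eta>" by (simp add: Y_def \<eta>_def ap_linear)
    then have Yx: "Y k 1 \<triangleright> \<xi> = y k \<triangleright> \<eta>" using xe by simp
    have sy: "star (y k) = y k" using posD(1)[OF py] .
    have ny: "norm (y k) \<le> 1"
      using norm_mult_ineq[of "star (z k)" "z k"] mult_mono[OF z(2) z(2), of k k] by (simp add: y_def)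
    have p1: "pos (1 *\<^sub>R 1 - y k)" by (rule pos_norm_bound_diff[OF sy ny])
    have le1: "(norm (y k \<triangleright> \<eta>))\<^sup>2 \<le> Re (cinner (y k \<triangleright> \<eta>) \<eta>)" using pos_norm_ap_sq[OF py p1, of \<eta>] by simp
    have le2: "Re (cinner (y k \<triangleright> y k \<triangleright> \<eta>) (y k \<triangleright> \<eta>)) \<le> (norm (y k \<triangleright> \<eta>))\<^sup>2"
      using posD(2)[OF p1, of "y k \<triangleright> \<eta>"] by (simp add: ap_linear cinner_linear)
    have "Re (cinner (y k \<triangleright> y k \<triangleright> \<eta>) \<eta>) = (norm (y k \<triangleright> \<eta>))\<^sup>2" by (simp add: cinner_star[of "y k" "y k \<triangleright> \<eta>"] sy)
    then have "Re (cinner (y k \<triangleright> \<xi>) \<xi>) = Re (cinner (y k \<triangleright> \<eta>) \<eta>) + 2 * (norm (y k \<triangleright> \<eta>))\<^sup>2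
        + Re (cinner (y k \<triangleright> y k \<triangleright> \<eta>) (y k \<triangleright> \<eta>))"
      unfolding xe by (simp add: ap_linear cinner_linear)
    also have "\<dots> \<le> 2 * (Re (cinner (y k \<triangleright> \<eta>) \<eta>) + (norm (y k \<triangleright> \<eta>))\<^sup>2)" using le1 le2 by simp
    also have "\<dots> = 2 * Re (cinner (Y k 1 \<triangleright> \<xi>) \<xi>)" unfolding Yx by (subst xe) (simp add: cinner_linear)
    also have "\<dots> \<le> 2 * Re (cinner (Z k \<triangleright> \<xi>) \<xi>)" using YZ by simp
    finally show ?thesis .
  qed
  show ?thesis unfolding sot_def
  proof
    fix \<xi>
    have "(\<lambda>k. Re (cinner (Z k \<triangleright> \<xi>) \<xi>)) \<longlonglongrightarrow> Re (cinner (0 \<triangleright> \<xi>) \<xi>)" by (intro tendsto_Re sot_cinner Z0)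
    then have lim0: "(\<lambda>k. 2 * Re (cinner (Z k \<triangleright> \<xi>) \<xi>)) \<longlonglongrightarrow> 0" using tendsto_mult_right_zero by simp
    have le: "(norm (z k \<triangleright> \<xi>))\<^sup>2 \<le> 2 * Re (cinner (Z k \<triangleright> \<xi>) \<xi>)" for k
    proof -
      have "Re (cinner (y k \<triangleright> \<xi>) \<xi>) = (norm (z k \<triangleright> \<xi>))\<^sup>2"
        by (simp add: y_def cinner_star_right[symmetric] flip: Re_cinner_self)
      then show ?thesis using yZ[of k \<xi>] by simp
    qed
    have "(\<lambda>k. (norm (z k \<triangleright> \<xi>))\<^sup>2) \<longlonglongrightarrow> 0"
      by (rule tendsto_sandwich[OF _ _ tendsto_const lim0]) (simp_all only: zero_le_power2 le eventually_True)
    then have "(\<lambda>k. sqrt ((norm (z k \<triangleright> \<xi>))\<^sup>2)) \<longlonglongrightarrow> sqrt 0" by (intro tendsto_real_sqrt)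
    then show "(\<lambda>k. z k \<triangleright> \<xi>) \<longlonglongrightarrow> 0 \<triangleright> \<xi>" by (simp add: tendsto_norm_zero_iff)
  qed
qed

text \<open>\<open>T\<close> need not lie in \<open>M\<close>, so convergence in the 2-norm has to
  be turned into strong convergence on the Hilbert space. The geometric rate makes the squares
  summable for \<open>n2_sot_zero\<close>, and halving the differences gives the norm bound
  1.\<close>

lemma commute_n2_limit:
  assumes x: "\<And>n. x n \<in> M" "\<And>n. norm (x n) \<le> 1" and y: "y \<in> M" "norm y \<le> 1"
    and lim: "\<And>n. n2 (x n - y) \<le> (1/2) ^ n" and T: "\<And>n. x n * T = T * x n"
  shows "y * T = T * y"
proof -
  define z where "z n = (1/2) *\<^sub>R (x n - y)" for n
  have "sot z 0"
  proof (rule n2_sot_zero)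
    show "z n \<in> M" for n by (simp add: z_def M_closed x y)
    show "norm (z n) \<le> 1" for n using norm_triangle_ineq4[of "x n" y] x(2)[of n] y(2) by (simp add: z_def)
    show "summable (\<lambda>n. (n2 (z n))\<^sup>2)"
    proof (rule summable_comparison_test'[of "\<lambda>n. (1/4::real) ^ n" 0])
      show "norm ((n2 (z n))\<^sup>2) \<le> (1/4) ^ n" for n
      proof -
        have "n2 (z n) = (1/2) * n2 (x n - y)" by (simp add: z_def n2_scaleR M_closed x y)
        then have "n2 (z n) \<le> (1/2) ^ n" using lim[of n] zero_le_power[of "1/2::real" n] by linarith
        then have "(n2 (z n))\<^sup>2 \<le> ((1/2) ^ n)\<^sup>2" by (intro power_mono) auto
        also have "((1/2) ^ n)\<^sup>2 = ((1/2)\<^sup>2::real) ^ n" by (simp only: power_mult[symmetric] mult.commute)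
        also have "\<dots> = (1/4) ^ n" by (simp add: power2_eq_square)
        finally show ?thesis by simp
      qed
    qed simp
  qed
  then have "sot (\<lambda>n. y + (z n + z n)) (y + (0 + 0))" by (intro sot_add sot_const)
  moreover have "y + (z n + z n) = x n" for n by (simp add: z_def flip: scaleR_add_left)
  ultimately have "sot x y" by simp
  then show ?thesis by (rule sot_commute[OF _ T])
qed

end

section \<open>Subalgebras closed in the 2-norm\<close>

context tracial
begin

text \<open>Spectral projections are needed inside the abelian algebra of the Haar unitary as well
  as in all of \<open>M\<close>; \<open>talg\<close> covers both. Limits are taken in the 2-norm
  without a bound on the operator norms of the approximants.\<close>

definition talg :: "'h bop set \<Rightarrow> bool" where
  "talg B \<longleftrightarrow> B \<subseteq> M \<and> 1 \<in> B \<and> (\<forall>a. \<forall>x\<in>B. cop a * x \<in> B) \<and> (\<forall>x\<in>B. \<forall>y\<in>B. x + y \<in> B) \<and>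
     (\<forall>x\<in>B. \<forall>y\<in>B. x * y \<in> B) \<and> (\<forall>x\<in>B. star x \<in> B) \<and>
     (\<forall>X x. (\<forall>n. X n \<in> B) \<and> x \<in> M \<and> (\<lambda>n. n2 (X n - x)) \<longlonglongrightarrow> 0 \<longrightarrow> x \<in> B)"

lemma talgD:
  assumes "talg B"
  shows talg_sub: "x \<in> B \<Longrightarrow> x \<in> M"
    and talg_one: "1 \<in> B"
    and talg_cop: "x \<in> B \<Longrightarrow> cop a * x \<in> B"
    and talg_add: "x \<in> B \<Longrightarrow> y \<in> B \<Longrightarrow> x + y \<in> B"
    and talg_mult: "x \<in> B \<Longrightarrow> y \<in> B \<Longrightarrow> x * y \<in> B"
    and talg_star: "x \<in> B \<Longrightarrow> star x \<in> B"
    and talg_limit: "(\<And>n. X n \<in> B) \<Longrightarrow> x \<in> M \<Longrightarrow> (\<lambda>n. n2 (X n - x)) \<longlonglongrightarrow> 0 \<Longrightarrow> x \<in> B"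
proof -
  show "x \<in> B \<Longrightarrow> x \<in> M" "1 \<in> B" "x \<in> B \<Longrightarrow> cop a * x \<in> B" "x \<in> B \<Longrightarrow> y \<in> B \<Longrightarrow> x + y \<in> B"
    "x \<in> B \<Longrightarrow> y \<in> B \<Longrightarrow> x * y \<in> B" "x \<in> B \<Longrightarrow> star x \<in> B"
    using assms unfolding talg_def by blast+
  show "x \<in> B" if "\<And>n. X n \<in> B" "x \<in> M" "(\<lambda>n. n2 (X n - x)) \<longlonglongrightarrow> 0"
    using assms that unfolding talg_def by metis
qed

lemma talg_M: "talg M"
  unfolding talg_def by (auto intro: M_closed)

context
  fixes B assumes B: "talg B"
begin

lemma talg_scaleR: "x \<in> B \<Longrightarrow> r *\<^sub>R x \<in> B"
  using talg_cop[OF B, of x "complex_of_real r"] by (simp add: cop_of_real_mult)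

lemma talg_diff: "x \<in> B \<Longrightarrow> y \<in> B \<Longrightarrow> x - y \<in> B"
  using talg_add[OF B, of x "- y"] talg_scaleR[of y "-1"] by simp

lemma talg_power: "x \<in> B \<Longrightarrow> x ^ n \<in> B"
  by (induction n) (auto intro: talg_mult[OF B] talg_one[OF B])

lemma talg_zero: "0 \<in> B"
  using talg_scaleR[OF talg_one[OF B], of 0] by simp

lemma talg_tendsto:
  assumes X: "\<And>n. X n \<in> B" and lim: "X \<longlonglongrightarrow> x"
  shows "x \<in> B"
proof (rule talg_limit[OF B X])
  show xM: "x \<in> M" by (rule M_tendsto[OF talg_sub[OF B X] lim])
  have "(\<lambda>n. norm (X n - x)) \<longlonglongrightarrow> 0" using lim by (simp add: LIM_zero tendsto_norm_zero)
  then show "(\<lambda>n. n2 (X n - x)) \<longlonglongrightarrow> 0"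
    by (rule tendsto_sandwich[OF _ _ tendsto_const, rotated 2])
      (simp_all add: n2_le_norm M_diff xM talg_sub[OF B X])
qed

lemma talg_vis: "x \<in> B \<Longrightarrow> vis n x \<in> B"
  by (induction n) (auto intro: talg_zero talg_scaleR talg_add[OF B] talg_mult[OF B])

lemma talg_sqrtc: "x \<in> B \<Longrightarrow> pos x \<Longrightarrow> norm x \<le> R \<Longrightarrow> 0 < R \<Longrightarrow> sqrtc R x \<in> B"
  by (rule talg_tendsto[OF _ sqrtc_tendsto])
    (auto simp: sqrt_approx_def intro!: talg_scaleR talg_diff talg_one[OF B] talg_vis)

text \<open>\<open>B\<close> is closed under 2-norm limits, and strong convergence alone is no such
  limit. The squared distance of \<open>d ^ n\<close> from \<open>E\<close> is
  \<open>tr (d ^ (n + n)) - tr E\<close>, which tends to 0 by normality of the trace.\<close>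

lemma talg_power_limit:
  assumes d: "d \<in> B" "pos d" "pos (1 - d)" and E: "proj E" "d * E = E" "E * d = E" "sot (\<lambda>n. d ^ n) E"
  shows "E \<in> B"
proof (rule talg_limit[OF B, of "\<lambda>n. d ^ n"])
  have dM: "d ^ n \<in> M" for n by (intro talg_sub[OF B] talg_power d)
  show EM: "E \<in> M" by (rule M_sot[OF dM E(4)])
  have dE: "d ^ n * E = E" "E * d ^ n = E" for n
    by (induction n) (simp_all add: mult.assoc E power_Suc2 del: power_Suc, simp_all add: mult.assoc[symmetric] E)
  have le1: "pos (1 - d ^ n)" for n
  proof (induction n)
    case (Suc n)
    show ?case using pos_add[OF Suc pos_power_diff[OF d(2,3), of n]] by simp
  qed simp
  have "(\<lambda>n. Re (\<tau> (1 - d ^ n))) \<longlonglongrightarrow> Re (\<tau> (1 - E))"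
  proof (rule tau_normal)
    show "1 - d ^ n \<in> M" "pos (1 - d ^ n)" for n by (auto intro: M_closed dM le1)
    show "pos (1 - d ^ Suc n - (1 - d ^ n))" for n using pos_power_diff[OF d(2,3), of n] by simp
    show "sot (\<lambda>n. 1 - d ^ n) (1 - E)" by (intro sot_diff sot_const E)
  qed
  from tendsto_diff[OF tendsto_const[of 1] this]
  have "(\<lambda>n. 1 - tr (1 - d ^ n)) \<longlonglongrightarrow> 1 - tr (1 - E)" unfolding tr_def .
  then have "(\<lambda>n. tr (d ^ n)) \<longlonglongrightarrow> tr E" by (simp add: tr_diff M_one dM EM)
  from LIM_zero[OF LIMSEQ_subseq_LIMSEQ[OF this, of "\<lambda>n. n + n"]]
  have l: "(\<lambda>n. tr (d ^ (n + n)) - tr E) \<longlonglongrightarrow> 0" by (simp add: strict_mono_def o_def)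
  have "(n2 (d ^ n - E))\<^sup>2 = tr (d ^ (n + n)) - tr E" for n
  proof -
    have "star (d ^ n - E) * (d ^ n - E) = d ^ (n + n) - E"
      using posD(1)[OF d(2)] projD[OF E(1)] dE by (simp add: star_simps algebra_simps power_add)
    then show ?thesis by (simp add: n2_sq M_diff dM EM tr_diff)
  qed
  then have "(\<lambda>n. (n2 (d ^ n - E))\<^sup>2) \<longlonglongrightarrow> 0" using l by simp
  then have "(\<lambda>n. sqrt ((n2 (d ^ n - E))\<^sup>2)) \<longlonglongrightarrow> sqrt 0" by (rule tendsto_real_sqrt)
  then show "(\<lambda>n. n2 (d ^ n - E)) \<longlonglongrightarrow> 0" by simp
qed (intro talg_power d)

end

text \<open>The difference of the two squares is
  \<open>(a - 1) * (a * a + 2 *\<^sub>R a) * (a - 1)\<close>, a conjugate of a positive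
  operator.\<close>

lemma n2_pos_diff_one_le:
  assumes "a \<in> M" "pos a"
  shows "n2 (1 - a) \<le> n2 (a * a - 1)"
proof -
  have sa: "star a = a" by (rule posD[OF assms(2)])
  have sc: "star (a - 1) = a - 1" by (simp add: star_simps sa)
  have "pos (star (a - 1) * (a * a + 2 *\<^sub>R a) * (a - 1))"
    by (intro pos_conj pos_add pos_sq sa pos_scaleR assms) simp
  moreover have "star (a - 1) * (a * a + 2 *\<^sub>R a) * (a - 1) = star (a * a - 1) * (a * a - 1) - star (1 - a) * (1 - a)"
    by (simp add: star_simps sa algebra_simps scaleR_2)
  ultimately have "tr (star (1 - a) * (1 - a)) \<le> tr (star (a * a - 1) * (a * a - 1))"
    using assms by (intro tr_mono) (auto intro: M_closed)
  then have "(n2 (1 - a))\<^sup>2 \<le> (n2 (a * a - 1))\<^sup>2" using assms by (simp add: n2_sq M_closed)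
  then show ?thesis by (rule power2_le_imp_le) simp
qed

lemma proj_reflection:
  fixes e :: "'h bop" assumes "proj e"
  shows "star (2 *\<^sub>R e - 1) = 2 *\<^sub>R e - 1" "(2 *\<^sub>R e - 1) * (2 *\<^sub>R e - 1) = 1" "norm (2 *\<^sub>R e - 1) \<le> 1"
proof -
  show s: "star (2 *\<^sub>R e - 1) = 2 *\<^sub>R e - 1" using projD[OF assms] by (simp add: star_simps)
  show q: "(2 *\<^sub>R e - 1) * (2 *\<^sub>R e - 1) = 1" using projD[OF assms] by (simp add: algebra_simps scaleR_2)
  show "norm (2 *\<^sub>R e - 1) \<le> 1"
  proof (rule norm_bop_bound)
    fix \<xi> :: 'h
    have "star (2 *\<^sub>R e - 1) * (2 *\<^sub>R e - 1) = star 1 * 1" by (simp only: s q star_one mult_1)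
    from norm_ap_eq_of_star_mult[OF this] show "norm ((2 *\<^sub>R e - 1) \<triangleright> \<xi>) \<le> 1 * norm \<xi>" by simp
  qed simp
qed

text \<open>The last clause says that \<open>e\<close> is a nearest projection to \<open>h\<close>
  in the 2-norm. For a reflection \<open>2 *\<^sub>R p - 1\<close> the squared distance from
  \<open>b\<close> depends only on the trace of its product with \<open>b\<close>, and this trace is
  at most \<open>tr a\<close>, with equality at \<open>p = e\<close>.\<close>

lemma spectral_projection:
  assumes B: "talg B" and h: "h \<in> B" "star h = h" and b: "b = 2 *\<^sub>R h - 1" and R: "0 < R" "norm (b * b) \<le> R"
    and a: "a = sqrtc R (b * b)"
  obtains e where "e \<in> B" "proj e" "\<And>y. h * y = y * h \<Longrightarrow> e * y = y * e"
    "\<And>p. proj p \<Longrightarrow> p * h = h \<Longrightarrow> p * e = e"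
    "pos a" "a \<in> B" "a * a = b * b" "a * e = e * a" "b = a * (2 *\<^sub>R e - 1)"
    "n2 (e - h) = n2 (1 - a) / 2" "n2 (e - h) \<le> 2 * n2 (h * h - h)"
    "\<And>p. p \<in> M \<Longrightarrow> proj p \<Longrightarrow> n2 (e - h) \<le> n2 (p - h)"
proof -
  obtain e r where e: "proj e" "b * e = a * e" "e - h = (1/2) *\<^sub>R ((1 - a) * (2 *\<^sub>R e - 1))"
    "\<And>y. h * y = y * h \<Longrightarrow> e * y = y * e"
    "\<And>p. proj p \<Longrightarrow> p * h = h \<Longrightarrow> p * e = e"
    "star (r *\<^sub>R (a - b)) = r *\<^sub>R (a - b)" "norm (r *\<^sub>R (a - b)) \<le> 1"
    "sot (\<lambda>n. (1 - r *\<^sub>R (a - b) * r *\<^sub>R (a - b)) ^ n) e"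
    by (rule spectral_projection_op[OF h(2) b R a], rule that)
  have sb: "star b = b" by (simp add: b star_simps h)
  have bB: "b \<in> B" unfolding b by (intro talg_diff[OF B] talg_scaleR[OF B] h talg_one[OF B])
  have pb: "pos (b * b)" by (rule pos_sq[OF sb])
  have bbB: "b * b \<in> B" by (intro talg_mult[OF B] bB)
  have aB: "a \<in> B" unfolding a by (rule talg_sqrtc[OF B bbB pb R(2,1)])
  have pa: "pos a" and aa: "a * a = b * b" unfolding a by (fact pos_sqrtc[OF pb R(2,1)] sqrtc_sq[OF pb R(2,1)])+
  have ah: "a * h = h * a"
    unfolding a by (rule sqrtc_commute[OF pb R(2,1)]) (simp add: b algebra_simps)
  have ae: "a * e = e * a" using e(4)[of a] ah by simp
  define c where "c = r *\<^sub>R (a - b)"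
  have sc: "star c = c" and nc: "norm c \<le> 1" and lim: "sot (\<lambda>n. (1 - c * c) ^ n) e"
    using e(6-8) by (simp_all only: c_def)
  have cB: "c \<in> B" unfolding c_def by (intro talg_scaleR[OF B] talg_diff[OF B] aB bB)
  define d where "d = 1 - c * c"
  have ncc: "norm (c * c) \<le> 1" using nc norm_mult_ineq[of c c] mult_mono[OF nc nc] by simp
  have pd: "pos d"
    using pos_norm_bound_diff[OF _ ncc] posD(1)[OF pos_sq[OF sc]] by (simp add: d_def)
  have pd1: "pos (1 - d)" using pos_sq[OF sc] by (simp add: d_def)
  have ce: "c * e = 0" using e(2) by (simp add: c_def algebra_simps)
  have "e * c = 0" using arg_cong[OF ce, of star] projD(1)[OF e(1)] sc by (simp add: star_mult)
  then have de: "d * e = e" "e * d = e" using ce by (simp_all add: d_def left_diff_distrib right_diff_distrib mult.assoc flip: mult.assoc[of e])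
  have eB: "e \<in> B"
    by (rule talg_power_limit[OF B _ pd pd1 e(1) de]) (use lim cB in \<open>auto simp: d_def intro: talg_diff[OF B] talg_mult[OF B] talg_one[OF B]\<close>)
  have eM: "e \<in> M" and aM: "a \<in> M" and hM: "h \<in> M" using talg_sub[OF B] eB aB h by auto
  let ?w = "2 *\<^sub>R e - 1"
  have wM: "?w \<in> M" by (intro M_closed eM)
  note w = proj_reflection[OF e(1)]
  have baw: "b = a * ?w"
  proof -
    have "?w - b = 2 *\<^sub>R (e - h)" by (simp add: b algebra_simps)
    also have "\<dots> = (1 - a) * ?w" by (subst e(3)) simp
    also have "\<dots> = ?w - a * ?w" by (simp only: left_diff_distrib mult_1)
    finally show ?thesis by simp
  qed
  have n1: "n2 ((1 - a) * ?w) = n2 (1 - a)"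
  proof (rule antisym)
    show "n2 ((1 - a) * ?w) \<le> n2 (1 - a)" by (rule n2_mult_right_le) (auto intro: M_closed aM eM w)
    have "(1 - a) * ?w * ?w = 1 - a" by (simp only: mult.assoc w mult_1_right)
    moreover have "n2 ((1 - a) * ?w * ?w) \<le> n2 ((1 - a) * ?w)" by (rule n2_mult_right_le) (auto intro: M_closed aM eM w)
    ultimately show "n2 (1 - a) \<le> n2 ((1 - a) * ?w)" by simp
  qed
  have neh: "n2 (e - h) = n2 (1 - a) / 2"
    unfolding e(3) by (subst n2_scaleR) (auto intro: M_closed aM eM simp: n1)
  have four: "4 *\<^sub>R y = 2 *\<^sub>R y + 2 *\<^sub>R y" for y :: "'h bop" by (simp flip: scaleR_add_left)
  have "a * a - 1 = 4 *\<^sub>R (h * h - h)" by (simp add: aa b algebra_simps four scaleR_2)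
  then have "n2 (a * a - 1) = 4 * n2 (h * h - h)" by (simp add: n2_scaleR M_closed hM)
  then have i: "n2 (e - h) \<le> 2 * n2 (h * h - h)" using n2_pos_diff_one_le[OF aM pa] neh by simp
  have ii: "n2 (e - h) \<le> n2 (p - h)" if p: "p \<in> M" "proj p" for p
  proof -
    let ?s = "2 *\<^sub>R p - 1"
    note s = proj_reflection[OF p(2)]
    have sM: "?s \<in> M" by (intro M_closed p)
    have bM: "b \<in> M" using talg_sub[OF B bB] .
    obtain q where q: "q \<in> M" "star q = q" "a = q * q" using M_pos_root[OF aM pa] .
    \<comment> \<open>Cauchy-Schwarz after splitting \<open>a = q * q\<close> into the two halves of
      the product.\<close>
    have trle: "tr (?s * b) \<le> tr a"
    proof -
      have "?s * b = (?s * q) * (q * ?w)" by (simp only: baw q mult.assoc)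
      then have "tr (?s * b) = tr (star q * (?w * ?s * q))"
        using tr_comm[of "?s * q" "q * ?w"] q sM wM by (simp only: M_closed mult.assoc)
      also have "\<dots> \<le> n2 q * n2 (?w * ?s * q)" using tr_cauchy_schwarz[of q "?w * ?s * q"] q sM wM by (simp add: M_closed)
      also have "\<dots> \<le> n2 q * n2 q"
      proof (intro mult_left_mono n2_mult_left_le M_mult wM sM q)
        show "norm (?w * ?s) \<le> 1" using norm_mult_ineq[of ?w ?s] mult_mono[OF w(3) s(3)] by simp
      qed simp
      also have "\<dots> = tr a" using n2_sq[OF q(1)] q by (simp add: power2_eq_square)
      finally show ?thesis .
    qed
    have "star (?s - b) * (?s - b) = 1 + b * b - ?s * b - b * ?s"
    proof -
      have gen: "(x - b) * (x - b) = x * x + b * b - x * b - b * x" for x :: "'h bop" by (simp add: algebra_simps)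
      have "star (?s - b) = ?s - b" by (subst star_diff) (simp only: s(1) sb)
      then show ?thesis by (simp only: gen s(2))
    qed
    then have "(n2 (?s - b))\<^sup>2 = 1 + tr (a * a) - 2 * tr (?s * b)"
      using n2_sq[of "?s - b"] tr_comm[OF bM sM] sM bM by (simp add: tr_add tr_diff M_closed aa)
    also have "\<dots> \<ge> 1 + tr (a * a) - 2 * tr a" using trle by simp
    also have "1 + tr (a * a) - 2 * tr a = (n2 (1 - a))\<^sup>2"
      using aM posD(1)[OF pa] by (simp add: n2_sq M_closed star_simps algebra_simps tr_diff tr_add)
    finally have le: "n2 (1 - a) \<le> n2 (?s - b)" by (rule power2_le_imp_le) simp
    have "?s - b = 2 *\<^sub>R (p - h)" by (simp add: b algebra_simps)
    then have "n2 (?s - b) = 2 * n2 (p - h)" by (simp add: n2_scaleR M_closed p hM)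
    then show ?thesis using le neh by simp
  qed
  show ?thesis
    by (rule that[OF eB e(1) e(4) e(5) pa aB aa ae baw neh i ii])
qed

end

subsection \<open>Partial isometries\<close>

definition piso :: "'h::complex_hilbert bop \<Rightarrow> bool" where
  "piso v \<longleftrightarrow> v * star v * v = v"

text \<open>Says \<open>(w - v) * star v = 0\<close> and \<open>star v * (w - v) = 0\<close>:
  \<open>w\<close> extends \<open>v\<close>, and the rest of \<open>w\<close> is orthogonal to
  \<open>v\<close> on both sides. On projections this is the usual order.\<close>

definition piso_le :: "'h::complex_hilbert bop \<Rightarrow> 'h bop \<Rightarrow> bool" where
  "piso_le v w \<longleftrightarrow> w * star v = v * star v \<and> star v * w = star v * v"

lemma piso_star: "piso v \<Longrightarrow> piso (star v)"
  unfolding piso_def by (metis mult.assoc star_mult star_star)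

lemma piso_proj: assumes "piso v" shows "proj (star v * v)" "proj (v * star v)"
  using assms unfolding piso_def proj_def by (simp_all add: star_simps) (metis mult.assoc)+

lemma piso_norm: assumes "piso v" shows "norm v \<le> 1"
proof (rule norm_bop_bound)
  fix \<xi>
  have "(norm (v \<triangleright> \<xi>))\<^sup>2 = Re (cinner (v \<triangleright> \<xi>) (v \<triangleright> \<xi>))" by simp
  also have "\<dots> = Re (cinner \<xi> ((star v * v) \<triangleright> \<xi>))" by (simp only: cinner_star ap_mult)
  also have "\<dots> \<le> norm \<xi> * norm ((star v * v) \<triangleright> \<xi>)" using Re_cinner_le[of \<xi> "(star v * v) \<triangleright> \<xi>"] by linarith
  also have "\<dots> \<le> norm \<xi> * (1 * norm \<xi>)"
    by (intro mult_left_mono order_trans[OF norm_ap] mult_right_mono proj_norm piso_proj assms) auto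
  finally have "(norm (v \<triangleright> \<xi>))\<^sup>2 \<le> (1 * norm \<xi>)\<^sup>2" by (simp add: power2_eq_square)
  then show "norm (v \<triangleright> \<xi>) \<le> 1 * norm \<xi>" by (rule power2_le_imp_le) simp
qed simp

lemma proj_piso: "proj e \<Longrightarrow> piso e" by (simp add: proj_def piso_def)

lemma piso_le_refl: "piso_le v v" by (simp add: piso_le_def)

lemma piso_le_star: "piso_le v w \<Longrightarrow> piso_le (star v) (star w)"
  unfolding piso_le_def by (metis star_mult star_star)

text \<open>One half of transitivity; the other half is the same statement for the adjoints.\<close>

lemma piso_le_trans_aux:
  assumes v: "piso v" and vw: "piso_le v w" and wx: "piso_le w x"
  shows "x * star v = v * star v"
proof -
  have "star (v * star v * w) = star v"
    using v vw unfolding piso_def piso_le_def by (metis mult.assoc)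
  then have sv: "star w * (v * star v) = star v" by (simp add: star_mult mult.assoc)
  have "x * star v = (x * star w) * (v * star v)" by (simp add: sv mult.assoc)
  also have "\<dots> = w * (star w * (v * star v))" using wx by (simp add: piso_le_def mult.assoc)
  also have "\<dots> = v * star v" using vw sv by (simp add: piso_le_def)
  finally show ?thesis .
qed

lemma piso_le_trans:
  assumes "piso v" "piso_le v w" "piso_le w x"
  shows "piso_le v x"
proof -
  have "star x * star (star v) = star v * star (star v)"
    by (rule piso_le_trans_aux[OF piso_star[OF assms(1)] piso_le_star[OF assms(2)] piso_le_star[OF assms(3)]])
  then have "star (star x * v) = star (star v * v)" by simp
  then have "star v * x = star v * v" by (simp only: star_mult star_star)
  then show ?thesis using piso_le_trans_aux[OF assms] by (simp add: piso_le_def)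
qed

text \<open>Takes the place of Zorn's lemma. As \<open>\<mu>\<close> is monotone and bounded, it
  suffices to extend countably often, in step \<open>n\<close> to within
  \<open>1 / real (Suc n)\<close> of the best possible value; only countable chains need an upper
  bound.\<close>

lemma exhaustion:
  fixes le :: "'a \<Rightarrow> 'a \<Rightarrow> bool" and \<mu> :: "'a \<Rightarrow> real"
  assumes a: "a \<in> S" and refl: "\<And>x. x \<in> S \<Longrightarrow> le x x"
    and trans: "\<And>x y z. x \<in> S \<Longrightarrow> y \<in> S \<Longrightarrow> z \<in> S \<Longrightarrow> le x y \<Longrightarrow> le y z \<Longrightarrow> le x z"
    and mono: "\<And>x y. x \<in> S \<Longrightarrow> y \<in> S \<Longrightarrow> le x y \<Longrightarrow> \<mu> x \<le> \<mu> y"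
    and bound: "\<And>x. x \<in> S \<Longrightarrow> \<mu> x \<le> K"
    and chain: "\<And>f. (\<And>n. f n \<in> S) \<Longrightarrow> (\<And>n. le (f n) (f (Suc n))) \<Longrightarrow> \<exists>u\<in>S. \<forall>n. le (f n) u"
  shows "\<exists>x\<in>S. \<forall>y\<in>S. le x y \<longrightarrow> \<mu> y \<le> \<mu> x"
proof -
  have step: "\<exists>y\<in>S. le x y \<and> (\<forall>z\<in>S. le x z \<longrightarrow> \<mu> z \<le> \<mu> y + 1 / real (Suc n))" if x: "x \<in> S" for x n
  proof -
    let ?A = "\<mu> ` {y\<in>S. le x y}"
    have bdd: "bdd_above ?A" by (rule bdd_aboveI[of _ K]) (auto simp: bound)
    have ne: "?A \<noteq> {}" using x refl by auto
    have "\<exists>m\<in>?A. Sup ?A - 1 / real (Suc n) < m"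
      using less_cSup_iff[OF ne bdd, of "Sup ?A - 1 / real (Suc n)"] by simp
    then obtain y where y: "y \<in> S" "le x y" "Sup ?A - 1 / real (Suc n) < \<mu> y" by auto
    have "\<mu> z \<le> \<mu> y + 1 / real (Suc n)" if "z \<in> S" "le x z" for z
    proof -
      have "\<mu> z \<le> Sup ?A" by (rule cSup_upper[OF _ bdd]) (use that in auto)
      then show ?thesis using y(3) by linarith
    qed
    then show ?thesis using y by blast
  qed
  then have "\<forall>n x. \<exists>y. x \<in> S \<longrightarrow> y \<in> S \<and> le x y \<and> (\<forall>z\<in>S. le x z \<longrightarrow> \<mu> z \<le> \<mu> y + 1 / real (Suc n))" by blast
  then obtain g where "\<forall>n x. x \<in> S \<longrightarrow> g n x \<in> S \<and> le x (g n x) \<and> (\<forall>z\<in>S. le x z \<longrightarrow> \<mu> z \<le> \<mu> (g n x) + 1 / real (Suc n))"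
    unfolding choice_iff by blast
  then have g: "\<And>x n. x \<in> S \<Longrightarrow> g n x \<in> S" "\<And>x n. x \<in> S \<Longrightarrow> le x (g n x)"
    "\<And>x n z. x \<in> S \<Longrightarrow> z \<in> S \<Longrightarrow> le x z \<Longrightarrow> \<mu> z \<le> \<mu> (g n x) + 1 / real (Suc n)" by blast+
  define f where "f = rec_nat a g"
  have f_Suc: "f (Suc n) = g n (f n)" for n by (simp add: f_def)
  have fS: "f n \<in> S" for n by (induction n) (auto simp: f_def a g)
  have "le (f n) (f (Suc n))" for n by (simp add: f_Suc g fS)
  then obtain u where u: "u \<in> S" "\<And>n. le (f n) u" using chain[of f] fS by blast
  have "\<mu> y \<le> \<mu> u" if y: "y \<in> S" "le u y" for y
  proof (rule field_le_epsilon)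
    fix e :: real assume "0 < e"
    then obtain n where n: "1 / real (Suc n) < e" using nat_approx_posE by blast
    have "\<mu> y \<le> \<mu> (f (Suc n)) + 1 / real (Suc n)"
      unfolding f_Suc by (rule g(3)[OF fS y(1) trans[OF fS u(1) y(1) u(2) y(2)]])
    also have "\<mu> (f (Suc n)) \<le> \<mu> u" by (rule mono[OF fS u])
    finally show "\<mu> y \<le> \<mu> u + e" using n by linarith
  qed
  then show ?thesis using u by blast
qed

context tracial
begin

text \<open>The increments are orthogonal: the squared length of the difference of two values is the
  difference of their squared lengths. Normality then adds convergence in the 2-norm, which keeps
  the limit of a chain inside a \<open>talg\<close>.\<close>

lemma piso_chain_limit:
  assumes V: "\<And>n. V n \<in> M" "\<And>n. piso (V n)" and le: "\<And>n. piso_le (V n) (V (Suc n))"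
  obtains v where "v \<in> M" "piso v" "\<And>n. piso_le (V n) v" "(\<lambda>n. n2 (V n - v)) \<longlonglongrightarrow> 0" "sot V v"
proof -
  have leD: "piso_le (V n) (V m)" if "n \<le> m" for n m using that
    by (induction m rule: dec_induct) (auto intro: piso_le_refl piso_le_trans V le)
  have lim: "\<exists>x. sot W x \<and> norm x \<le> 1"
    if W: "\<And>n. piso (W n)" and Wle: "\<And>n m. n \<le> m \<Longrightarrow> piso_le (W n) (W m)" for W :: "nat \<Rightarrow> 'h bop"
  proof (rule sot_exists)
    show "norm (W n) \<le> 1" for n by (rule piso_norm[OF W])
    fix \<xi>
    have eq: "(norm (W m \<triangleright> \<xi> - W n \<triangleright> \<xi>))\<^sup>2 = (norm (W m \<triangleright> \<xi>))\<^sup>2 - (norm (W n \<triangleright> \<xi>))\<^sup>2" if "n \<le> m" for n m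
    proof -
      have "cinner (W n \<triangleright> \<xi>) (W m \<triangleright> \<xi>) = cinner \<xi> ((star (W n) * W m) \<triangleright> \<xi>)" by (simp add: cinner_star)
      also have "\<dots> = cinner (W n \<triangleright> \<xi>) (W n \<triangleright> \<xi>)"
        using Wle[OF that] by (simp add: piso_le_def cinner_star)
      finally show ?thesis using Re_cinner_commute[of "W n \<triangleright> \<xi>" "W m \<triangleright> \<xi>"] by (simp add: norm_diff_sq)
    qed
    have "incseq (\<lambda>n. (norm (W n \<triangleright> \<xi>))\<^sup>2)" unfolding incseq_def
      using eq by (metis diff_ge_0_iff_ge zero_le_power2)
    moreover have "(norm (W n \<triangleright> \<xi>))\<^sup>2 \<le> (norm \<xi>)\<^sup>2" for n
      using order_trans[OF norm_ap mult_right_mono[OF piso_norm[OF W] norm_ge_zero]] by (intro power_mono) auto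
    ultimately obtain L where "(\<lambda>n. (norm (W n \<triangleright> \<xi>))\<^sup>2) \<longlonglongrightarrow> L" using incseq_convergent by blast
    then have "Cauchy (\<lambda>n. (norm (W n \<triangleright> \<xi>))\<^sup>2)" by (rule LIMSEQ_imp_Cauchy)
    then show "Cauchy (\<lambda>n. W n \<triangleright> \<xi>)"
      by (rule Cauchy_of_sq_bound[where K = 1]) (use eq in auto)
  qed
  obtain v where v: "sot V v" using lim[of V, OF V(2) leD] by blast
  \<comment> \<open>The adjoint is not strongly continuous, but the adjoints form a chain of their
    own.\<close>
  obtain v' where v': "sot (\<lambda>n. star (V n)) v'"
    using lim[of "\<lambda>n. star (V n)", OF piso_star[OF V(2)] piso_le_star[OF leD]] by blast
  have "star v = v'" by (rule sot_star[OF v v'])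
  then have v': "sot (\<lambda>n. star (V n)) (star v)" using v' by simp
  have vM: "v \<in> M" by (rule M_sot[OF V(1) v])
  have n1: "norm (V n) \<le> 1" "norm (star (V n)) \<le> 1" for n using piso_norm[OF V(2)] by simp_all
  have "sot (\<lambda>n. V n * (star (V n) * V n)) (v * (star v * v))"
    by (rule sot_mult[OF v sot_mult[OF v' v n1(2)] n1(1)])
  moreover have "V n * (star (V n) * V n) = V n" for n using V(2) by (simp add: piso_def mult.assoc)
  ultimately have "sot V (v * (star v * v))" by simp
  then have "v * (star v * v) = v" by (rule sot_unique[OF _ v])
  then have pv: "piso v" by (simp add: piso_def mult.assoc)
  have lev: "piso_le (V n) v" for n
  proof -
    have sh: "sot (\<lambda>m. V (m + n)) v" using v LIMSEQ_ignore_initial_segment[of "\<lambda>n. V n \<triangleright> \<xi>" for \<xi>] unfolding sot_def by blast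
    have eq: "V (m + n) * star (V n) = V n * star (V n)" "star (V n) * V (m + n) = star (V n) * V n" for m
      using leD[of n "m + n"] by (simp_all add: piso_le_def)
    have "v * star (V n) = V n * star (V n)"
      using sot_mult_right[OF sh, of "star (V n)"] unfolding eq by (rule sot_unique[OF _ sot_const])
    moreover have "star (V n) * v = star (V n) * V n"
      using sot_mult_left[OF sh, of "star (V n)"] unfolding eq by (rule sot_unique[OF _ sot_const])
    ultimately show ?thesis by (simp add: piso_le_def)
  qed
  have diff: "star (w - V n) * (w - V n) = star w * w - star (V n) * V n" if "piso_le (V n) w" for n w
  proof -
    have "star (V n) * w = star (V n) * V n" using that by (simp add: piso_le_def)
    moreover from arg_cong[OF this, of star] have "star w * V n = star (V n) * V n" by (simp add: star_mult)
    ultimately show ?thesis by (simp add: star_diff left_diff_distrib right_diff_distrib)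
  qed
  have "(\<lambda>n. Re (\<tau> (star (V n) * V n))) \<longlonglongrightarrow> Re (\<tau> (star v * v))"
  proof (rule tau_normal)
    show "star (V n) * V n \<in> M" "pos (star (V n) * V n)" for n by (auto intro: M_closed V pos_star_mult)
    show "pos (star (V (Suc n)) * V (Suc n) - star (V n) * V n)" for n
      using diff[OF le[of n]] pos_star_mult by metis
    show "sot (\<lambda>n. star (V n) * V n) (star v * v)" by (rule sot_mult[OF v' v n1(2)])
  qed
  then have "(\<lambda>n. tr (star v * v) - tr (star (V n) * V n)) \<longlonglongrightarrow> tr (star v * v) - tr (star v * v)"
    unfolding tr_def by (rule tendsto_diff[OF tendsto_const])
  moreover have "(n2 (V n - v))\<^sup>2 = tr (star v * v) - tr (star (V n) * V n)" for n
    using n2_sq[of "v - V n"] diff[OF lev, of n] n2_minus_commute[of v "V n"] by (simp add: M_closed V vM tr_diff)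
  ultimately have "(\<lambda>n. (n2 (V n - v))\<^sup>2) \<longlonglongrightarrow> 0" by simp
  then have "(\<lambda>n. sqrt ((n2 (V n - v))\<^sup>2)) \<longlonglongrightarrow> sqrt 0" by (rule tendsto_real_sqrt)
  then have "(\<lambda>n. n2 (V n - v)) \<longlonglongrightarrow> 0" by simp
  then show ?thesis by (rule that[OF vM pv lev _ v])
qed

lemma tr_proj_le_one: "e \<in> M \<Longrightarrow> proj e \<Longrightarrow> tr e \<le> 1"
  using tr_mono[of e 1] proj_pos[OF proj_compl[of e]] by (simp add: M_one)

lemma piso_le_tr:
  assumes "v \<in> M" "w \<in> M" "piso_le v w"
  shows "tr (star w * w) = tr (star v * v) + tr (star (w - v) * (w - v))"
proof -
  have "star v * w = star v * v" using assms by (simp add: piso_le_def)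
  moreover from arg_cong[OF this, of star] have "star w * v = star v * v" by (simp add: star_mult)
  ultimately have "star (w - v) * (w - v) = star w * w - star v * v"
    by (simp add: star_diff left_diff_distrib right_diff_distrib)
  then show ?thesis using assms by (simp add: tr_diff M_closed)
qed

end

definition unit :: "'h::complex_hilbert bop \<Rightarrow> bool" where
  "unit u \<longleftrightarrow> star u * u = 1 \<and> u * star u = 1"

section \<open>Comparison of projections in a factor with a trace\<close>

locale II1 = tracial M \<tau> for M :: "'h::complex_hilbert bop set" and \<tau> +
  assumes factor: "x \<in> M \<Longrightarrow> (\<And>y. y \<in> M \<Longrightarrow> x * y = y * x) \<Longrightarrow> \<exists>a. x = cop a"
begin

text \<open>If \<open>q * x * p = 0\<close> for all \<open>x\<close>, the vectors annihilated by all
  \<open>p * x\<close> form a closed subspace that is invariant under \<open>M\<close> and under its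
  commutant. The projection onto it is central, hence a scalar; it fixes \<open>q \<noteq> 0\<close>
  and is annihilated by \<open>p \<noteq> 0\<close>, a contradiction.\<close>

lemma factor_connected:
  assumes p: "p \<in> M" "proj p" "p \<noteq> 0" and q: "q \<in> M" "proj q" "q \<noteq> 0"
  shows "\<exists>x\<in>M. q * x * p \<noteq> 0"
proof (rule ccontr)
  assume "\<not> ?thesis"
  then have qxp: "q * x * p = 0" if "x \<in> M" for x using that by blast
  have pxq: "p * x * q = 0" if "x \<in> M" for x
  proof -
    have "star (q * star x * p) = p * x * q" using projD[OF p(2)] projD[OF q(2)] by (simp add: star_simps mult.assoc)
    then show ?thesis using qxp[OF M_star[OF that]] by simp
  qed
  define L where "L = {\<eta>. \<forall>x\<in>M. p \<triangleright> x \<triangleright> \<eta> = 0}"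
  have "L = (\<Inter>x\<in>M. {\<eta>. (p * x) \<triangleright> \<eta> = 0})" by (auto simp: L_def)
  moreover have "closed {\<eta>. y \<triangleright> \<eta> = 0}" for y :: "'h bop"
    by (intro closed_Collect_eq continuous_intros bounded_linear.continuous_on[OF bounded_bilinear.bounded_linear_right[OF bounded_bilinear_ap]])
  ultimately have clL: "closed L" by (simp only:) (blast intro: closed_INT)
  obtain e where e: "star e = e" "e * e = e" "\<And>\<xi>. e \<triangleright> \<xi> \<in> L" "\<And>\<xi>. \<xi> \<in> L \<Longrightarrow> e \<triangleright> \<xi> = \<xi>"
    using projection_exists[OF clL] by (auto simp: L_def ap_linear)
  have inv: "e * y = y * e" if y: "\<And>\<xi>. \<xi> \<in> L \<Longrightarrow> y \<triangleright> \<xi> \<in> L" "\<And>\<xi>. \<xi> \<in> L \<Longrightarrow> star y \<triangleright> \<xi> \<in> L" for y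
  proof -
    have 1: "e * y * e = y * e" by (rule bop_eqI) (simp add: e y)
    have 2: "e * star y * e = star y * e" by (rule bop_eqI) (simp add: e y)
    from arg_cong[OF 2, of star] have "e * y * e = e * y" by (simp add: star_mult e mult.assoc)
    with 1 show ?thesis by simp
  qed
  have eM: "e \<in> M"
  proof (rule M_I, rule inv)
    fix T \<xi> assume T: "T \<in> comm M" and \<xi>: "\<xi> \<in> L"
    have *: "S \<triangleright> \<xi> \<in> L" if S: "S \<in> comm M" for S
    proof -
      have "p \<triangleright> x \<triangleright> S \<triangleright> \<xi> = 0" if x: "x \<in> M" for x
      proof -
        have "p * x * S = S * (p * x)" by (rule M_D[OF M_mult[OF p(1) x] S])
        then have "(p * x * S) \<triangleright> \<xi> = (S * (p * x)) \<triangleright> \<xi>" by simp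
        then show ?thesis using \<xi> x by (simp add: L_def)
      qed
      then show ?thesis by (simp add: L_def)
    qed
    show "T \<triangleright> \<xi> \<in> L" "star T \<triangleright> \<xi> \<in> L" using * T comm_star by blast+
  qed
  have "\<exists>a. e = cop a"
  proof (rule factor[OF eM], rule inv)
    fix y \<xi> assume y: "y \<in> M" and \<xi>: "\<xi> \<in> L"
    have *: "z \<triangleright> \<xi> \<in> L" if z: "z \<in> M" for z
    proof -
      have "p \<triangleright> (x * z) \<triangleright> \<xi> = 0" if "x \<in> M" for x using M_mult[OF that z] \<xi> by (simp add: L_def del: ap_mult)
      then show ?thesis by (simp add: L_def)
    qed
    show "y \<triangleright> \<xi> \<in> L" "star y \<triangleright> \<xi> \<in> L" using * y M_star by blast+
  qed
  then obtain a where a: "e = cop a" by blast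
  have "q \<triangleright> \<xi> \<in> L" for \<xi> using arg_cong[OF pxq, of _ "\<lambda>z. z \<triangleright> \<xi>"] by (simp add: L_def)
  then have eq: "cop a * q = q" unfolding a[symmetric] by (intro bop_eqI) (simp add: e)
  have "p \<triangleright> 1 \<triangleright> e \<triangleright> \<xi> = 0" for \<xi> using e(3)[of \<xi>] M_one unfolding L_def by blast
  then have "p * e = 0" by (intro bop_eqI) simp
  then have ap: "cop a * p = 0" by (simp add: a cop_commute)
  have "a \<noteq> 0" using eq q(3) by auto
  then have "p = cop (1 / a) * (cop a * p)" by (simp add: cop_mult flip: mult.assoc)
  then show False using ap p(3) by simp
qed

text \<open>The polar part of a non-zero \<open>q * x * p\<close>, scaled to norm one for
  \<open>polar_decomposition_op\<close>.\<close>

lemma exists_piso: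
  assumes p: "p \<in> M" "proj p" "p \<noteq> 0" and q: "q \<in> M" "proj q" "q \<noteq> 0"
  shows "\<exists>v\<in>M. piso v \<and> v \<noteq> 0 \<and> v * p = v \<and> q * v = v"
proof -
  obtain x where x: "x \<in> M" "q * x * p \<noteq> 0" using factor_connected[OF p q] by blast
  define y where "y = (1 / norm (q * x * p)) *\<^sub>R (q * x * p)"
  have yM: "y \<in> M" unfolding y_def by (intro M_closed p q x)
  have y1: "norm y \<le> 1" using x(2) by (simp add: y_def)
  have y0: "y \<noteq> 0" using x(2) by (simp add: y_def)
  have yp: "y * p = y" "q * y = y" using projD[OF p(2)] projD[OF q(2)] by (simp_all add: y_def mult.assoc flip: mult.assoc[of q q])
  obtain v E s where v: "s = sqrtc 1 (star y * y)" "pos s" "s * s = star y * y" "y = v * s"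
    "star v * v = 1 - E" "proj E" "s * E = 0"
    "\<And>T. T * y = y * T \<Longrightarrow> T * star y = star y * T \<Longrightarrow> T * v = v * T"
    "\<And>z. y * z = 0 \<Longrightarrow> v * z = 0" "\<And>r. r * y = y \<Longrightarrow> r * v = v"
    by (rule polar_decomposition_op[OF y1], rule that)
  have vM: "v \<in> M" by (rule M_I) (use v(8) M_D yM M_star in metis)
  have "y * (1 - p) = 0" using yp by (simp add: algebra_simps)
  then have "v * (1 - p) = 0" by (rule v(9))
  then have vp: "v * p = v" by (simp add: algebra_simps)
  have vE: "v * E = 0"
  proof (rule star_mult_eq_zero)
    have "star (v * E) * (v * E) = star E * (star v * v) * E" by (simp only: star_mult mult.assoc)
    also have "\<dots> = 0" using projD[OF v(6)] by (simp add: v(5) algebra_simps)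
    finally show "star (v * E) * (v * E) = 0" .
  qed
  have "piso v" unfolding piso_def mult.assoc v(5) using vE by (simp add: algebra_simps)
  moreover have "v \<noteq> 0" using v(4) y0 by auto
  ultimately show ?thesis using vM vp v(10)[OF yp(2)] by blast
qed

text \<open>Take a partial isometry from a part of \<open>p\<close> into \<open>q\<close> with
  initial projection of maximal trace. If both remainders were non-zero, \<open>exists_piso\<close>
  would extend it. As the remainders have equal traces, one of them vanishing forces the other to
  vanish.\<close>

lemma comparison:
  assumes p: "p \<in> M" "proj p" and q: "q \<in> M" "proj q" and eq: "tr p = tr q"
  shows "\<exists>v\<in>M. star v * v = p \<and> v * star v = q"
proof -
  define S where "S = {v \<in> M. piso v \<and> v * p = v \<and> q * v = v}"
  have "\<exists>x\<in>S. \<forall>y\<in>S. piso_le x y \<longrightarrow> tr (star y * y) \<le> tr (star x * x)"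
  proof (rule exhaustion)
    show "0 \<in> S" by (simp add: S_def M_zero piso_def)
    show "piso_le x x" for x by (rule piso_le_refl)
    show "piso_le x z" if "x \<in> S" "piso_le x y" "piso_le y z" for x y z
      using piso_le_trans that by (auto simp: S_def)
    show "tr (star x * x) \<le> tr (star y * y)" if "x \<in> S" "y \<in> S" "piso_le x y" for x y
      using piso_le_tr[of x y] tr_star_mult_nonneg[of "y - x"] that by (auto simp: S_def M_closed)
    show "tr (star x * x) \<le> 1" if "x \<in> S" for x
      using that by (auto simp: S_def intro!: tr_proj_le_one M_closed piso_proj)
    fix f assume f: "\<And>n. f n \<in> S" "\<And>n. piso_le (f n) (f (Suc n))"
    obtain v where v: "v \<in> M" "piso v" "\<And>n. piso_le (f n) v" "(\<lambda>n. n2 (f n - v)) \<longlonglongrightarrow> 0" "sot f v"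
      by (rule piso_chain_limit[of f]) (use f in \<open>auto simp: S_def\<close>)
    have "f n * p = f n" "q * f n = f n" for n using f(1) by (auto simp: S_def)
    then have "sot f (v * p)" "sot f (q * v)"
      using sot_mult_right[OF v(5), of p] sot_mult_left[OF v(5), of q] by simp_all
    then have "v * p = v" "q * v = v" using sot_unique v(5) by blast+
    then show "\<exists>u\<in>S. \<forall>n. piso_le (f n) u" using v by (auto simp: S_def)
  qed
  then obtain v where vS: "v \<in> S" and vmax: "\<And>y. y \<in> S \<Longrightarrow> piso_le v y \<Longrightarrow> tr (star y * y) \<le> tr (star v * v)" by blast
  have v: "v \<in> M" "piso v" "v * p = v" "q * v = v" using vS by (auto simp: S_def)
  have sv: "p * star v = star v" "star v * q = star v"
    using arg_cong[OF v(3), of star] arg_cong[OF v(4), of star] projD[OF p(2)] projD[OF q(2)] by (simp_all add: star_mult)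
  note vp = piso_proj[OF v(2)]
  define p' q' where "p' = p - star v * v" and "q' = q - v * star v"
  have vv: "v * star v * v = v" "star v * v * star v = star v" using v(2) piso_star[OF v(2)] by (simp_all add: piso_def)
  have a1: "p * (star v * v) = star v * v" "star v * v * p = star v * v" "q * (v * star v) = v * star v" "v * star v * q = v * star v"
    using v sv by (simp_all add: mult.assoc flip: mult.assoc[of p] mult.assoc[of q])
  have P: "proj p'" "proj q'"
    using projD[OF p(2)] projD[OF q(2)] projD[OF vp(1)] projD[OF vp(2)] a1
    by (simp_all add: proj_def p'_def q'_def star_diff left_diff_distrib right_diff_distrib)
  have PM: "p' \<in> M" "q' \<in> M" by (auto simp: p'_def q'_def intro: M_closed p q v)
  have "p' = 0 \<or> q' = 0"
  proof (rule ccontr)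
    assume "\<not> ?thesis"
    then obtain w where w: "w \<in> M" "piso w" "w \<noteq> 0" "w * p' = w" "q' * w = w"
      using exists_piso[OF PM(1) P(1) _ PM(2) P(2)] by blast
    have p'v: "p' * star v = 0" "star v * q' = 0" using sv vv by (simp_all add: p'_def q'_def left_diff_distrib right_diff_distrib mult.assoc)
    have wv: "w * star v = 0" using w(4) p'v(1) by (metis mult.assoc mult_zero_right)
    have vw: "star v * w = 0" using w(5) p'v(2) by (metis mult.assoc mult_zero_left)
    have vw': "v * star w = 0" "star w * v = 0" using arg_cong[OF wv, of star] arg_cong[OF vw, of star] by (simp_all add: star_mult)
    have le: "piso_le v (v + w)" by (simp add: piso_le_def distrib_left distrib_right wv vw)
    have p'p: "p' * p = p'" "q * q' = q'"
      using projD[OF p(2)] projD[OF q(2)] a1 by (simp_all add: p'_def q'_def left_diff_distrib right_diff_distrib)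
    have "w * p = w" "q * w = w" using w(4,5) p'p by (metis mult.assoc)+
    moreover have "piso (v + w)"
      using v(2) w(2) unfolding piso_def star_add
      by (simp add: distrib_left distrib_right wv vw vw' mult.assoc)
    ultimately have "v + w \<in> S" using v w by (simp add: S_def M_closed distrib_left distrib_right)
    from vmax[OF this le] have "tr (star w * w) \<le> 0"
      using piso_le_tr[OF v(1) M_add[OF v(1) w(1)] le] by simp
    then have "star w * w = 0" by (intro tr_faithful) (auto intro: M_closed w pos_star_mult)
    then show False using w(3) star_mult_eq_zero by blast
  qed
  moreover have "tr p' = tr q'"
    using eq tr_comm[OF v(1) M_star[OF v(1)]] by (simp add: p'_def q'_def tr_diff M_closed p q v)
  ultimately have "p' = 0 \<and> q' = 0"
    using tr_faithful[OF PM(1) proj_pos[OF P(1)]] tr_faithful[OF PM(2) proj_pos[OF P(2)]] by auto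
  then show ?thesis using v(1) by (intro bexI[of _ v]) (auto simp: p'_def q'_def)
qed

text \<open>In the polar decomposition \<open>z = v * t\<close> the defects \<open>E\<close> and
  \<open>1 - v * star v\<close> are equivalent by \<open>comparison\<close>, through some
  \<open>w\<close>, and \<open>v + w\<close> is unitary. Since \<open>w * t = 0\<close>, the
  difference \<open>z - (v + w)\<close> is \<open>(v + w) * (t - 1)\<close>, to which
  \<open>n2_pos_diff_one_le\<close> applies because \<open>t * t = star z * z\<close>.\<close>

lemma unitary_lift:
  assumes z: "z \<in> M"
  shows "\<exists>u\<in>M. unit u \<and> n2 (z - u) \<le> n2 (star z * z - 1)"
proof -
  define K where "K = norm z + 1"
  have K: "0 < K" by (simp add: K_def add_nonneg_pos)
  define y where "y = (1 / K) *\<^sub>R z"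
  have yM: "y \<in> M" unfolding y_def by (intro M_closed z)
  have y1: "norm y \<le> 1" using K by (simp add: y_def K_def)
  obtain v E s where v: "s = sqrtc 1 (star y * y)" "pos s" "s * s = star y * y" "y = v * s"
    "star v * v = 1 - E" "proj E" "s * E = 0"
    "\<And>T. T * y = y * T \<Longrightarrow> T * star y = star y * T \<Longrightarrow> T * v = v * T"
    "\<And>z. y * z = 0 \<Longrightarrow> v * z = 0" "\<And>r. r * y = y \<Longrightarrow> r * v = v"
    by (rule polar_decomposition_op[OF y1], rule that)
  have vM: "v \<in> M" by (rule M_I) (use v(8) M_D yM M_star in metis)
  have sM: "s \<in> M" unfolding v(1)
  proof (rule M_sqrtc)
    show "norm (star y * y) \<le> 1" using norm_mult_ineq[of "star y" y] mult_mono[OF y1 y1] by simp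
  qed (auto intro: M_closed yM pos_star_mult)
  define t where "t = K *\<^sub>R s"
  have tM: "t \<in> M" unfolding t_def by (intro M_closed sM)
  have zt: "z = v * t" using K arg_cong[OF v(4), of "\<lambda>x. K *\<^sub>R x"] by (simp add: y_def t_def)
  have tt: "t * t = star z * z"
  proof -
    have "t * t = (K * K) *\<^sub>R (star y * y)" by (simp add: t_def v(3))
    also have "\<dots> = star z * z" using K by (simp add: y_def star_simps)
    finally show ?thesis .
  qed
  have pt: "pos t" unfolding t_def by (rule pos_scaleR[OF v(2)]) (use K in simp)
  have tE: "t * E = 0" by (simp add: t_def v(7))
  have Et: "E * t = 0" using arg_cong[OF tE, of star] posD(1)[OF pt] projD(1)[OF v(6)] by (simp add: star_mult)
  have vE: "v * E = 0"
  proof (rule star_mult_eq_zero)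
    have "star (v * E) * (v * E) = star E * (star v * v) * E" by (simp only: star_mult mult.assoc)
    also have "\<dots> = 0" using projD[OF v(6)] by (simp add: v(5) algebra_simps)
    finally show "star (v * E) * (v * E) = 0" .
  qed
  have pv: "piso v" unfolding piso_def mult.assoc v(5) using vE by (simp add: algebra_simps)
  have EM: "E \<in> M"
  proof -
    have "E = 1 - star v * v" by (simp add: v(5))
    then show ?thesis by (simp add: M_closed vM)
  qed
  \<comment> \<open>Finiteness enters here: the trace forces the two defects of a partial isometry
    to be equally large.\<close>
  have "tr E = tr (1 - v * star v)"
  proof -
    have "tr (1 - E) = tr (star v * v)" by (simp add: v(5))
    then show ?thesis using tr_comm[OF vM M_star[OF vM]] by (simp add: tr_diff M_closed EM vM)
  qed
  moreover have "1 - v * star v \<in> M" by (intro M_closed vM)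
  ultimately obtain w where w: "w \<in> M" "star w * w = E" "w * star w = 1 - v * star v"
    using comparison[OF EM v(6) _ proj_compl[OF piso_proj(2)[OF pv]]] by blast
  have vv: "star v * (1 - v * star v) = 0"
    using piso_star[OF pv] by (simp add: right_diff_distrib piso_def mult.assoc)
  have wE: "w * (1 - E) = 0"
  proof (rule zero_of_star_mult[of w E])
    show "star w * w = star E * E" using projD[OF v(6)] by (simp add: w)
    show "E * (1 - E) = 0" using projD[OF v(6)] by (simp add: algebra_simps)
  qed
  then have wE': "w * E = w" by (simp add: algebra_simps)
  have "w * star w * w = w" unfolding mult.assoc w(2) by (rule wE')
  then have vw: "star v * w = 0" using vv w(3) by (metis mult.assoc mult_zero_left)
  have wv: "w * star v = 0"
  proof -
    have "E * star v = 0" using arg_cong[OF vE, of star] projD(1)[OF v(6)] by (simp add: star_mult)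
    then show ?thesis using wE' by (metis mult.assoc mult_zero_right)
  qed
  have vw': "v * star w = 0" "star w * v = 0" using arg_cong[OF wv, of star] arg_cong[OF vw, of star] by (simp_all add: star_mult)
  have u: "unit (v + w)"
    by (simp add: unit_def star_add distrib_left distrib_right vw wv vw' v(5) w)
  have wt: "w * t = 0" using wE' Et by (metis mult.assoc mult_zero_right)
  have "z - (v + w) = (v + w) * (t - 1)" by (simp add: distrib_right right_diff_distrib zt wt)
  also have "n2 \<dots> \<le> n2 (t - 1)"
  proof (rule n2_mult_left_le)
    show "norm (v + w) \<le> 1" using u by (intro piso_norm) (simp add: unit_def piso_def)
  qed (auto intro: M_closed vM w tM)
  also have "\<dots> = n2 (1 - t)" by (rule n2_minus_commute) (auto intro: M_closed tM)
  also have "\<dots> \<le> n2 (star z * z - 1)" using n2_pos_diff_one_le[OF tM pt] by (simp only: tt)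
  finally show ?thesis using u vM w by (intro bexI[of _ "v + w"]) (auto intro: M_closed)
qed

end

section \<open>*-polynomials in a Haar unitary\<close>

lemma mult_less_of_less_divide: "c < e / d \<Longrightarrow> 0 < d \<Longrightarrow> d * c < (e::real)"
  by (simp add: pos_less_divide_eq mult.commute)

text \<open>A *-polynomial is represented by its evaluation function, so that the same
  \<open>F\<close> can be applied to \<open>u\<close> and to every member of a sequence of
  unitaries.\<close>

inductive tpoly :: "('h::complex_hilbert bop \<Rightarrow> 'h bop) \<Rightarrow> bool" where
  tpoly_const: "tpoly (\<lambda>v. cop a)"
| tpoly_var: "tpoly (\<lambda>v. v)"
| tpoly_star: "tpoly F \<Longrightarrow> tpoly (\<lambda>v. star (F v))"
| tpoly_add: "tpoly F \<Longrightarrow> tpoly G \<Longrightarrow> tpoly (\<lambda>v. F v + G v)"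
| tpoly_mult: "tpoly F \<Longrightarrow> tpoly G \<Longrightarrow> tpoly (\<lambda>v. F v * G v)"

lemma tpoly_scaleR: "tpoly F \<Longrightarrow> tpoly (\<lambda>v. r *\<^sub>R F v)"
  using tpoly_mult[OF tpoly_const[of "complex_of_real r"]] by (simp add: cop_of_real_mult)

lemma tpoly_one: "tpoly (\<lambda>v. 1)" and tpoly_zero: "tpoly (\<lambda>v. 0)"
  using tpoly_const[of 1] tpoly_const[of 0] by simp_all

lemma tpoly_diff: "tpoly F \<Longrightarrow> tpoly G \<Longrightarrow> tpoly (\<lambda>v. F v - G v)"
  using tpoly_add[of F "\<lambda>v. -1 *\<^sub>R G v"] tpoly_scaleR[of G "-1"] by simp

lemma tpoly_vis: "tpoly F \<Longrightarrow> tpoly (\<lambda>v. vis n (F v))"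
  by (induction n) (auto intro: tpoly_zero intro!: tpoly_scaleR tpoly_add tpoly_mult)

lemma tpoly_sqrt_approx: "tpoly F \<Longrightarrow> tpoly (\<lambda>v. sqrt_approx R n (F v))"
  unfolding sqrt_approx_def by (intro tpoly_scaleR tpoly_diff tpoly_one tpoly_vis)

text \<open>One bound for all contractions; this provides a common \<open>R\<close> for
  \<open>sqrt_approx\<close> in \<open>projection_transfer\<close>.\<close>

lemma tpoly_norm_bound: "tpoly F \<Longrightarrow> \<exists>K\<ge>0. \<forall>v. norm v \<le> 1 \<longrightarrow> norm (F v) \<le> K"
proof (induction rule: tpoly.induct)
  case (tpoly_const a)
  then show ?case by (intro exI[of _ "norm (cop a :: 'a bop)"]) simp
next
  case (tpoly_add F G)
  then obtain K L where "K \<ge> 0" "L \<ge> 0" "\<And>v. norm v \<le> 1 \<Longrightarrow> norm (F v) \<le> K" "\<And>v. norm v \<le> 1 \<Longrightarrow> norm (G v) \<le> L" by blast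
  then show ?case by (intro exI[of _ "K + L"]) (auto intro: norm_triangle_le add_mono)
next
  case (tpoly_mult F G)
  then obtain K L where "K \<ge> 0" "L \<ge> 0" "\<And>v. norm v \<le> 1 \<Longrightarrow> norm (F v) \<le> K" "\<And>v. norm v \<le> 1 \<Longrightarrow> norm (G v) \<le> L" by blast
  then show ?case by (intro exI[of _ "K * L"]) (auto intro!: order_trans[OF norm_mult_ineq] mult_mono)
next
  case tpoly_var
  show ?case by (intro exI[of _ 1]) simp
qed auto

lemma unit_norm: "unit u \<Longrightarrow> norm u \<le> 1"
  by (rule piso_norm) (simp add: unit_def piso_def)

lemma unit_star: "unit u \<Longrightarrow> unit (star u)"
  by (simp add: unit_def)

lemma unit_mult: "unit u \<Longrightarrow> unit v \<Longrightarrow> unit (u * v)"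
proof -
  assume u: "unit u" and v: "unit v"
  have "star v * star u * (u * v) = star v * (star u * u) * v" "u * v * (star v * star u) = u * (v * star v) * star u"
    by (simp_all only: mult.assoc)
  then show ?thesis using u v by (simp add: unit_def star_mult)
qed

text \<open>A normal form of words in a unitary and its adjoint. Keeping both exponents instead of
  their difference makes the product law \<open>umono_mult\<close> plain addition.\<close>

definition umono :: "'h::complex_hilbert bop \<Rightarrow> nat \<Rightarrow> nat \<Rightarrow> 'h bop" where
  "umono v i j = star v ^ i * v ^ j"

lemma umono_mult:
  assumes "unit v"
  shows "umono v i j * umono v k l = umono v (i + k) (j + l)"
proof -
  have "v * star v = star v * v" using assms by (simp add: unit_def)
  then have "v ^ j * star v ^ k = star v ^ k * v ^ j" by (metis commute_power)
  then show ?thesis unfolding umono_def power_add by (metis mult.assoc)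
qed

lemma umono_star: "star (umono v i j) = umono v j i"
  by (simp add: umono_def star_mult star_power)

lemma unit_power_cancel: "unit v \<Longrightarrow> star v ^ i * v ^ i = 1"
proof (induction i)
  case (Suc i)
  have "star v ^ Suc i * v ^ Suc i = star v ^ i * (star v * v) * v ^ i" by (simp only: power_Suc2[of "star v"] power_Suc[of v] mult.assoc)
  then show ?case using Suc by (simp add: unit_def)
qed simp

lemma umono_reduce:
  assumes "unit v"
  shows "umono v i (i + d) = v ^ d" "umono v (i + d) i = star (v ^ d)"
proof -
  show 1: "umono v i (i + d) = v ^ d"
    using unit_power_cancel[OF assms, of i] by (simp add: umono_def power_add flip: mult.assoc)
  show "umono v (i + d) i = star (v ^ d)" unfolding 1[symmetric] umono_star ..
qed

definition ueval :: "(complex \<times> nat \<times> nat) list \<Rightarrow> 'h::complex_hilbert bop \<Rightarrow> 'h bop" where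
  "ueval xs v = (\<Sum>(a, i, j)\<leftarrow>xs. cop a * umono v i j)"

lemma ueval_mult:
  assumes "unit v"
  shows "ueval xs v * ueval ys v = ueval (concat (map (\<lambda>(a, i, j). map (\<lambda>(b, k, l). (a * b, i + k, j + l)) ys) xs)) v"
proof (induction xs)
  case (Cons x xs)
  obtain a i j where x: "x = (a, i, j)" by (rule prod_cases3)
  have "cop a * umono v i j * ueval ys v = ueval (map (\<lambda>(b, k, l). (a * b, i + k, j + l)) ys) v"
  proof (induction ys)
    case (Cons y ys)
    obtain b k l where y: "y = (b, k, l)" by (rule prod_cases3)
    have "cop a * umono v i j * (cop b * umono v k l) = cop (a * b) * umono v (i + k) (j + l)"
      by (simp only: cop_mult_mult umono_mult[OF assms])
    then show ?case using Cons by (simp add: ueval_def y distrib_left)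
  qed (simp add: ueval_def)
  then show ?case using Cons by (simp add: ueval_def x distrib_right)
qed (simp add: ueval_def)

text \<open>The list does not depend on the unitary, so traces of *-polynomials at a unitary are
  fixed linear expressions in its moments.\<close>

lemma tpoly_ueval: "tpoly F \<Longrightarrow> \<exists>xs. \<forall>v. unit v \<longrightarrow> F v = ueval xs v"
proof (induction rule: tpoly.induct)
  case (tpoly_const a)
  show ?case by (rule exI[of _ "[(a, 0, 0)]"]) (simp add: ueval_def umono_def)
next
  case tpoly_var
  show ?case by (rule exI[of _ "[(1, 0, 1)]"]) (simp add: ueval_def umono_def)
next
  case (tpoly_star F)
  then obtain xs where xs: "\<And>v. unit v \<Longrightarrow> F v = ueval xs v" by blast
  have "star (ueval xs v) = ueval (map (\<lambda>(a, i, j). (cnj a, j, i)) xs) v" for v :: "'a bop"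
    by (induction xs) (auto simp: ueval_def star_add star_mult star_cop umono_star cop_commute)
  then show ?case using xs by (intro exI[of _ "map (\<lambda>(a, i, j). (cnj a, j, i)) xs"]) simp
next
  case (tpoly_add F G)
  then obtain xs ys where "\<And>v. unit v \<Longrightarrow> F v = ueval xs v" "\<And>v. unit v \<Longrightarrow> G v = ueval ys v" by blast
  then show ?case by (intro exI[of _ "xs @ ys"]) (simp add: ueval_def)
next
  case (tpoly_mult F G)
  then obtain xs ys where "\<And>v. unit v \<Longrightarrow> F v = ueval xs v" "\<And>v. unit v \<Longrightarrow> G v = ueval ys v" by blast
  then have "\<forall>v. unit v \<longrightarrow> F v * G v = ueval xs v * ueval ys v" by simp
  then show ?case using ueval_mult[of _ xs ys] by auto
qed

context tracial
begin

lemma tau_star: assumes "x \<in> M" shows "\<tau> (star x) = cnj (\<tau> x)"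
proof (rule complex_eqI)
  show "Re (\<tau> (star x)) = Re (cnj (\<tau> x))" using tr_star[OF assms] by (simp add: tr_def)
  have "tr (star (cop \<i> * x)) = tr (cop \<i> * x)" by (intro tr_star M_closed assms)
  then show "Im (\<tau> (star x)) = Im (cnj (\<tau> x))" using assms by (simp add: tr_def star_cop_mult tau_cop M_closed)
qed

lemma tau_zero [simp]: "\<tau> 0 = 0" using tau_scaleR[OF M_zero, of 0] by simp

lemma tpoly_M: "tpoly F \<Longrightarrow> v \<in> M \<Longrightarrow> F v \<in> M"
  by (induction rule: tpoly.induct) (auto intro: M_closed)

lemma umono_M: "v \<in> M \<Longrightarrow> umono v i j \<in> M"
  by (simp add: umono_def M_closed)

lemma ueval_M: "v \<in> M \<Longrightarrow> ueval xs v \<in> M"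
  by (induction xs) (auto simp: ueval_def intro: M_closed umono_M)

lemma n2_commutator_mult_left:
  assumes "x \<in> M" "f \<in> M" "g \<in> M"
  shows "n2 (x * (f * g) - f * g * x) \<le> n2 (x * f - f * x) * norm g + norm f * n2 (x * g - g * x)"
proof -
  have "x * (f * g) - f * g * x = (x * f - f * x) * g + f * (x * g - g * x)" by (simp add: algebra_simps)
  also have "n2 \<dots> \<le> n2 ((x * f - f * x) * g) + n2 (f * (x * g - g * x))"
    by (intro n2_triangle M_closed assms)
  also have "\<dots> \<le> n2 (x * f - f * x) * norm g + norm f * n2 (x * g - g * x)"
    by (intro add_mono n2_mult_left n2_mult_right M_closed assms)
  finally show ?thesis .
qed

text \<open>The constant depends on \<open>F\<close> only. The second estimate is carried along so
  that the case of an adjoint in the induction is immediate; products use the Leibniz rule together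
  with \<open>tpoly_norm_bound\<close>.\<close>

lemma tpoly_commutator:
  "tpoly F \<Longrightarrow> \<exists>L\<ge>0. \<forall>v\<in>M. unit v \<longrightarrow> (\<forall>x\<in>M. n2 (x * F v - F v * x) \<le> L * n2 (x * v - v * x) \<and>
     n2 (x * star (F v) - star (F v) * x) \<le> L * n2 (x * v - v * x))"
proof (induction rule: tpoly.induct)
  case (tpoly_const a)
  show ?case by (intro exI[of _ 0]) (simp add: cop_commute star_cop)
next
  case tpoly_var
  have "n2 (x * star v - star v * x) \<le> n2 (x * v - v * x)" if "v \<in> M" "unit v" "x \<in> M" for v x
  proof -
    have "x * star v - star v * x = star v * ((v * x - x * v) * star v)"
      using that(2) by (simp add: unit_def algebra_simps) (metis mult.assoc mult_1)
    also have "n2 \<dots> \<le> n2 ((v * x - x * v) * star v)"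
      using that by (intro n2_mult_left_le M_closed) (auto simp: unit_norm)
    also have "\<dots> \<le> n2 (v * x - x * v)"
      using that by (intro n2_mult_right_le M_closed) (auto simp: unit_norm)
    also have "\<dots> = n2 (x * v - v * x)" using that by (intro n2_minus_commute M_closed)
    finally show ?thesis .
  qed
  then show ?case by (intro exI[of _ 1]) auto
next
  case (tpoly_star F)
  then show ?case unfolding star_star by blast
next
  case (tpoly_add F G)
  then obtain K L where K: "K \<ge> 0" "L \<ge> 0"
    "\<And>v x. v \<in> M \<Longrightarrow> unit v \<Longrightarrow> x \<in> M \<Longrightarrow> n2 (x * F v - F v * x) \<le> K * n2 (x * v - v * x) \<and>
       n2 (x * star (F v) - star (F v) * x) \<le> K * n2 (x * v - v * x)"
    "\<And>v x. v \<in> M \<Longrightarrow> unit v \<Longrightarrow> x \<in> M \<Longrightarrow> n2 (x * G v - G v * x) \<le> L * n2 (x * v - v * x) \<and>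
       n2 (x * star (G v) - star (G v) * x) \<le> L * n2 (x * v - v * x)" by metis
  have gen: "n2 (x * (f + g) - (f + g) * x) \<le> n2 (x * f - f * x) + n2 (x * g - g * x)" if "x \<in> M" "f \<in> M" "g \<in> M" for x f g
  proof -
    have "x * (f + g) - (f + g) * x = (x * f - f * x) + (x * g - g * x)" by (simp add: algebra_simps)
    then show ?thesis using that by (simp only:) (intro n2_triangle M_closed)
  qed
  show ?case
  proof (intro exI[of _ "K + L"] conjI ballI impI)
    fix v x assume v: "v \<in> M" "unit v" "x \<in> M"
    have FG: "F v \<in> M" "G v \<in> M" using tpoly_add.hyps tpoly_M v by auto
    show "n2 (x * (F v + G v) - (F v + G v) * x) \<le> (K + L) * n2 (x * v - v * x)"
      using gen[OF v(3) FG] K(3,4)[OF v] by (simp add: distrib_right)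
    show "n2 (x * star (F v + G v) - star (F v + G v) * x) \<le> (K + L) * n2 (x * v - v * x)"
      using gen[OF v(3) M_star[OF FG(1)] M_star[OF FG(2)]] K(3,4)[OF v] by (simp add: distrib_right star_add)
  qed (use K in simp)
next
  case (tpoly_mult F G)
  then obtain K L where K: "K \<ge> 0" "L \<ge> 0"
    "\<And>v x. v \<in> M \<Longrightarrow> unit v \<Longrightarrow> x \<in> M \<Longrightarrow> n2 (x * F v - F v * x) \<le> K * n2 (x * v - v * x) \<and>
       n2 (x * star (F v) - star (F v) * x) \<le> K * n2 (x * v - v * x)"
    "\<And>v x. v \<in> M \<Longrightarrow> unit v \<Longrightarrow> x \<in> M \<Longrightarrow> n2 (x * G v - G v * x) \<le> L * n2 (x * v - v * x) \<and>
       n2 (x * star (G v) - star (G v) * x) \<le> L * n2 (x * v - v * x)" by metis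
  obtain A C where A: "A \<ge> 0" "\<And>v. norm v \<le> 1 \<Longrightarrow> norm (F v) \<le> A" and C: "C \<ge> 0" "\<And>v. norm v \<le> 1 \<Longrightarrow> norm (G v) \<le> C"
    using tpoly_norm_bound[OF tpoly_mult.hyps(1)] tpoly_norm_bound[OF tpoly_mult.hyps(2)] by blast
  show ?case
  proof (intro exI[of _ "K * C + A * L"] conjI ballI impI)
    fix v x assume v: "v \<in> M" "unit v" "x \<in> M"
    have FG: "F v \<in> M" "G v \<in> M" using tpoly_mult.hyps tpoly_M v by auto
    have nF: "norm (F v) \<le> A" "norm (G v) \<le> C" using A C unit_norm[OF v(2)] by auto
    define D where "D = n2 (x * v - v * x)"
    have D: "0 \<le> D" by (simp add: D_def)
    note KD = K(3,4)[OF v, folded D_def]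
    have "n2 (x * (F v * G v) - F v * G v * x) \<le> n2 (x * F v - F v * x) * norm (G v) + norm (F v) * n2 (x * G v - G v * x)"
      by (rule n2_commutator_mult_left[OF v(3) FG])
    also have "\<dots> \<le> (K * D) * C + A * (L * D)"
      using KD nF K A C D by (intro add_mono mult_mono) auto
    finally show "n2 (x * (F v * G v) - F v * G v * x) \<le> (K * C + A * L) * n2 (x * v - v * x)"
      by (simp add: D_def[symmetric] algebra_simps)
    have "n2 (x * (star (G v) * star (F v)) - star (G v) * star (F v) * x)
        \<le> n2 (x * star (G v) - star (G v) * x) * norm (star (F v)) + norm (star (G v)) * n2 (x * star (F v) - star (F v) * x)"
      by (rule n2_commutator_mult_left[OF v(3) M_star[OF FG(2)] M_star[OF FG(1)]])
    also have "\<dots> \<le> (L * D) * A + C * (K * D)"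
      using KD nF K A C D by (intro add_mono mult_mono) auto
    finally show "n2 (x * star (F v * G v) - star (F v * G v) * x) \<le> (K * C + A * L) * n2 (x * v - v * x)"
      by (simp add: D_def[symmetric] star_mult algebra_simps)
  qed (use K A C in simp)
qed

end

section \<open>The abelian algebra of a Haar unitary\<close>

locale haar = II1 M \<tau> for M :: "'h::complex_hilbert bop set" and \<tau> +
  fixes u :: "'h bop"
  assumes uM: "u \<in> M" and uunit: "unit u" and uhaar: "\<And>m. 1 \<le> m \<Longrightarrow> \<tau> (u ^ m) = 0"
begin

text \<open>All *-moments reduce to traces of positive powers: equal exponents cancel, and a surplus
  of adjoints gives the complex conjugate.\<close>

lemma tpoly_transfer:
  assumes F: "tpoly F" and v: "\<And>t. v t \<in> M" "\<And>t. unit (v t)" and lim: "\<And>m. 1 \<le> m \<Longrightarrow> ((\<lambda>t. \<tau> (v t ^ m)) \<longlongrightarrow> 0) \<F>"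
  shows "((\<lambda>t. tr (F (v t))) \<longlongrightarrow> tr (F u)) \<F>"
proof -
  obtain xs where xs: "\<And>v. unit v \<Longrightarrow> F v = ueval xs v" using tpoly_ueval[OF F] by blast
  have mono: "((\<lambda>t. \<tau> (umono (v t) i j)) \<longlongrightarrow> \<tau> (umono u i j)) \<F>" for i j
  proof -
    consider "i = j" | d where "j = i + d" "1 \<le> d" | d where "i = j + d" "1 \<le> d"
      by (metis add_diff_inverse_nat less_one linorder_neqE_nat nat_less_le not_less zero_less_diff le_add_diff_inverse less_imp_le_nat)
    then show ?thesis
    proof cases
      case 1
      have "umono w j j = 1" if "unit w" for w :: "'h bop" using unit_power_cancel[OF that] by (simp add: umono_def)
      then show ?thesis using 1 v(2) uunit by simp
    next
      case 2
      then show ?thesis using lim[OF 2(2)] v uunit by (simp add: umono_reduce uhaar)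
    next
      case 3
      have "((\<lambda>t. cnj (\<tau> (v t ^ d))) \<longlongrightarrow> cnj 0) \<F>" by (intro tendsto_cnj lim 3)
      then show ?thesis using 3 v uunit by (simp add: umono_reduce tau_star M_closed uM uhaar)
    qed
  qed
  have "((\<lambda>t. \<tau> (ueval xs (v t))) \<longlongrightarrow> \<tau> (ueval xs u)) \<F>"
  proof (induction xs)
    case (Cons x xs)
    obtain a i j where x: "x = (a, i, j)" by (rule prod_cases3)
    have "\<tau> (ueval (x # xs) w) = a * \<tau> (umono w i j) + \<tau> (ueval xs w)" if "w \<in> M" for w
      using tau_add[of "cop a * umono w i j" "ueval xs w"] that
      by (simp add: x M_closed umono_M ueval_M tau_cop) (simp add: ueval_def)
    then show ?case using v uM Cons mono by (auto intro!: tendsto_intros)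
  qed (simp add: ueval_def)
  then show ?thesis using xs v uunit unfolding tr_def by (auto intro: tendsto_Re)
qed

lemma tpoly_transfer_n2:
  assumes F: "tpoly F" and v: "\<And>t. v t \<in> M" "\<And>t. unit (v t)" and lim: "\<And>m. 1 \<le> m \<Longrightarrow> ((\<lambda>t. \<tau> (v t ^ m)) \<longlongrightarrow> 0) \<F>"
  shows "((\<lambda>t. n2 (F (v t))) \<longlongrightarrow> n2 (F u)) \<F>"
proof -
  have "((\<lambda>t. sqrt \<bar>tr (star (F (v t)) * F (v t))\<bar>) \<longlongrightarrow> sqrt \<bar>tr (star (F u) * F u)\<bar>) \<F>"
    by (intro tendsto_real_sqrt tendsto_rabs tpoly_transfer[OF tpoly_mult[OF tpoly_star[OF F] F] v lim])
  then show ?thesis by (simp only: n2_def)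
qed

text \<open>Plays the part of the von Neumann algebra generated by \<open>u\<close>. Approximation
  in the 2-norm by *-polynomials is what \<open>tpoly_transfer_n2\<close> can carry over to
  unitaries with asymptotically the same moments.\<close>

definition A0 :: "'h bop set" where
  "A0 = {x \<in> M. \<forall>\<epsilon>>0. \<exists>F. tpoly F \<and> n2 (F u - x) < \<epsilon>}"

lemma A0I: "x \<in> M \<Longrightarrow> (\<And>\<epsilon>. 0 < \<epsilon> \<Longrightarrow> \<exists>F. tpoly F \<and> n2 (F u - x) < \<epsilon>) \<Longrightarrow> x \<in> A0"
  by (auto simp: A0_def)

lemma A0_M: "x \<in> A0 \<Longrightarrow> x \<in> M" by (auto simp: A0_def)

lemma A0D: "x \<in> A0 \<Longrightarrow> 0 < \<epsilon> \<Longrightarrow> \<exists>F. tpoly F \<and> F u \<in> M \<and> n2 (F u - x) < \<epsilon>"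
  using tpoly_M uM by (fastforce simp: A0_def)

lemma A0_tpoly: "tpoly F \<Longrightarrow> F u \<in> A0"
  by (rule A0I) (auto intro: tpoly_M uM intro!: exI[of _ F])

lemma talg_A0: "talg A0"
  unfolding talg_def
proof (intro conjI ballI allI impI)
  show "A0 \<subseteq> M" by (auto simp: A0_def)
  show "1 \<in> A0" using A0_tpoly[OF tpoly_one] by simp
  fix x assume x: "x \<in> A0"
  note xM = A0_M[OF x]
  show "cop a * x \<in> A0" for a
  proof (rule A0I)
    fix \<epsilon> :: real assume e: "0 < \<epsilon>"
    have "0 < \<epsilon> / (cmod a + 1)" using e by (simp add: add_nonneg_pos)
    then obtain F where F: "tpoly F" "F u \<in> M" "n2 (F u - x) < \<epsilon> / (cmod a + 1)" using A0D[OF x] by blast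
    have "n2 (cop a * F u - cop a * x) = cmod a * n2 (F u - x)"
      using n2_cop[of "F u - x" a] F xM by (simp add: right_diff_distrib M_diff)
    also have "\<dots> \<le> (cmod a + 1) * n2 (F u - x)" by (intro mult_right_mono) auto
    also have "\<dots> < \<epsilon>" by (rule mult_less_of_less_divide[OF F(3)]) (simp add: add_nonneg_pos)
    finally show "\<exists>F. tpoly F \<and> n2 (F u - cop a * x) < \<epsilon>"
      using tpoly_mult[OF tpoly_const F(1), of a] by blast
  qed (intro M_closed xM)
  show "star x \<in> A0"
  proof (rule A0I)
    fix \<epsilon> :: real assume e: "0 < \<epsilon>"
    then obtain F where F: "tpoly F" "F u \<in> M" "n2 (F u - x) < \<epsilon>" using A0D[OF x] by blast
    have "n2 (star (F u) - star x) = n2 (F u - x)" using n2_star[of "F u - x"] F xM by (simp add: star_diff M_diff)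
    then show "\<exists>F. tpoly F \<and> n2 (F u - star x) < \<epsilon>" using tpoly_star[OF F(1)] F(3) by metis
  qed (intro M_closed xM)
  fix y assume y: "y \<in> A0"
  note yM = A0_M[OF y]
  show "x + y \<in> A0"
  proof (rule A0I)
    fix \<epsilon> :: real assume "0 < \<epsilon>"
    then have e: "0 < \<epsilon> / 2" by simp
    obtain F where F: "tpoly F" "F u \<in> M" "n2 (F u - x) < \<epsilon> / 2" using A0D[OF x e] by blast
    obtain G where G: "tpoly G" "G u \<in> M" "n2 (G u - y) < \<epsilon> / 2" using A0D[OF y e] by blast
    have "n2 (F u + G u - (x + y)) \<le> n2 (F u - x) + n2 (G u - y)"
      using n2_triangle[of "F u - x" "G u - y"] F G xM yM by (simp add: M_diff algebra_simps)
    then show "\<exists>F. tpoly F \<and> n2 (F u - (x + y)) < \<epsilon>"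
      using tpoly_add[OF F(1) G(1)] F(3) G(3) by (intro exI[of _ "\<lambda>v. F v + G v"]) auto
  qed (intro M_closed xM yM)
  show "x * y \<in> A0"
  proof (rule A0I)
    fix \<epsilon> :: real assume e: "0 < \<epsilon>"
    have "0 < \<epsilon> / (2 * (norm x + 1))" using e by (simp add: add_nonneg_pos)
    then obtain G where G: "tpoly G" "G u \<in> M" "n2 (G u - y) < \<epsilon> / (2 * (norm x + 1))" using A0D[OF y] by blast
    have "0 < \<epsilon> / (2 * (norm (G u) + 1))" using e by (simp add: add_nonneg_pos)
    then obtain F where F: "tpoly F" "F u \<in> M" "n2 (F u - x) < \<epsilon> / (2 * (norm (G u) + 1))" using A0D[OF x] by blast
    have "F u * G u - x * y = (F u - x) * G u + x * (G u - y)" by (simp add: algebra_simps)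
    also have "n2 \<dots> \<le> n2 ((F u - x) * G u) + n2 (x * (G u - y))" by (intro n2_triangle M_closed F G xM yM)
    also have "\<dots> \<le> n2 (F u - x) * norm (G u) + norm x * n2 (G u - y)"
      by (intro add_mono n2_mult_left n2_mult_right M_closed F G xM yM)
    also have "\<dots> \<le> n2 (F u - x) * (norm (G u) + 1) + (norm x + 1) * n2 (G u - y)"
      by (intro add_mono mult_left_mono mult_right_mono) auto
    also have "\<dots> < \<epsilon> / 2 + \<epsilon> / 2"
    proof (rule add_strict_mono)
      have "2 * (norm (G u) + 1) * n2 (F u - x) < \<epsilon>"
        by (rule mult_less_of_less_divide[OF F(3)]) (simp add: add_nonneg_pos)
      then show "n2 (F u - x) * (norm (G u) + 1) < \<epsilon> / 2" by (simp add: algebra_simps)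
      have "2 * (norm x + 1) * n2 (G u - y) < \<epsilon>"
        by (rule mult_less_of_less_divide[OF G(3)]) (simp add: add_nonneg_pos)
      then show "(norm x + 1) * n2 (G u - y) < \<epsilon> / 2" by (simp add: algebra_simps)
    qed
    finally show "\<exists>F. tpoly F \<and> n2 (F u - x * y) < \<epsilon>"
      using tpoly_mult[OF F(1) G(1)] by (intro exI[of _ "\<lambda>v. F v * G v"]) auto
  qed (intro M_closed xM yM)
next
  fix X x assume *: "(\<forall>n. X n \<in> A0) \<and> x \<in> M \<and> (\<lambda>n. n2 (X n - x)) \<longlonglongrightarrow> 0"
  show "x \<in> A0"
  proof (rule A0I)
    fix \<epsilon> :: real assume "0 < \<epsilon>"
    then have e: "0 < \<epsilon> / 2" by simp
    have "\<forall>\<^sub>F n in sequentially. n2 (X n - x) < \<epsilon> / 2" using * e order_tendstoD(2) by blast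
    then obtain n where n: "n2 (X n - x) < \<epsilon> / 2" using eventually_happens' sequentially_bot by blast
    have Xn: "X n \<in> A0" using * by blast
    obtain F where F: "tpoly F" "F u \<in> M" "n2 (F u - X n) < \<epsilon> / 2" using A0D[OF Xn e] by blast
    have "n2 (F u - x) \<le> n2 (F u - X n) + n2 (X n - x)" using * F A0_M[OF Xn] by (intro n2_dist_triangle) auto
    then show "\<exists>F. tpoly F \<and> n2 (F u - x) < \<epsilon>" using F n by (intro exI[of _ F]) auto
  qed (use * in blast)
qed

text \<open>Two uses of \<open>tpoly_commutator\<close>, whose right-hand side vanishes once
  \<open>x\<close> commutes with \<open>v\<close>: first with \<open>x = v\<close>, then with
  \<open>x = G v\<close>.\<close>

lemma tpoly_commute:
  assumes "tpoly F" "tpoly G" "unit v" "v \<in> M" shows "F v * G v = G v * F v"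
proof -
  obtain K where K: "n2 (v * G v - G v * v) \<le> K * n2 (v * v - v * v)"
    using tpoly_commutator[OF assms(2)] assms(3,4) by blast
  then have "n2 (v * G v - G v * v) = 0" using n2_nonneg[of "v * G v - G v * v"] by simp
  then have vG: "v * G v = G v * v" using n2_eq_zero[of "v * G v - G v * v"] tpoly_M[OF assms(2,4)] assms(4) by (simp add: M_closed)
  obtain L where L: "n2 (G v * F v - F v * G v) \<le> L * n2 (G v * v - v * G v)"
    using tpoly_commutator[OF assms(1)] assms(3,4) tpoly_M[OF assms(2,4)] by blast
  then have "n2 (G v * F v - F v * G v) = 0" using n2_nonneg[of "G v * F v - F v * G v"] vG by simp
  then show ?thesis using n2_eq_zero[of "G v * F v - F v * G v"] tpoly_M[OF assms(2,4)] tpoly_M[OF assms(1,4)] by (simp add: M_closed)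
qed

lemma A0_commute_tpoly: assumes x: "x \<in> A0" and G: "tpoly G" shows "x * G u = G u * x"
proof -
  have GM: "G u \<in> M" by (rule tpoly_M[OF G uM])
  have "n2 (x * G u - G u * x) \<le> 0"
  proof (rule field_le_epsilon)
    fix e :: real assume e: "0 < e"
    have "0 < e / (2 * (norm (G u) + 1))" using e by (simp add: add_nonneg_pos)
    then obtain F where F: "tpoly F" "F u \<in> M" "n2 (F u - x) < e / (2 * (norm (G u) + 1))" using A0D[OF x] by blast
    have xF: "x - F u \<in> M" by (intro M_closed A0_M x F)
    have "x * G u - G u * x = (x - F u) * G u - G u * (x - F u)"
      using tpoly_commute[OF F(1) G uunit uM] by (simp add: algebra_simps)
    also have "n2 \<dots> \<le> n2 ((x - F u) * G u) + n2 (G u * (x - F u))" by (intro n2_triangle_diff M_mult xF GM)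
    also have "\<dots> \<le> n2 (x - F u) * norm (G u) + norm (G u) * n2 (x - F u)"
      by (intro add_mono n2_mult_left n2_mult_right xF GM)
    also have "\<dots> \<le> 2 * (norm (G u) + 1) * n2 (x - F u)" by (simp add: algebra_simps)
    also have "n2 (x - F u) = n2 (F u - x)" by (intro n2_minus_commute A0_M x F)
    also have "2 * (norm (G u) + 1) * n2 (F u - x) \<le> e"
      by (rule less_imp_le, rule mult_less_of_less_divide[OF F(3)]) (simp add: add_nonneg_pos)
    finally show "n2 (x * G u - G u * x) \<le> 0 + e" by simp
  qed
  then show ?thesis using n2_eq_zero[of "x * G u - G u * x"] n2_nonneg[of "x * G u - G u * x"] A0_M[OF x] GM by (simp add: M_closed)
qed

lemma A0_commute: assumes x: "x \<in> A0" and y: "y \<in> A0" shows "x * y = y * x"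
proof -
  note xM = A0_M[OF x] and yM = A0_M[OF y]
  have "n2 (x * y - y * x) \<le> 0"
  proof (rule field_le_epsilon)
    fix e :: real assume e: "0 < e"
    have "0 < e / (2 * (norm x + 1))" using e by (simp add: add_nonneg_pos)
    then obtain F where F: "tpoly F" "F u \<in> M" "n2 (F u - y) < e / (2 * (norm x + 1))" using A0D[OF y] by blast
    have yF: "y - F u \<in> M" by (intro M_closed yM F)
    have "x * y - y * x = x * (y - F u) - (y - F u) * x"
      using A0_commute_tpoly[OF x F(1)] by (simp add: algebra_simps)
    also have "n2 \<dots> \<le> n2 (x * (y - F u)) + n2 ((y - F u) * x)" by (intro n2_triangle_diff M_mult yF xM)
    also have "\<dots> \<le> norm x * n2 (y - F u) + n2 (y - F u) * norm x"
      by (intro add_mono n2_mult_left n2_mult_right yF xM)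
    also have "\<dots> \<le> 2 * (norm x + 1) * n2 (y - F u)" by (simp add: algebra_simps)
    also have "n2 (y - F u) = n2 (F u - y)" by (intro n2_minus_commute yM F)
    also have "2 * (norm x + 1) * n2 (F u - y) \<le> e"
      by (rule less_imp_le, rule mult_less_of_less_divide[OF F(3)]) (simp add: add_nonneg_pos)
    finally show "n2 (x * y - y * x) \<le> 0 + e" by simp
  qed
  then show ?thesis using n2_eq_zero[of "x * y - y * x"] n2_nonneg[of "x * y - y * x"] xM yM by (simp add: M_closed)
qed

end

context haar
begin

subsection \<open>Diffuseness\<close>

lemma proj_mult_commute: "proj e \<Longrightarrow> proj f \<Longrightarrow> e * f = f * e \<Longrightarrow> proj (e * f)"
  unfolding proj_def star_mult by (metis mult.assoc)

text \<open>For every \<open>t\<close> the spectral projection of \<open>h\<close> at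
  \<open>t\<close> either contains \<open>e\<close> or is orthogonal to it, so \<open>h * e\<close>
  lies above or below \<open>t *\<^sub>R e\<close>. The supremum of the \<open>t\<close> of the
  first kind is the scalar.\<close>

lemma minimal_scalar:
  assumes e: "e \<in> A0" "proj e" "e \<noteq> 0" and min: "\<And>f. f \<in> A0 \<Longrightarrow> proj f \<Longrightarrow> f * e = f \<Longrightarrow> f = 0 \<or> f = e"
    and h: "h \<in> A0" "star h = h"
  shows "\<exists>r. h * e = r *\<^sub>R e"
proof -
  note B = talg_A0
  have he: "h * e = e * h" by (rule A0_commute[OF h(1) e(1)])
  have she: "star (h * e) = h * e" using he h projD[OF e(2)] by (simp add: star_mult)
  have eee: "star e = e" "e * e = e" by (fact projD[OF e(2)])+
  have key: "pos (h * e - t *\<^sub>R e) \<or> pos (t *\<^sub>R e - h * e)" for t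
  proof -
    \<comment> \<open>\<open>spectral_projection\<close> cuts at 1/2 through
      \<open>b = 2 *\<^sub>R k - 1\<close>; this choice of \<open>k\<close> makes
      \<open>b = h - t *\<^sub>R 1\<close>, a cut of \<open>h\<close> at \<open>t\<close>.\<close>
    define k where "k = (1/2) *\<^sub>R (1 + (h - t *\<^sub>R 1))"
    define b where "b = 2 *\<^sub>R k - 1"
    have b: "b = h - t *\<^sub>R 1" by (simp add: b_def k_def)
    have k: "k \<in> A0" unfolding k_def by (intro talg_scaleR[OF B] talg_add[OF B] talg_diff[OF B] talg_one[OF B] h)
    have sk: "star k = k" by (simp add: k_def star_simps h)
    define R where "R = norm (b * b) + 1"
    have R: "0 < R" "norm (b * b) \<le> R" by (simp_all add: R_def add_nonneg_pos)
    define a where "a = sqrtc R (b * b)"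
    obtain f where f: "f \<in> A0" "proj f" "\<And>y. k * y = y * k \<Longrightarrow> f * y = y * f"
      "\<And>p. proj p \<Longrightarrow> p * k = k \<Longrightarrow> p * f = f"
      "pos a" "a \<in> A0" "a * a = b * b" "a * f = f * a" "b = a * (2 *\<^sub>R f - 1)"
      "n2 (f - k) = n2 (1 - a) / 2" "n2 (f - k) \<le> 2 * n2 (k * k - k)"
      "\<And>p. p \<in> M \<Longrightarrow> proj p \<Longrightarrow> n2 (f - k) \<le> n2 (p - k)"
      by (rule spectral_projection[OF B k sk b_def R a_def], rule that)
    have "a * e = e * a" by (rule A0_commute[OF f(6) e(1)])
    then have ae: "a * e = star e * a * e" using eee by (metis mult.assoc)
    have pae: "pos (a * e)" unfolding ae by (rule pos_conj[OF f(5)])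
    have fe: "f * e = e * f" by (rule A0_commute[OF f(1) e(1)])
    have "f * e * e = f * e" by (simp only: mult.assoc eee)
    then have "f * e = 0 \<or> f * e = e"
      by (rule min[OF talg_mult[OF B f(1) e(1)] proj_mult_commute[OF f(2) e(2) fe]])
    moreover have "h * e - t *\<^sub>R e = b * e" by (simp add: b left_diff_distrib)
    moreover have "b * e = 2 *\<^sub>R (a * (f * e)) - a * e" by (subst f(9)) (simp add: algebra_simps)
    ultimately have "h * e - t *\<^sub>R e = a * e \<or> t *\<^sub>R e - h * e = a * e"
      by (auto simp: scaleR_2 algebra_simps)
    then show ?thesis using pae by auto
  qed
  define \<Lambda> where "\<Lambda> = {t. pos (h * e - t *\<^sub>R e)}"
  have q: "Re (cinner ((h * e - t *\<^sub>R e) \<triangleright> \<xi>) \<xi>) = Re (cinner ((h * e) \<triangleright> \<xi>) \<xi>) - t * (norm (e \<triangleright> \<xi>))\<^sup>2" for t \<xi>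
  proof -
    have "cinner (e \<triangleright> \<xi>) \<xi> = cinner ((e * e) \<triangleright> \<xi>) \<xi>" by (simp only: eee)
    also have "\<dots> = cinner (e \<triangleright> \<xi>) (star e \<triangleright> \<xi>)" unfolding ap_mult by (rule cinner_star)
    also have "\<dots> = cinner (e \<triangleright> \<xi>) (e \<triangleright> \<xi>)" by (simp only: eee)
    finally show ?thesis by (simp add: ap_linear cinner_linear cinner_scaleR_left cinner_self)
  qed
  obtain \<xi>0 where x0: "e \<triangleright> \<xi>0 \<noteq> 0" using e(3) bop_eqI[of e 0] by auto
  have n0: "0 < (norm (e \<triangleright> \<xi>0))\<^sup>2" using x0 by simp
  have bound: "t \<le> Re (cinner ((h * e) \<triangleright> \<xi>0) \<xi>0) / (norm (e \<triangleright> \<xi>0))\<^sup>2" if "t \<in> \<Lambda>" for t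
    using that posD(2)[of "h * e - t *\<^sub>R e" \<xi>0] q[of t \<xi>0] n0 by (simp add: \<Lambda>_def field_simps)
  then have bdd: "bdd_above \<Lambda>" by (rule bdd_aboveI)
  have "- norm h \<in> \<Lambda>"
  proof -
    have "pos (norm (- h) *\<^sub>R 1 - (- h))" by (rule pos_norm_bound_diff) (auto simp: star_simps h)
    from pos_conj[OF this, of e] have "pos (star e * (norm h *\<^sub>R 1 + h) * e)" by simp
    moreover have "star e * (norm h *\<^sub>R 1 + h) * e = h * e - (- norm h) *\<^sub>R e"
      using he eee by (simp add: algebra_simps) (metis mult.assoc)
    ultimately show ?thesis by (simp add: \<Lambda>_def)
  qed
  then have ne: "\<Lambda> \<noteq> {}" by blast
  define r where "r = Sup \<Lambda>"
  have ge: "r * (norm (e \<triangleright> \<xi>))\<^sup>2 \<le> Re (cinner ((h * e) \<triangleright> \<xi>) \<xi>)" for \<xi>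
  proof (cases "e \<triangleright> \<xi> = 0")
    case True
    then have "(h * e) \<triangleright> \<xi> = 0" by simp
    then show ?thesis using True by (simp del: ap_mult)
  next
    case False
    then have n: "0 < (norm (e \<triangleright> \<xi>))\<^sup>2" by simp
    have "r \<le> Re (cinner ((h * e) \<triangleright> \<xi>) \<xi>) / (norm (e \<triangleright> \<xi>))\<^sup>2" unfolding r_def
    proof (rule cSup_least[OF ne])
      fix t assume "t \<in> \<Lambda>"
      then show "t \<le> Re (cinner ((h * e) \<triangleright> \<xi>) \<xi>) / (norm (e \<triangleright> \<xi>))\<^sup>2"
        using posD(2)[of "h * e - t *\<^sub>R e" \<xi>] q[of t \<xi>] n by (simp add: \<Lambda>_def field_simps)
    qed
    then show ?thesis using n by (simp add: field_simps)
  qed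
  have le: "Re (cinner ((h * e) \<triangleright> \<xi>) \<xi>) \<le> r * (norm (e \<triangleright> \<xi>))\<^sup>2" for \<xi>
  proof (cases "e \<triangleright> \<xi> = 0")
    case True
    then have "(h * e) \<triangleright> \<xi> = 0" by simp
    then show ?thesis using True by (simp del: ap_mult)
  next
    case False
    then have n: "0 < (norm (e \<triangleright> \<xi>))\<^sup>2" by simp
    have "Re (cinner ((h * e) \<triangleright> \<xi>) \<xi>) / (norm (e \<triangleright> \<xi>))\<^sup>2 \<le> r"
    proof (rule dense_ge)
      fix t assume "r < t"
      then have "t \<notin> \<Lambda>" using cSup_upper[OF _ bdd, of t] by (auto simp: r_def)
      then have "pos (t *\<^sub>R e - h * e)" using key[of t] by (simp add: \<Lambda>_def)
      then have "Re (cinner ((h * e - t *\<^sub>R e) \<triangleright> \<xi>) \<xi>) \<le> 0" using posD(2)[of "t *\<^sub>R e - h * e" \<xi>] by (simp add: ap_linear cinner_linear)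
      then show "Re (cinner ((h * e) \<triangleright> \<xi>) \<xi>) / (norm (e \<triangleright> \<xi>))\<^sup>2 \<le> t" using q[of t \<xi>] n by (simp add: field_simps)
    qed
    then show ?thesis using n by (simp add: field_simps)
  qed
  have s: "star (h * e - r *\<^sub>R e) = h * e - r *\<^sub>R e" by (simp only: star_diff she star_scaleR eee)
  have "pos (h * e - r *\<^sub>R e)" by (rule posI[OF s]) (simp only: q ge diff_ge_0_iff_ge)
  moreover have "pos (- (h * e - r *\<^sub>R e))"
  proof (rule posI)
    show "0 \<le> Re (cinner ((- (h * e - r *\<^sub>R e)) \<triangleright> \<xi>) \<xi>)" for \<xi>
      using le[of \<xi>] q[of r \<xi>] by (simp only: ap_minus_left cinner_minus_left) simp
  qed (simp only: star_minus s)
  ultimately have "h * e - r *\<^sub>R e = 0" by (rule pos_antisym)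
  then show ?thesis by auto
qed

text \<open>Under a minimal \<open>e\<close> the real and imaginary parts of \<open>u\<close> are
  scalars, so \<open>u * e = cop l * e\<close> with \<open>cmod l = 1\<close>. By the Haar property
  the powers of \<open>w = cop (cnj l) * u\<close> are orthonormal for the trace. Hence the sum of
  the first \<open>n\<close> powers has 2-norm \<open>sqrt n\<close>, while it acts as
  multiplication by \<open>n\<close> on \<open>e\<close>: impossible for large
  \<open>n\<close>.\<close>

lemma A0_no_minimal:
  assumes e: "e \<in> A0" "proj e" "e \<noteq> 0"
  shows "\<exists>f\<in>A0. proj f \<and> f * e = f \<and> f \<noteq> 0 \<and> f \<noteq> e"
proof (rule ccontr)
  assume "\<not> ?thesis"
  then have min: "f = 0 \<or> f = e" if "f \<in> A0" "proj f" "f * e = f" for f using that by blast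
  note eM = A0_M[OF e(1)]
  have uA: "u \<in> A0" using A0_tpoly[OF tpoly_var] .
  define h k where "h = (1/2) *\<^sub>R (u + star u)" and "k = cop (- \<i> / 2) * (u - star u)"
  have hk: "h \<in> A0" "k \<in> A0" unfolding h_def k_def
    by (intro talg_scaleR[OF talg_A0] talg_add[OF talg_A0] talg_cop[OF talg_A0] talg_diff[OF talg_A0] talg_star[OF talg_A0] uA)+
  have sh: "star h = h" by (simp add: h_def star_simps add.commute)
  have "star k = cop (\<i> / 2) * (star u - u)" by (simp add: k_def star_cop_mult star_diff)
  also have "\<dots> = k"
  proof -
    have "cop (- \<i> / 2) + cop (\<i> / 2) = (0 :: 'h bop)" by (simp add: cop_add)
    then have "cop (- \<i> / 2) = - (cop (\<i> / 2) :: 'h bop)" by (rule add_eq_0_iff2[THEN iffD1])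
    then show ?thesis by (simp add: k_def algebra_simps)
  qed
  finally have sk: "star k = k" .
  obtain r s where r: "h * e = r *\<^sub>R e" "k * e = s *\<^sub>R e"
    using minimal_scalar[OF e min hk(1) sh] minimal_scalar[OF e min hk(2) sk] by blast
  define l where "l = complex_of_real r + \<i> * complex_of_real s"
  have "u = h + cop \<i> * k"
  proof -
    have "cop \<i> * k = (1/2) *\<^sub>R (u - star u)"
      by (simp add: k_def cop_mult flip: mult.assoc) (metis cop_of_real_mult of_real_1 of_real_divide of_real_numeral)
    moreover have "(1/2) *\<^sub>R u + (1/2) *\<^sub>R u = u" by (simp flip: scaleR_add_left)
    ultimately show ?thesis by (simp add: h_def scaleR_add_right scaleR_diff_right)
  qed
  then have "u * e = h * e + cop \<i> * (k * e)" by (simp add: distrib_right mult.assoc)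
  also have "\<dots> = cop l * e"
    unfolding r cop_of_real_mult[symmetric] l_def by (simp add: distrib_right cop_mult flip: mult.assoc cop_add)
  finally have ue: "u * e = cop l * e" .
  have "star (u * e) * (u * e) = star e * (star u * u) * e" by (simp only: star_mult mult.assoc)
  then have "star (u * e) * (u * e) = e" using uunit projD[OF e(2)] by (simp add: unit_def)
  moreover have "star (u * e) * (u * e) = cop (cnj l * l) * e"
    unfolding ue star_cop_mult cop_mult_mult using projD[OF e(2)] by simp
  ultimately have "cop (cnj l * l) * e = e" by simp
  moreover have "cnj l * l = complex_of_real ((cmod l)\<^sup>2)" by (metis complex_norm_square mult.commute of_real_power)
  ultimately have "(cmod l)\<^sup>2 *\<^sub>R e = e" by (simp only: cop_of_real_mult)
  then have "((cmod l)\<^sup>2 - 1) *\<^sub>R e = 0" by (simp add: scaleR_diff_left)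
  then have l1: "(cmod l)\<^sup>2 = 1" using e(3) by simp
  have cl: "cnj l * l = 1" using \<open>cnj l * l = _\<close> l1 by simp
  define w where "w = cop (cnj l) * u"
  have wM: "w \<in> M" unfolding w_def by (intro M_closed uM)
  have wp: "w ^ m = cop (cnj l ^ m) * u ^ m" for m
    by (induction m) (simp_all add: w_def cop_mult_mult)
  have wu: "unit w" using uunit cl by (simp add: unit_def w_def star_cop_mult cop_mult_mult mult.commute)
  have we: "w ^ m * e = e" for m
  proof (induction m)
    case (Suc m)
    have "w * e = e" using cl by (simp add: w_def mult.assoc ue cop_mult flip: mult.assoc[of "cop _" "cop _"])
    then show ?case using Suc by (simp add: mult.assoc)
  qed simp
  define S where "S n = (\<Sum>m<n. w ^ m)" for n
  have SM: "S n \<in> M" for n by (auto simp: S_def intro: M_closed wM)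
  have S2: "(n2 (S n))\<^sup>2 = real n" for n
  proof (induction n)
    case (Suc n)
    have "tr (star (S n) * w ^ n) = 0"
    proof -
      have "star (S n) * w ^ n = (\<Sum>m<n. star w ^ m * w ^ n)" by (simp add: S_def star_sum star_power sum_distrib_right)
      also have "\<dots> = (\<Sum>m<n. w ^ (n - m))"
      proof (rule sum.cong)
        fix m assume "m \<in> {..<n}"
        then show "star w ^ m * w ^ n = w ^ (n - m)" using umono_reduce(1)[OF wu, of m "n - m"] by (simp add: umono_def)
      qed simp
      also have "tr \<dots> = (\<Sum>m<n. tr (w ^ (n - m)))" by (intro tr_sum M_closed wM)
      also have "\<dots> = 0"
        by (rule sum.neutral) (auto simp: wp tr_def tau_cop M_closed uM uhaar)
      finally show ?thesis .
    qed
    moreover have "star (w ^ n) * w ^ n = 1" using unit_power_cancel[OF wu, of n] by (simp add: star_power)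
    moreover have "star (S (Suc n)) * S (Suc n) = star (S n) * S n + star (S n) * w ^ n + star (w ^ n) * S n + star (w ^ n) * w ^ n"
      by (simp add: S_def star_add algebra_simps)
    ultimately show ?case using Suc tr_star_mult_comm[OF SM M_power[OF wM], of n n]
      by (simp add: n2_sq SM tr_add M_closed wM)
  qed (simp add: S_def)
  have bound: "real n * n2 e \<le> sqrt (real n)" for n
  proof -
    have "S n * e = real n *\<^sub>R e" by (simp add: S_def sum_distrib_right we sum_constant_scaleR)
    then have "real n * n2 e = n2 (S n * e)" by (simp add: n2_scaleR eM)
    also have "\<dots> \<le> n2 (S n)" by (rule n2_mult_right_le[OF SM eM proj_norm[OF e(2)]])
    also have "\<dots> = sqrt (real n)" using S2[of n] by (metis n2_nonneg real_sqrt_unique)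
    finally show ?thesis .
  qed
  have pe: "0 < n2 e" using n2_eq_zero[OF eM] e(3) n2_nonneg[of e] by (auto simp: less_le)
  obtain n :: nat where n: "1 / (n2 e)\<^sup>2 < real n" using reals_Archimedean2 by blast
  have n0: "0 < real n" using n pe by (smt (verit) zero_le_power2 divide_nonneg_nonneg)
  have "(real n * n2 e)\<^sup>2 \<le> (sqrt (real n))\<^sup>2" by (rule power_mono[OF bound]) (use pe in simp)
  then have "real n * (real n * (n2 e)\<^sup>2) \<le> real n * 1" by (simp add: power2_eq_square mult_ac)
  then have "real n * (n2 e)\<^sup>2 \<le> 1" by (rule mult_left_le_imp_le[OF _ n0])
  then show False using n pe by (simp add: field_simps)
qed

definition diffuse :: "'h bop set \<Rightarrow> bool" where
  "diffuse B \<longleftrightarrow> (\<forall>e\<in>B. proj e \<longrightarrow> e \<noteq> 0 \<longrightarrow> (\<forall>\<delta>>0. \<exists>f\<in>B. proj f \<and> f * e = f \<and> f \<noteq> 0 \<and> tr f \<le> \<delta>))"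

lemma proj_sub: assumes "proj e" "proj f" "f * e = f" shows "e * f = f" "proj (e - f)"
proof -
  show "e * f = f" using arg_cong[OF assms(3), of star] projD[OF assms(1)] projD[OF assms(2)] by (simp add: star_mult)
  then show "proj (e - f)" using assms by (simp add: proj_def star_diff left_diff_distrib right_diff_distrib)
qed

lemma tr_proj_pos: "e \<in> M \<Longrightarrow> proj e \<Longrightarrow> e \<noteq> 0 \<Longrightarrow> 0 < tr e"
  using tr_faithful[of e] proj_pos[of e] by (meson linorder_not_less)

lemma tr_proj_nonneg: "e \<in> M \<Longrightarrow> proj e \<Longrightarrow> 0 \<le> tr e"
  using tr_pos proj_pos by blast

text \<open>When a projection is split properly, one of the two parts has at most half of its
  trace.\<close>

lemma diffuse_A0: "diffuse A0"
  unfolding diffuse_def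
proof (intro ballI allI impI)
  fix e \<delta> assume e: "e \<in> A0" "proj e" "e \<noteq> 0" and d: "(0::real) < \<delta>"
  have "\<exists>f\<in>A0. proj f \<and> f * e = f \<and> f \<noteq> 0 \<and> tr f \<le> (1/2) ^ n" for n
  proof (induction n)
    case 0
    show ?case using e tr_proj_le_one[OF A0_M[OF e(1)] e(2)] projD[OF e(2)] by (intro bexI[of _ e]) auto
  next
    case (Suc n)
    then obtain f where f: "f \<in> A0" "proj f" "f * e = f" "f \<noteq> 0" "tr f \<le> (1/2) ^ n" by blast
    obtain g where g: "g \<in> A0" "proj g" "g * f = g" "g \<noteq> 0" "g \<noteq> f" using A0_no_minimal[OF f(1,2,4)] by blast
    have fg: "f - g \<in> A0" by (intro talg_diff[OF talg_A0] f g)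
    have "tr f = tr g + tr (f - g)" using f g by (simp add: tr_diff A0_M)
    moreover have "(1/2::real) ^ Suc n = (1/2) ^ n / 2" by simp
    ultimately have "tr g \<le> (1/2) ^ Suc n \<or> tr (f - g) \<le> (1/2) ^ Suc n" using f(5) by linarith
    moreover have "g * e = g" "(f - g) * e = f - g" using g(3) f(3) by (metis mult.assoc, metis f(3) g(3) left_diff_distrib mult.assoc)
    moreover have "f - g \<noteq> 0" using g(5) by auto
    ultimately show ?case using g fg proj_sub(2)[OF f(2) g(2,3)] by blast
  qed
  moreover obtain n where "(1/2::real) ^ n < \<delta>" using real_arch_pow_inv[OF d, of "1/2"] by auto
  ultimately show "\<exists>f\<in>A0. proj f \<and> f * e = f \<and> f \<noteq> 0 \<and> tr f \<le> \<delta>" by (meson less_imp_le order_trans)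
qed

lemma one_neq_zero: "(1::'h bop) \<noteq> 0"
  using tau_one by auto

text \<open>A partial isometry from a part of \<open>e\<close> into a small projection of
  \<open>A0\<close> has an initial projection below \<open>e\<close> whose trace is as
  small.\<close>

lemma diffuse_M: "diffuse M"
  unfolding diffuse_def
proof (intro ballI allI impI)
  fix e \<delta> assume e: "e \<in> M" "proj e" "e \<noteq> 0" and d: "(0::real) < \<delta>"
  have p1: "proj (1::'h bop)" by (simp add: proj_def)
  obtain a where a: "a \<in> A0" "proj a" "a \<noteq> 0" "tr a \<le> \<delta>"
    using diffuse_A0 talg_one[OF talg_A0] p1 one_neq_zero d unfolding diffuse_def by blast
  obtain v where v: "v \<in> M" "piso v" "v \<noteq> 0" "v * e = v" "a * v = v"
    using exists_piso[OF e A0_M[OF a(1)] a(2,3)] by blast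
  have "tr (star v * v) = tr (v * star v)" by (intro tr_comm M_closed v)
  also have "\<dots> \<le> tr a"
  proof (rule tr_mono)
    have "v * star v * a = v * star v" using arg_cong[OF v(5), of star] projD[OF a(2)] by (simp add: star_mult mult.assoc)
    then show "pos (a - v * star v)" by (intro proj_pos proj_sub a piso_proj v)
  qed (intro M_closed v A0_M a)+
  finally show "\<exists>f\<in>M. proj f \<and> f * e = f \<and> f \<noteq> 0 \<and> tr f \<le> \<delta>"
    using v a(4) piso_proj[OF v(2)] star_mult_eq_zero[of v] by (intro bexI[of _ "star v * v"]) (auto intro: M_closed simp: mult.assoc)
qed

text \<open>Exhaustion among the subprojections of \<open>e\<close> of trace at most
  \<open>t\<close>. If a maximal one had smaller trace, diffuseness would supply a further
  orthogonal piece small enough to be added.\<close>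

lemma exact_trace:
  assumes B: "talg B" "diffuse B" and e: "e \<in> B" "proj e" and t: "0 \<le> t" "t \<le> tr e"
  shows "\<exists>f\<in>B. proj f \<and> f * e = f \<and> tr f = t"
proof -
  note BM = talg_sub[OF B(1)]
  define S where "S = {f\<in>B. proj f \<and> f * e = f \<and> tr f \<le> t}"
  have le: "piso_le f g \<longleftrightarrow> g * f = f" if "proj f" "proj g" for f g
  proof -
    have "f * g = star (g * f)" using projD[OF that(1)] projD[OF that(2)] by (simp add: star_mult)
    then show ?thesis using projD[OF that(1)] by (auto simp: piso_le_def)
  qed
  have trle: "tr f \<le> tr g" if "f \<in> M" "g \<in> M" "proj f" "proj g" "piso_le f g" for f g
    using piso_le_tr[OF that(1,2,5)] tr_star_mult_nonneg[OF M_diff[OF that(2,1)]] projD[OF that(3)] projD[OF that(4)] by simp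
  have "\<exists>x\<in>S. \<forall>y\<in>S. piso_le x y \<longrightarrow> tr y \<le> tr x"
  proof (rule exhaustion)
    show "0 \<in> S" using t by (simp add: S_def talg_zero[OF B(1)] proj_def)
    show "piso_le x x" for x by (rule piso_le_refl)
    show "piso_le x z" if "x \<in> S" "piso_le x y" "piso_le y z" for x y z
      using piso_le_trans that proj_piso by (auto simp: S_def)
    show "tr x \<le> tr y" if "x \<in> S" "y \<in> S" "piso_le x y" for x y
      using that by (auto simp: S_def intro: trle BM)
    show "tr x \<le> t" if "x \<in> S" for x using that by (simp add: S_def)
    fix f assume f: "\<And>n. f n \<in> S" "\<And>n. piso_le (f n) (f (Suc n))"
    have fB: "f n \<in> B" "proj (f n)" "f n * e = f n" "tr (f n) \<le> t" for n using f(1) by (auto simp: S_def)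
    obtain v where v: "v \<in> M" "piso v" "\<And>n. piso_le (f n) v" "(\<lambda>n. n2 (f n - v)) \<longlonglongrightarrow> 0" "sot f v"
      by (rule piso_chain_limit[of f, OF BM[OF fB(1)] proj_piso[OF fB(2)] f(2)], rule that)
    have vB: "v \<in> B" by (rule talg_limit[OF B(1) fB(1) v(1,4)])
    have "sot (\<lambda>n. star (f n)) v" using v(5) projD(1)[OF fB(2)] by simp
    then have sv: "star v = v" by (rule sot_star[OF v(5)])
    have "sot (\<lambda>n. f n * f n) (v * v)" by (rule sot_mult[OF v(5) v(5) proj_norm[OF fB(2)]])
    then have "sot f (v * v)" using projD(2)[OF fB(2)] by simp
    then have "v * v = v" using sot_unique v(5) by blast
    then have pv: "proj v" using sv by (simp add: proj_def)
    have "sot f (v * e)" using sot_mult_right[OF v(5), of e] fB(3) by simp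
    then have ve: "v * e = v" using sot_unique v(5) by blast
    have "tr v \<le> t"
    proof (rule field_le_epsilon)
      fix d :: real assume "0 < d"
      then have "\<forall>\<^sub>F n in sequentially. n2 (f n - v) < d" using v(4) order_tendstoD(2) by blast
      then obtain n where n: "n2 (f n - v) < d" using eventually_happens' sequentially_bot by blast
      have "tr v - tr (f n) = - tr (f n - v)" using v(1) BM[OF fB(1)] by (simp add: tr_diff)
      also have "\<dots> \<le> n2 (f n - v)" using tr_le_n2[of "f n - v"] v(1) BM[OF fB(1)] by (simp add: M_diff abs_le_iff)
      finally show "tr v \<le> t + d" using n fB(4)[of n] by linarith
    qed
    then show "\<exists>u\<in>S. \<forall>n. piso_le (f n) u" using v vB pv ve by (auto simp: S_def)
  qed
  then obtain f where fS: "f \<in> S" and fmax: "\<And>y. y \<in> S \<Longrightarrow> piso_le f y \<Longrightarrow> tr y \<le> tr f" by blast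
  have f: "f \<in> B" "proj f" "f * e = f" "tr f \<le> t" using fS by (auto simp: S_def)
  have "tr f = t"
  proof (rule ccontr)
    assume "tr f \<noteq> t"
    then have lt: "tr f < t" using f(4) by simp
    then have "e - f \<noteq> 0" using t by auto
    moreover have "e - f \<in> B" by (intro talg_diff[OF B(1)] e f)
    ultimately obtain g where g: "g \<in> B" "proj g" "g * (e - f) = g" "g \<noteq> 0" "tr g \<le> t - tr f"
      using B(2) proj_sub(2)[OF e(2) f(2,3)] lt unfolding diffuse_def by (metis diff_gt_0_iff_gt)
    have "(e - f) * f = 0" "(e - f) * e = e - f" using f(3) projD[OF f(2)] projD[OF e(2)] proj_sub(1)[OF e(2) f(2,3)] by (simp_all add: left_diff_distrib)
    then have gf: "g * f = 0" "g * e = g" using g(3) by (metis mult.assoc mult_zero_right, metis mult.assoc g(3))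
    have fg: "f * g = 0" using arg_cong[OF gf(1), of star] projD[OF f(2)] projD[OF g(2)] by (simp add: star_mult)
    have P: "proj (f + g)"
      using projD[OF f(2)] projD[OF g(2)] gf(1) fg by (simp add: proj_def star_add distrib_left distrib_right)
    have "f + g \<in> S"
      using f(1,3) g(1,5) gf(2) P by (simp add: S_def talg_add[OF B(1)] distrib_right tr_add BM)
    moreover have "piso_le f (f + g)" unfolding le[OF f(2) P] using projD[OF f(2)] gf by (simp add: distrib_right)
    ultimately have "tr (f + g) \<le> tr f" by (rule fmax)
    then have "tr g \<le> 0" using f(1) g(1) by (simp add: tr_add BM)
    then show False using tr_proj_pos[OF BM[OF g(1)] g(2,4)] by simp
  qed
  then show ?thesis using f by blast
qed

end

section \<open>A dyadic tower of matrix units\<close>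

lemma binary_refine:
  fixes q :: "nat \<Rightarrow> nat \<Rightarrow> 'a::comm_monoid_add"
  assumes "\<And>m i. q m i = q (Suc m) (2 * i) + q (Suc m) (Suc (2 * i))"
  shows "q m i = (\<Sum>j\<in>{i * 2 ^ k..<Suc i * 2 ^ k}. q (m + k) j)"
proof (induction k arbitrary: m i)
  case (Suc k)
  have "q m i = q (Suc m) (2 * i) + q (Suc m) (Suc (2 * i))" by (rule assms)
  also have "\<dots> = (\<Sum>j\<in>{2 * i * 2 ^ k..<Suc (2 * i) * 2 ^ k}. q (m + Suc k) j) + (\<Sum>j\<in>{Suc (2 * i) * 2 ^ k..<Suc (Suc (2 * i)) * 2 ^ k}. q (m + Suc k) j)"
    by (simp only: Suc[of "Suc m"]) simp
  also have "\<dots> = (\<Sum>j\<in>{2 * i * 2 ^ k..<Suc (Suc (2 * i)) * 2 ^ k}. q (m + Suc k) j)"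
    by (rule sum.atLeastLessThan_concat) auto
  finally show ?case by (simp add: mult_ac)
qed simp

lemma commute_mult: "T * x = x * T \<Longrightarrow> T * y = y * T \<Longrightarrow> T * (x * y) = x * y * (T::'a::semigroup_mult)"
  by (metis mult.assoc)

text \<open>The operators \<open>T\<close> that commute with \<open>x\<close> in this sense form the
  commutant of the von Neumann algebra generated by \<open>x\<close>; that \<open>x\<close>
  generates \<open>M\<close> amounts to their lying in \<open>comm M\<close>.\<close>

definition commutes :: "'h::complex_hilbert bop \<Rightarrow> 'h bop \<Rightarrow> bool" where
  "commutes T x \<longleftrightarrow> T * x = x * T \<and> T * star x = star x * T"

lemma commutes_mult: "commutes T x \<Longrightarrow> commutes T y \<Longrightarrow> commutes T (x * y)"
  unfolding commutes_def star_mult by (metis mult.assoc)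
lemma commutes_star: "commutes T x \<Longrightarrow> commutes T (star x)" by (simp add: commutes_def)
lemma commutes_one: "commutes T 1" by (simp add: commutes_def)
lemma commutes_star_left: assumes "commutes T x" shows "commutes (star T) x"
proof -
  have "T * x = x * T" "T * star x = star x * T" using assms by (auto simp: commutes_def)
  from this[THEN arg_cong[of _ _ star]] show ?thesis by (simp add: commutes_def star_mult)
qed
context haar
begin

definition hf :: "'h bop \<Rightarrow> 'h bop" where
  "hf e = (SOME f. f \<in> A0 \<and> proj f \<and> f * e = f \<and> tr f = tr e / 2)"

lemma hf: assumes "e \<in> A0" "proj e"
  shows "hf e \<in> A0" "proj (hf e)" "hf e * e = hf e" "tr (hf e) = tr e / 2"
proof -
  have "0 \<le> tr e / 2" "tr e / 2 \<le> tr e" using tr_proj_nonneg[OF A0_M[OF assms(1)] assms(2)] by auto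
  then have "\<exists>f. f \<in> A0 \<and> proj f \<and> f * e = f \<and> tr f = tr e / 2"
    using exact_trace[OF talg_A0 diffuse_A0 assms] by blast
  from someI_ex[OF this, folded hf_def] show "hf e \<in> A0" "proj (hf e)" "hf e * e = hf e" "tr (hf e) = tr e / 2" by auto
qed

text \<open>A binary tree of halvings in which \<open>2 * i\<close> and \<open>Suc (2 * i)\<close>
  are the children of \<open>i\<close>. As \<open>atom 0\<close> ignores its index, only the lowest
  \<open>m\<close> binary digits of \<open>i\<close> count: \<open>atom_split\<close> holds for
  every \<open>i\<close>, and bounds on indices first appear in \<open>atom_orth\<close>.\<close>

primrec atom :: "nat \<Rightarrow> nat \<Rightarrow> 'h bop" where
  "atom 0 i = 1"
| "atom (Suc m) i = (if even i then hf (atom m (i div 2)) else atom m (i div 2) - hf (atom m (i div 2)))"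

lemma atom_basic: "atom m i \<in> A0 \<and> proj (atom m i) \<and> tr (atom m i) = 1 / 2 ^ m"
proof (induction m arbitrary: i)
  case 0
  show ?case using talg_one[OF talg_A0] by (simp add: proj_def)
next
  case (Suc m)
  define e where "e = atom m (i div 2)"
  have e: "e \<in> A0" "proj e" "tr e = 1 / 2 ^ m" using Suc[of "i div 2"] by (auto simp: e_def)
  note h = hf[OF e(1,2)]
  have "e - hf e \<in> A0" "proj (e - hf e)" "tr (e - hf e) = tr e / 2"
    using proj_sub(2)[OF e(2) h(2,3)] talg_diff[OF talg_A0 e(1) h(1)] A0_M[OF e(1)] A0_M[OF h(1)] h(4) by (auto simp: tr_diff)
  then show ?case using h e(3) by (simp add: e_def[symmetric])
qed

lemma atom_A0: "atom m i \<in> A0" and atom_proj: "proj (atom m i)" and tr_atom: "tr (atom m i) = 1 / 2 ^ m"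
  using atom_basic by blast+

lemma atom_M: "atom m i \<in> M" by (rule A0_M[OF atom_A0])

lemma atom_split: "atom m i = atom (Suc m) (2 * i) + atom (Suc m) (Suc (2 * i))" by simp

lemmas atom_refine = binary_refine[of atom, OF atom_split]

lemma atom_sum: "(\<Sum>i<2 ^ m. atom m i) = 1"
  using atom_refine[of 0 0 m] by (simp add: lessThan_atLeast0)

lemma atom_sub: "atom (Suc m) i * atom m (i div 2) = atom (Suc m) i" "atom m (i div 2) * atom (Suc m) i = atom (Suc m) i"
proof -
  note h = hf[OF atom_A0[of m "i div 2"] atom_proj[of m "i div 2"]]
  note e = projD[OF atom_proj[of m "i div 2"]]
  show "atom (Suc m) i * atom m (i div 2) = atom (Suc m) i" using h e by (simp add: left_diff_distrib)
  show "atom m (i div 2) * atom (Suc m) i = atom (Suc m) i"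
    using h e proj_sub(1)[OF atom_proj h(2,3)] by (simp add: right_diff_distrib)
qed

lemma atom_orth: "i < 2 ^ m \<Longrightarrow> j < 2 ^ m \<Longrightarrow> i \<noteq> j \<Longrightarrow> atom m i * atom m j = 0"
proof (induction m arbitrary: i j)
  case (Suc m)
  have lt: "i div 2 < 2 ^ m" "j div 2 < 2 ^ m" using Suc.prems by auto
  show ?case
  proof (cases "i div 2 = j div 2")
    case True
    define e where "e = atom m (i div 2)"
    note h = hf[OF atom_A0[of m "i div 2"] atom_proj[of m "i div 2"], folded e_def]
    have eh: "e * hf e = hf e" using proj_sub(1)[OF _ h(2,3)] atom_proj by (simp add: e_def)
    have "even i \<noteq> even j" using True Suc.prems(3) by (metis div_mult_mod_eq even_iff_mod_2_eq_zero mod2_eq_if)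
    moreover have "atom m (i div 2) = e" "atom m (j div 2) = e" using True by (simp_all add: e_def)
    ultimately show ?thesis using projD[OF h(2)] h(3) eh by (auto simp: left_diff_distrib right_diff_distrib)
  next
    case False
    have "atom (Suc m) i * atom (Suc m) j = atom (Suc m) i * (atom m (i div 2) * atom m (j div 2)) * atom (Suc m) j"
      using atom_sub(1)[of m i] atom_sub(2)[of m j] by (metis mult.assoc)
    then show ?thesis using Suc.IH[OF lt False] by simp
  qed
qed simp

text \<open>\<open>g n\<close> is the first atom of level \<open>n\<close> and \<open>f n\<close>
  its second half. The \<open>f n\<close> are mutually orthogonal with trace
  \<open>1 / 2 ^ Suc n\<close>: one corner for each of countably many storage tasks, linked to
  \<open>g (Suc n)\<close> by \<open>s n\<close>.\<close>

definition g :: "nat \<Rightarrow> 'h bop" where "g n = atom n 0"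
definition f :: "nat \<Rightarrow> 'h bop" where "f n = atom (Suc n) 1"
definition s :: "nat \<Rightarrow> 'h bop" where
  "s n = (SOME v. v \<in> M \<and> star v * v = g (Suc n) \<and> v * star v = f n)"

lemma g_M: "g n \<in> M" and f_M: "f n \<in> M" and g_proj: "proj (g n)" and f_proj: "proj (f n)"
  by (simp_all only: g_def f_def atom_M atom_proj)

lemma s_props: "s n \<in> M" "star (s n) * s n = g (Suc n)" "s n * star (s n) = f n"
proof -
  have "\<exists>v\<in>M. star v * v = g (Suc n) \<and> v * star v = f n"
    by (intro comparison g_M f_M g_proj f_proj) (simp only: g_def f_def tr_atom)
  then have "\<exists>v. v \<in> M \<and> star v * v = g (Suc n) \<and> v * star v = f n" by blast
  from someI_ex[OF this, folded s_def] show "s n \<in> M" "star (s n) * s n = g (Suc n)" "s n * star (s n) = f n" by auto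
qed

lemma g_zero: "g 0 = 1" by (simp add: g_def)

lemma g_split: "g n = g (Suc n) + f n"
  unfolding g_def f_def using atom_split[of n 0] by simp

lemma g_f_orth: "g (Suc n) * f n = 0" "f n * g (Suc n) = 0"
proof -
  have "1 < (2::nat) ^ Suc n" using one_less_power[of "2::nat" "Suc n"] by simp
  then show "g (Suc n) * f n = 0" "f n * g (Suc n) = 0"
    unfolding g_def f_def by (intro atom_orth; simp only: zero_less_power zero_less_numeral zero_neq_one zero_neq_one[symmetric] not_False_eq_True)+
qed

lemma g_absorb: "n \<le> m \<Longrightarrow> g n * g m = g m \<and> g m * g n = g m"
proof (induction m rule: dec_induct)
  case base
  show ?case using projD[OF g_proj] by simp
next
  case (step m)
  have "g m * g (Suc m) = g (Suc m)" "g (Suc m) * g m = g (Suc m)"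
    using projD[OF g_proj[of "Suc m"]] by (simp_all add: g_split[of m] distrib_left distrib_right g_f_orth)
  then show ?case using step.IH by (metis mult.assoc)
qed

lemma g_f: "n \<le> m \<Longrightarrow> g n * f m = f m" "n \<le> m \<Longrightarrow> f m * g n = f m" "n < m \<Longrightarrow> g m * f n = 0" "n < m \<Longrightarrow> f n * g m = 0"
proof -
  have fm: "f m = g m - g (Suc m)" using g_split[of m] by simp
  show "n \<le> m \<Longrightarrow> g n * f m = f m" "n \<le> m \<Longrightarrow> f m * g n = f m"
    using g_absorb[of n m] g_absorb[of n "Suc m"] by (simp_all add: fm left_diff_distrib right_diff_distrib)
  show "g m * f n = 0" "f n * g m = 0" if "n < m"
    using g_absorb[of "Suc n" m] that g_f_orth[of n] by (metis Suc_leI mult.assoc mult_zero_right, metis Suc_leI mult.assoc mult_zero_left)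
qed

lemma f_orth: "n \<noteq> m \<Longrightarrow> f n * f m = 0"
proof (induction n m rule: linorder_wlog)
  case (le n m)
  then have "f n * (g m * f m) = 0" using g_f(4)[of n m] by (simp flip: mult.assoc)
  then show ?case using g_f(1)[of m m] by simp
next
  case (sym n m)
  then have "star (f m * f n) = 0" by simp
  then show ?case using projD[OF f_proj] by (simp add: star_mult)
qed

lemma s_absorb: "f n * s n = s n" "s n * g (Suc n) = s n"
proof -
  have "star (s n) * s n = star (g (Suc n)) * g (Suc n)" using projD[OF g_proj] s_props by simp
  moreover have "g (Suc n) * (1 - g (Suc n)) = 0" using projD[OF g_proj] by (simp add: right_diff_distrib)
  ultimately have "s n * (1 - g (Suc n)) = 0" by (rule zero_of_star_mult)
  then show sg: "s n * g (Suc n) = s n" by (simp add: right_diff_distrib)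
  then show "f n * s n = s n" by (simp add: mult.assoc s_props flip: s_props(3))
qed

text \<open>The factors of \<open>t m i\<close> are read off the binary digits of \<open>i\<close>; \<open>t m i\<close> maps \<open>g m\<close> to \<open>e m i\<close>.\<close>

primrec t :: "nat \<Rightarrow> nat \<Rightarrow> 'h bop" where
  "t 0 i = 1"
| "t (Suc m) i = t m (i div 2) * (if even i then g (Suc m) else s m)"

definition e :: "nat \<Rightarrow> nat \<Rightarrow> 'h bop" where "e m i = t m i * star (t m i)"

lemma t_M: "t m i \<in> M"
  by (induction m arbitrary: i) (auto intro: M_closed g_M s_props)

lemma t_g: "t m i * g m = t m i"
  by (cases m) (auto simp: g_zero mult.assoc s_absorb projD[OF g_proj])

lemma g_t: "g m * star (t m i) = star (t m i)"
  using arg_cong[OF t_g[of m i], of star] projD[OF g_proj] by (simp add: star_mult)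

text \<open>Consequently the products \<open>t m i * star (t m j)\<close> are matrix units of size
  \<open>2 ^ m\<close>, with diagonal entries \<open>e m i\<close>.\<close>

lemma t_star_t: "i < 2 ^ m \<Longrightarrow> j < 2 ^ m \<Longrightarrow> star (t m i) * t m j = (if i = j then g m else 0)"
proof (induction m arbitrary: i j)
  case 0
  then show ?case by (simp add: g_zero)
next
  case (Suc m)
  define x where "x i = (if even i then g (Suc m) else s m)" for i :: nat
  have lt: "i div 2 < 2 ^ m" "j div 2 < 2 ^ m" using Suc.prems by auto
  have "star (t (Suc m) i) * t (Suc m) j = star (x i) * (star (t m (i div 2)) * t m (j div 2)) * x j"
    by (simp add: x_def star_mult mult.assoc)
  also have "\<dots> = star (x i) * (if i div 2 = j div 2 then g m else 0) * x j" by (simp only: Suc.IH[OF lt])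
  also have "\<dots> = (if i div 2 = j div 2 then star (x i) * (g m * x j) else 0)" by (simp add: mult.assoc)
  also have "g m * x j = x j"
  proof -
    have "g m * s m = s m" using s_absorb(1)[of m] g_f(1)[of m m] by (metis mult.assoc order_refl)
    then show ?thesis using g_absorb[of m "Suc m"] by (simp add: x_def)
  qed
  also have "star (x i) * x j = (if even i = even j then g (Suc m) else 0)"
  proof -
    have "g (Suc m) * s m = 0" using s_absorb(1)[of m] g_f_orth(1)[of m] by (metis mult.assoc mult_zero_left)
    moreover from arg_cong[OF this, of star] have "star (s m) * g (Suc m) = 0" using projD[OF g_proj] by (simp add: star_mult)
    ultimately show ?thesis using projD[OF g_proj] s_props by (simp add: x_def)
  qed
  also have "(if i div 2 = j div 2 then if even i = even j then g (Suc m) else 0 else 0) = (if i = j then g (Suc m) else 0)"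
    by (metis div_mult_mod_eq even_iff_mod_2_eq_zero mod2_eq_if)
  finally show ?case .
qed

lemma e_M: "e m i \<in> M" unfolding e_def by (intro M_closed t_M)

lemma e_split: "e m i = e (Suc m) (2 * i) + e (Suc m) (Suc (2 * i))"
proof -
  have "g (Suc m) * (star (g (Suc m)) * z) = g (Suc m) * z" for z
    using projD[OF g_proj[of "Suc m"]] by (simp flip: mult.assoc)
  then have "e (Suc m) (2 * i) + e (Suc m) (Suc (2 * i)) = t m i * (g (Suc m) + s m * star (s m)) * star (t m i)"
    by (simp add: e_def star_mult mult.assoc distrib_left distrib_right)
  also have "g (Suc m) + s m * star (s m) = g m" by (simp add: s_props g_split[of m])
  finally show ?thesis by (simp add: e_def t_g)
qed

lemmas e_refine = binary_refine[of e, OF e_split]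

lemma e_sum: "(\<Sum>i<2 ^ m. e m i) = 1"
  using e_refine[of 0 0 m] by (simp add: lessThan_atLeast0 e_def)

lemma e_mult: "i < 2 ^ m \<Longrightarrow> j < 2 ^ m \<Longrightarrow> e m i * e m j = (if i = j then e m i else 0)"
proof -
  assume ij: "i < 2 ^ m" "j < 2 ^ m"
  have "e m i * e m j = t m i * (star (t m i) * t m j) * star (t m j)" by (simp only: e_def mult.assoc)
  then show ?thesis by (simp add: t_star_t[OF ij] e_def t_g)
qed

lemma e_star: "star (e m i) = e m i" by (simp add: e_def star_mult)

lemma tr_e: "i < 2 ^ m \<Longrightarrow> tr (e m i) = 1 / 2 ^ m"
  using tr_comm[OF t_M M_star[OF t_M], of m i m i] t_star_t[of i m i] tr_atom[of m 0] by (simp add: e_def g_def)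

lemma t_zero: "t m 0 = g m"
  by (induction m) (use g_absorb in \<open>auto simp: g_zero\<close>)

text \<open>At level \<open>Suc n + k\<close> these are the indices whose first \<open>n\<close>
  binary digits are 0 and whose next digit is 1, so \<open>t\<close> begins with
  \<open>g n * s n\<close>, which has range in \<open>f n\<close>.\<close>

lemma f_t: "2 ^ k \<le> i \<Longrightarrow> i < 2 ^ Suc k \<Longrightarrow> f n * t (Suc n + k) i = t (Suc n + k) i"
proof (induction k arbitrary: i)
  case 0
  then have "i = 1" by simp
  moreover have "f n * (g n * s n) = g n * s n" using s_absorb(1)[of n] g_f(1)[of n n] by (metis mult.assoc order_refl)
  ultimately show ?case by (simp add: t_zero)
next
  case (Suc k)
  have "f n * t (Suc n + k) (i div 2) = t (Suc n + k) (i div 2)" by (rule Suc.IH) (use Suc.prems in auto)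
  then show ?case by (simp flip: mult.assoc)
qed

text \<open>The \<open>s n\<close> alone determine all matrix units: \<open>g (Suc n)\<close> is
  \<open>star (s n) * s n\<close>, and everything else is built from these by products and
  adjoints.\<close>

lemma commutes_t:
  assumes "\<And>n. commutes T (s n)"
  shows "commutes T (g n)" "commutes T (t m i)" "commutes T (e m i)"
proof -
  show G: "commutes T (g n)" for n
  proof (cases n)
    case (Suc k)
    show ?thesis unfolding Suc s_props(2)[symmetric] by (intro commutes_mult commutes_star assms)
  qed (simp add: g_zero commutes_one)
  show "commutes T (t m i)" by (induction m arbitrary: i) (auto intro: commutes_one commutes_mult G assms)
  then show "commutes T (e m i)" unfolding e_def by (intro commutes_mult commutes_star)
qed

text \<open>Matrix units move the non-zero entries into distinct off-diagonal positions of the corner \<open>f r\<close>, which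
  has \<open>4 * 2 ^ k\<close> diagonal entries at level \<open>r + 3 + k\<close>.\<close>

lemma encode_corner:
  assumes X: "finite X" "X \<subseteq> M"
    and card: "card {(x, i, j). x \<in> X \<and> i < 2 ^ (r + 3 + k) \<and> j < 2 ^ (r + 3 + k) \<and> e (r + 3 + k) i * x * e (r + 3 + k) j \<noteq> 0} \<le> 4 ^ Suc k"
  shows "\<exists>a\<in>M. star a = a \<and> f r * a = a \<and>
    (\<forall>T. (\<forall>n. commutes T (s n)) \<longrightarrow> T * a = a * T \<longrightarrow> (\<forall>x\<in>X. T * x = x * T))"
proof -
  define m H where "m = r + 3 + k" and "H = (2::nat) ^ Suc k"
  define S where "S = {(x, i, j). x \<in> X \<and> i < 2 ^ m \<and> j < 2 ^ m \<and> e m i * x * e m j \<noteq> 0}"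
  have finS: "finite S" by (rule finite_subset[of _ "X \<times> {..<2 ^ m} \<times> {..<2 ^ m}"]) (auto simp: S_def X)
  have m: "m = Suc r + Suc (Suc k)" by (simp add: m_def)
  have "card S \<le> card ({2 * H..<3 * H} \<times> {3 * H..<4 * H})"
    using card by (simp add: S_def m_def H_def power_mult_distrib[symmetric])
  then obtain \<iota> where im: "\<iota> ` S \<subseteq> {2 * H..<3 * H} \<times> {3 * H..<4 * H}" and inj: "inj_on \<iota> S"
    using card_le_inj[OF finS, of "{2 * H..<3 * H} \<times> {3 * H..<4 * H}"] by auto
  \<comment> \<open>Row indices run through the lower half of the corner's index range and column
    indices through the upper half, which gives \<open>H * H = 4 ^ Suc k\<close> slots. Rows and
    columns being disjoint, \<open>star b\<close> contributes nothing to the entries that are read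
    off from \<open>a\<close>.\<close>
  define c d where "c \<sigma> = fst (\<iota> \<sigma>)" and "d \<sigma> = snd (\<iota> \<sigma>)" for \<sigma>
  have cd: "2 * H \<le> c \<sigma>" "c \<sigma> < 3 * H" "3 * H \<le> d \<sigma>" "d \<sigma> < 4 * H" if "\<sigma> \<in> S" for \<sigma>
    using im that by (auto simp: c_def d_def)
  have H: "4 * H \<le> 2 ^ m" "4 * H = 2 ^ Suc (Suc (Suc k))" "2 * H = 2 ^ Suc (Suc k)" by (simp_all add: H_def m)
  have lt: "c \<sigma> < 2 ^ m" "d \<sigma> < 2 ^ m" if "\<sigma> \<in> S" for \<sigma> using cd[OF that] H(1) by linarith+
  have ft: "f r * t m i = t m i" if "2 * H \<le> i" "i < 4 * H" for i
    using f_t[of "Suc (Suc k)" i r] that H by (simp add: m)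
  \<comment> \<open>The entry at \<open>(i, j)\<close> is first transported to the corner
    \<open>g m\<close>, from where the isometries carry it to its slot and back.\<close>
  define core where "core = (\<lambda>(x, i, j). star (t m i) * x * t m j)"
  define b where "b = (\<Sum>\<sigma>\<in>S. t m (c \<sigma>) * core \<sigma> * star (t m (d \<sigma>)))"
  define a where "a = b + star b"
  have coreM: "core \<sigma> \<in> M" if "\<sigma> \<in> S" for \<sigma> using that X by (auto simp: core_def S_def intro: M_closed t_M)
  have bM: "b \<in> M" unfolding b_def by (intro M_sum M_mult M_star t_M coreM)
  have fb: "f r * b = b" unfolding b_def sum_distrib_left
  proof (rule sum.cong)
    fix \<sigma> assume "\<sigma> \<in> S"
    then have "f r * t m (c \<sigma>) = t m (c \<sigma>)" using cd[of \<sigma>] by (intro ft) auto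
    then show "f r * (t m (c \<sigma>) * core \<sigma> * star (t m (d \<sigma>))) = t m (c \<sigma>) * core \<sigma> * star (t m (d \<sigma>))"
      by (simp flip: mult.assoc)
  qed simp
  have "b * f r = b"
  proof -
    have "star (t m (d \<sigma>)) * f r = star (t m (d \<sigma>))" if "\<sigma> \<in> S" for \<sigma>
      using arg_cong[OF ft[of "d \<sigma>"], of star] cd[OF that] projD[OF f_proj] by (simp add: star_mult)
    then show ?thesis unfolding b_def sum_distrib_right by (intro sum.cong) (auto simp: mult.assoc)
  qed
  from arg_cong[OF this, of star] have fsb: "f r * star b = star b" using projD[OF f_proj] by (simp add: star_mult)
  have sa: "star a = a" by (simp add: a_def star_add add.commute)
  have extr: "star (t m (c \<sigma>)) * a * t m (d \<sigma>) = core \<sigma>" if s: "\<sigma> \<in> S" for \<sigma>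
  proof -
    have 1: "star (t m (c \<sigma>)) * (t m (c \<rho>) * core \<rho> * star (t m (d \<rho>))) * t m (d \<sigma>) = (if \<rho> = \<sigma> then core \<sigma> else 0)" if r: "\<rho> \<in> S" for \<rho>
    proof -
      have "star (t m (c \<sigma>)) * (t m (c \<rho>) * core \<rho> * star (t m (d \<rho>))) * t m (d \<sigma>)
          = (star (t m (c \<sigma>)) * t m (c \<rho>)) * core \<rho> * (star (t m (d \<rho>)) * t m (d \<sigma>))" by (simp only: mult.assoc)
      also have "\<dots> = (if c \<sigma> = c \<rho> then g m else 0) * core \<rho> * (if d \<rho> = d \<sigma> then g m else 0)"
        by (simp only: t_star_t lt s r)
      also have "\<dots> = (if \<rho> = \<sigma> then g m * core \<sigma> * g m else 0)"
      proof (cases "\<rho> = \<sigma>")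
        case False
        then have "\<iota> \<rho> \<noteq> \<iota> \<sigma>" using inj s r by (auto dest: inj_onD)
        then have "c \<sigma> \<noteq> c \<rho> \<or> d \<rho> \<noteq> d \<sigma>" by (auto simp: c_def d_def prod_eq_iff)
        then show ?thesis using False by auto
      qed simp
      also have "g m * core \<sigma> * g m = core \<sigma>"
        by (cases \<sigma>) (simp add: core_def t_g mult.assoc, simp add: g_t flip: mult.assoc)
      finally show ?thesis .
    qed
    have "star (t m (c \<sigma>)) * b * t m (d \<sigma>) = (\<Sum>\<rho>\<in>S. if \<rho> = \<sigma> then core \<sigma> else 0)"
      unfolding b_def sum_distrib_left sum_distrib_right by (rule sum.cong) (simp_all only: 1)
    then have bb: "star (t m (c \<sigma>)) * b * t m (d \<sigma>) = core \<sigma>" using s finS by simp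
    have "star (t m (c \<sigma>)) * star b = 0"
    proof -
      have "b * t m (c \<sigma>) = (\<Sum>\<rho>\<in>S. t m (c \<rho>) * core \<rho> * (star (t m (d \<rho>)) * t m (c \<sigma>)))"
        by (simp add: b_def sum_distrib_right mult.assoc)
      also have "\<dots> = 0"
      proof (rule sum.neutral, intro ballI)
        fix \<rho> assume r: "\<rho> \<in> S"
        have "d \<rho> \<noteq> c \<sigma>" using cd[OF r] cd[OF s] by linarith
        then show "t m (c \<rho>) * core \<rho> * (star (t m (d \<rho>)) * t m (c \<sigma>)) = 0" by (simp add: t_star_t lt s r)
      qed
      finally have "star (b * t m (c \<sigma>)) = 0" by simp
      then show ?thesis by (simp add: star_mult)
    qed
    then show ?thesis using bb by (simp add: a_def distrib_left distrib_right)
  qed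
  have "\<forall>T. (\<forall>n. commutes T (s n)) \<longrightarrow> T * a = a * T \<longrightarrow> (\<forall>x\<in>X. T * x = x * T)"
  proof (intro allI impI ballI)
    fix T x assume T: "\<forall>n. commutes T (s n)" "T * a = a * T" and x: "x \<in> X"
    have ct: "T * t m i = t m i * T" "T * star (t m i) = star (t m i) * T" for i
      using commutes_t(2)[of T m i] T(1) by (auto simp: commutes_def)
    have Te: "T * (e m i * x * e m j) = e m i * x * e m j * T" if "i < 2 ^ m" "j < 2 ^ m" for i j
    proof (cases "(x, i, j) \<in> S")
      case True
      define y where "y = star (t m (c (x, i, j))) * a * t m (d (x, i, j))"
      have "T * y = y * T" unfolding y_def by (intro commute_mult ct T(2))
      then have "T * (t m i * y * star (t m j)) = t m i * y * star (t m j) * T" by (intro commute_mult ct)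
      moreover have "t m i * y * star (t m j) = e m i * x * e m j"
        unfolding y_def extr[OF True] by (simp add: core_def e_def mult.assoc)
      ultimately show ?thesis by simp
    qed (use that x in \<open>auto simp: S_def\<close>)
    have "x = (\<Sum>i<2 ^ m. e m i) * x * (\<Sum>j<2 ^ m. e m j)" by (simp add: e_sum)
    then have xs: "x = (\<Sum>j<2 ^ m. \<Sum>i<2 ^ m. e m i * x * e m j)" by (simp add: sum_distrib_left sum_distrib_right)
    have "T * (\<Sum>j<2 ^ m. \<Sum>i<2 ^ m. e m i * x * e m j) = (\<Sum>j<2 ^ m. \<Sum>i<2 ^ m. e m i * x * e m j) * T"
      unfolding sum_distrib_left sum_distrib_right by (intro sum.cong refl Te) auto
    then show "T * x = x * T" using xs by simp
  qed
  moreover have "a \<in> M" "f r * a = a" by (auto simp: a_def distrib_left fb fsb intro: M_closed bM)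
  ultimately show ?thesis using sa by blast
qed

text \<open>The spectra of the summands of \<open>a\<close> lie in disjoint intervals around the \<open>8\<^sup>-\<^sup>n\<close>, which makes the \<open>f n\<close>
  recoverable from \<open>a\<close>.\<close>

lemma generator_exists:
  assumes c: "\<And>n. c n \<in> M" "\<And>n. star (c n) = c n" "\<And>n. f n * c n = c n" and nc: "\<And>n. norm (c n) \<le> 1 / 2"
  shows "\<exists>x\<in>M. \<forall>T. commutes T x \<longrightarrow> (\<forall>n. commutes T (s n) \<and> T * c n = c n * T)"
proof -
  have cf: "c n * f n = c n" for n using arg_cong[OF c(3)[of n], of star] c(2) projD[OF f_proj] by (simp add: star_mult)
  \<comment> \<open>On the range of \<open>f n\<close> this summand is bounded below by
    \<open>(1/2) * (1/8) ^ n\<close>, since \<open>norm (c n) \<le> 1 / 2\<close>, while all later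
    summands together have norm at most \<open>(3/14) * (1/8) ^ n\<close>. Their ratio 3/7 is what
    \<open>corner0\<close> exploits.\<close>
  define A where "A n = (1/8) ^ n *\<^sub>R (f n + c n)" for n
  define Bn where "Bn n = (1/2) ^ n *\<^sub>R (s n + star (s n))" for n
  have nfc: "norm (f n + c n) \<le> 3 / 2" for n
    using norm_triangle_ineq[of "f n" "c n"] proj_norm[OF f_proj, of n] nc[of n] by linarith
  have nA: "norm (A n) \<le> (3/2) * (1/8) ^ n" for n
  proof -
    have "norm (A n) = (1/8) ^ n * norm (f n + c n)" by (simp add: A_def power_divide)
    then show ?thesis using mult_left_mono[OF nfc[of n], of "(1/8) ^ n"] by (simp only: mult.commute zero_le_power zero_le_divide_1_iff zero_le_numeral)
  qed
  have sums: "summable (\<lambda>n. (3/2) * (1/8::real) ^ n)" by (intro summable_mult summable_geometric) simp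
  have smA: "summable A" by (rule summable_comparison_test'[OF sums]) (rule nA)
  have nsn: "norm (s n) \<le> 1" for n
    by (rule piso_norm) (simp add: piso_def s_props s_absorb)
  have smB: "summable Bn"
  proof (rule summable_comparison_test')
    show "summable (\<lambda>n. 2 * (1/2::real) ^ n)" by (intro summable_mult summable_geometric) simp
    show "norm (Bn n) \<le> 2 * (1/2) ^ n" for n
    proof -
      have "norm (s n + star (s n)) \<le> 2" using norm_triangle_ineq[of "s n" "star (s n)"] nsn[of n] by simp
      moreover have "norm (Bn n) = (1/2) ^ n * norm (s n + star (s n))" by (simp add: Bn_def power_divide)
      ultimately show ?thesis using mult_left_mono[of "norm (s n + star (s n))" 2 "(1/2) ^ n"] by (simp only: mult.commute zero_le_power zero_le_divide_1_iff zero_le_numeral)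
    qed
  qed
  define a b where "a = (\<Sum>n. A n)" and "b = (\<Sum>n. Bn n)"
  have AM: "A n \<in> M" and BM: "Bn n \<in> M" for n by (auto simp: A_def Bn_def intro: M_closed f_M c s_props)
  have limM: "suminf h \<in> M" if "summable h" "\<And>n. h n \<in> M" for h
    by (rule M_tendsto[OF _ summable_LIMSEQ[OF that(1)]]) (intro M_sum that)
  have aM: "a \<in> M" and bM: "b \<in> M" unfolding a_def b_def by (intro limM smA smB AM BM)+
  have sa: "star a = a" and sb: "star b = b"
  proof -
    have "star (A n) = A n" "star (Bn n) = Bn n" for n
      using c(2) projD[OF f_proj] by (simp_all add: A_def Bn_def star_simps add.commute)
    then show "star a = a" "star b = b" unfolding a_def b_def
      using bounded_linear.suminf[OF bounded_linear_star smA] bounded_linear.suminf[OF bounded_linear_star smB] by simp_all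
  qed
  have cfo: "c k * f n = 0" if "k \<noteq> n" for k n
  proof -
    have "c k * f n = c k * (f k * f n)" by (simp add: cf flip: mult.assoc)
    then show ?thesis using f_orth[OF that] by simp
  qed
  have Af: "A k * f n = (if k = n then A n else 0)" for k n
    using f_orth[of k n] cfo[of k n] projD[OF f_proj] cf by (auto simp: A_def distrib_right)
  have af: "a * f n = A n" for n
  proof -
    have "a * f n = (\<Sum>k. A k * f n)" unfolding a_def by (rule suminf_mult2[OF smA])
    also have "\<dots> = (\<Sum>k\<in>{n}. A k * f n)" by (rule suminf_finite) (auto simp: Af)
    finally show ?thesis by (simp add: Af)
  qed
  have sA: "star (A n) = A n" for n using c(2) projD[OF f_proj] by (simp add: A_def star_simps)
  have fa: "f n * a = A n" for n using arg_cong[OF af[of n], of star] sa sA projD[OF f_proj] by (simp add: star_mult)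
  define ag where "ag n = a * g (Suc n)" for n
  have Ag: "A k * g n = 0" if "k < n" for k n
  proof -
    have "f k * g n = 0" using g_f(4)[OF that] .
    moreover have "c k * g n = 0" using cf[of k] calculation by (metis mult.assoc mult_zero_right)
    ultimately show ?thesis by (simp add: A_def distrib_right)
  qed
  have Ag2: "A k * g n = A k" if "n \<le> k" for k n
  proof -
    have "f k * g n = f k" using g_f(2)[OF that] .
    moreover have "c k * g n = c k" using cf[of k] calculation by (metis mult.assoc)
    ultimately show ?thesis by (simp add: A_def distrib_right)
  qed
  have ag_eq: "ag n = (\<Sum>k. A (k + Suc n))" for n
  proof -
    have sm: "summable (\<lambda>k. A k * g (Suc n))" by (rule summable_mult2[OF smA])
    have "ag n = (\<Sum>k. A k * g (Suc n))" unfolding ag_def a_def by (rule suminf_mult2[OF smA])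
    also have "\<dots> = (\<Sum>k. A (k + Suc n) * g (Suc n)) + (\<Sum>k<Suc n. A k * g (Suc n))"
      by (rule suminf_split_initial_segment[OF sm])
    also have "(\<Sum>k<Suc n. A k * g (Suc n)) = 0" by (rule sum.neutral) (auto simp: Ag)
    finally show ?thesis by (simp add: Ag2)
  qed
  have nag: "norm (ag n) \<le> (3/14) * (1/8) ^ n" for n
  proof -
    have nA': "norm (A (k + Suc n)) \<le> (3/16) * (1/8) ^ n * (1/8) ^ k" for k using nA[of "k + Suc n"] by (simp add: power_add mult_ac)
    have geo: "summable (\<lambda>k. (3/16) * (1/8::real) ^ n * (1/8) ^ k)" by (intro summable_mult summable_geometric) simp
    have smn: "summable (\<lambda>k. norm (A (k + Suc n)))" by (rule summable_comparison_test'[OF geo]) (use nA' in simp)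
    have "norm (ag n) \<le> (\<Sum>k. norm (A (k + Suc n)))" unfolding ag_eq by (rule summable_norm[OF smn])
    also have "\<dots> \<le> (\<Sum>k. (3/16) * (1/8::real) ^ n * (1/8) ^ k)" by (rule suminf_le[OF nA' smn geo])
    also have "\<dots> = (3/14) * (1/8) ^ n" by (subst suminf_mult) (auto simp: suminf_geometric)
    finally show ?thesis .
  qed
  have gag: "g (Suc n) * ag n = ag n" for n
  proof -
    have gA: "g (Suc n) * A (k + Suc n) = A (k + Suc n)" for k
      using arg_cong[OF Ag2[of "Suc n" "k + Suc n"], of star] sA projD[OF g_proj] by (simp add: star_mult)
    have "summable (\<lambda>k. A (k + Suc n))" using smA by (rule summable_ignore_initial_segment)
    from suminf_mult[OF this, of "g (Suc n)"] show ?thesis unfolding ag_eq by (simp only: gA)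
  qed
  have corner0: "f n * T * g (Suc n) = 0" if T: "T * a = a * T" for T n
  proof -
    \<comment> \<open>\<open>Y\<close> intertwines \<open>a\<close> on \<open>f n\<close> with its
      tail: \<open>a * Y = Y * ag n\<close>. Bounding the left side below and the right side above
      leaves only \<open>Y = 0\<close>.\<close>
    define Y where "Y = f n * T * g (Suc n)"
    have "a * Y = f n * (a * T) * g (Suc n)" unfolding Y_def by (simp add: af fa flip: mult.assoc)
    also have "\<dots> = f n * T * (g (Suc n) * ag n)" unfolding gag by (simp add: T[symmetric] ag_def mult.assoc)
    also have "\<dots> = Y * ag n" by (simp add: Y_def mult.assoc)
    finally have aY: "a * Y = Y * ag n" .
    have fY: "f n * Y = Y" using projD[OF f_proj] by (simp add: Y_def flip: mult.assoc)
    have aY2: "a * Y = (1/8) ^ n *\<^sub>R (Y + c n * Y)"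
    proof -
      have "a * Y = a * f n * Y" by (simp add: fY mult.assoc)
      then show ?thesis using fY by (simp add: af A_def distrib_right)
    qed
    have "norm Y \<le> (3/7) * norm Y"
    proof (rule norm_bop_bound)
      fix \<xi>
      have "norm (c n \<triangleright> Y \<triangleright> \<xi>) \<le> (1/2) * norm (Y \<triangleright> \<xi>)"
        by (rule order_trans[OF norm_ap mult_right_mono[OF nc]]) simp
      then have "(1/2) * norm (Y \<triangleright> \<xi>) \<le> norm (Y \<triangleright> \<xi> + c n \<triangleright> Y \<triangleright> \<xi>)"
        using norm_triangle_ineq4[of "Y \<triangleright> \<xi> + c n \<triangleright> Y \<triangleright> \<xi>" "c n \<triangleright> Y \<triangleright> \<xi>"] by simp
      then have "(1/8) ^ n * ((1/2) * norm (Y \<triangleright> \<xi>)) \<le> norm ((a * Y) \<triangleright> \<xi>)"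
        unfolding aY2 using mult_left_mono[of "(1/2) * norm (Y \<triangleright> \<xi>)" _ "(1/8) ^ n"] by (simp add: ap_linear power_divide)
      also have "\<dots> \<le> norm Y * norm (ag n \<triangleright> \<xi>)" unfolding aY ap_mult by (rule norm_ap)
      also have "\<dots> \<le> norm Y * ((3/14) * (1/8) ^ n * norm \<xi>)"
        by (intro mult_left_mono order_trans[OF norm_ap] mult_right_mono nag) auto
      finally have "(1/8) ^ n * ((1/2) * norm (Y \<triangleright> \<xi>)) \<le> (1/8) ^ n * (norm Y * ((3/14) * norm \<xi>))" by (simp add: mult_ac)
      then have "(1/2) * norm (Y \<triangleright> \<xi>) \<le> norm Y * ((3/14) * norm \<xi>)" by (rule mult_left_le_imp_le) simp
      then show "norm (Y \<triangleright> \<xi>) \<le> 3 / 7 * norm Y * norm \<xi>" by simp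
    qed simp
    then have "norm Y \<le> 0" by simp
    then show ?thesis by (simp add: Y_def)
  qed
  have fbg: "f n * b * g (Suc n) = (1/2) ^ n *\<^sub>R s n" for n
  proof -
    have trm: "f n * Bn k * g (Suc n) = (if k = n then (1/2) ^ n *\<^sub>R s n else 0)" for k
    proof -
      have 1: "f n * s k = (if k = n then s n else 0)"
        using f_orth[of n k] s_absorb(1)[of k] by (metis mult.assoc mult_zero_left)
      have sk: "star (s k) = g (Suc k) * star (s k)" "star (s k) = star (s k) * f k"
        using arg_cong[OF s_absorb(2)[of k], of star] arg_cong[OF s_absorb(1)[of k], of star] projD[OF g_proj] projD[OF f_proj] by (simp_all add: star_mult)
      have 2: "f n * star (s k) * g (Suc n) = 0"
      proof (cases "n < Suc k")
        case True
        then have "f n * g (Suc k) = 0" by (rule g_f(4))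
        then have "f n * star (s k) = 0" by (subst sk(1)) (simp flip: mult.assoc)
        then show ?thesis by simp
      next
        case False
        then have "f k * g (Suc n) = 0" by (intro g_f(4)) simp
        then show ?thesis by (subst sk(2)) (simp add: mult.assoc)
      qed
      show ?thesis using 1 2 s_absorb(2)[of n] by (simp add: Bn_def distrib_left distrib_right)
    qed
    have "f n * b * g (Suc n) = (\<Sum>k. f n * Bn k * g (Suc n))" unfolding b_def
      by (simp add: suminf_mult[OF smB, symmetric] suminf_mult2[OF summable_mult[OF smB]])
    also have "\<dots> = (\<Sum>k\<in>{n}. f n * Bn k * g (Suc n))" by (rule suminf_finite) (auto simp: trm)
    finally show ?thesis by (simp add: trm)
  qed
  define x where "x = a + cop \<i> * b"
  have sx: "star x = a - cop \<i> * b"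
  proof -
    have "cop (- \<i>) + cop \<i> = (0 :: 'h bop)" by (simp add: cop_add)
    then have "cop (- \<i>) = - (cop \<i> :: 'h bop)" by (rule add_eq_0_iff2[THEN iffD1])
    then show ?thesis by (simp add: x_def star_add star_cop_mult sa sb)
  qed
  have aeq: "a = (1/2) *\<^sub>R (x + star x)" by (simp add: sx) (simp add: x_def flip: scaleR_2)
  have beq: "b = cop (- \<i> / 2) * (x - star x)"
  proof -
    have "x - star x = 2 *\<^sub>R (cop \<i> * b)" by (simp add: sx) (simp add: x_def scaleR_2)
    also have "\<dots> = cop (2 * \<i>) * b" by (simp only: cop_of_real_mult[symmetric] mult.assoc[symmetric] cop_mult) simp
    finally show ?thesis by (simp add: cop_mult flip: mult.assoc)
  qed
  show ?thesis
  proof (intro bexI allI impI)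
    show "x \<in> M" unfolding x_def by (intro M_closed aM bM)
    fix T n assume T: "commutes T x"
    have Ta: "S * a = a * S" if "commutes S x" for S
      unfolding aeq using that by (simp add: commutes_def algebra_simps)
    have Tb: "T * b = b * T"
    proof -
      have "T * (x - star x) = (x - star x) * T" using T by (simp add: commutes_def algebra_simps)
      then show ?thesis unfolding beq by (intro commute_mult cop_commute)
    qed
    \<comment> \<open>In the decomposition \<open>g n = g (Suc n) + f n\<close>,
      \<open>corner0\<close> removes one off-diagonal corner of \<open>T\<close>, and
      \<open>corner0\<close> for \<open>star T\<close> the other.\<close>
    have gc: "T * g n = g n * T" for n
    proof (induction n)
      case (Suc n)
      have 1: "f n * T * g (Suc n) = 0" by (rule corner0[OF Ta[OF T]])
      have "f n * star T * g (Suc n) = 0" by (rule corner0[OF Ta[OF commutes_star_left[OF T]]])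
      from arg_cong[OF this, of star] have 2: "g (Suc n) * T * f n = 0"
        using projD[OF f_proj] projD[OF g_proj] by (simp add: star_mult mult.assoc)
      have a1: "g (Suc n) * g n = g (Suc n)" "g n * g (Suc n) = g (Suc n)" using g_absorb[of n "Suc n"] by auto
      have "g (Suc n) * T = g (Suc n) * (g n * T)" by (simp add: a1 flip: mult.assoc)
      also have "\<dots> = g (Suc n) * T * g n" by (simp add: Suc[symmetric] mult.assoc)
      also have "\<dots> = g (Suc n) * T * g (Suc n)" by (simp add: g_split[of n] distrib_left 2)
      finally have A1: "g (Suc n) * T = g (Suc n) * T * g (Suc n)" .
      have "T * g (Suc n) = T * g n * g (Suc n)" by (simp add: a1 mult.assoc)
      also have "\<dots> = (g (Suc n) + f n) * T * g (Suc n)" by (simp add: Suc g_split[of n, symmetric])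
      also have "\<dots> = g (Suc n) * T * g (Suc n)" by (simp add: distrib_right 1)
      finally show ?case using A1 by simp
    qed (simp add: g_zero)
    have fc: "T * f n = f n * T" using gc[of n] gc[of "Suc n"] by (simp add: g_split[of n] algebra_simps)
    have "T * (f n * b * g (Suc n)) = f n * b * g (Suc n) * T" by (intro commute_mult fc Tb gc)
    then have Ts: "T * s n = s n * T" unfolding fbg by simp
    have "T * star (s n) = star (s n) * T"
    proof -
      have "T * (g (Suc n) * b * f n) = g (Suc n) * b * f n * T" by (intro commute_mult fc Tb gc)
      moreover have "g (Suc n) * b * f n = (1/2) ^ n *\<^sub>R star (s n)"
        using arg_cong[OF fbg[of n], of star] sb projD[OF f_proj] projD[OF g_proj] by (simp add: star_mult star_scaleR mult.assoc)
      ultimately show ?thesis by simp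
    qed
    moreover have "T * (a * f n) = a * f n * T" by (intro commute_mult fc Ta[OF T])
    then have "T * (f n + c n) = (f n + c n) * T" unfolding af A_def by simp
    then have "T * c n = c n * T" using fc by (simp add: distrib_left distrib_right)
    ultimately show "commutes T (s n) \<and> T * c n = c n * T" using Ts by (simp add: commutes_def)
  qed
qed

end

section \<open>Perturbation to exact partitions\<close>

text \<open>The traces of sums of the \<open>e m i\<close> have this form, so these are the only
  traces for which a projection can be rotated onto such a sum.\<close>

definition dyadic :: "real \<Rightarrow> bool" where "dyadic x \<longleftrightarrow> (\<exists>k n::nat. x = real k / 2 ^ n)"

lemma dyadic_level: "dyadic x \<Longrightarrow> \<exists>n. \<forall>m\<ge>n. \<exists>k::nat. x = real k / 2 ^ m"
proof -
  assume "dyadic x"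
  then obtain k n :: nat where x: "x = real k / 2 ^ n" by (auto simp: dyadic_def)
  have "\<exists>k'::nat. x = real k' / 2 ^ m" if nm: "n \<le> m" for m
  proof -
    obtain d where "m = n + d" using le_Suc_ex[OF nm] by auto
    then show ?thesis by (intro exI[of _ "k * 2 ^ d"]) (simp add: x power_add)
  qed
  then show ?thesis by (intro exI[of _ n]) simp
qed

lemma dyadic_common:
  assumes "dyadic x" "dyadic y"
  obtains N and k l :: nat where "x = real k / 2 ^ N" "y = real l / 2 ^ N"
proof -
  obtain k n l m :: nat where "x = real k / 2 ^ n" "y = real l / 2 ^ m" using assms by (auto simp: dyadic_def)
  then show ?thesis by (intro that[of "k * 2 ^ m" "n + m" "l * 2 ^ n"]) (simp_all add: power_add)
qed

lemma dyadic_diff: assumes "dyadic x" "dyadic y" "y \<le> x" shows "dyadic (x - y)"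
proof -
  obtain N and k l :: nat where kl: "x = real k / 2 ^ N" "y = real l / 2 ^ N"
    by (rule dyadic_common[OF assms(1) assms(2)])
  have "l \<le> k" using assms(3) by (simp add: kl divide_le_cancel)
  then have "x - y = real (k - l) / 2 ^ N" by (simp add: kl of_nat_diff diff_divide_distrib)
  then show ?thesis unfolding dyadic_def by blast
qed

lemma dyadic_zero: "dyadic 0" by (auto simp: dyadic_def)

lemma dyadic_add: assumes "dyadic x" "dyadic y" shows "dyadic (x + y)"
proof -
  obtain N and k l :: nat where kl: "x = real k / 2 ^ N" "y = real l / 2 ^ N"
    by (rule dyadic_common[OF assms])
  have "x + y = real (k + l) / 2 ^ N" by (simp add: kl add_divide_distrib)
  then show ?thesis unfolding dyadic_def by blast
qed

lemma dyadic_sum: "(\<And>i. i \<in> A \<Longrightarrow> dyadic (f i)) \<Longrightarrow> dyadic (sum f A)"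
  by (induction A rule: infinite_finite_induct) (auto intro: dyadic_add dyadic_zero)

lemma dyadic_approx: assumes "0 \<le> t" "0 < \<epsilon>" shows "\<exists>d. dyadic d \<and> 0 \<le> d \<and> d \<le> t \<and> t - d \<le> \<epsilon>"
proof -
  obtain n where "(1/2::real) ^ n < \<epsilon>" using real_arch_pow_inv[OF assms(2), of "1/2"] by auto
  then have n: "1 / 2 ^ n < \<epsilon>" by (simp add: power_divide)
  define k where "k = nat \<lfloor>t * 2 ^ n\<rfloor>"
  have k: "real k = of_int \<lfloor>t * 2 ^ n\<rfloor>" using assms(1) by (simp add: k_def)
  have "real k \<le> t * 2 ^ n" "t * 2 ^ n < real k + 1" unfolding k by linarith+
  then have "real k / 2 ^ n \<le> t" "t < (real k + 1) / 2 ^ n" by (simp_all add: pos_divide_le_eq pos_less_divide_eq)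
  then have "real k / 2 ^ n \<le> t" "t - real k / 2 ^ n < 1 / 2 ^ n" by (simp_all add: add_divide_distrib)
  then show ?thesis using n by (intro exI[of _ "real k / 2 ^ n"]) (auto simp: dyadic_def)
qed

lemma proj_mult_le: "proj p \<Longrightarrow> norm (p * h) \<le> norm h" "proj p \<Longrightarrow> norm (h * p) \<le> norm h"
proof -
  assume "proj p"
  then have p: "norm p \<le> 1" by (rule proj_norm)
  show "norm (p * h) \<le> norm h" using norm_mult_ineq[of p h] mult_right_mono[OF p norm_ge_zero[of h]] by simp
  show "norm (h * p) \<le> norm h" using norm_mult_ineq[of h p] mult_left_mono[OF p norm_ge_zero[of h]] by simp
qed

lemma proj_sum:
  assumes "finite A" "\<And>i. i \<in> A \<Longrightarrow> proj (q i)" "\<And>i j. i \<in> A \<Longrightarrow> j \<in> A \<Longrightarrow> i \<noteq> j \<Longrightarrow> q i * q j = 0"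
  shows "proj (sum q A)" "\<And>i. i \<in> A \<Longrightarrow> q i * sum q A = q i" "\<And>i. i \<in> A \<Longrightarrow> sum q A * q i = q i"
proof -
  have l: "q i * sum q A = q i" "sum q A * q i = q i" if "i \<in> A" for i
  proof -
    have "q i * sum q A = (\<Sum>j\<in>A. if j = i then q i else 0)" unfolding sum_distrib_left
      using assms that by (intro sum.cong) (auto dest: projD)
    then show "q i * sum q A = q i" using assms(1) that by simp
    have "sum q A * q i = (\<Sum>j\<in>A. if j = i then q i else 0)" unfolding sum_distrib_right
      using assms that by (intro sum.cong) (auto dest: projD)
    then show "sum q A * q i = q i" using assms(1) that by simp
  qed
  then show "\<And>i. i \<in> A \<Longrightarrow> q i * sum q A = q i" "\<And>i. i \<in> A \<Longrightarrow> sum q A * q i = q i" by blast+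
  have "sum q A * sum q A = (\<Sum>i\<in>A. q i * sum q A)" by (rule sum_distrib_right)
  also have "\<dots> = sum q A" by (intro sum.cong refl l)
  finally show "proj (sum q A)" using assms(2) by (simp add: proj_def star_sum)
qed

context haar
begin

lemma n2_commutator_perturb:
  assumes "x \<in> M" "y \<in> M" "z \<in> M" "norm z \<le> 1"
  shows "n2 (x * z - z * x) \<le> n2 (y * z - z * y) + 2 * n2 (x - y)"
proof -
  have "x * z - z * x = (y * z - z * y) + ((x - y) * z - z * (x - y))" by (simp add: algebra_simps)
  also have "n2 \<dots> \<le> n2 (y * z - z * y) + n2 ((x - y) * z - z * (x - y))"
    by (intro n2_triangle M_closed assms)
  also have "n2 ((x - y) * z - z * (x - y)) \<le> n2 ((x - y) * z) + n2 (z * (x - y))"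
    by (intro n2_triangle_diff M_closed assms)
  also have "\<dots> \<le> n2 (x - y) + n2 (x - y)"
    by (intro add_mono n2_mult_right_le n2_mult_left_le M_closed assms)
  finally show ?thesis by simp
qed

lemma n2_commutator_swap: "x \<in> M \<Longrightarrow> y \<in> M \<Longrightarrow> n2 (x * y - y * x) = n2 (y * x - x * y)"
  by (intro n2_minus_commute M_mult)

lemma spectral_projection_M:
  assumes h: "h \<in> M" "star h = h"
  obtains e where "e \<in> M" "proj e" "\<And>p. proj p \<Longrightarrow> p * h = h \<Longrightarrow> p * e = e" "n2 (e - h) \<le> 2 * n2 (h * h - h)"
proof -
  define b R where "b = 2 *\<^sub>R h - 1" and "R = norm (b * b) + 1"
  have R: "0 < R" "norm (b * b) \<le> R" by (simp_all add: R_def add_nonneg_pos)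
  define a where "a = sqrtc R (b * b)"
  show ?thesis by (rule spectral_projection[OF talg_M h b_def R a_def], rule that)
qed

definition approx_projs :: "nat \<Rightarrow> real \<Rightarrow> 'h bop \<Rightarrow> (nat \<Rightarrow> 'h bop) \<Rightarrow> bool" where
  "approx_projs k \<delta> p h \<longleftrightarrow> p \<in> M \<and> proj p \<and>
     (\<forall>s<k. h s \<in> M \<and> star (h s) = h s \<and> norm (h s) \<le> 1 \<and> p * h s = h s \<and> n2 (h s * h s - h s) \<le> \<delta>) \<and>
     (\<forall>r<k. \<forall>s<k. r \<noteq> s \<longrightarrow> n2 (h r * h s) \<le> \<delta>)"

definition orth_projs :: "nat \<Rightarrow> 'h bop \<Rightarrow> (nat \<Rightarrow> 'h bop) \<Rightarrow> bool" where
  "orth_projs k p q \<longleftrightarrow> (\<forall>s<k. q s \<in> M \<and> proj (q s) \<and> q s * p = q s \<and> dyadic (tr (q s))) \<and>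
     (\<forall>r<k. \<forall>s<k. r \<noteq> s \<longrightarrow> q r * q s = 0)"

text \<open>Induction on \<open>k\<close>. The last operator is compressed to the complement
  \<open>\<rho>\<close> of the projections already found, which costs little as it is almost
  orthogonal to them, and is then replaced by a spectral projection. \<open>exact_trace\<close> cuts
  that one down to a dyadic trace.\<close>

lemma orth_perturb: "0 < \<eta> \<Longrightarrow> \<exists>\<delta>>0. \<forall>p h. approx_projs k \<delta> p h \<longrightarrow> (\<exists>q. orth_projs k p q \<and> (\<forall>s<k. n2 (q s - h s) \<le> \<eta>))"
proof (induction k arbitrary: \<eta>)
  case 0
  then show ?case by (intro exI[of _ 1]) (auto simp: orth_projs_def)
next
  case (Suc k)
  \<comment> \<open>The new projection is off by at most \<eta>/4 + 7 D + 2 \<delta>, where D is at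
    most \<open>4 * (real k + 1) * \<eta>1\<close>. The factor 56 makes 7 D at most
    \<eta>/2.\<close>
  define \<eta>1 where "\<eta>1 = min \<eta> (\<eta> / (56 * (real k + 1)))"
  have e1: "0 < \<eta>1" "\<eta>1 \<le> \<eta>" using Suc.prems by (auto simp: \<eta>1_def)
  have "56 * (real k + 1) * \<eta>1 \<le> 56 * (real k + 1) * (\<eta> / (56 * (real k + 1)))"
    by (rule mult_left_mono) (auto simp: \<eta>1_def)
  then have e2: "56 * (real k + 1) * \<eta>1 \<le> \<eta>" by (simp add: add_nonneg_eq_0_iff)
  obtain \<delta>1 where d1: "0 < \<delta>1" and IH: "\<And>p h. approx_projs k \<delta>1 p h \<Longrightarrow> \<exists>q. orth_projs k p q \<and> (\<forall>s<k. n2 (q s - h s) \<le> \<eta>1)"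
    using Suc.IH[OF e1(1)] by blast
  define \<delta> where "\<delta> = min \<delta>1 (min \<eta>1 (\<eta> / 8))"
  have d: "0 < \<delta>" "\<delta> \<le> \<delta>1" "\<delta> \<le> \<eta>1" "\<delta> \<le> \<eta> / 8" using d1 e1 Suc.prems by (auto simp: \<delta>_def)
  show ?case
  proof (intro exI[of _ \<delta>] conjI allI impI d)
    fix p h assume A: "approx_projs (Suc k) \<delta> p h"
    have p: "p \<in> M" "proj p" and h: "h s \<in> M" "star (h s) = h s" "norm (h s) \<le> 1" "p * h s = h s" "n2 (h s * h s - h s) \<le> \<delta>" if "s \<le> k" for s
      using A that by (auto simp: approx_projs_def less_Suc_eq_le)
    have ho: "n2 (h r * h s) \<le> \<delta>" if "r \<le> k" "s \<le> k" "r \<noteq> s" for r s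
      using A that by (auto simp: approx_projs_def less_Suc_eq_le)
    have "approx_projs k \<delta>1 p h"
      using A d(2) unfolding approx_projs_def by (meson less_SucI order_trans)
    then obtain q where q: "orth_projs k p q" "\<And>s. s < k \<Longrightarrow> n2 (q s - h s) \<le> \<eta>1" using IH by blast
    have qM: "q s \<in> M" "proj (q s)" "q s * p = q s" if "s < k" for s using q(1) that by (auto simp: orth_projs_def)
    have qo: "q r * q s = 0" if "r < k" "s < k" "r \<noteq> s" for r s using q(1) that by (auto simp: orth_projs_def)
    define \<sigma> where "\<sigma> = (\<Sum>s<k. q s)"
    have \<sigma>M: "\<sigma> \<in> M" unfolding \<sigma>_def by (intro M_sum) (simp add: qM)
    have \<sigma>p: "proj \<sigma>" "\<And>s. s < k \<Longrightarrow> q s * \<sigma> = q s" "\<And>s. s < k \<Longrightarrow> \<sigma> * q s = q s"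
      unfolding \<sigma>_def using proj_sum[of "{..<k}" q] qM qo by auto
    have \<sigma>_sub: "\<sigma> * p = \<sigma>" unfolding \<sigma>_def sum_distrib_right by (rule sum.cong) (auto simp: qM)
    define \<rho> where "\<rho> = p - \<sigma>"
    have \<rho>: "proj \<rho>" "p * \<sigma> = \<sigma>" unfolding \<rho>_def using proj_sub[OF p(2)[OF le0] \<sigma>p(1) \<sigma>_sub] by auto
    have \<rho>M: "\<rho> \<in> M" unfolding \<rho>_def by (intro M_diff p(1)[OF le0] \<sigma>M)
    let ?h = "h k"
    note hk = h[OF order_refl]
    have hp: "?h * p = ?h" using arg_cong[OF hk(4), of star] hk(2) projD[OF p(2)[OF le0]] by (simp add: star_mult)
    have n\<sigma>h: "n2 (\<sigma> * ?h) \<le> real k * (\<eta>1 + \<delta>)"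
    proof -
      have "n2 (\<sigma> * ?h) \<le> (\<Sum>s<k. n2 (q s * ?h))" unfolding \<sigma>_def sum_distrib_right
        by (rule n2_sum) (auto intro: M_closed qM hk)
      also have "\<dots> \<le> (\<Sum>s<k. \<eta>1 + \<delta>)"
      proof (rule sum_mono)
        fix s assume "s \<in> {..<k}"
        then have s: "s < k" "s \<le> k" "s \<noteq> k" by auto
        have "q s * ?h = (q s - h s) * ?h + h s * ?h" by (simp add: algebra_simps)
        also have "n2 \<dots> \<le> n2 ((q s - h s) * ?h) + n2 (h s * ?h)"
          by (intro n2_triangle M_closed qM h s order_refl)
        also have "n2 ((q s - h s) * ?h) \<le> n2 (q s - h s)" by (intro n2_mult_right_le M_closed qM h s order_refl)
        also have "\<dots> \<le> \<eta>1" by (rule q(2)[OF s(1)])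
        finally show "n2 (q s * ?h) \<le> \<eta>1 + \<delta>" using ho[OF s(2) order_refl s(3)] by simp
      qed
      finally show ?thesis by simp
    qed
    define D where "D = 2 * (real k * (\<eta>1 + \<delta>))"
    have D7: "7 * D \<le> \<eta> / 2"
    proof -
      have "real k * (\<eta>1 + \<delta>) \<le> (real k + 1) * (\<eta>1 + \<eta>1)" using d e1 by (intro mult_mono) auto
      then show ?thesis using e2 by (simp add: D_def algebra_simps)
    qed
    define h' where "h' = \<rho> * ?h * \<rho>"
    have h'M: "h' \<in> M" unfolding h'_def by (intro M_closed \<rho>M hk)
    have sh': "star h' = h'" by (simp add: h'_def star_mult projD[OF \<rho>(1)] hk mult.assoc)
    have nh': "norm h' \<le> 1"
      unfolding h'_def using proj_mult_le(2)[OF \<rho>(1), of "\<rho> * ?h"] proj_mult_le(1)[OF \<rho>(1), of ?h] hk(3) by linarith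
    have hh': "n2 (h' - ?h) \<le> D"
    proof -
      have "?h - h' = \<sigma> * ?h + \<rho> * (?h * \<sigma>)"
        by (simp add: h'_def \<rho>_def left_diff_distrib right_diff_distrib hp hk(4) mult.assoc flip: mult.assoc[of p ?h \<sigma>])
      then have "n2 (h' - ?h) = n2 (\<sigma> * ?h + \<rho> * (?h * \<sigma>))" using n2_minus_commute[OF h'M hk(1)] by simp
      also have "\<dots> \<le> n2 (\<sigma> * ?h) + n2 (\<rho> * (?h * \<sigma>))" by (intro n2_triangle M_closed \<sigma>M \<rho>M hk)
      also have "n2 (\<rho> * (?h * \<sigma>)) \<le> n2 (?h * \<sigma>)" by (intro n2_mult_left_le M_closed \<sigma>M \<rho>M hk proj_norm \<rho>)
      also have "n2 (?h * \<sigma>) = n2 (\<sigma> * ?h)" using n2_star[of "?h * \<sigma>"] \<sigma>M hk projD[OF \<sigma>p(1)] by (simp add: star_mult M_mult)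
      finally show ?thesis using n\<sigma>h by (simp add: D_def)
    qed
    have hh2: "n2 (h' * h' - h') \<le> 3 * D + \<delta>"
    proof -
      have "h' * h' - h' = (h' * (h' - ?h) + (h' - ?h) * ?h) + ((?h * ?h - ?h) - (h' - ?h))" by (simp add: algebra_simps)
      also have "n2 \<dots> \<le> (n2 (h' * (h' - ?h)) + n2 ((h' - ?h) * ?h)) + (n2 (?h * ?h - ?h) + n2 (h' - ?h))"
        by (intro order_trans[OF n2_triangle] add_mono n2_triangle n2_triangle_diff M_closed h'M hk)
      also have "\<dots> \<le> (D + D) + (\<delta> + D)"
        by (intro add_mono order_trans[OF n2_mult_left_le hh'] order_trans[OF n2_mult_right_le hh'] hh' M_closed h'M hk nh')
      finally show ?thesis by simp
    qed
    obtain e where e: "e \<in> M" "proj e" "\<And>p. proj p \<Longrightarrow> p * h' = h' \<Longrightarrow> p * e = e" "n2 (e - h') \<le> 2 * n2 (h' * h' - h')"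
      by (rule spectral_projection_M[OF h'M sh'], rule that)
    have "\<rho> * h' = h'" using projD[OF \<rho>(1)] by (simp add: h'_def flip: mult.assoc)
    then have \<rho>e: "\<rho> * e = e" by (rule e(3)[OF \<rho>(1)])
    \<comment> \<open>The square of the 2-norm of a projection is its trace, so losing at most the
      square of \<eta>/4 in trace costs at most \<eta>/4 in the 2-norm.\<close>
    have "0 < (\<eta> / 4)\<^sup>2" using Suc.prems by simp
    then obtain x where x: "dyadic x" "0 \<le> x" "x \<le> tr e" "tr e - x \<le> (\<eta> / 4)\<^sup>2"
      using dyadic_approx[OF tr_proj_nonneg[OF e(1,2)]] by blast
    obtain f where f: "f \<in> M" "proj f" "f * e = f" "tr f = x"
      using exact_trace[OF talg_M diffuse_M e(1,2) x(2,3)] by blast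
    have ef: "e * f = f" "proj (e - f)" using proj_sub[OF e(2) f(2,3)] .
    have "(n2 (e - f))\<^sup>2 = tr e - x" using projD[OF ef(2)] f(1,4) e(1) by (simp add: n2_sq M_diff tr_diff)
    with x(4) have "(n2 (e - f))\<^sup>2 \<le> (\<eta> / 4)\<^sup>2" by linarith
    then have nef: "n2 (e - f) \<le> \<eta> / 4" by (rule power2_le_imp_le) (use Suc.prems in linarith)
    have \<rho>f: "\<rho> * f = f" using \<rho>e ef(1) by (metis mult.assoc)
    have f\<rho>: "f * \<rho> = f" using arg_cong[OF \<rho>f, of star] projD[OF f(2)] projD[OF \<rho>(1)] by (simp add: star_mult)
    have "\<rho> * p = \<rho>" using \<sigma>_sub projD[OF p(2)[OF le0]] by (simp add: \<rho>_def left_diff_distrib)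
    then have fp: "f * p = f" using f\<rho> by (metis mult.assoc)
    have fq: "f * q s = 0" "q s * f = 0" if "s < k" for s
    proof -
      have "p * q s = q s" using arg_cong[OF qM(3)[OF that], of star] projD[OF p(2)[OF le0]] projD[OF qM(2)[OF that]] by (simp add: star_mult)
      then have "\<rho> * q s = 0" using \<sigma>p(3)[OF that] by (simp add: \<rho>_def left_diff_distrib)
      then show 1: "f * q s = 0" using f\<rho> by (metis mult.assoc mult_zero_right)
      show "q s * f = 0" using arg_cong[OF 1, of star] projD[OF f(2)] projD[OF qM(2)[OF that]] by (simp add: star_mult)
    qed
    have nfh: "n2 (f - ?h) \<le> \<eta>"
    proof -
      have "n2 (f - ?h) \<le> n2 (f - e) + n2 (e - ?h)" by (intro n2_dist_triangle f e hk)
      moreover have "n2 (e - ?h) \<le> n2 (e - h') + n2 (h' - ?h)" by (intro n2_dist_triangle e hk h'M)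
      moreover have "n2 (f - e) = n2 (e - f)" by (intro n2_minus_commute f e)
      ultimately have le: "n2 (f - ?h) \<le> n2 (e - f) + (n2 (e - h') + n2 (h' - ?h))" by linarith
      have "2 * n2 (h' * h' - h') \<le> 2 * (3 * D + \<delta>)" using hh2 by simp
      with e(4) have "n2 (e - h') \<le> 2 * (3 * D + \<delta>)" by (rule order_trans)
      with le nef hh' have "n2 (f - ?h) \<le> \<eta> / 4 + (2 * (3 * D + \<delta>) + D)" by linarith
      then show ?thesis using D7 d(4) by (simp add: algebra_simps)
    qed
    define q' where "q' s = (if s = k then f else q s)" for s
    have "orth_projs (Suc k) p q'"
      using q(1) f fp fq x(1) unfolding orth_projs_def q'_def by (auto simp: less_Suc_eq)
    moreover have "n2 (q' s - h s) \<le> \<eta>" if "s < Suc k" for s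
      using that nfh q(2)[of s] e1(2) by (cases "s = k") (auto simp: q'_def)
    ultimately show "\<exists>q. orth_projs (Suc k) p q \<and> (\<forall>s<Suc k. n2 (q s - h s) \<le> \<eta>)" by blast
  qed
qed

text \<open>The last of the \<open>\<kappa> + 1\<close> pieces takes up what \<open>\<kappa>\<close> only approximately complementary projections leave over.\<close>

definition part :: "nat \<Rightarrow> (nat \<Rightarrow> 'h bop) \<Rightarrow> bool" where
  "part \<kappa> p \<longleftrightarrow> (\<forall>i\<le>\<kappa>. p i \<in> M \<and> proj (p i) \<and> dyadic (tr (p i))) \<and>
     (\<forall>i\<le>\<kappa>. \<forall>j\<le>\<kappa>. i \<noteq> j \<longrightarrow> p i * p j = 0) \<and> (\<Sum>i\<le>\<kappa>. p i) = 1"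

text \<open>\<open>r\<close> is a common refinement with row sums \<open>p\<close> and column sums
  \<open>q\<close>. That its own traces are dyadic allows \<open>diagd_joint\<close> to diagonalise
  \<open>p\<close> and \<open>q\<close> simultaneously.\<close>

definition joint :: "nat \<Rightarrow> (nat \<Rightarrow> 'h bop) \<Rightarrow> (nat \<Rightarrow> 'h bop) \<Rightarrow> bool" where
  "joint \<kappa> p q \<longleftrightarrow> (\<exists>r. (\<forall>i\<le>\<kappa>. \<forall>s\<le>\<kappa>. r i s \<in> M \<and> proj (r i s) \<and> dyadic (tr (r i s))) \<and>
     (\<forall>i\<le>\<kappa>. \<forall>s\<le>\<kappa>. \<forall>i'\<le>\<kappa>. \<forall>s'\<le>\<kappa>. (i, s) \<noteq> (i', s') \<longrightarrow> r i s * r i' s' = 0) \<and>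
     (\<forall>i\<le>\<kappa>. (\<Sum>s\<le>\<kappa>. r i s) = p i) \<and> (\<forall>s\<le>\<kappa>. (\<Sum>i\<le>\<kappa>. r i s) = q s))"

lemma partD:
  assumes "part \<kappa> p"
  shows "i \<le> \<kappa> \<Longrightarrow> p i \<in> M" "i \<le> \<kappa> \<Longrightarrow> proj (p i)" "i \<le> \<kappa> \<Longrightarrow> dyadic (tr (p i))"
    "i \<le> \<kappa> \<Longrightarrow> j \<le> \<kappa> \<Longrightarrow> i \<noteq> j \<Longrightarrow> p i * p j = 0" "(\<Sum>i\<le>\<kappa>. p i) = 1"
  using assms by (auto simp: part_def)

text \<open>Since \<open>e s\<close> almost commutes with \<open>p i\<close>, the compressions
  \<open>p i * e s * p i\<close> are almost orthogonal near-projections under \<open>p i\<close>.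
  \<open>orth_perturb\<close> makes them exact in each row separately, and the column sums form a
  partition that commutes with \<open>p\<close> exactly and is still close to
  \<open>e\<close>.\<close>

lemma joint_perturb:
  assumes "0 < \<eta>"
  shows "\<exists>\<delta>>0. \<forall>p e. part \<kappa> p \<longrightarrow> (\<forall>s<\<kappa>. e s \<in> M \<and> proj (e s)) \<longrightarrow> (\<forall>i\<le>\<kappa>. \<forall>s<\<kappa>. n2 (p i * e s - e s * p i) \<le> \<delta>) \<longrightarrow>
    (\<forall>r<\<kappa>. \<forall>s<\<kappa>. r \<noteq> s \<longrightarrow> n2 (e r * e s) \<le> \<delta>) \<longrightarrow>
    (\<exists>q. part \<kappa> q \<and> joint \<kappa> p q \<and> (\<forall>s<\<kappa>. n2 (q s - e s) \<le> \<eta>))"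
proof -
  \<comment> \<open>The difference \<open>q s - e s\<close> is split into two sums of
    \<open>\<kappa> + 1\<close> terms, each of which may use up half of
    \<open>\<eta>\<close>.\<close>
  define \<eta>0 where "\<eta>0 = \<eta> / (2 * (real \<kappa> + 1))"
  have e0: "0 < \<eta>0" "(real \<kappa> + 1) * \<eta>0 = \<eta> / 2" using assms by (simp_all add: \<eta>0_def add_nonneg_eq_0_iff field_simps)
  obtain \<delta>0 where d0: "0 < \<delta>0" and orth: "\<And>p h. approx_projs \<kappa> \<delta>0 p h \<Longrightarrow> \<exists>q. orth_projs \<kappa> p q \<and> (\<forall>s<\<kappa>. n2 (q s - h s) \<le> \<eta>0)"
    using orth_perturb[OF e0(1), of \<kappa>] by blast
  define \<delta> where "\<delta> = min (\<delta>0 / 2) \<eta>0"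
  have d: "0 < \<delta>" "\<delta> \<le> \<delta>0 / 2" "\<delta> \<le> \<eta>0" using d0 e0 by (auto simp: \<delta>_def)
  show ?thesis
  proof (intro exI[of _ \<delta>] conjI allI impI d(1))
    fix p e
    assume p: "part \<kappa> p" and e0': "\<forall>s<\<kappa>. e s \<in> M \<and> proj (e s)"
      and c0: "\<forall>i\<le>\<kappa>. \<forall>s<\<kappa>. n2 (p i * e s - e s * p i) \<le> \<delta>" and o0: "\<forall>r<\<kappa>. \<forall>s<\<kappa>. r \<noteq> s \<longrightarrow> n2 (e r * e s) \<le> \<delta>"
    note P = partD[OF p]
    have e: "e s \<in> M" "proj (e s)" if "s < \<kappa>" for s using e0' that by auto
    have c: "n2 (p i * e s - e s * p i) \<le> \<delta>" if "i \<le> \<kappa>" "s < \<kappa>" for i s using c0 that by auto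
    have o: "n2 (e r * e s) \<le> \<delta>" if "r < \<kappa>" "s < \<kappa>" "r \<noteq> s" for r s using o0 that by auto
    have "\<exists>q. orth_projs \<kappa> (p i) q \<and> (\<forall>s<\<kappa>. n2 (q s - p i * e s * p i) \<le> \<eta>0)" if i: "i \<le> \<kappa>" for i
    proof (rule orth, unfold approx_projs_def, intro conjI allI impI)
      note pi = P(1,2)[OF i] and pd = projD[OF P(2)[OF i]]
      have n1: "norm (p i) \<le> 1" by (rule proj_norm[OF pi(2)])
      show "p i \<in> M" "proj (p i)" by (fact pi)+
      fix s assume s: "s < \<kappa>"
      note es = e[OF s] and ed = projD[OF e(2)[OF s]]
      show "p i * e s * p i \<in> M" by (intro M_closed pi es)
      show "star (p i * e s * p i) = p i * e s * p i" by (simp add: star_mult pd ed mult.assoc)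
      show "norm (p i * e s * p i) \<le> 1"
        using proj_mult_le(2)[OF pi(2), of "p i * e s"] proj_mult_le(1)[OF pi(2), of "e s"] proj_norm[OF es(2)] by linarith
      show "p i * (p i * e s * p i) = p i * e s * p i" by (simp add: pd flip: mult.assoc)
      have pp: "p i * (p i * z) = p i * z" and ee: "e s * (e s * z) = e s * z" for z by (simp_all add: pd ed flip: mult.assoc)
      have "p i * e s * p i * (p i * e s * p i) - p i * e s * p i = p i * e s * ((p i * e s - e s * p i) * p i)"
        by (simp add: left_diff_distrib right_diff_distrib mult.assoc pp ee pd)
      also have "n2 \<dots> \<le> n2 ((p i * e s - e s * p i) * p i)"
        using proj_mult_le(1)[OF pi(2), of "e s"] proj_norm[OF es(2)] by (intro n2_mult_left_le M_closed pi es) linarith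
      also have "\<dots> \<le> n2 (p i * e s - e s * p i)" by (intro n2_mult_right_le M_closed pi es n1)
      also have "\<dots> \<le> \<delta>0" using c[OF i s] d d0 by simp
      finally show "n2 (p i * e s * p i * (p i * e s * p i) - p i * e s * p i) \<le> \<delta>0" .
      fix r assume r: "r < \<kappa>" and rs: "r \<noteq> s"
      have "p i * e r * p i * (p i * e s * p i) = p i * e r * ((p i * e s - e s * p i) * p i) + p i * (e r * e s) * p i"
        by (simp add: left_diff_distrib right_diff_distrib mult.assoc pp pd)
      also have "n2 \<dots> \<le> n2 (p i * e r * ((p i * e s - e s * p i) * p i)) + n2 (p i * (e r * e s) * p i)"
        by (intro n2_triangle M_closed pi es e r)
      also have "n2 (p i * e r * ((p i * e s - e s * p i) * p i)) \<le> n2 ((p i * e s - e s * p i) * p i)"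
        using proj_mult_le(1)[OF pi(2), of "e r"] proj_norm[OF e(2)[OF r]] by (intro n2_mult_left_le M_closed pi es e r) linarith
      also have "\<dots> \<le> n2 (p i * e s - e s * p i)" by (intro n2_mult_right_le M_closed pi es n1)
      also have "\<dots> \<le> \<delta>" by (rule c[OF i s])
      also have "n2 (p i * (e r * e s) * p i) \<le> n2 (p i * (e r * e s))" by (intro n2_mult_right_le M_closed pi es e r n1)
      also have "\<dots> \<le> n2 (e r * e s)" by (intro n2_mult_left_le M_closed pi es e r n1)
      also have "\<dots> \<le> \<delta>" by (rule o[OF r s rs])
      finally show "n2 (p i * e r * p i * (p i * e s * p i)) \<le> \<delta>0" using d by simp
    qed
    then obtain w where w: "\<And>i. i \<le> \<kappa> \<Longrightarrow> orth_projs \<kappa> (p i) (w i)" "\<And>i s. i \<le> \<kappa> \<Longrightarrow> s < \<kappa> \<Longrightarrow> n2 (w i s - p i * e s * p i) \<le> \<eta>0" by metis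
    have w1: "w i s \<in> M" "proj (w i s)" "w i s * p i = w i s" "dyadic (tr (w i s))" if "i \<le> \<kappa>" "s < \<kappa>" for i s
      using w(1)[OF that(1)] that by (auto simp: orth_projs_def)
    have w2: "w i r * w i s = 0" if "i \<le> \<kappa>" "r < \<kappa>" "s < \<kappa>" "r \<noteq> s" for i r s
      using w(1)[OF that(1)] that by (auto simp: orth_projs_def)
    define \<sigma> where "\<sigma> i = (\<Sum>s<\<kappa>. w i s)" for i
    have \<sigma>: "\<sigma> i \<in> M" "proj (\<sigma> i)" "\<And>s. s < \<kappa> \<Longrightarrow> w i s * \<sigma> i = w i s" "\<And>s. s < \<kappa> \<Longrightarrow> \<sigma> i * w i s = w i s" "\<sigma> i * p i = \<sigma> i" if "i \<le> \<kappa>" for i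
    proof -
      show "\<sigma> i \<in> M" unfolding \<sigma>_def by (intro M_sum) (use w1 that in auto)
      show "proj (\<sigma> i)" "\<And>s. s < \<kappa> \<Longrightarrow> w i s * \<sigma> i = w i s" "\<And>s. s < \<kappa> \<Longrightarrow> \<sigma> i * w i s = w i s"
        unfolding \<sigma>_def using proj_sum[of "{..<\<kappa>}" "w i"] w1[OF that] w2[OF that] by auto
      show "\<sigma> i * p i = \<sigma> i" unfolding \<sigma>_def sum_distrib_right by (rule sum.cong) (auto simp: w1[OF that])
    qed
    define r where "r i s = (if s < \<kappa> then w i s else p i - \<sigma> i)" for i s
    have rM: "r i s \<in> M" "proj (r i s)" "r i s * p i = r i s" "p i * r i s = r i s" "dyadic (tr (r i s))" if i: "i \<le> \<kappa>" for i s
    proof -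
      have "dyadic (tr (p i - \<sigma> i))"
      proof -
        have "pos (p i - \<sigma> i)" by (intro proj_pos proj_sub P(2)[OF i] \<sigma>[OF i])
        then have "tr (\<sigma> i) \<le> tr (p i)" by (intro tr_mono \<sigma>[OF i] P(1)[OF i])
        moreover have "dyadic (tr (\<sigma> i))"
          unfolding \<sigma>_def by (subst tr_sum) (auto intro!: dyadic_sum w1 i)
        ultimately show ?thesis using P(3)[OF i] by (simp add: tr_diff P(1)[OF i] \<sigma>[OF i] dyadic_diff)
      qed
      then show "dyadic (tr (r i s))" using w1(4)[OF i] by (simp add: r_def)
      show "r i s \<in> M" using w1(1)[OF i] by (auto simp: r_def intro: M_diff P(1)[OF i] \<sigma>[OF i])
      show pr: "proj (r i s)" using w1(2)[OF i] proj_sub(2)[OF P(2)[OF i] \<sigma>(2)[OF i] \<sigma>(5)[OF i]] by (simp add: r_def)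
      show rp: "r i s * p i = r i s" using w1(3)[OF i] \<sigma>(5)[OF i] projD[OF P(2)[OF i]] by (simp add: r_def left_diff_distrib)
      from arg_cong[OF rp, of star] show "p i * r i s = r i s" using projD[OF pr] projD[OF P(2)[OF i]] by (simp add: star_mult)
    qed
    have rsum: "(\<Sum>s\<le>\<kappa>. r i s) = p i" for i
      by (simp add: lessThan_Suc_atMost[symmetric] r_def \<sigma>_def)
    have ro: "r i s * r i' s' = 0" if "i \<le> \<kappa>" "s \<le> \<kappa>" "i' \<le> \<kappa>" "s' \<le> \<kappa>" "(i, s) \<noteq> (i', s')" for i s i' s'
    proof (cases "i = i'")
      case False
      have "r i s * r i' s' = r i s * (p i * p i') * r i' s'" using rM(3)[OF that(1), of s] rM(4)[OF that(3), of s'] by (metis mult.assoc)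
      then show ?thesis using P(4)[OF that(1,3) False] by simp
    next
      case True
      have a: "w i s * p i = w i s" "p i * w i s = w i s" if "s < \<kappa>" for s
        using rM(3,4)[OF \<open>i \<le> \<kappa>\<close>, of s] that by (simp_all add: r_def)
      have "s \<noteq> s'" using that True by simp
      then show ?thesis using True that w2[OF that(1)] \<sigma>(3,4)[OF that(1)] a
        by (cases "s < \<kappa>"; cases "s' < \<kappa>") (auto simp: r_def left_diff_distrib right_diff_distrib)
    qed
    define q where "q s = (\<Sum>i\<le>\<kappa>. r i s)" for s
    have J: "joint \<kappa> p q" unfolding joint_def
      by (intro exI[of _ r]) (use rM rsum ro in \<open>auto simp: q_def\<close>)
    have Q: "part \<kappa> q" unfolding part_def
    proof (intro conjI allI impI)
      fix s assume s: "s \<le> \<kappa>"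
      show "q s \<in> M" unfolding q_def by (intro M_sum) (auto intro: rM)
      show "proj (q s)" unfolding q_def by (intro proj_sum) (use s ro in \<open>auto intro: rM\<close>)
      show "dyadic (tr (q s))" unfolding q_def by (subst tr_sum) (auto intro!: dyadic_sum rM)
      fix s' assume s': "s' \<le> \<kappa>" "s \<noteq> s'"
      show "q s * q s' = 0" unfolding q_def sum_distrib_left sum_distrib_right
        by (intro sum.neutral ballI) (use s s' ro in auto)
    next
      have "(\<Sum>s\<le>\<kappa>. q s) = (\<Sum>i\<le>\<kappa>. \<Sum>s\<le>\<kappa>. r i s)" unfolding q_def by (rule sum.swap)
      then show "(\<Sum>s\<le>\<kappa>. q s) = 1" by (simp add: rsum P(5))
    qed
    have "n2 (q s - e s) \<le> \<eta>" if s: "s < \<kappa>" for s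
    proof -
      note es = e[OF s]
      have m1: "w i s - p i * e s * p i \<in> M" and m2: "(p i * e s - e s * p i) * p i \<in> M" if "i \<le> \<kappa>" for i
        by (intro M_closed w1(1)[OF that s] P(1)[OF that] es)+
      have "q s - e s = (\<Sum>i\<le>\<kappa>. (w i s - p i * e s * p i)) + (\<Sum>i\<le>\<kappa>. (p i * e s - e s * p i) * p i)"
      proof -
        have "(\<Sum>i\<le>\<kappa>. e s * p i * p i) = e s * (\<Sum>i\<le>\<kappa>. p i)" unfolding sum_distrib_left
          by (rule sum.cong) (auto simp: mult.assoc projD[OF P(2)])
        then have "(\<Sum>i\<le>\<kappa>. e s * p i * p i) = e s" by (simp add: P(5))
        then show ?thesis using s by (simp add: q_def r_def sum_subtractf left_diff_distrib)
      qed
      then have "n2 (q s - e s) \<le> n2 (\<Sum>i\<le>\<kappa>. (w i s - p i * e s * p i)) + n2 (\<Sum>i\<le>\<kappa>. (p i * e s - e s * p i) * p i)"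
        by (simp only:) (intro n2_triangle M_sum, simp_all add: m1 m2)
      moreover have "n2 (\<Sum>i\<le>\<kappa>. (w i s - p i * e s * p i)) \<le> (\<Sum>i\<le>\<kappa>. \<eta>0)"
        by (rule order_trans[OF n2_sum sum_mono]) (simp_all add: m1 w(2) s)
      moreover have "n2 (\<Sum>i\<le>\<kappa>. (p i * e s - e s * p i) * p i) \<le> (\<Sum>i\<le>\<kappa>. \<eta>0)"
      proof (rule order_trans[OF n2_sum sum_mono])
        fix i assume "i \<in> {..\<kappa>}"
        then have i: "i \<le> \<kappa>" by simp
        show "(p i * e s - e s * p i) * p i \<in> M" by (rule m2[OF i])
        have "n2 ((p i * e s - e s * p i) * p i) \<le> n2 (p i * e s - e s * p i)"
          by (intro n2_mult_right_le M_closed P(1)[OF i] es proj_norm P(2)[OF i])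
        then show "n2 ((p i * e s - e s * p i) * p i) \<le> \<eta>0" using c[OF i s] d by linarith
      qed simp
      moreover have "(\<Sum>i\<le>\<kappa>. \<eta>0) = \<eta> / 2" using e0(2) by (simp add: algebra_simps)
      ultimately show ?thesis by linarith
    qed
    then show "\<exists>q. part \<kappa> q \<and> joint \<kappa> p q \<and> (\<forall>s<\<kappa>. n2 (q s - e s) \<le> \<eta>)" using J Q by blast
  qed
qed

section \<open>Transfer along asymptotically commuting Haar unitaries\<close>

definition asymp_haar :: "nat filter \<Rightarrow> (nat \<Rightarrow> 'h bop) \<Rightarrow> bool" where
  "asymp_haar \<F> v \<longleftrightarrow> (\<forall>t. v t \<in> M \<and> unit (v t)) \<and> (\<forall>m\<ge>1. ((\<lambda>t. \<tau> (v t ^ m)) \<longlongrightarrow> 0) \<F>)"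

text \<open>\<open>F u\<close> is close to \<open>p\<close> only in the 2-norm, and an estimate
  through \<open>n2 (h * h - h)\<close> would bring in the operator norm of \<open>F u\<close>,
  which may grow as \<epsilon> shrinks. Instead, the distance of \<open>F w\<close> from its
  spectral projection equals \<open>n2 (1 - a w) / 2\<close>; at \<open>u\<close> it is small
  because that projection is a nearest one, and this number can be carried from \<open>u\<close> to
  the \<open>v t\<close>.\<close>

lemma projection_transfer:
  assumes p: "p \<in> A0" "proj p" and e: "0 < \<epsilon>" and v: "asymp_haar \<F> v"
  shows "\<exists>F. tpoly F \<and> (\<forall>v. star (F v) = F v) \<and> n2 (F u - p) \<le> \<epsilon> \<and>
    (\<forall>\<^sub>F t in \<F>. \<exists>e\<in>M. proj e \<and> n2 (e - F (v t)) \<le> 2 * \<epsilon>)"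
proof -
  note pM = A0_M[OF p(1)] and sp = projD(1)[OF p(2)]
  have vt: "v t \<in> M" "unit (v t)" and lim: "1 \<le> m \<Longrightarrow> ((\<lambda>t. \<tau> (v t ^ m)) \<longlongrightarrow> 0) \<F>" for t m
    using v by (auto simp: asymp_haar_def)
  obtain G where G: "tpoly G" "G u \<in> M" "n2 (G u - p) < \<epsilon>" using A0D[OF p(1) e] by blast
  define F where "F v = (1/2) *\<^sub>R (G v + star (G v))" for v
  have F: "tpoly F" unfolding F_def by (intro tpoly_scaleR tpoly_add tpoly_star G)
  have sF: "star (F v) = F v" for v by (simp add: F_def star_simps add.commute)
  have FM: "w \<in> M \<Longrightarrow> F w \<in> M" for w by (rule tpoly_M[OF F])
  have Fp: "n2 (F u - p) \<le> \<epsilon>"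
  proof -
    have "F u - p = (1/2) *\<^sub>R ((G u - p) + star (G u - p))"
      by (simp add: F_def star_diff sp algebra_simps flip: scaleR_add_left)
    then have "n2 (F u - p) = (1/2) * n2 ((G u - p) + star (G u - p))" using G pM by (simp add: n2_scaleR M_closed)
    also have "\<dots> \<le> (1/2) * (n2 (G u - p) + n2 (star (G u - p)))" using G pM by (intro mult_left_mono n2_triangle M_closed) auto
    also have "n2 (star (G u - p)) = n2 (G u - p)" by (intro n2_star M_diff G pM)
    finally show ?thesis using G(3) by simp
  qed
  obtain K where K: "0 \<le> K" "\<And>w. norm w \<le> 1 \<Longrightarrow> norm (F w) \<le> K" using tpoly_norm_bound[OF F] by blast
  define b where "b w = 2 *\<^sub>R F w - 1" for w
  define R where "R = (2 * K + 1) * (2 * K + 1)"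
  have R: "0 < R" using K(1) by (simp add: R_def add_nonneg_pos)
  have bR: "norm (b w * b w) \<le> R" if "unit w" for w
  proof -
    have "norm (b w) \<le> norm (2 *\<^sub>R F w) + norm (1::'h bop)" unfolding b_def by (rule norm_triangle_ineq4)
    then have "norm (b w) \<le> 2 * K + 1" using K(2)[OF unit_norm[OF that]] norm_one_le[where 'h='h] by simp
    then show ?thesis unfolding R_def by (intro order_trans[OF norm_mult_ineq] mult_mono) (use K in auto)
  qed
  define a where "a w = sqrtc R (b w * b w)" for w
  have spec: "\<exists>e\<in>M. proj e \<and> n2 (e - F w) = n2 (1 - a w) / 2 \<and> (\<forall>p\<in>M. proj p \<longrightarrow> n2 (e - F w) \<le> n2 (p - F w))"
    if w: "w \<in> M" "unit w" for w
  proof -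
    obtain e where e: "e \<in> M" "proj e" "\<And>y. F w * y = y * F w \<Longrightarrow> e * y = y * e"
      "\<And>p. proj p \<Longrightarrow> p * F w = F w \<Longrightarrow> p * e = e" "pos (a w)" "a w \<in> M" "a w * a w = b w * b w" "a w * e = e * a w"
      "b w = a w * (2 *\<^sub>R e - 1)" "n2 (e - F w) = n2 (1 - a w) / 2" "n2 (e - F w) \<le> 2 * n2 (F w * F w - F w)"
      "\<And>p. p \<in> M \<Longrightarrow> proj p \<Longrightarrow> n2 (e - F w) \<le> n2 (p - F w)"
      by (rule spectral_projection[OF talg_M FM[OF w(1)] sF b_def R bR[OF w(2)] a_def], rule that)
    show ?thesis by (intro bexI[of _ e] conjI ballI impI e)
  qed
  have au: "n2 (1 - a u) \<le> 2 * \<epsilon>"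
  proof -
    obtain e where "n2 (e - F u) = n2 (1 - a u) / 2" "n2 (e - F u) \<le> n2 (p - F u)" using spec[OF uM uunit] pM p(2) by blast
    then show ?thesis using Fp n2_minus_commute[OF pM FM[OF uM]] by simp
  qed
  obtain N where N: "sqrt R * (1 - visc N) \<le> \<epsilon> / 2"
  proof -
    have "(\<lambda>n. sqrt R * (1 - visc n)) \<longlonglongrightarrow> sqrt R * (1 - 1)" by (intro tendsto_intros visc_tendsto)
    then have "\<forall>\<^sub>F n in sequentially. sqrt R * (1 - visc n) < \<epsilon> / 2" using e by (intro order_tendstoD) auto
    then show ?thesis using that eventually_happens' sequentially_bot less_imp_le by blast
  qed
  \<comment> \<open>\<open>1 - a w\<close> is not a *-polynomial in \<open>w\<close>, but it is
    approximated by \<open>H w\<close> in operator norm with an error uniform over all unitaries of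
    \<open>M\<close>. So its 2-norm at \<open>v t\<close> is controlled by that of
    \<open>H (v t)\<close>, which converges.\<close>
  define H where "H w = 1 - sqrt_approx R N (b w * b w)" for w
  have tb: "tpoly b" unfolding b_def by (intro tpoly_diff tpoly_scaleR tpoly_one F)
  have tH: "tpoly H" unfolding H_def by (intro tpoly_diff tpoly_one tpoly_sqrt_approx tpoly_mult tb)
  have aH: "n2 ((1 - a w) - H w) \<le> \<epsilon> / 2" if w: "w \<in> M" "unit w" for w
  proof -
    have bw: "b w \<in> M" "star (b w) = b w" using FM[OF w(1)] sF by (auto simp: b_def star_simps intro: M_closed)
    have pb: "pos (b w * b w)" by (rule pos_sq[OF bw(2)])
    have aM: "a w \<in> M" unfolding a_def by (intro M_sqrtc M_mult bw pb bR[OF w(2)] R)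
    have HM: "H w \<in> M" by (rule tpoly_M[OF tH w(1)])
    have "norm ((1 - a w) - H w) = norm (sqrt_approx R N (b w * b w) - sqrtc R (b w * b w))" by (simp add: H_def a_def)
    also have "\<dots> \<le> \<epsilon> / 2" by (rule order_trans[OF norm_sqrt_approx[OF pb bR[OF w(2)] R] N])
    finally show ?thesis using n2_le_norm[of "(1 - a w) - H w"] aM HM by (simp add: M_closed)
  qed
  have aM: "a w \<in> M" if w: "w \<in> M" "unit w" for w
    unfolding a_def using FM[OF w(1)] sF by (intro M_sqrtc M_mult pos_sq bR[OF w(2)] R) (auto simp: b_def star_simps intro: M_closed)
  have HM: "w \<in> M \<Longrightarrow> H w \<in> M" for w by (rule tpoly_M[OF tH])
  have "n2 (H u) \<le> n2 (1 - a u) + n2 ((1 - a u) - H u)"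
    using n2_triangle_diff[of "1 - a u" "(1 - a u) - H u"] aM[OF uM uunit] HM[OF uM] by (simp add: M_closed)
  then have "n2 (H u) < 3 * \<epsilon>" using au aH[OF uM uunit] e by simp
  then have ev: "\<forall>\<^sub>F t in \<F>. n2 (H (v t)) < 3 * \<epsilon>"
    using order_tendstoD(2)[OF tpoly_transfer_n2[OF tH vt lim]] by blast
  have "\<forall>\<^sub>F t in \<F>. \<exists>e\<in>M. proj e \<and> n2 (e - F (v t)) \<le> 2 * \<epsilon>"
  proof (rule eventually_mono[OF ev])
    fix t assume t: "n2 (H (v t)) < 3 * \<epsilon>"
    have "n2 (1 - a (v t)) \<le> n2 ((1 - a (v t)) - H (v t)) + n2 (H (v t))"
      using n2_triangle[of "(1 - a (v t)) - H (v t)" "H (v t)"] aM[OF vt] HM[OF vt(1)] by (simp add: M_closed)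
    then have "n2 (1 - a (v t)) / 2 \<le> 2 * \<epsilon>" using aH[OF vt, of t] t e by simp
    then show "\<exists>e\<in>M. proj e \<and> n2 (e - F (v t)) \<le> 2 * \<epsilon>" using spec[OF vt, of t] by metis
  qed
  then show ?thesis using F sF Fp by blast
qed

end

context haar
begin

lemma n2_proj_le_one: "p \<in> M \<Longrightarrow> proj p \<Longrightarrow> n2 p \<le> 1"
  using n2_le_norm[of p] proj_norm[of p] by linarith

lemma n2_le_add: "x \<in> M \<Longrightarrow> y \<in> M \<Longrightarrow> n2 x \<le> n2 (x - y) + n2 y"
  using n2_triangle[of "x - y" y] by (simp add: M_diff)

lemma tr_mult_le: "x \<in> M \<Longrightarrow> y \<in> M \<Longrightarrow> star x = x \<Longrightarrow> \<bar>tr (x * y)\<bar> \<le> n2 x * n2 y"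
  using tr_cauchy_schwarz[of x y] by simp

text \<open>Projections \<open>e s\<close> close to \<open>F s (v t)\<close> almost commute with
  everything that almost commutes with \<open>v t\<close>, in particular with \<open>p\<close> and
  with \<open>v' t\<close>. They are almost orthogonal because the traces of
  \<open>F r (v t) * F s (v t)\<close> tend to their values at \<open>u\<close>, where the
  \<open>F s\<close> approximate orthogonal atoms. \<open>joint_perturb\<close> turns them into
  \<open>q\<close>. The tolerance \<delta> is fixed before \<open>t\<close> and \<open>p\<close>,
  since it rests on the commutator constants of the \<open>F s\<close>.\<close>

lemma step:
  assumes v: "asymp_haar \<F> v" and v': "\<And>t. v' t \<in> M" "\<And>t. unit (v' t)"
    and comm: "((\<lambda>t. n2 (v t * v' t - v' t * v t)) \<longlongrightarrow> 0) \<F>" and \<epsilon>: "0 < \<epsilon>" and \<kappa>: "\<kappa> = 2 ^ m"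
  shows "\<exists>\<delta>>0. \<forall>\<^sub>F t in \<F>. \<forall>p. part \<kappa> p \<longrightarrow> (\<forall>i\<le>\<kappa>. n2 (p i * v t - v t * p i) \<le> \<delta>) \<longrightarrow>
    (\<exists>q. part \<kappa> q \<and> joint \<kappa> p q \<and> (\<forall>s\<le>\<kappa>. tr (q s) \<le> 4 / real \<kappa>) \<and> (\<forall>s\<le>\<kappa>. n2 (q s * v' t - v' t * q s) \<le> \<epsilon>))"
proof -
  have k1: "1 \<le> real \<kappa>" by (simp add: \<kappa>)
  \<comment> \<open>For \<open>s < \<kappa>\<close> the commutator of \<open>q s\<close> with
    \<open>v' t\<close> is at most 7 \<zeta>, and the last piece inherits the sum of these. The
    2-norm of \<open>q s\<close> is within 5 \<zeta> of that of an atom, so the last piece has trace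
    at most \<open>2 * (real \<kappa> * (5 * \<zeta>))\<close>; the second bound makes this at most
    \<open>2 / real \<kappa>\<close>.\<close>
  define \<zeta> where "\<zeta> = min (\<epsilon> / (7 * real \<kappa>)) (1 / (5 * real \<kappa> * real \<kappa>))"
  have z0: "0 < \<zeta>" using \<epsilon> k1 by (simp add: \<zeta>_def)
  have z1: "real \<kappa> * (7 * \<zeta>) \<le> \<epsilon>"
  proof -
    have "\<zeta> \<le> \<epsilon> / (7 * real \<kappa>)" by (simp add: \<zeta>_def)
    then show ?thesis using k1 by (simp add: pos_le_divide_eq mult_ac)
  qed
  have z2: "real \<kappa> * (real \<kappa> * (5 * \<zeta>)) \<le> 1"
  proof -
    have "\<zeta> \<le> 1 / (5 * real \<kappa> * real \<kappa>)" by (simp add: \<zeta>_def)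
    then show ?thesis using k1 by (simp add: pos_le_divide_eq mult_ac)
  qed
  have z3: "real \<kappa> * (5 * \<zeta>) \<le> 1" "5 * \<zeta> \<le> 1"
  proof -
    have "1 * (real \<kappa> * (5 * \<zeta>)) \<le> real \<kappa> * (real \<kappa> * (5 * \<zeta>))" using k1 z0 by (intro mult_right_mono) auto
    then show a: "real \<kappa> * (5 * \<zeta>) \<le> 1" using z2 by linarith
    have "1 * (5 * \<zeta>) \<le> real \<kappa> * (5 * \<zeta>)" using k1 z0 by (intro mult_right_mono) auto
    then show "5 * \<zeta> \<le> 1" using a by linarith
  qed
  obtain \<delta>0 where d0: "0 < \<delta>0" and jp: "\<And>p e. part \<kappa> p \<Longrightarrow> \<forall>s<\<kappa>. e s \<in> M \<and> proj (e s) \<Longrightarrow>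
      \<forall>i\<le>\<kappa>. \<forall>s<\<kappa>. n2 (p i * e s - e s * p i) \<le> \<delta>0 \<Longrightarrow> \<forall>r<\<kappa>. \<forall>s<\<kappa>. r \<noteq> s \<longrightarrow> n2 (e r * e s) \<le> \<delta>0 \<Longrightarrow>
      \<exists>q. part \<kappa> q \<and> joint \<kappa> p q \<and> (\<forall>s<\<kappa>. n2 (q s - e s) \<le> \<zeta>)"
    using joint_perturb[OF z0, of \<kappa>] by blast
  \<comment> \<open>\<open>5 * \<epsilon>1\<close> will bound the commutators of \<open>p i\<close>
    and \<open>e s\<close>. \<open>12 * \<epsilon>1\<close> will bound the traces of
    \<open>e r * e s\<close>, which are squares of 2-norms and therefore compared with the square of
    \<open>\<delta>0\<close>.\<close>
  define \<epsilon>1 where "\<epsilon>1 = min (min \<zeta> 1) (min (\<delta>0 / 5) (\<delta>0\<^sup>2 / 12))"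
  have e1: "0 < \<epsilon>1" "\<epsilon>1 \<le> \<zeta>" "\<epsilon>1 \<le> 1" "5 * \<epsilon>1 \<le> \<delta>0" "12 * \<epsilon>1 \<le> \<delta>0\<^sup>2"
    using z0 d0 by (auto simp: \<epsilon>1_def min_def)
  have "\<forall>s. \<exists>F. tpoly F \<and> (\<forall>v. star (F v) = F v) \<and> n2 (F u - atom m s) \<le> \<epsilon>1 \<and>
      (\<forall>\<^sub>F t in \<F>. \<exists>e\<in>M. proj e \<and> n2 (e - F (v t)) \<le> 2 * \<epsilon>1)"
    by (intro allI projection_transfer atom_A0 atom_proj e1 v)
  then obtain F where F': "\<forall>s. tpoly (F s) \<and> (\<forall>v. star (F s v) = F s v) \<and> n2 (F s u - atom m s) \<le> \<epsilon>1 \<and>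
      (\<forall>\<^sub>F t in \<F>. \<exists>e\<in>M. proj e \<and> n2 (e - F s (v t)) \<le> 2 * \<epsilon>1)"
    by (rule exE[OF choice])
  then have F: "tpoly (F s)" "star (F s w) = F s w" "n2 (F s u - atom m s) \<le> \<epsilon>1"
    and FE: "\<forall>\<^sub>F t in \<F>. \<exists>e\<in>M. proj e \<and> n2 (e - F s (v t)) \<le> 2 * \<epsilon>1" for s w by blast+
  have FM: "F s w \<in> M" if "w \<in> M" for s w by (rule tpoly_M[OF F(1) that])
  have vt: "v t \<in> M" "unit (v t)" and lim: "1 \<le> m \<Longrightarrow> ((\<lambda>t. \<tau> (v t ^ m)) \<longlongrightarrow> 0) \<F>" for t m
    using v by (auto simp: asymp_haar_def)
  have "\<forall>s. \<exists>L\<ge>0. \<forall>w\<in>M. unit w \<longrightarrow> (\<forall>x\<in>M. n2 (x * F s w - F s w * x) \<le> L * n2 (x * w - w * x))"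
    using tpoly_commutator[OF F(1)] by blast
  then obtain L where L': "\<forall>s. L s \<ge> 0 \<and> (\<forall>w\<in>M. unit w \<longrightarrow> (\<forall>x\<in>M. n2 (x * F s w - F s w * x) \<le> L s * n2 (x * w - w * x)))"
    by (rule exE[OF choice])
  then have L: "0 \<le> L s" "w \<in> M \<Longrightarrow> unit w \<Longrightarrow> x \<in> M \<Longrightarrow> n2 (x * F s w - F s w * x) \<le> L s * n2 (x * w - w * x)" for s w x by blast+
  define Lm where "Lm = (\<Sum>s<\<kappa>. L s)"
  have Lm: "0 \<le> Lm" "s < \<kappa> \<Longrightarrow> L s \<le> Lm" for s
    unfolding Lm_def by (auto intro: sum_nonneg L(1) member_le_sum)
  define \<delta> where "\<delta> = \<epsilon>1 / (Lm + 1)"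
  have d: "0 < \<delta>" "(Lm + 1) * \<delta> = \<epsilon>1" using e1 Lm(1) by (simp_all add: \<delta>_def)
  have ev1: "\<forall>\<^sub>F t in \<F>. \<forall>s\<in>{..<\<kappa>}. \<exists>e\<in>M. proj e \<and> n2 (e - F s (v t)) \<le> 2 * \<epsilon>1"
    by (intro eventually_ball_finite ballI FE) simp
  have ev2: "\<forall>\<^sub>F t in \<F>. \<forall>r\<in>{..<\<kappa>}. \<forall>s\<in>{..<\<kappa>}. tr (F r (v t) * F s (v t)) < tr (F r u * F s u) + \<epsilon>1"
  proof (intro eventually_ball_finite ballI)
    fix r s
    have "((\<lambda>t. tr (F r (v t) * F s (v t))) \<longlongrightarrow> tr (F r u * F s u)) \<F>"
      by (rule tpoly_transfer[OF tpoly_mult[OF F(1) F(1)] vt lim])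
    then show "\<forall>\<^sub>F t in \<F>. tr (F r (v t) * F s (v t)) < tr (F r u * F s u) + \<epsilon>1"
      using e1(1) by (intro order_tendstoD) auto
  qed auto
  have ev3: "\<forall>\<^sub>F t in \<F>. \<forall>s\<in>{..<\<kappa>}. n2 (v' t * F s (v t) - F s (v t) * v' t) \<le> \<epsilon>1"
  proof (intro eventually_ball_finite ballI)
    fix s
    have "((\<lambda>t. L s * n2 (v t * v' t - v' t * v t)) \<longlongrightarrow> L s * 0) \<F>" by (intro tendsto_intros comm)
    then have "\<forall>\<^sub>F t in \<F>. L s * n2 (v t * v' t - v' t * v t) < \<epsilon>1" using e1(1) by (intro order_tendstoD) auto
    then show "\<forall>\<^sub>F t in \<F>. n2 (v' t * F s (v t) - F s (v t) * v' t) \<le> \<epsilon>1"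
    proof (rule eventually_mono)
      fix t assume "L s * n2 (v t * v' t - v' t * v t) < \<epsilon>1"
      then show "n2 (v' t * F s (v t) - F s (v t) * v' t) \<le> \<epsilon>1"
        using L(2)[OF vt v'(1), of t s t, unfolded n2_commutator_swap[OF v'(1) vt(1), of t t]] by linarith
    qed
  qed auto
  have ev4: "\<forall>\<^sub>F t in \<F>. \<forall>s\<in>{..<\<kappa>}. \<bar>n2 (F s (v t)) - n2 (F s u)\<bar> < \<epsilon>1"
  proof (intro eventually_ball_finite ballI)
    fix s
    have "((\<lambda>t. n2 (F s (v t))) \<longlongrightarrow> n2 (F s u)) \<F>" by (rule tpoly_transfer_n2[OF F(1) vt lim])
    from tendstoD[OF this e1(1)] show "\<forall>\<^sub>F t in \<F>. \<bar>n2 (F s (v t)) - n2 (F s u)\<bar> < \<epsilon>1" by (simp add: dist_real_def)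
  qed auto
  define c where "c = sqrt (1 / real \<kappa>)"
  have c: "0 \<le> c" "c * c = 1 / real \<kappa>" "c \<le> 1" using k1 by (auto simp: c_def)
  have nc: "n2 (atom m s) = c" for s
    using tr_atom[of m s] projD[OF atom_proj[of m s]] by (simp add: n2_def c_def \<kappa>)
  have Fu: "n2 (F s u) \<le> c + \<epsilon>1" "c \<le> n2 (F s u) + \<epsilon>1" for s
    using n2_le_add[OF FM[OF uM] atom_M, of s m s] n2_le_add[OF atom_M FM[OF uM], of m s s]
      n2_minus_commute[OF atom_M FM[OF uM], of m s s] F(3)[of s] nc[of s] by linarith+
  have trFu: "tr (F r u * F s u) \<le> 3 * \<epsilon>1" if rs: "r < \<kappa>" "s < \<kappa>" "r \<noteq> s" for r s
  proof -
    let ?p = "atom m"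
    have "F r u * F s u = (F r u - ?p r) * F s u + (?p r * (F s u - ?p s) + ?p r * ?p s)" by (simp add: algebra_simps)
    also have "?p r * ?p s = 0" using atom_orth[of r m s] rs by (simp add: \<kappa>)
    finally have "tr (F r u * F s u) = tr ((F r u - ?p r) * F s u) + tr (?p r * (F s u - ?p s))"
      by (simp add: tr_add M_closed FM uM atom_M)
    moreover have "\<bar>tr ((F r u - ?p r) * F s u)\<bar> \<le> n2 (F r u - ?p r) * n2 (F s u)"
      by (intro tr_mult_le M_closed FM uM atom_M) (simp add: star_diff F projD[OF atom_proj])
    moreover have "\<bar>tr (?p r * (F s u - ?p s))\<bar> \<le> n2 (?p r) * n2 (F s u - ?p s)"
      by (intro tr_mult_le M_closed FM uM atom_M projD atom_proj)
    moreover have "n2 (F r u - ?p r) * n2 (F s u) \<le> \<epsilon>1 * 2"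
      using F(3) Fu(1)[of s] c e1 by (intro mult_mono) auto
    moreover have "n2 (?p r) * n2 (F s u - ?p s) \<le> 1 * \<epsilon>1"
      using F(3) nc c by (intro mult_mono) auto
    ultimately show ?thesis by linarith
  qed
  show ?thesis
  proof (intro exI[of _ \<delta>] conjI d)
    show "\<forall>\<^sub>F t in \<F>. \<forall>p. part \<kappa> p \<longrightarrow> (\<forall>i\<le>\<kappa>. n2 (p i * v t - v t * p i) \<le> \<delta>) \<longrightarrow>
      (\<exists>q. part \<kappa> q \<and> joint \<kappa> p q \<and> (\<forall>s\<le>\<kappa>. tr (q s) \<le> 4 / real \<kappa>) \<and> (\<forall>s\<le>\<kappa>. n2 (q s * v' t - v' t * q s) \<le> \<epsilon>))"
    proof (rule eventually_mono[OF eventually_conj[OF eventually_conj[OF ev1 ev2] eventually_conj[OF ev3 ev4]]], intro allI impI)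
      fix t p
      assume ev: "((\<forall>s\<in>{..<\<kappa>}. \<exists>e\<in>M. proj e \<and> n2 (e - F s (v t)) \<le> 2 * \<epsilon>1) \<and>
          (\<forall>r\<in>{..<\<kappa>}. \<forall>s\<in>{..<\<kappa>}. tr (F r (v t) * F s (v t)) < tr (F r u * F s u) + \<epsilon>1)) \<and>
          (\<forall>s\<in>{..<\<kappa>}. n2 (v' t * F s (v t) - F s (v t) * v' t) \<le> \<epsilon>1) \<and>
          (\<forall>s\<in>{..<\<kappa>}. \<bar>n2 (F s (v t)) - n2 (F s u)\<bar> < \<epsilon>1)"
        and p: "part \<kappa> p" and pc: "\<forall>i\<le>\<kappa>. n2 (p i * v t - v t * p i) \<le> \<delta>"
      define G where "G s = F s (v t)" for s
      have GM: "G s \<in> M" and sG: "star (G s) = G s" for s by (simp_all add: G_def FM vt F)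
      from ev have "\<forall>s\<in>{..<\<kappa>}. \<exists>e\<in>M. proj e \<and> n2 (e - G s) \<le> 2 * \<epsilon>1" by (simp add: G_def)
      then have "\<forall>s. \<exists>e. s < \<kappa> \<longrightarrow> e \<in> M \<and> proj e \<and> n2 (e - G s) \<le> 2 * \<epsilon>1" by blast
      then obtain e where "\<forall>s. s < \<kappa> \<longrightarrow> e s \<in> M \<and> proj (e s) \<and> n2 (e s - G s) \<le> 2 * \<epsilon>1"
        by (rule exE[OF choice])
      then have e: "e s \<in> M" "proj (e s)" "n2 (e s - G s) \<le> 2 * \<epsilon>1" if "s < \<kappa>" for s using that by auto
      have GG: "tr (G r * G s) < tr (F r u * F s u) + \<epsilon>1" if "r < \<kappa>" "s < \<kappa>" for r s using ev that by (simp add: G_def)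
      have Gv: "n2 (v' t * G s - G s * v' t) \<le> \<epsilon>1" if "s < \<kappa>" for s using ev that by (simp add: G_def)
      have Gn: "\<bar>n2 (G s) - n2 (F s u)\<bar> < \<epsilon>1" if "s < \<kappa>" for s using ev that by (simp add: G_def)
      have ne: "n2 (e s) \<le> c + 4 * \<epsilon>1" "c \<le> n2 (e s) + 4 * \<epsilon>1" if s: "s < \<kappa>" for s
        using n2_le_add[OF e(1)[OF s] GM[of s]] n2_le_add[OF GM[of s] e(1)[OF s]] n2_minus_commute[OF e(1)[OF s] GM[of s]]
          e(3)[OF s] Gn[OF s] Fu[of s] by linarith+
      have tre: "tr (e r * e s) \<le> 12 * \<epsilon>1" if rs: "r < \<kappa>" "s < \<kappa>" "r \<noteq> s" for r s
      proof -
        note er = e[OF rs(1)] and es = e[OF rs(2)]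
        have "e r * e s = e r * (e s - G s) + ((e r - G r) * G s + G r * G s)" by (simp add: algebra_simps)
        then have "tr (e r * e s) = tr (e r * (e s - G s)) + (tr ((e r - G r) * G s) + tr (G r * G s))"
          by (simp add: tr_add M_closed GM er es)
        moreover have "\<bar>tr (e r * (e s - G s))\<bar> \<le> n2 (e r) * n2 (e s - G s)"
          by (intro tr_mult_le M_closed GM er es projD)
        moreover have "n2 (e r) * n2 (e s - G s) \<le> 1 * (2 * \<epsilon>1)"
          using n2_proj_le_one[OF er(1,2)] es(3) by (intro mult_mono) auto
        moreover have "\<bar>tr ((e r - G r) * G s)\<bar> \<le> n2 (e r - G r) * n2 (G s)"
          by (intro tr_mult_le M_closed GM er) (simp add: star_diff sG projD[OF er(2)])
        moreover have "n2 (e r - G r) * n2 (G s) \<le> (2 * \<epsilon>1) * 3"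
          using Gn[OF rs(2)] Fu(1)[of s] er(3) c e1 by (intro mult_mono) auto
        ultimately show ?thesis using GG[OF rs(1,2)] trFu[OF rs] by linarith
      qed
      have oe: "n2 (e r * e s) \<le> \<delta>0" if rs: "r < \<kappa>" "s < \<kappa>" "r \<noteq> s" for r s
      proof (rule power2_le_imp_le)
        note er = e[OF rs(1)] and es = e[OF rs(2)]
        have "star (e r * e s) * (e r * e s) = e s * ((e r * e r) * e s)" by (simp only: star_mult projD(1)[OF er(2)] projD(1)[OF es(2)] mult.assoc)
        also have "\<dots> = e s * (e r * e s)" by (simp add: projD[OF er(2)])
        finally have "(n2 (e r * e s))\<^sup>2 = tr (e s * (e r * e s))" by (simp add: n2_sq M_mult er es)
        also have "\<dots> = tr (e r * e s * e s)" by (rule tr_comm) (intro M_mult er es)+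
        also have "\<dots> = tr (e r * e s)" by (simp add: mult.assoc projD[OF es(2)])
        also have "\<dots> \<le> \<delta>0\<^sup>2" using tre[OF rs] e1(5) by linarith
        finally show "(n2 (e r * e s))\<^sup>2 \<le> \<delta>0\<^sup>2" .
      qed (use d0 in simp)
      have ce: "n2 (p i * e s - e s * p i) \<le> \<delta>0" if i: "i \<le> \<kappa>" and s: "s < \<kappa>" for i s
      proof -
        note pi = partD(1,2)[OF p i]
        have "n2 (e s * p i - p i * e s) \<le> n2 (G s * p i - p i * G s) + 2 * n2 (e s - G s)"
          by (intro n2_commutator_perturb e s GM pi proj_norm)
        moreover have "n2 (p i * G s - G s * p i) \<le> L s * n2 (p i * v t - v t * p i)" unfolding G_def by (rule L(2)[OF vt pi(1)])
        moreover have "L s * n2 (p i * v t - v t * p i) \<le> (Lm + 1) * \<delta>"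
          using pc i Lm(2)[OF s] Lm(1) L(1)[of s] by (intro mult_mono) auto
        ultimately have "n2 (e s * p i - p i * e s) \<le> 5 * \<epsilon>1"
          using n2_commutator_swap[OF GM pi(1), of s] e(3)[OF s] d(2) by linarith
        then show ?thesis using n2_commutator_swap[OF e(1)[OF s] pi(1)] e1(4) by linarith
      qed
      obtain q where q: "part \<kappa> q" "joint \<kappa> p q" "\<And>s. s < \<kappa> \<Longrightarrow> n2 (q s - e s) \<le> \<zeta>"
        using jp[of p e] p e(1,2) ce oe by blast
      note Q = partD[OF q(1)]
      have qc: "n2 (q s * v' t - v' t * q s) \<le> 7 * \<zeta>" if s: "s < \<kappa>" for s
      proof -
        have "n2 (q s * v' t - v' t * q s) \<le> n2 (e s * v' t - v' t * e s) + 2 * n2 (q s - e s)"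
          by (intro n2_commutator_perturb Q e s v' unit_norm less_imp_le[OF s])
        moreover have "n2 (e s * v' t - v' t * e s) \<le> n2 (G s * v' t - v' t * G s) + 2 * n2 (e s - G s)"
          by (intro n2_commutator_perturb GM e s v' unit_norm)
        ultimately show ?thesis
          using q(3)[OF s] e(3)[OF s] Gv[OF s] n2_commutator_swap[OF GM v'(1), of s t] e1(2) by linarith
      qed
      have nq: "n2 (q s) \<le> c + 5 * \<zeta>" "c \<le> n2 (q s) + 5 * \<zeta>" if s: "s < \<kappa>" for s
        using n2_le_add[OF Q(1)[OF less_imp_le[OF s]] e(1)[OF s]] n2_le_add[OF e(1)[OF s] Q(1)[OF less_imp_le[OF s]]]
          n2_minus_commute[OF Q(1)[OF less_imp_le[OF s]] e(1)[OF s]] q(3)[OF s] ne[OF s] e1(2) by linarith+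
      have trq: "tr (q s) = n2 (q s) * n2 (q s)" if "s \<le> \<kappa>" for s
        using n2_sq[OF Q(1)[OF that]] projD[OF Q(2)[OF that]] by (simp add: power2_eq_square)
      have c5: "5 * \<zeta> \<le> c"
      proof (rule power2_le_imp_le)
        have "5 * \<zeta> * (5 * \<zeta>) \<le> 1 * (5 * \<zeta>)" using z3 z0 by (intro mult_right_mono) auto
        moreover have "5 * \<zeta> \<le> 1 / real \<kappa>" using z3(1) k1 by (simp add: pos_le_divide_eq mult.commute)
        ultimately show "(5 * \<zeta>)\<^sup>2 \<le> c\<^sup>2" unfolding power2_eq_square c(2) by linarith
      qed (rule c)
      \<comment> \<open>The 2-norm of \<open>q s\<close> is at most \<open>c + 5 * \<zeta>\<close>,
        hence at most twice the 2-norm \<open>c\<close> of an atom; squaring gives the 4.\<close>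
      have small1: "tr (q s) \<le> 4 / real \<kappa>" if s: "s < \<kappa>" for s
      proof -
        have "n2 (q s) * n2 (q s) \<le> (2 * c) * (2 * c)" using nq(1)[OF s] c5 c(1) by (intro mult_mono) auto
        then show ?thesis using trq[of s] s c(2) by (simp add: mult_ac)
      qed
      have low: "1 / real \<kappa> - 2 * (5 * \<zeta>) \<le> tr (q s)" if s: "s < \<kappa>" for s
      proof -
        have "(c - 5 * \<zeta>) * (c - 5 * \<zeta>) \<le> n2 (q s) * n2 (q s)" using nq(2)[OF s] c5 by (intro mult_mono) auto
        moreover have "(c - 5 * \<zeta>) * (c - 5 * \<zeta>) = c * c - 2 * (c * (5 * \<zeta>)) + (5 * \<zeta>) * (5 * \<zeta>)" by (simp add: algebra_simps)
        moreover have "c * (5 * \<zeta>) \<le> 1 * (5 * \<zeta>)" using c z0 by (intro mult_right_mono) auto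
        moreover have "0 \<le> (5 * \<zeta>) * (5 * \<zeta>)" by simp
        ultimately show ?thesis using trq[of s] s c(2) by linarith
      qed
      have qsum: "(\<Sum>s<\<kappa>. q s) + q \<kappa> = 1" using Q(5) by (simp add: lessThan_Suc_atMost[symmetric])
      have smallk: "tr (q \<kappa>) \<le> 4 / real \<kappa>"
      proof -
        have "tr ((\<Sum>s<\<kappa>. q s) + q \<kappa>) = (\<Sum>s<\<kappa>. tr (q s)) + tr (q \<kappa>)"
          by (subst tr_add, intro M_sum Q(1), simp, intro Q(1), simp, subst tr_sum, intro Q(1), auto)
        then have "tr (q \<kappa>) = 1 - (\<Sum>s<\<kappa>. tr (q s))" using qsum by simp
        moreover have "(\<Sum>s<\<kappa>. 1 / real \<kappa> - 2 * (5 * \<zeta>)) \<le> (\<Sum>s<\<kappa>. tr (q s))" by (intro sum_mono low) simp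
        moreover have "(\<Sum>s<\<kappa>. 1 / real \<kappa> - 2 * (5 * \<zeta>)) = 1 - 2 * (real \<kappa> * (5 * \<zeta>))"
          using k1 by (simp add: algebra_simps)
        moreover have "real \<kappa> * (5 * \<zeta>) \<le> 1 / real \<kappa>" using z2 k1 by (simp add: pos_le_divide_eq mult_ac)
        ultimately have "tr (q \<kappa>) \<le> 2 * (1 / real \<kappa>)" by linarith
        also have "\<dots> \<le> 4 / real \<kappa>" using k1 by (simp add: divide_right_mono)
        finally show ?thesis .
      qed
      have ck: "n2 (q \<kappa> * v' t - v' t * q \<kappa>) \<le> \<epsilon>"
      proof -
        have "q \<kappa> = 1 - (\<Sum>s<\<kappa>. q s)" using qsum by (simp add: algebra_simps)
        then have "v' t * q \<kappa> - q \<kappa> * v' t = (\<Sum>s<\<kappa>. q s * v' t - v' t * q s)"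
          by (simp add: left_diff_distrib right_diff_distrib sum_distrib_left sum_distrib_right sum_subtractf)
        then have "n2 (v' t * q \<kappa> - q \<kappa> * v' t) \<le> (\<Sum>s<\<kappa>. n2 (q s * v' t - v' t * q s))"
          using n2_sum[of "{..<\<kappa>}" "\<lambda>s. q s * v' t - v' t * q s"] Q(1) v'(1) by (simp add: M_closed)
        also have "\<dots> \<le> (\<Sum>s<\<kappa>. 7 * \<zeta>)" by (intro sum_mono) (simp add: qc)
        also have "\<dots> \<le> \<epsilon>" using z1 by simp
        finally show ?thesis using n2_commutator_swap[OF v'(1) Q(1)[OF order_refl], of t] by linarith
      qed
      have "7 * \<zeta> \<le> \<epsilon>"
      proof -
        have "1 * (7 * \<zeta>) \<le> real \<kappa> * (7 * \<zeta>)" using k1 z0 by (intro mult_right_mono) auto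
        then show ?thesis using z1 by linarith
      qed
      then have "n2 (q s * v' t - v' t * q s) \<le> \<epsilon>" if "s \<le> \<kappa>" for s
        using that ck qc[of s] by (cases "s = \<kappa>") auto
      moreover have "tr (q s) \<le> 4 / real \<kappa>" if "s \<le> \<kappa>" for s
        using that smallk small1[of s] by (cases "s = \<kappa>") auto
      ultimately show "\<exists>q. part \<kappa> q \<and> joint \<kappa> p q \<and> (\<forall>s\<le>\<kappa>. tr (q s) \<le> 4 / real \<kappa>) \<and> (\<forall>s\<le>\<kappa>. n2 (q s * v' t - v' t * q s) \<le> \<epsilon>)"
        using q(1,2) by blast
    qed
  qed
qed

text \<open>Pads the atoms by a zero piece at index \<open>2 ^ m\<close>, since a
  \<open>part\<close> has one piece more than there are atoms.\<close>

definition base :: "nat \<Rightarrow> nat \<Rightarrow> 'h bop" where "base m i = (if i < 2 ^ m then atom m i else 0)"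

text \<open>This is all that the diagonalisation has to know about a step of the chain; the
  unitaries themselves have disappeared from it.\<close>

definition jrel :: "nat \<Rightarrow> (nat \<Rightarrow> 'h bop) \<Rightarrow> (nat \<Rightarrow> 'h bop) \<Rightarrow> bool" where
  "jrel m p q \<longleftrightarrow> part (2 ^ m) q \<and> joint (2 ^ m) p q \<and> (\<forall>s\<le>2 ^ m. tr (q s) \<le> 4 / 2 ^ m)"

lemma base_part: "part (2 ^ m) (base m)"
  unfolding part_def
proof (intro conjI allI impI)
  fix i assume "i \<le> (2::nat) ^ m"
  show "base m i \<in> M" "proj (base m i)" using atom_proj[of m i] by (auto simp: base_def atom_M M_zero proj_def)
  have "dyadic (1 / 2 ^ m)" unfolding dyadic_def by (intro exI[of _ 1] exI[of _ m]) simp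
  then show "dyadic (tr (base m i))" by (simp add: base_def tr_atom dyadic_zero)
  fix j assume "j \<le> (2::nat) ^ m" "i \<noteq> j"
  then show "base m i * base m j = 0" by (simp add: base_def atom_orth)
next
  have "(\<Sum>i\<le>2 ^ m. base m i) = (\<Sum>i<2 ^ m. base m i) + base m (2 ^ m)" by (simp add: lessThan_Suc_atMost[symmetric])
  also have "\<dots> = (\<Sum>i<2 ^ m. atom m i)" by (simp add: base_def)
  finally show "(\<Sum>i\<le>2 ^ m. base m i) = 1" by (simp add: atom_sum)
qed

text \<open>Tolerances run backwards: step \<open>l\<close> must reach the \<delta> that the
  following step asks for, hence the induction for arbitrary \<epsilon>. The index is shifted by one
  because the atoms of \<open>u\<close> already almost commute with
  \<open>v (Suc 0)\<close>.\<close>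

lemma chain:
  assumes v: "\<And>l. l \<le> k \<Longrightarrow> asymp_haar \<F> (v l)" and v0: "v 0 = (\<lambda>t. u)"
    and comm: "\<And>l. l < k \<Longrightarrow> ((\<lambda>t. n2 (v l t * v (Suc l) t - v (Suc l) t * v l t)) \<longlongrightarrow> 0) \<F>"
  shows "l < k \<Longrightarrow> 0 < \<epsilon> \<Longrightarrow> \<forall>\<^sub>F t in \<F>. \<exists>P. (jrel m ^^ l) (base m) P \<and> part (2 ^ m) P \<and>
    (\<forall>s\<le>2 ^ m. n2 (P s * v (Suc l) t - v (Suc l) t * P s) \<le> \<epsilon>)"
proof (induction l arbitrary: \<epsilon>)
  case 0
  have v1: "v (Suc 0) t \<in> M" "unit (v (Suc 0) t)" for t using v[of "Suc 0"] 0 by (auto simp: asymp_haar_def)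
  have "\<forall>\<^sub>F t in \<F>. \<forall>s\<in>{..<2 ^ m}. n2 (atom m s * v (Suc 0) t - v (Suc 0) t * atom m s) \<le> \<epsilon>"
  proof (intro eventually_ball_finite ballI)
    fix s
    have "0 < \<epsilon> / 4" using 0 by simp
    then obtain F where F: "tpoly F" "F u \<in> M" "n2 (F u - atom m s) < \<epsilon> / 4" using A0D[OF atom_A0] by blast
    obtain L where L: "0 \<le> L" "\<And>x. x \<in> M \<Longrightarrow> n2 (x * F u - F u * x) \<le> L * n2 (x * u - u * x)"
      using tpoly_commutator[OF F(1)] uM uunit by blast
    have "((\<lambda>t. L * n2 (v 0 t * v (Suc 0) t - v (Suc 0) t * v 0 t)) \<longlongrightarrow> L * 0) \<F>" by (intro tendsto_intros comm 0)
    then have "\<forall>\<^sub>F t in \<F>. L * n2 (u * v (Suc 0) t - v (Suc 0) t * u) < \<epsilon> / 2"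
      using 0 unfolding v0 by (intro order_tendstoD) auto
    then show "\<forall>\<^sub>F t in \<F>. n2 (atom m s * v (Suc 0) t - v (Suc 0) t * atom m s) \<le> \<epsilon>"
    proof (rule eventually_mono)
      fix t assume t: "L * n2 (u * v (Suc 0) t - v (Suc 0) t * u) < \<epsilon> / 2"
      have "n2 (atom m s * v (Suc 0) t - v (Suc 0) t * atom m s) \<le> n2 (F u * v (Suc 0) t - v (Suc 0) t * F u) + 2 * n2 (atom m s - F u)"
        by (intro n2_commutator_perturb atom_M F v1 unit_norm)
      then show "n2 (atom m s * v (Suc 0) t - v (Suc 0) t * atom m s) \<le> \<epsilon>"
        using L(2)[OF v1(1), of t, unfolded n2_commutator_swap[OF v1(1) uM, of t]] t F(3) n2_minus_commute[OF atom_M F(2), of m s]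
          n2_commutator_swap[OF F(2) v1(1), of t] by linarith
    qed
  qed auto
  then show ?case
  proof (rule eventually_mono)
    fix t assume t: "\<forall>s\<in>{..<2 ^ m}. n2 (atom m s * v (Suc 0) t - v (Suc 0) t * atom m s) \<le> \<epsilon>"
    have "n2 (base m s * v (Suc 0) t - v (Suc 0) t * base m s) \<le> \<epsilon>" for s using t 0 by (auto simp: base_def)
    then show "\<exists>P. (jrel m ^^ 0) (base m) P \<and> part (2 ^ m) P \<and> (\<forall>s\<le>2 ^ m. n2 (P s * v (Suc 0) t - v (Suc 0) t * P s) \<le> \<epsilon>)"
      using base_part by auto
  qed
next
  case (Suc l)
  have vl: "asymp_haar \<F> (v (Suc l))" by (rule v) (use Suc.prems in simp)
  have v2: "v (Suc (Suc l)) t \<in> M" "unit (v (Suc (Suc l)) t)" for t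
    using v[of "Suc (Suc l)"] Suc.prems by (auto simp: asymp_haar_def)
  obtain \<delta> where d: "0 < \<delta>" and ev: "\<forall>\<^sub>F t in \<F>. \<forall>p. part (2 ^ m) p \<longrightarrow> (\<forall>i\<le>2 ^ m. n2 (p i * v (Suc l) t - v (Suc l) t * p i) \<le> \<delta>) \<longrightarrow>
      (\<exists>q. part (2 ^ m) q \<and> joint (2 ^ m) p q \<and> (\<forall>s\<le>2 ^ m. tr (q s) \<le> 4 / real (2 ^ m)) \<and>
        (\<forall>s\<le>2 ^ m. n2 (q s * v (Suc (Suc l)) t - v (Suc (Suc l)) t * q s) \<le> \<epsilon>))"
    using step[OF vl v2 comm[OF Suc.prems(1)] Suc.prems(2) refl] by blast
  have "\<forall>\<^sub>F t in \<F>. \<exists>P. (jrel m ^^ l) (base m) P \<and> part (2 ^ m) P \<and> (\<forall>s\<le>2 ^ m. n2 (P s * v (Suc l) t - v (Suc l) t * P s) \<le> \<delta>)"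
    by (rule Suc.IH[OF _ d]) (use Suc.prems in simp)
  from eventually_conj[OF this ev] show ?case
  proof (rule eventually_mono)
    fix t
    assume A: "(\<exists>P. (jrel m ^^ l) (base m) P \<and> part (2 ^ m) P \<and> (\<forall>s\<le>2 ^ m. n2 (P s * v (Suc l) t - v (Suc l) t * P s) \<le> \<delta>)) \<and>
      (\<forall>p. part (2 ^ m) p \<longrightarrow> (\<forall>i\<le>2 ^ m. n2 (p i * v (Suc l) t - v (Suc l) t * p i) \<le> \<delta>) \<longrightarrow>
      (\<exists>q. part (2 ^ m) q \<and> joint (2 ^ m) p q \<and> (\<forall>s\<le>2 ^ m. tr (q s) \<le> 4 / real (2 ^ m)) \<and>
        (\<forall>s\<le>2 ^ m. n2 (q s * v (Suc (Suc l)) t - v (Suc (Suc l)) t * q s) \<le> \<epsilon>)))"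
    then obtain P where P: "(jrel m ^^ l) (base m) P" "part (2 ^ m) P" "\<forall>s\<le>2 ^ m. n2 (P s * v (Suc l) t - v (Suc l) t * P s) \<le> \<delta>" by blast
    obtain q where q: "part (2 ^ m) q" "joint (2 ^ m) P q" "\<forall>s\<le>2 ^ m. tr (q s) \<le> 4 / real (2 ^ m)"
      "\<forall>s\<le>2 ^ m. n2 (q s * v (Suc (Suc l)) t - v (Suc (Suc l)) t * q s) \<le> \<epsilon>"
      using conjunct2[OF A, rule_format, OF P(2)] P(3) by blast
    have "jrel m P q" using q by (simp add: jrel_def)
    then have "(jrel m ^^ Suc l) (base m) q" using P(1) by (rule relpowp_Suc_I[rotated])
    then show "\<exists>P. (jrel m ^^ Suc l) (base m) P \<and> part (2 ^ m) P \<and> (\<forall>s\<le>2 ^ m. n2 (P s * v (Suc (Suc l)) t - v (Suc (Suc l)) t * P s) \<le> \<epsilon>)"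
      using q(1,4) by blast
  qed
qed

text \<open>The pinching of \<open>w\<close> along \<open>P\<close>. It is a contraction because
  \<open>1 - star x * x\<close> is the sum of the positive operators
  \<open>P s * (1 - star w * P s * w) * P s\<close>.\<close>

lemma block_diagonal_approx:
  assumes P: "part \<kappa> P" and w: "w \<in> M" "norm w \<le> 1" and e: "\<And>s. s \<le> \<kappa> \<Longrightarrow> n2 (P s * w - w * P s) \<le> \<epsilon>"
  obtains x where "x \<in> M" "norm x \<le> 1" "n2 (x - w) \<le> (real \<kappa> + 1) * \<epsilon>" "\<And>s. s \<le> \<kappa> \<Longrightarrow> P s * x = x * P s"
proof -
  note Q = partD[OF P]
  define x where "x = (\<Sum>s\<le>\<kappa>. P s * w * P s)"
  have xM: "x \<in> M" unfolding x_def by (intro M_sum M_mult Q(1) w) auto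
  have Px: "P s * x = P s * w * P s" "x * P s = P s * w * P s" if s: "s \<le> \<kappa>" for s
  proof -
    have "P s * x = (\<Sum>r\<le>\<kappa>. if r = s then P s * w * P s else 0)" unfolding x_def sum_distrib_left
    proof (rule sum.cong)
      fix r assume "r \<in> {..\<kappa>}"
      then show "P s * (P r * w * P r) = (if r = s then P s * w * P s else 0)"
        using Q(4)[OF s, of r] projD[OF Q(2)[OF s]] by (auto simp flip: mult.assoc)
    qed simp
    then show "P s * x = P s * w * P s" using s by simp
    have "x * P s = (\<Sum>r\<le>\<kappa>. if r = s then P s * w * P s else 0)" unfolding x_def sum_distrib_right
    proof (rule sum.cong)
      fix r assume "r \<in> {..\<kappa>}"
      then show "P r * w * P r * P s = (if r = s then P s * w * P s else 0)"
        using Q(4)[OF _ s, of r] projD[OF Q(2)[OF s]] by (auto simp: mult.assoc)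
    qed simp
    then show "x * P s = P s * w * P s" using s by simp
  qed
  have "norm x \<le> 1"
  proof (rule norm_bop_bound)
    fix \<xi>
    have "star x * x = (\<Sum>s\<le>\<kappa>. P s * star w * P s * w * P s)"
    proof -
      have "star x = (\<Sum>s\<le>\<kappa>. P s * star w * P s)"
        unfolding x_def star_sum by (rule sum.cong) (auto simp: star_mult projD[OF Q(2)] mult.assoc)
      then have "star x * x = (\<Sum>s\<le>\<kappa>. P s * star w * (P s * x))" by (simp add: sum_distrib_right mult.assoc)
      also have "\<dots> = (\<Sum>s\<le>\<kappa>. P s * star w * P s * w * P s)" by (rule sum.cong) (auto simp: Px mult.assoc)
      finally show ?thesis .
    qed
    moreover have "(1::'h bop) = (\<Sum>s\<le>\<kappa>. P s * P s)" using Q(5) projD(2)[OF Q(2)] by simp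
    ultimately have "1 - star x * x = (\<Sum>s\<le>\<kappa>. star (P s) * (1 - star w * P s * w) * P s)"
      using projD(1)[OF Q(2)] by (simp add: left_diff_distrib right_diff_distrib sum_subtractf mult.assoc)
    moreover have "pos (1 - star w * P s * w)" if s: "s \<le> \<kappa>" for s
    proof -
      have "norm (star w * P s * w) \<le> 1"
      proof -
        have "norm (star w * P s) \<le> 1" using proj_mult_le(2)[OF Q(2)[OF s], of "star w"] w(2) by simp
        then show ?thesis using norm_mult_ineq[of "star w * P s" w] mult_mono[of "norm (star w * P s)" 1 "norm w" 1] w(2) by simp
      qed
      moreover have "star (star w * P s * w) = star w * P s * w" by (simp add: star_mult projD[OF Q(2)[OF s]] mult.assoc)
      ultimately show ?thesis using pos_norm_bound_diff[of "star w * P s * w" 1] by simp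
    qed
    ultimately have "pos (1 - star x * x)" by (simp only:) (intro pos_sum pos_conj, simp)
    from posD(2)[OF this, of \<xi>] have "(norm (x \<triangleright> \<xi>))\<^sup>2 \<le> (norm \<xi>)\<^sup>2"
      using cinner_star[of "star x" "x \<triangleright> \<xi>" \<xi>] by (simp add: ap_linear cinner_linear)
    then show "norm (x \<triangleright> \<xi>) \<le> 1 * norm \<xi>" by (simp add: power2_le_iff_abs_le)
  qed simp
  moreover have "n2 (x - w) \<le> (real \<kappa> + 1) * \<epsilon>"
  proof -
    have "w = (\<Sum>s\<le>\<kappa>. w * (P s * P s))" using Q(5) projD(2)[OF Q(2)] by (simp flip: sum_distrib_left)
    then have "x - w = (\<Sum>s\<le>\<kappa>. (P s * w - w * P s) * P s)"
      by (simp add: x_def left_diff_distrib sum_subtractf mult.assoc)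
    then have "n2 (x - w) \<le> (\<Sum>s\<le>\<kappa>. n2 ((P s * w - w * P s) * P s))"
      using n2_sum[of "{..\<kappa>}" "\<lambda>s. (P s * w - w * P s) * P s"] Q(1) w(1) by (simp add: M_closed)
    also have "\<dots> \<le> (\<Sum>s\<le>\<kappa>. \<epsilon>)"
    proof (rule sum_mono)
      fix s assume "s \<in> {..\<kappa>}"
      then have s: "s \<le> \<kappa>" by simp
      have "n2 ((P s * w - w * P s) * P s) \<le> n2 (P s * w - w * P s)"
        by (intro n2_mult_right_le M_closed Q(1)[OF s] w proj_norm Q(2)[OF s])
      then show "n2 ((P s * w - w * P s) * P s) \<le> \<epsilon>" using e[OF s] by linarith
    qed
    finally show ?thesis by (simp add: algebra_simps)
  qed
  ultimately show ?thesis using that[of x] xM Px by simp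
qed

text \<open>The last member of the chain is the constant \<open>w\<close>, so a single
  \<open>t\<close> at which the estimates hold suffices; such a \<open>t\<close> exists as the
  filter is proper.\<close>

lemma run_exists:
  assumes nb: "\<F> \<noteq> bot" and v: "\<And>l. l \<le> Suc k \<Longrightarrow> asymp_haar \<F> (v l)" and v0: "v 0 = (\<lambda>t. u)" and vk: "v (Suc k) = (\<lambda>t. w)"
    and comm: "\<And>l. l < Suc k \<Longrightarrow> ((\<lambda>t. n2 (v l t * v (Suc l) t - v (Suc l) t * v l t)) \<longlongrightarrow> 0) \<F>" and e: "0 < \<epsilon>"
  obtains P x where "(jrel m ^^ k) (base m) P" "part (2 ^ m) P" "x \<in> M" "norm x \<le> 1" "n2 (x - w) \<le> \<epsilon>"
    "\<And>s. s \<le> 2 ^ m \<Longrightarrow> P s * x = x * P s"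
proof -
  have w: "w \<in> M" "unit w" using v[of "Suc k"] by (simp_all add: asymp_haar_def vk)
  define \<eta> where "\<eta> = \<epsilon> / (real (2 ^ m) + 1)"
  have h: "0 < \<eta>" "(real (2 ^ m) + 1) * \<eta> = \<epsilon>" using e by (simp_all add: \<eta>_def add_nonneg_eq_0_iff add_nonneg_pos)
  have "\<forall>\<^sub>F t in \<F>. \<exists>P. (jrel m ^^ k) (base m) P \<and> part (2 ^ m) P \<and> (\<forall>s\<le>2 ^ m. n2 (P s * v (Suc k) t - v (Suc k) t * P s) \<le> \<eta>)"
    by (rule chain[OF v v0 comm _ h(1)]) auto
  then obtain P where P: "(jrel m ^^ k) (base m) P" "part (2 ^ m) P" "\<And>s. s \<le> 2 ^ m \<Longrightarrow> n2 (P s * w - w * P s) \<le> \<eta>"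
    using eventually_happens'[OF nb] unfolding vk by blast
  obtain x where "x \<in> M" "norm x \<le> 1" "n2 (x - w) \<le> (real (2 ^ m) + 1) * \<eta>" "\<And>s. s \<le> 2 ^ m \<Longrightarrow> P s * x = x * P s"
    by (rule block_diagonal_approx[OF P(2) w(1) unit_norm[OF w(2)] P(3)], assumption, rule that)
  then show ?thesis using that[OF P(1,2)] unfolding h(2) by blast
qed

end

section \<open>Diagonalisation along the tower\<close>

lemma unit_cancel: "unit T \<Longrightarrow> star T * (T * z) = z" "unit T \<Longrightarrow> T * (star T * z) = z"
  by (simp_all add: unit_def flip: mult.assoc)

lemma unit_eqs: "unit T \<Longrightarrow> star T * T = 1" "unit T \<Longrightarrow> T * star T = 1"
  by (simp_all add: unit_def)

lemma unit_conj_commute: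
  assumes T: "unit T" and S: "S * (T * x * star T) = T * x * star T * S"
  shows "star T * S * T * x = x * (star T * S * T)"
proof -
  have "star T * S * T * x = star T * (S * (T * x * star T)) * T"
    by (simp add: mult.assoc unit_eqs[OF T])
  also have "\<dots> = x * (star T * S * T)" unfolding S by (simp add: mult.assoc unit_cancel[OF T])
  finally show ?thesis .
qed

lemma unit_commute_star: "unit T \<Longrightarrow> S * T = T * S \<Longrightarrow> S * star T = star T * S"
proof -
  assume T: "unit T" and S: "S * T = T * S"
  have "S * star T = star T * (T * S) * star T" by (simp add: mult.assoc unit_cancel[OF T])
  also have "\<dots> = star T * S" unfolding S[symmetric] by (simp add: mult.assoc unit_eqs[OF T])
  finally show ?thesis .
qed

lemma split_function:
  fixes N :: "nat \<Rightarrow> nat"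
  assumes A: "finite A" "card A = (\<Sum>i\<le>\<kappa>. N i)"
  shows "\<exists>\<psi>. (\<forall>a\<in>A. \<psi> a \<le> \<kappa>) \<and> (\<forall>i\<le>\<kappa>. card {a \<in> A. \<psi> a = i} = N i)"
proof -
  define B where "B = Sigma {..\<kappa>} (\<lambda>i. {..<N i})"
  have "finite B" "card A = card B" by (simp_all add: B_def A)
  then obtain h where h: "bij_betw h A B" using finite_same_card_bij[OF A(1)] by blast
  have 1: "fst (h a) \<le> \<kappa>" if "a \<in> A" for a using bij_betwE[OF h] that by (auto simp: B_def)
  have "card {a \<in> A. fst (h a) = i} = N i" if i: "i \<le> \<kappa>" for i
  proof -
    have inj: "inj_on h {a \<in> A. fst (h a) = i}" using bij_betw_imp_inj_on[OF h] by (rule inj_on_subset) auto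
    have "h ` {a \<in> A. fst (h a) = i} = {b \<in> h ` A. fst b = i}" by auto
    also have "\<dots> = {i} \<times> {..<N i}" using i by (auto simp: bij_betw_imp_surj_on[OF h] B_def)
    finally show ?thesis using card_image[OF inj] by (simp add: card_cartesian_product)
  qed
  then show ?thesis using 1 by (intro exI[of _ "\<lambda>a. fst (h a)"]) blast
qed

context haar
begin

text \<open>\<open>comparison\<close> gives a partial isometry from each \<open>r x\<close> to
  \<open>q x\<close>; orthogonality on both sides makes their sum unitary.\<close>

lemma partition_unitary:
  assumes I: "finite I"
    and r: "\<And>x. x \<in> I \<Longrightarrow> r x \<in> M" "\<And>x. x \<in> I \<Longrightarrow> proj (r x)"
      "\<And>x y. x \<in> I \<Longrightarrow> y \<in> I \<Longrightarrow> x \<noteq> y \<Longrightarrow> r x * r y = 0" "(\<Sum>x\<in>I. r x) = 1"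
    and q: "\<And>x. x \<in> I \<Longrightarrow> q x \<in> M" "\<And>x. x \<in> I \<Longrightarrow> proj (q x)"
      "\<And>x y. x \<in> I \<Longrightarrow> y \<in> I \<Longrightarrow> x \<noteq> y \<Longrightarrow> q x * q y = 0" "(\<Sum>x\<in>I. q x) = 1"
    and tr: "\<And>x. x \<in> I \<Longrightarrow> tr (r x) = tr (q x)"
  shows "\<exists>T\<in>M. unit T \<and> (\<forall>x\<in>I. T * r x * star T = q x)"
proof -
  have "\<forall>x. \<exists>v. x \<in> I \<longrightarrow> v \<in> M \<and> star v * v = r x \<and> v * star v = q x"
    using comparison[OF r(1,2) q(1,2) tr] by blast
  then obtain v where "\<forall>x. x \<in> I \<longrightarrow> v x \<in> M \<and> star (v x) * v x = r x \<and> v x * star (v x) = q x"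
    by (rule exE[OF choice])
  then have v: "v x \<in> M" "star (v x) * v x = r x" "v x * star (v x) = q x" if "x \<in> I" for x using that by auto
  have vr: "v x * r x = v x" if x: "x \<in> I" for x
  proof -
    have "star (v x) * v x = star (r x) * r x" using projD[OF r(2)[OF x]] v[OF x] by simp
    moreover have "r x * (1 - r x) = 0" using projD[OF r(2)[OF x]] by (simp add: right_diff_distrib)
    ultimately have "v x * (1 - r x) = 0" by (rule zero_of_star_mult)
    then show ?thesis by (simp add: right_diff_distrib)
  qed
  have qv: "q x * v x = v x" if x: "x \<in> I" for x
    using vr[OF x] by (simp add: v(2,3)[OF x, symmetric] mult.assoc)
  define T where "T = (\<Sum>x\<in>I. v x)"
  have TM: "T \<in> M" unfolding T_def by (intro M_sum v)
  have Tr: "T * r x = v x" if x: "x \<in> I" for x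
  proof -
    have "v y * r x = (if y = x then v x else 0)" if y: "y \<in> I" for y
    proof (cases "y = x")
      case False
      have "v y * r x = v y * (r y * r x)" by (simp add: vr[OF y] flip: mult.assoc)
      then show ?thesis using r(3)[OF y x] False by simp
    qed (simp add: vr[OF x])
    then show ?thesis using x I by (simp add: T_def sum_distrib_right)
  qed
  have qT: "q x * T = v x" if x: "x \<in> I" for x
  proof -
    have "q x * v y = (if y = x then v x else 0)" if y: "y \<in> I" for y
    proof (cases "y = x")
      case False
      have "q x * v y = q x * q y * v y" by (simp add: qv[OF y] mult.assoc)
      then show ?thesis using q(3)[OF x y] False by simp
    qed (simp add: qv[OF x])
    then show ?thesis using x I by (simp add: T_def sum_distrib_left)
  qed
  have conj: "T * r x * star T = q x" if x: "x \<in> I" for x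
  proof -
    have "star (T * r x) = r x * star T" using projD[OF r(2)[OF x]] by (simp add: star_mult)
    then have st: "star (v x) = r x * star T" using Tr[OF x] by simp
    have "T * r x * star T = v x * star T" by (simp only: Tr[OF x])
    also have "\<dots> = v x * r x * star T" by (simp only: vr[OF x])
    also have "\<dots> = v x * star (v x)" by (simp only: st mult.assoc)
    finally show ?thesis using v[OF x] by simp
  qed
  have "T * star T = (\<Sum>x\<in>I. T * r x * star T)"
    using r(4) by (simp flip: sum_distrib_left sum_distrib_right)
  then have 1: "T * star T = 1" using conj q(4) by simp
  have "star (v x) * T = r x" if x: "x \<in> I" for x
  proof -
    have "star (v x) = star (v x) * q x"
      using arg_cong[OF qv[OF x], of star] projD[OF q(2)[OF x]] by (simp add: star_mult)
    then have "star (v x) * T = star (v x) * (q x * T)" by (metis mult.assoc)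
    then show ?thesis using qT[OF x] v[OF x] by simp
  qed
  then have 2: "star T * T = 1" using r(4) by (simp add: T_def star_sum sum_distrib_right)
  show ?thesis using TM 1 2 conj by (intro bexI[of _ T]) (auto simp: unit_def)
qed

lemma e_proj: "i < 2 ^ m \<Longrightarrow> proj (e m i)"
  by (simp add: proj_def e_star e_mult)

lemma e_sum_mult:
  assumes "A \<subseteq> {..<2 ^ m}" "B \<subseteq> {..<2 ^ m}"
  shows "sum (e m) A * sum (e m) B = sum (e m) (A \<inter> B)"
proof -
  have fin: "finite A" "finite B" using assms finite_subset by blast+
  have "sum (e m) A * sum (e m) B = (\<Sum>i\<in>A. \<Sum>j\<in>B. e m i * e m j)" by (simp add: sum_product)
  also have "\<dots> = (\<Sum>i\<in>A. \<Sum>j\<in>B. if i = j then e m i else 0)"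
    using assms by (intro sum.cong refl e_mult) auto
  also have "\<dots> = (\<Sum>i\<in>A. if i \<in> B then e m i else 0)" using fin by simp
  also have "\<dots> = sum (e m) (A \<inter> B)" by (rule sum.inter_restrict[OF fin(1), symmetric])
  finally show ?thesis .
qed

lemma e_sum_basic:
  assumes A: "A \<subseteq> {..<2 ^ m}"
  shows "sum (e m) A \<in> M" "proj (sum (e m) A)" "tr (sum (e m) A) = real (card A) / 2 ^ m"
proof -
  show "sum (e m) A \<in> M" by (intro M_sum e_M)
  show "proj (sum (e m) A)" using e_sum_mult[OF A A] by (simp add: proj_def star_sum e_star)
  have "tr (sum (e m) A) = (\<Sum>i\<in>A. tr (e m i))" by (intro tr_sum e_M)
  also have "\<dots> = (\<Sum>i\<in>A. 1 / 2 ^ m)" using A by (intro sum.cong refl tr_e) auto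
  finally show "tr (sum (e m) A) = real (card A) / 2 ^ m" by simp
qed

definition cls :: "nat \<Rightarrow> (nat \<Rightarrow> nat) \<Rightarrow> nat \<Rightarrow> nat set" where
  "cls m \<phi> i = {j. j < 2 ^ m \<and> \<phi> j = i}"

lemma cls_sub: "cls m \<phi> i \<subseteq> {..<2 ^ m}" "finite (cls m \<phi> i)" by (auto simp: cls_def)

text \<open>\<phi> labels the diagonal positions by the pieces of the partition. With the labelling
  as a function, passing to a finer level is composition with division by a power of 2.\<close>

definition diagd :: "nat \<Rightarrow> (nat \<Rightarrow> nat) \<Rightarrow> nat \<Rightarrow> 'h bop \<Rightarrow> (nat \<Rightarrow> 'h bop) \<Rightarrow> bool" where
  "diagd m \<phi> \<kappa> T P \<longleftrightarrow> T \<in> M \<and> unit T \<and> (\<forall>i<2 ^ m. \<phi> i \<le> \<kappa>) \<and> (\<forall>i\<le>\<kappa>. T * P i * star T = sum (e m) (cls m \<phi> i))"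

lemma diagdD: assumes "diagd m \<phi> \<kappa> T P"
  shows "T \<in> M" "unit T" "i < 2 ^ m \<Longrightarrow> \<phi> i \<le> \<kappa>" "i \<le> \<kappa> \<Longrightarrow> T * P i * star T = sum (e m) (cls m \<phi> i)"
  using assms by (auto simp: diagd_def)

lemma diagd_lift:
  assumes d: "diagd m \<phi> \<kappa> T P"
  shows "diagd (m + k) (\<lambda>j. \<phi> (j div 2 ^ k)) \<kappa> T P"
proof -
  note D = diagdD[OF d]
  have lt: "j div 2 ^ k < 2 ^ m" if "j < 2 ^ (m + k)" for j :: nat
    using that by (simp add: power_add less_mult_imp_div_less)
  have "sum (e m) (cls m \<phi> i) = sum (e (m + k)) (cls (m + k) (\<lambda>j. \<phi> (j div 2 ^ k)) i)" for i
  proof -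
    let ?S = "cls (m + k) (\<lambda>j. \<phi> (j div 2 ^ k)) i"
    have "{j \<in> ?S. j div 2 ^ k = y} = {y * 2 ^ k..<Suc y * 2 ^ k}" if y: "y \<in> cls m \<phi> i" for y
    proof (intro set_eqI iffI)
      fix j assume "j \<in> {j \<in> ?S. j div 2 ^ k = y}"
      then have "j div 2 ^ k = y" by simp
      then show "j \<in> {y * 2 ^ k..<Suc y * 2 ^ k}" using div_nat_eqI dividend_less_div_times[of "2 ^ k" j] by (auto simp: div_times_less_eq_dividend)
    next
      fix j assume j: "j \<in> {y * 2 ^ k..<Suc y * 2 ^ k}"
      then have dj: "j div 2 ^ k = y" by (intro div_nat_eqI) (auto simp: mult.commute)
      have "Suc y * 2 ^ k \<le> 2 ^ m * 2 ^ k" using y by (intro mult_right_mono) (auto simp: cls_def)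
      then have "j < 2 ^ (m + k)" using j by (simp add: power_add)
      then show "j \<in> {j \<in> ?S. j div 2 ^ k = y}" using y dj by (simp add: cls_def)
    qed
    then have "(\<Sum>y\<in>cls m \<phi> i. e m y) = (\<Sum>y\<in>cls m \<phi> i. sum (e (m + k)) {j \<in> ?S. j div 2 ^ k = y})"
      by (intro sum.cong refl) (simp only: e_refine[of m _ k])
    also have "\<dots> = sum (e (m + k)) ?S"
      by (rule sum.group) (auto simp: cls_def intro: lt)
    finally show ?thesis .
  qed
  then show ?thesis using D lt by (auto simp: diagd_def)
qed

lemma tr_unit_conj: "T \<in> M \<Longrightarrow> unit T \<Longrightarrow> x \<in> M \<Longrightarrow> tr (T * x * star T) = tr x"
  using tr_comm[of "T * x" "star T"] by (simp add: M_closed unit_cancel)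

lemma diagd_card: "diagd m \<phi> \<kappa> T P \<Longrightarrow> i \<le> \<kappa> \<Longrightarrow> P i \<in> M \<Longrightarrow> real (card (cls m \<phi> i)) = 2 ^ m * tr (P i)"
  using tr_unit_conj[of T "P i"] e_sum_basic(3)[OF cls_sub(1), of m \<phi> i] by (simp add: diagd_def field_simps)

text \<open>The bound is required at all fine levels, so that finitely many sparse elements can be
  stored at one common level.\<close>

definition sparse :: "real \<Rightarrow> 'h bop \<Rightarrow> bool" where
  "sparse \<epsilon> X \<longleftrightarrow> (\<exists>m0. \<forall>m\<ge>m0. real (card {(i, j). i < 2 ^ m \<and> j < 2 ^ m \<and> e m i * X * e m j \<noteq> 0}) \<le> \<epsilon> * 4 ^ m)"

text \<open>An entry at \<open>(i, j)\<close> can be non-zero only if \<open>i\<close> and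
  \<open>j\<close> carry the same label. A row therefore has at most as many non-zero entries as a
  block has positions, which at level \<open>n\<close> is \<open>2 ^ n\<close> times the trace of
  the block.\<close>

lemma sparse_block:
  assumes d: "diagd m \<phi> \<kappa> T P" and P: "\<And>i. i \<le> \<kappa> \<Longrightarrow> P i \<in> M" "\<And>i. i \<le> \<kappa> \<Longrightarrow> tr (P i) \<le> \<epsilon>"
    and X: "\<And>i. i \<le> \<kappa> \<Longrightarrow> X * (T * P i * star T) = T * P i * star T * X"
  shows "sparse \<epsilon> X"
  unfolding sparse_def
proof (intro exI[of _ m] allI impI)
  fix n assume "m \<le> n"
  then obtain k where n: "n = m + k" using le_Suc_ex by blast
  define \<psi> where "\<psi> j = \<phi> (j div 2 ^ k)" for j
  have d': "diagd n \<psi> \<kappa> T P" using diagd_lift[OF d, of k] by (simp add: n \<psi>_def[abs_def])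
  note D = diagdD[OF d']
  have eE: "e n i * sum (e n) (cls n \<psi> l) = (if \<psi> i = l then e n i else 0)"
      "sum (e n) (cls n \<psi> l) * e n i = (if \<psi> i = l then e n i else 0)" if "i < 2 ^ n" for i l
  proof -
    have "{i} \<inter> cls n \<psi> l = (if \<psi> i = l then {i} else {})" "cls n \<psi> l \<inter> {i} = (if \<psi> i = l then {i} else {})"
      using that by (auto simp: cls_def)
    then show "e n i * sum (e n) (cls n \<psi> l) = (if \<psi> i = l then e n i else 0)"
      "sum (e n) (cls n \<psi> l) * e n i = (if \<psi> i = l then e n i else 0)"
      using e_sum_mult[of "{i}" n "cls n \<psi> l"] e_sum_mult[of "cls n \<psi> l" n "{i}"] that cls_sub(1)[of n \<psi> l] by auto
  qed
  have "\<psi> j = \<psi> i" if ij: "i < 2 ^ n" "j < 2 ^ n" and nz: "e n i * X * e n j \<noteq> 0" for i j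
  proof (rule ccontr)
    assume ne: "\<psi> j \<noteq> \<psi> i"
    let ?E = "sum (e n) (cls n \<psi> (\<psi> i))"
    have XE: "?E * X = X * ?E" using X[OF D(3)[OF ij(1)]] D(4)[OF D(3)[OF ij(1)]] by simp
    have "e n i * X * e n j = e n i * ?E * X * e n j" using eE(1)[OF ij(1), of "\<psi> i"] by simp
    also have "\<dots> = e n i * (?E * X) * e n j" by (simp only: mult.assoc)
    also have "\<dots> = e n i * X * (?E * e n j)" unfolding XE by (simp only: mult.assoc)
    finally have "e n i * X * e n j = e n i * X * (?E * e n j)" .
    then show False using nz eE(2)[OF ij(2), of "\<psi> i"] ne by simp
  qed
  then have "{(i, j). i < 2 ^ n \<and> j < 2 ^ n \<and> e n i * X * e n j \<noteq> 0} \<subseteq> Sigma {..<2 ^ n} (\<lambda>i. cls n \<psi> (\<psi> i))"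
    by (auto simp: cls_def)
  then have "card {(i, j). i < 2 ^ n \<and> j < 2 ^ n \<and> e n i * X * e n j \<noteq> 0} \<le> card (Sigma {..<2 ^ n} (\<lambda>i. cls n \<psi> (\<psi> i)))"
    by (rule card_mono[rotated]) (auto intro: cls_sub)
  also have "\<dots> = (\<Sum>i<2 ^ n. card (cls n \<psi> (\<psi> i)))" by (simp add: cls_sub)
  finally have "real (card {(i, j). i < 2 ^ n \<and> j < 2 ^ n \<and> e n i * X * e n j \<noteq> 0}) \<le> (\<Sum>i<2 ^ n. real (card (cls n \<psi> (\<psi> i))))"
    by (simp only: of_nat_le_iff flip: of_nat_sum)
  also have "\<dots> \<le> (\<Sum>i<(2::nat) ^ n. 2 ^ n * \<epsilon>)"
  proof (rule sum_mono)
    fix i assume "i \<in> {..<(2::nat) ^ n}"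
    then have l: "\<psi> i \<le> \<kappa>" using D(3) by simp
    show "real (card (cls n \<psi> (\<psi> i))) \<le> 2 ^ n * \<epsilon>" using diagd_card[OF d' l P(1)[OF l]] P(2)[OF l] by simp
  qed
  also have "\<dots> = \<epsilon> * 4 ^ n" by (simp add: mult_ac flip: power_mult_distrib)
  finally show "real (card {(i, j). i < 2 ^ n \<and> j < 2 ^ n \<and> e n i * X * e n j \<noteq> 0}) \<le> \<epsilon> * 4 ^ n" .
qed

text \<open>At a level where all traces of the common refinement are multiples of
  \<open>1 / 2 ^ m'\<close>, the positions of each \<open>p i\<close> can be distributed over the
  cells of its row in the right numbers. A unitary \<open>T'\<close> that puts every cell into its
  place diagonalises \<open>q\<close> and moves \<open>p\<close> in the same way as \<open>T\<close>
  does, so the quotient \<open>T' * star T\<close> commutes with the images of the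
  \<open>p i\<close>.\<close>

lemma diagd_joint:
  assumes d: "diagd m \<phi> \<kappa> T p" and p: "part \<kappa> p" and j: "joint \<kappa> p q"
  shows "\<exists>m' \<phi>' T'. diagd m' \<phi>' \<kappa> T' q \<and>
    (\<forall>i\<le>\<kappa>. T' * star T * (T * p i * star T) = T * p i * star T * (T' * star T))"
proof -
  obtain r where R: "(\<forall>i\<le>\<kappa>. \<forall>l\<le>\<kappa>. r i l \<in> M \<and> proj (r i l) \<and> dyadic (tr (r i l))) \<and>
     (\<forall>i\<le>\<kappa>. \<forall>l\<le>\<kappa>. \<forall>i'\<le>\<kappa>. \<forall>l'\<le>\<kappa>. (i, l) \<noteq> (i', l') \<longrightarrow> r i l * r i' l' = 0) \<and>
     (\<forall>i\<le>\<kappa>. (\<Sum>l\<le>\<kappa>. r i l) = p i) \<and> (\<forall>l\<le>\<kappa>. (\<Sum>i\<le>\<kappa>. r i l) = q l)"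
    using j unfolding joint_def by (rule exE)
  have r: "r i l \<in> M" "proj (r i l)" "dyadic (tr (r i l))" if "i \<le> \<kappa>" "l \<le> \<kappa>" for i l
    using R[THEN conjunct1] that by auto
  note r = r R[THEN conjunct2, THEN conjunct1, rule_format] R[THEN conjunct2, THEN conjunct2, THEN conjunct1, rule_format]
    R[THEN conjunct2, THEN conjunct2, THEN conjunct2, rule_format]
  have "\<forall>x. \<exists>n. x \<in> {..\<kappa>} \<times> {..\<kappa>} \<longrightarrow> (\<forall>m\<ge>n. \<exists>k::nat. tr (r (fst x) (snd x)) = real k / 2 ^ m)"
    using dyadic_level[OF r(3)] by auto
  then obtain n where n: "\<forall>x. x \<in> {..\<kappa>} \<times> {..\<kappa>} \<longrightarrow> (\<forall>m\<ge>n x. \<exists>k::nat. tr (r (fst x) (snd x)) = real k / 2 ^ m)"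
    by (rule exE[OF choice])
  \<comment> \<open>A sum as a common bound for the finitely many levels \<open>n x\<close>.\<close>
  define K where "K = (\<Sum>x\<in>{..\<kappa>} \<times> {..\<kappa>}. n x)"
  define m' where "m' = m + K"
  have "\<forall>i. \<forall>l. \<exists>k::nat. i \<le> \<kappa> \<and> l \<le> \<kappa> \<longrightarrow> tr (r i l) = real k / 2 ^ m'"
  proof (intro allI)
    fix i l
    have "n (i, l) \<le> m'" if "i \<le> \<kappa>" "l \<le> \<kappa>"
      unfolding m'_def K_def using member_le_sum[of "(i, l)" "{..\<kappa>} \<times> {..\<kappa>}" n] that by simp
    then show "\<exists>k::nat. i \<le> \<kappa> \<and> l \<le> \<kappa> \<longrightarrow> tr (r i l) = real k / 2 ^ m'" using n[rule_format, of "(i, l)" m'] by auto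
  qed
  then obtain N :: "nat \<Rightarrow> nat \<Rightarrow> nat" where N: "\<And>i l. i \<le> \<kappa> \<Longrightarrow> l \<le> \<kappa> \<Longrightarrow> tr (r i l) = real (N i l) / 2 ^ m'" by metis
  define \<phi>1 where "\<phi>1 j = \<phi> (j div 2 ^ K)" for j
  have d1: "diagd m' \<phi>1 \<kappa> T p" using diagd_lift[OF d, of K] by (simp add: m'_def \<phi>1_def[abs_def])
  note D = diagdD[OF d1]
  have cN: "card (cls m' \<phi>1 i) = (\<Sum>l\<le>\<kappa>. N i l)" if i: "i \<le> \<kappa>" for i
  proof -
    have "tr (p i) = (\<Sum>l\<le>\<kappa>. tr (r i l))" unfolding r(5)[OF i, symmetric] by (rule tr_sum) (simp add: r(1) i)
    also have "\<dots> = (\<Sum>l\<le>\<kappa>. real (N i l) / 2 ^ m')" by (simp add: N i)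
    also have "\<dots> = real (\<Sum>l\<le>\<kappa>. N i l) / 2 ^ m'" by (simp add: sum_divide_distrib)
    finally have "real (card (cls m' \<phi>1 i)) = real (\<Sum>l\<le>\<kappa>. N i l)"
      using diagd_card[OF d1 i partD(1)[OF p i]] by simp
    then show ?thesis by (simp only: of_nat_eq_iff)
  qed
  have "\<forall>i. \<exists>\<psi>. i \<le> \<kappa> \<longrightarrow> (\<forall>a\<in>cls m' \<phi>1 i. \<psi> a \<le> \<kappa>) \<and> (\<forall>l\<le>\<kappa>. card {a \<in> cls m' \<phi>1 i. \<psi> a = l} = N i l)"
    using split_function[OF cls_sub(2) cN] by blast
  then obtain \<psi> where "\<forall>i. i \<le> \<kappa> \<longrightarrow> (\<forall>a\<in>cls m' \<phi>1 i. \<psi> i a \<le> \<kappa>) \<and> (\<forall>l\<le>\<kappa>. card {a \<in> cls m' \<phi>1 i. \<psi> i a = l} = N i l)"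
    by (rule exE[OF choice])
  then have psi: "a \<in> cls m' \<phi>1 i \<Longrightarrow> \<psi> i a \<le> \<kappa>" "l \<le> \<kappa> \<Longrightarrow> card {a \<in> cls m' \<phi>1 i. \<psi> i a = l} = N i l" if "i \<le> \<kappa>" for i a l
    using that by auto
  define \<phi>' where "\<phi>' a = \<psi> (\<phi>1 a) a" for a
  have p': "\<phi>' a \<le> \<kappa>" if "a < 2 ^ m'" for a
    unfolding \<phi>'_def by (rule psi(1)[OF D(3)[OF that]]) (use that in \<open>simp add: cls_def\<close>)
  define C where "C x = {a \<in> cls m' \<phi>1 (fst x). \<phi>' a = snd x}" for x
  define Q where "Q x = sum (e m') (C x)" for x
  have C: "C x \<subseteq> {..<2 ^ m'}" for x by (auto simp: C_def cls_def)
  have cC: "card (C x) = N (fst x) (snd x)" if "x \<in> {..\<kappa>} \<times> {..\<kappa>}" for x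
  proof -
    have "C x = {a \<in> cls m' \<phi>1 (fst x). \<psi> (fst x) a = snd x}" by (auto simp: C_def cls_def \<phi>'_def)
    then show ?thesis using psi(2)[of "fst x" "snd x"] that by auto
  qed
  have Qrow: "(\<Sum>l\<le>\<kappa>. Q (i, l)) = sum (e m') (cls m' \<phi>1 i)" for i
  proof -
    have "Q (i, l) = sum (e m') {a \<in> cls m' \<phi>1 i. \<phi>' a = l}" for l by (simp add: Q_def C_def)
    then show ?thesis using p' cls_sub by (simp only:) (rule sum.group, auto simp: cls_def)
  qed
  have Qcol: "(\<Sum>i\<le>\<kappa>. Q (i, l)) = sum (e m') (cls m' \<phi>' l)" for l
  proof -
    have "Q (i, l) = sum (e m') {a \<in> cls m' \<phi>' l. \<phi>1 a = i}" for i
      unfolding Q_def C_def by (rule sum.cong) (auto simp: cls_def)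
    then show ?thesis using D(3) cls_sub by (simp only:) (rule sum.group, auto simp: cls_def)
  qed
  have "\<exists>T'\<in>M. unit T' \<and> (\<forall>x\<in>{..\<kappa>} \<times> {..\<kappa>}. T' * r (fst x) (snd x) * star T' = Q x)"
  proof (rule partition_unitary)
    show "r (fst x) (snd x) \<in> M" "proj (r (fst x) (snd x))" if "x \<in> {..\<kappa>} \<times> {..\<kappa>}" for x
      using r(1,2) that by auto
    show "r (fst x) (snd x) * r (fst y) (snd y) = 0" if "x \<in> {..\<kappa>} \<times> {..\<kappa>}" "y \<in> {..\<kappa>} \<times> {..\<kappa>}" "x \<noteq> y" for x y
      using r(4)[of "fst x" "snd x" "fst y" "snd y"] that by (auto simp: prod_eq_iff)
    have "(\<Sum>x\<in>{..\<kappa>} \<times> {..\<kappa>}. r (fst x) (snd x)) = (\<Sum>i\<le>\<kappa>. \<Sum>l\<le>\<kappa>. r i l)"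
      by (simp add: sum.cartesian_product case_prod_unfold)
    also have "\<dots> = (\<Sum>i\<le>\<kappa>. p i)" by (simp add: r(5))
    finally show "(\<Sum>x\<in>{..\<kappa>} \<times> {..\<kappa>}. r (fst x) (snd x)) = 1" using partD(5)[OF p] by simp
    show "Q x \<in> M" "proj (Q x)" for x unfolding Q_def by (intro e_sum_basic C)+
    show "Q x * Q y = 0" if "x \<noteq> y" for x y
    proof -
      have "C x \<inter> C y = {}" using that by (auto simp: C_def cls_def prod_eq_iff)
      then show ?thesis unfolding Q_def by (simp add: e_sum_mult[OF C C])
    qed
    have "(\<Sum>x\<in>{..\<kappa>} \<times> {..\<kappa>}. Q x) = (\<Sum>i\<le>\<kappa>. \<Sum>l\<le>\<kappa>. Q (i, l))"
      by (simp add: sum.cartesian_product)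
    also have "\<dots> = (\<Sum>i\<le>\<kappa>. sum (e m') {a \<in> {..<2 ^ m'}. \<phi>1 a = i})" unfolding Qrow by (simp add: cls_def)
    also have "\<dots> = sum (e m') {..<2 ^ m'}" by (rule sum.group) (use D(3) in auto)
    finally show "(\<Sum>x\<in>{..\<kappa>} \<times> {..\<kappa>}. Q x) = 1" using e_sum by simp
    show "tr (r (fst x) (snd x)) = tr (Q x)" if "x \<in> {..\<kappa>} \<times> {..\<kappa>}" for x
      unfolding Q_def e_sum_basic(3)[OF C] cC[OF that] using N that by auto
  qed simp
  then obtain T' where T': "T' \<in> M" "unit T'" and TQ: "\<And>i l. i \<le> \<kappa> \<Longrightarrow> l \<le> \<kappa> \<Longrightarrow> T' * r i l * star T' = Q (i, l)"
    by fastforce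
  have Tq: "T' * q l * star T' = sum (e m') (cls m' \<phi>' l)" if l: "l \<le> \<kappa>" for l
  proof -
    have "T' * q l * star T' = (\<Sum>i\<le>\<kappa>. T' * r i l * star T')" by (simp add: r(6)[OF l, symmetric] sum_distrib_left sum_distrib_right)
    also have "\<dots> = (\<Sum>i\<le>\<kappa>. Q (i, l))" by (simp add: TQ l)
    finally show ?thesis using Qcol by simp
  qed
  \<comment> \<open>The cells of row \<open>i\<close> occupy together exactly the old positions of
    \<open>p i\<close>.\<close>
  have Tp: "T' * p i * star T' = T * p i * star T" if i: "i \<le> \<kappa>" for i
  proof -
    have "T' * p i * star T' = (\<Sum>l\<le>\<kappa>. T' * r i l * star T')" by (simp add: r(5)[OF i, symmetric] sum_distrib_left sum_distrib_right)
    also have "\<dots> = (\<Sum>l\<le>\<kappa>. Q (i, l))" by (simp add: TQ i)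
    finally show ?thesis using Qrow D(4)[OF i] by simp
  qed
  have "T' * star T * (T * p i * star T) = T * p i * star T * (T' * star T)" if i: "i \<le> \<kappa>" for i
  proof -
    have "T * p i * star T * (T' * star T) = T' * p i * star T" unfolding Tp[OF i, symmetric]
      by (simp add: mult.assoc unit_cancel[OF T'(2)])
    then show ?thesis by (simp add: mult.assoc unit_cancel[OF D(2)])
  qed
  moreover have "diagd m' \<phi>' \<kappa> T' q" unfolding diagd_def using T' p' Tq by blast
  ultimately show ?thesis by blast
qed

text \<open>The product \<open>T' * star T\<close> telescopes into quotients of consecutive
  unitaries. Each quotient is block diagonal for the partition in between and therefore sparse; no
  sparsity is claimed for the product, so the factors are collected instead.\<close>

lemma diagd_chain:
  assumes P: "(jrel m0 ^^ l) p P" and p: "part (2 ^ m0) p" "\<And>i. i \<le> 2 ^ m0 \<Longrightarrow> tr (p i) \<le> 4 / 2 ^ m0"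
    and d: "diagd m \<phi> (2 ^ m0) T p"
  shows "\<exists>m' \<phi>' T' Zs. diagd m' \<phi>' (2 ^ m0) T' P \<and> part (2 ^ m0) P \<and> (\<forall>i\<le>2 ^ m0. tr (P i) \<le> 4 / 2 ^ m0) \<and>
    finite Zs \<and> Zs \<subseteq> M \<and> card Zs \<le> l \<and> (\<forall>Z\<in>Zs. sparse (4 / 2 ^ m0) Z) \<and>
    (\<forall>S. (\<forall>Z\<in>Zs. S * Z = Z * S) \<longrightarrow> S * (T' * star T) = T' * star T * S)"
  using P
proof (induction l arbitrary: P)
  case 0
  show ?case
    using 0 p d unit_eqs[OF diagdD(2)[OF d]] by (intro exI[of _ m] exI[of _ \<phi>] exI[of _ T] exI[of _ "{}"]) simp
next
  case (Suc l)
  from Suc.prems obtain Q where Q: "(jrel m0 ^^ l) p Q" and j: "jrel m0 Q P" by (auto elim: relpowp_Suc_E)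
  obtain m' \<phi>' T' Zs where d': "diagd m' \<phi>' (2 ^ m0) T' Q" and pQ: "part (2 ^ m0) Q" "\<And>i. i \<le> 2 ^ m0 \<Longrightarrow> tr (Q i) \<le> 4 / 2 ^ m0"
    and Zs: "finite Zs" "Zs \<subseteq> M" "card Zs \<le> l" "\<forall>Z\<in>Zs. sparse (4 / 2 ^ m0) Z"
      "\<And>S. (\<forall>Z\<in>Zs. S * Z = Z * S) \<Longrightarrow> S * (T' * star T) = T' * star T * S"
    using Suc.IH[OF Q] by blast
  from j have pP: "part (2 ^ m0) P" "joint (2 ^ m0) Q P" "\<forall>i\<le>2 ^ m0. tr (P i) \<le> 4 / 2 ^ m0"
    by (auto simp: jrel_def)
  obtain m'' \<phi>'' T'' where d'': "diagd m'' \<phi>'' (2 ^ m0) T'' P"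
    and c: "\<And>i. i \<le> 2 ^ m0 \<Longrightarrow> T'' * star T' * (T' * Q i * star T') = T' * Q i * star T' * (T'' * star T')"
    using diagd_joint[OF d' pQ(1) pP(2)] by blast
  define Z where "Z = T'' * star T'"
  have ZM: "Z \<in> M" unfolding Z_def by (intro M_closed diagdD[OF d'] diagdD[OF d''])
  have spZ: "sparse (4 / 2 ^ m0) Z"
    unfolding Z_def by (rule sparse_block[OF d' partD(1)[OF pQ(1)] pQ(2) c])
  have "S * (T'' * star T) = T'' * star T * S" if "\<forall>Z\<in>insert Z Zs. S * Z = Z * S" for S
  proof -
    have "T'' * star T = Z * (T' * star T)" by (simp add: Z_def mult.assoc unit_cancel[OF diagdD(2)[OF d']])
    moreover have "S * (Z * (T' * star T)) = Z * (T' * star T) * S"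
      using that by (intro commute_mult Zs(5)) auto
    ultimately show ?thesis by simp
  qed
  moreover have "card (insert Z Zs) \<le> Suc l" using card_insert_le_m1[of "Suc l" Zs Z] Zs(1,3) by (simp add: card_insert_if)
  ultimately show ?case using d'' pP Zs ZM spZ
    by (intro exI[of _ m''] exI[of _ \<phi>''] exI[of _ T''] exI[of _ "insert Z Zs"]) auto
qed

section \<open>Unitaries from the atoms to the matrix units\<close>

definition tow :: "nat \<Rightarrow> 'h bop" where
  "tow m = (SOME T. T \<in> M \<and> unit T \<and> (\<forall>i<2 ^ m. T * atom m i * star T = e m i))"

lemma tow: "tow m \<in> M" "unit (tow m)" "i < 2 ^ m \<Longrightarrow> tow m * atom m i * star (tow m) = e m i"
proof -
  have "\<exists>T\<in>M. unit T \<and> (\<forall>i\<in>{..<2 ^ m}. T * atom m i * star T = e m i)"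
    by (rule partition_unitary) (auto simp: atom_M atom_proj atom_orth atom_sum e_M e_proj e_mult e_sum tr_atom tr_e)
  then have "\<exists>T. T \<in> M \<and> unit T \<and> (\<forall>i<2 ^ m. T * atom m i * star T = e m i)" by blast
  from someI_ex[OF this, folded tow_def]
  show "tow m \<in> M" "unit (tow m)" "i < 2 ^ m \<Longrightarrow> tow m * atom m i * star (tow m) = e m i" by auto
qed

text \<open>The unitaries of different levels are chosen independently, yet they send coarse atoms
  to the same place. Hence \<open>tow m' * star (tow m)\<close> commutes with all
  \<open>e m i\<close> and is sparse.\<close>

lemma tow_le:
  assumes "m \<le> m'" "i < 2 ^ m"
  shows "tow m' * atom m i * star (tow m') = e m i"
proof -
  obtain k where k: "m' = m + k" using assms le_Suc_ex by blast
  have "Suc i * 2 ^ k \<le> 2 ^ m * 2 ^ k" using assms(2) by (intro mult_right_mono) auto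
  then have lt: "j < 2 ^ m'" if "j \<in> {i * 2 ^ k..<Suc i * 2 ^ k}" for j using that by (simp add: k power_add)
  have "tow m' * atom m i * star (tow m') = (\<Sum>j\<in>{i * 2 ^ k..<Suc i * 2 ^ k}. tow m' * atom m' j * star (tow m'))"
    by (simp only: atom_refine[of m i k] k sum_distrib_left sum_distrib_right)
  also have "\<dots> = (\<Sum>j\<in>{i * 2 ^ k..<Suc i * 2 ^ k}. e m' j)" by (intro sum.cong refl tow(3) lt)
  finally show ?thesis by (simp only: e_refine[of m i k] k)
qed

lemma diagd_base: "diagd m (\<lambda>i. i) (2 ^ m) (tow m) (base m)"
proof -
  have "cls m (\<lambda>i. i) i = (if i < 2 ^ m then {i} else {})" for i by (auto simp: cls_def)
  then have "tow m * base m i * star (tow m) = sum (e m) (cls m (\<lambda>i. i) i)" for i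
    using tow(3)[of i m] by (simp add: base_def)
  then show ?thesis by (simp add: diagd_def tow)
qed

lemma base_small: "tr (base m i) \<le> 4 / 2 ^ m"
  by (simp add: base_def tr_atom divide_right_mono)

lemma sparse_base:
  assumes "\<And>i. i < 2 ^ m \<Longrightarrow> X * e m i = e m i * X"
  shows "sparse (4 / 2 ^ m) X"
proof (rule sparse_block[OF diagd_base])
  fix i
  show "base m i \<in> M" by (simp add: base_def atom_M M_zero)
  show "tr (base m i) \<le> 4 / 2 ^ m" by (rule base_small)
  show "X * (tow m * base m i * star (tow m)) = tow m * base m i * star (tow m) * X"
    using assms[of i] tow(3)[of i m] by (simp add: base_def)
qed

text \<open>A chain with \<open>k\<close> intermediate unitaries, expressed by representing
  sequences; its two ends are constant sequences.\<close>

definition linked :: "nat filter \<Rightarrow> nat \<Rightarrow> 'h bop \<Rightarrow> bool" where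
  "linked \<F> k w \<longleftrightarrow> (\<exists>v. (\<forall>l\<le>Suc k. asymp_haar \<F> (v l)) \<and> v 0 = (\<lambda>t. u) \<and> v (Suc k) = (\<lambda>t. w) \<and>
    (\<forall>l<Suc k. ((\<lambda>t. n2 (v l t * v (Suc l) t - v (Suc l) t * v l t)) \<longlongrightarrow> 0) \<F>))"

text \<open>The count \<open>k + 3\<close> consists of at most \<open>k\<close> quotients along the
  chain and three further elements: \<open>X1\<close> for the block diagonal approximation
  \<open>x\<close>, \<open>X2\<close> for \<open>u\<close>, and \<open>X3\<close> for the passage to
  the tower unitary of another run.\<close>

lemma run_set:
  assumes nb: "\<F> \<noteq> bot" and li: "linked \<F> k w" and \<epsilon>: "0 < \<epsilon>" and mm: "m \<le> m'"
  shows "\<exists>x Xs. x \<in> M \<and> norm x \<le> 1 \<and> n2 (x - w) \<le> \<epsilon> \<and> finite Xs \<and> Xs \<subseteq> M \<and> card Xs \<le> k + 3 \<and>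
    (\<forall>X\<in>Xs. sparse (4 / 2 ^ m) X) \<and>
    (\<forall>S. (\<forall>X\<in>Xs. S * X = X * S) \<longrightarrow> S * (tow m' * star (tow m)) = tow m' * star (tow m) * S \<and>
       star (tow m) * S * tow m * x = x * (star (tow m) * S * tow m) \<and>
       star (tow m) * S * tow m * u = u * (star (tow m) * S * tow m))"
proof -
  obtain v where v: "\<And>l. l \<le> Suc k \<Longrightarrow> asymp_haar \<F> (v l)" "v 0 = (\<lambda>t. u)" "v (Suc k) = (\<lambda>t. w)"
    "\<And>l. l < Suc k \<Longrightarrow> ((\<lambda>t. n2 (v l t * v (Suc l) t - v (Suc l) t * v l t)) \<longlongrightarrow> 0) \<F>"
    using li unfolding linked_def by blast
  obtain P x where P: "(jrel m ^^ k) (base m) P" and x: "x \<in> M" "norm x \<le> 1" "n2 (x - w) \<le> \<epsilon>"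
    and Px: "\<And>i. i \<le> 2 ^ m \<Longrightarrow> P i * x = x * P i"
    by (rule run_exists[OF nb v(1,2,3,4) \<epsilon>, of m]) (assumption, assumption, rule that)
  let ?T = "tow m" and ?T1 = "tow m'"
  note T = tow(1,2)[of m] and T1 = tow(1,2)[of m']
  obtain n \<phi> V Zs where d: "diagd n \<phi> (2 ^ m) V P" and pP: "part (2 ^ m) P" "\<And>i. i \<le> 2 ^ m \<Longrightarrow> tr (P i) \<le> 4 / 2 ^ m"
    and Zs: "finite Zs" "Zs \<subseteq> M" "card Zs \<le> k" "\<And>Z. Z \<in> Zs \<Longrightarrow> sparse (4 / 2 ^ m) Z"
      "\<And>S. (\<forall>Z\<in>Zs. S * Z = Z * S) \<Longrightarrow> S * (V * star ?T) = V * star ?T * S"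
    using diagd_chain[OF P base_part base_small diagd_base] by blast
  note V = diagdD(1,2)[OF d]
  define X1 X2 X3 where "X1 = V * x * star V" and "X2 = ?T * u * star ?T" and "X3 = ?T1 * star ?T"
  have XM: "X1 \<in> M" "X2 \<in> M" "X3 \<in> M" unfolding X1_def X2_def X3_def by (intro M_closed V x T T1 uM)+
  have s1: "sparse (4 / 2 ^ m) X1"
  proof (rule sparse_block[OF d partD(1)[OF pP(1)] pP(2)])
    fix i :: nat assume i: "i \<le> 2 ^ m"
    have "X1 * (V * P i * star V) = V * (x * P i) * star V" by (simp add: X1_def mult.assoc unit_cancel[OF V(2)])
    also have "\<dots> = V * P i * star V * X1" unfolding Px[OF i, symmetric] by (simp add: X1_def mult.assoc unit_cancel[OF V(2)])
    finally show "X1 * (V * P i * star V) = V * P i * star V * X1" .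
  qed
  have s2: "sparse (4 / 2 ^ m) X2"
  proof (rule sparse_base)
    fix i :: nat assume i: "i < 2 ^ m"
    have ua: "u * atom m i = atom m i * u"
      using A0_commute[OF A0_tpoly[OF tpoly_var] atom_A0] .
    have "X2 * e m i = ?T * (u * atom m i) * star ?T" unfolding tow(3)[OF i, symmetric] X2_def by (simp add: mult.assoc unit_cancel[OF T(2)])
    also have "\<dots> = e m i * X2" unfolding tow(3)[OF i, symmetric] X2_def ua by (simp add: mult.assoc unit_cancel[OF T(2)])
    finally show "X2 * e m i = e m i * X2" .
  qed
  have s3: "sparse (4 / 2 ^ m) X3"
  proof (rule sparse_base)
    fix i :: nat assume i: "i < 2 ^ m"
    have "X3 * e m i = ?T1 * atom m i * star ?T" unfolding tow(3)[OF i, symmetric] X3_def by (simp add: mult.assoc unit_cancel[OF T(2)])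
    also have "\<dots> = e m i * X3" unfolding tow_le[OF mm i, symmetric] X3_def by (simp add: mult.assoc unit_cancel[OF T1(2)])
    finally show "X3 * e m i = e m i * X3" .
  qed
  define Xs where "Xs = insert X1 (insert X2 (insert X3 Zs))"
  have "card Xs \<le> k + 3" unfolding Xs_def using Zs(1,3) by (simp add: card_insert_if)
  moreover have "S * X3 = X3 * S \<and> star ?T * S * ?T * x = x * (star ?T * S * ?T) \<and> star ?T * S * ?T * u = u * (star ?T * S * ?T)"
    if S: "\<forall>X\<in>Xs. S * X = X * S" for S
  proof (intro conjI)
    show "S * X3 = X3 * S" using S by (simp add: Xs_def)
    show "star ?T * S * ?T * u = u * (star ?T * S * ?T)"
      by (rule unit_conj_commute[OF T(2)]) (use S in \<open>simp add: Xs_def X2_def\<close>)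
    show "star ?T * S * ?T * x = x * (star ?T * S * ?T)"
    proof (rule unit_conj_commute[OF T(2)])
      \<comment> \<open>\<open>X1\<close> is \<open>x\<close> in the frame of the last partition,
        where it is sparse. \<open>W\<close> commutes with \<open>S\<close> because the stored
        quotients do, and it carries \<open>X1\<close> back to the frame of
        \<open>tow m\<close>.\<close>
      define W where "W = V * star ?T"
      have W: "unit W" unfolding W_def by (intro unit_mult unit_star V T)
      have c: "S * W = W * S" unfolding W_def by (rule Zs(5)) (use S in \<open>simp add: Xs_def\<close>)
      have eq: "?T * x * star ?T = star W * X1 * W"
        unfolding W_def X1_def by (simp add: star_mult mult.assoc unit_cancel[OF V(2)])
      have "S * X1 = X1 * S" using S by (simp add: Xs_def)
      then show "S * (?T * x * star ?T) = ?T * x * star ?T * S" unfolding eq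
        by (intro commute_mult c unit_commute_star[OF W])
    qed
  qed
  moreover have "sparse (4 / 2 ^ m) X" if "X \<in> Xs" for X using that s1 s2 s3 Zs(4) by (auto simp: Xs_def)
  moreover have "finite Xs" "Xs \<subseteq> M" using Zs(1,2) XM by (auto simp: Xs_def)
  ultimately show ?thesis using x unfolding X3_def by blast
qed

text \<open>At level \<open>r + 3 + k\<close> there are at most
  \<open>card X * (4 / 2 ^ m) * 4 ^ (r + 3 + k)\<close> non-zero entries for
  \<open>4 ^ Suc k\<close> slots; the condition on \<open>m\<close> is exactly that the former does
  not exceed the latter.\<close>

lemma encode_sparse:
  assumes X: "finite X" "X \<subseteq> M" and sp: "\<And>x. x \<in> X \<Longrightarrow> sparse (4 / 2 ^ m) x" and card: "card X * 4 ^ (r + 3) \<le> 2 ^ m"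
  shows "\<exists>a\<in>M. star a = a \<and> f r * a = a \<and>
    (\<forall>T. (\<forall>n. commutes T (s n)) \<longrightarrow> T * a = a * T \<longrightarrow> (\<forall>x\<in>X. T * x = x * T))"
proof -
  define S where "S n x = {(i, j). i < 2 ^ n \<and> j < 2 ^ n \<and> e n i * x * e n j \<noteq> 0}" for n x
  have "\<forall>x. \<exists>m0. x \<in> X \<longrightarrow> (\<forall>n\<ge>m0. real (card (S n x)) \<le> 4 / 2 ^ m * 4 ^ n)"
    using sp unfolding sparse_def S_def by blast
  then obtain m0 where m0: "\<forall>x. x \<in> X \<longrightarrow> (\<forall>n\<ge>m0 x. real (card (S n x)) \<le> 4 / 2 ^ m * 4 ^ n)" by (rule exE[OF choice])
  define k where "k = (\<Sum>x\<in>X. m0 x)"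
  define n where "n = r + 3 + k"
  have le: "real (card (S n x)) \<le> 4 / 2 ^ m * 4 ^ n" if x: "x \<in> X" for x
  proof -
    have "m0 x \<le> k" unfolding k_def by (rule member_le_sum[OF x _ X(1)]) simp
    then show ?thesis using m0 x by (simp add: n_def)
  qed
  have fS: "finite (S n x)" for x
    by (rule finite_subset[of _ "{..<2 ^ n} \<times> {..<2 ^ n}"]) (auto simp: S_def)
  have eq: "{(x, i, j). x \<in> X \<and> i < 2 ^ n \<and> j < 2 ^ n \<and> e n i * x * e n j \<noteq> 0} = Sigma X (S n)" by (auto simp: S_def)
  have "real (card (Sigma X (S n))) = (\<Sum>x\<in>X. real (card (S n x)))" using X(1) fS by simp
  also have "\<dots> \<le> (\<Sum>x\<in>X. 4 / 2 ^ m * 4 ^ n)" by (intro sum_mono le)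
  also have "\<dots> = real (card X * 4 ^ (r + 3)) / 2 ^ m * 4 ^ Suc k" by (simp add: n_def power_add)
  also have "\<dots> \<le> 1 * 4 ^ Suc k"
  proof (rule mult_right_mono)
    have "real (card X * 4 ^ (r + 3)) \<le> 2 ^ m" using card by (metis of_nat_le_iff of_nat_numeral of_nat_power)
    then show "real (card X * 4 ^ (r + 3)) / 2 ^ m \<le> 1" by simp
  qed simp
  finally have "card (Sigma X (S n)) \<le> 4 ^ Suc k" by (metis mult_1 of_nat_le_iff of_nat_numeral of_nat_power)
  then show ?thesis using encode_corner[OF X, of r k] eq unfolding n_def by simp
qed

text \<open>The run number \<open>r\<close> encodes a pair of a generator and an exponent
  \<open>n\<close>, so every generator is approximated to within every \<open>(1/2) ^ n\<close>, and
  \<open>commute_n2_limit\<close> reaches the generator itself.\<close>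

lemma generated_core:
  fixes w :: "nat \<Rightarrow> 'h bop"
  assumes nb: "\<F> \<noteq> bot" and li: "\<And>j. linked \<F> (K j) (w j)" and w: "\<And>j. w j \<in> M" "\<And>j. unit (w j)"
  shows "\<exists>x\<in>M. \<exists>T\<in>M. unit T \<and> (\<forall>S. commutes S x \<longrightarrow>
    commutes (star T * S * T) u \<and> (\<forall>j. commutes (star T * S * T) (w j)))"
proof -
  define J where "J r = fst (prod_decode r)" for r
  \<comment> \<open>The summand for \<open>r\<close> alone ensures that \<open>2 ^ mm r\<close>
    exceeds the number of stored elements times \<open>4 ^ (r + 3)\<close>. Summing makes
    \<open>mm\<close> monotone, so that consecutive tower unitaries can be compared.\<close>
  define mm where "mm r = (\<Sum>i\<le>r. K (J i) + 3 + 2 * (i + 3))" for r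
  have mmS: "mm r \<le> mm (Suc r)" for r by (simp add: mm_def)
  have mmr: "K (J r) + 3 + 2 * (r + 3) \<le> mm r" for r
    unfolding mm_def using member_le_sum[of r "{..r}" "\<lambda>i. K (J i) + 3 + 2 * (i + 3)"] by simp
  let ?c = "\<lambda>r S. star (tow (mm r)) * S * tow (mm r)"
  have "\<forall>r. \<exists>y. fst y \<in> M \<and> norm (fst y) \<le> 1 \<and> n2 (fst y - w (J r)) \<le> (1/2) ^ snd (prod_decode r) \<and> finite (snd y) \<and> snd y \<subseteq> M \<and>
    card (snd y) \<le> K (J r) + 3 \<and> (\<forall>X\<in>snd y. sparse (4 / 2 ^ mm r) X) \<and>
    (\<forall>S. (\<forall>X\<in>snd y. S * X = X * S) \<longrightarrow> S * (tow (mm (Suc r)) * star (tow (mm r))) = tow (mm (Suc r)) * star (tow (mm r)) * S \<and>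
       ?c r S * fst y = fst y * ?c r S \<and> ?c r S * u = u * ?c r S)"
  proof
    fix r
    show "\<exists>y. fst y \<in> M \<and> norm (fst y) \<le> 1 \<and> n2 (fst y - w (J r)) \<le> (1/2) ^ snd (prod_decode r) \<and> finite (snd y) \<and> snd y \<subseteq> M \<and>
      card (snd y) \<le> K (J r) + 3 \<and> (\<forall>X\<in>snd y. sparse (4 / 2 ^ mm r) X) \<and>
      (\<forall>S. (\<forall>X\<in>snd y. S * X = X * S) \<longrightarrow> S * (tow (mm (Suc r)) * star (tow (mm r))) = tow (mm (Suc r)) * star (tow (mm r)) * S \<and>
         ?c r S * fst y = fst y * ?c r S \<and> ?c r S * u = u * ?c r S)"
      unfolding split_paired_Ex fst_conv snd_conv by (rule run_set[OF nb li _ mmS]) simp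
  qed
  then obtain y where "\<forall>r. fst (y r) \<in> M \<and> norm (fst (y r)) \<le> 1 \<and> n2 (fst (y r) - w (J r)) \<le> (1/2) ^ snd (prod_decode r) \<and> finite (snd (y r)) \<and> snd (y r) \<subseteq> M \<and>
    card (snd (y r)) \<le> K (J r) + 3 \<and> (\<forall>X\<in>snd (y r). sparse (4 / 2 ^ mm r) X) \<and>
    (\<forall>S. (\<forall>X\<in>snd (y r). S * X = X * S) \<longrightarrow> S * (tow (mm (Suc r)) * star (tow (mm r))) = tow (mm (Suc r)) * star (tow (mm r)) * S \<and>
       ?c r S * fst (y r) = fst (y r) * ?c r S \<and> ?c r S * u = u * ?c r S)"
    by (rule exE[OF choice])
  then have x: "fst (y r) \<in> M" "norm (fst (y r)) \<le> 1" "n2 (fst (y r) - w (J r)) \<le> (1/2) ^ snd (prod_decode r)"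
    and X: "finite (snd (y r))" "snd (y r) \<subseteq> M" "card (snd (y r)) \<le> K (J r) + 3" "\<And>X. X \<in> snd (y r) \<Longrightarrow> sparse (4 / 2 ^ mm r) X"
    and c: "(\<forall>X\<in>snd (y r). S * X = X * S) \<Longrightarrow> S * (tow (mm (Suc r)) * star (tow (mm r))) = tow (mm (Suc r)) * star (tow (mm r)) * S \<and>
       ?c r S * fst (y r) = fst (y r) * ?c r S \<and> ?c r S * u = u * ?c r S" for r S by blast+
  have "\<forall>r. \<exists>a. a \<in> M \<and> star a = a \<and> f r * a = a \<and>
    (\<forall>T. (\<forall>n. commutes T (s n)) \<longrightarrow> T * a = a * T \<longrightarrow> (\<forall>X\<in>snd (y r). T * X = X * T))"
  proof
    fix r
    have "card (snd (y r)) * 4 ^ (r + 3) \<le> 2 ^ mm r"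
    proof -
      have "card (snd (y r)) \<le> 2 ^ (K (J r) + 3)" using X(3)[of r] less_exp[of "K (J r) + 3"] by linarith
      then have "card (snd (y r)) * 2 ^ (2 * (r + 3)) \<le> 2 ^ (K (J r) + 3) * 2 ^ (2 * (r + 3))" by (rule mult_right_mono) simp
      also have "\<dots> = 2 ^ (K (J r) + 3 + 2 * (r + 3))" by (simp only: power_add)
      also have "\<dots> \<le> (2::nat) ^ mm r" by (intro power_increasing mmr) simp
      finally show ?thesis by (simp only: power_mult) simp
    qed
    then show "\<exists>a. a \<in> M \<and> star a = a \<and> f r * a = a \<and>
      (\<forall>T. (\<forall>n. commutes T (s n)) \<longrightarrow> T * a = a * T \<longrightarrow> (\<forall>X\<in>snd (y r). T * X = X * T))"
      using encode_sparse[OF X(1,2,4)] by blast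
  qed
  then obtain a where "\<forall>r. a r \<in> M \<and> star (a r) = a r \<and> f r * a r = a r \<and>
    (\<forall>T. (\<forall>n. commutes T (s n)) \<longrightarrow> T * a r = a r * T \<longrightarrow> (\<forall>X\<in>snd (y r). T * X = X * T))" by (rule exE[OF choice])
  then have a: "a r \<in> M" "star (a r) = a r" "f r * a r = a r"
    and aX: "(\<And>n. commutes T (s n)) \<Longrightarrow> T * a r = a r * T \<Longrightarrow> (\<forall>X\<in>snd (y r). T * X = X * T)" for r T by blast+
  \<comment> \<open>Scales \<open>a r\<close> to norm at most 1/2, as
    \<open>generator_exists\<close> demands; commutation with it is unaffected.\<close>
  define \<rho> where "\<rho> r = 1 / (2 * (norm (a r) + 1))" for r
  have rho: "0 < \<rho> r" "\<rho> r * norm (a r) \<le> 1 / 2" for r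
  proof -
    have "0 < 2 * (norm (a r) + 1)" by (simp add: add_nonneg_pos)
    then show "0 < \<rho> r" "\<rho> r * norm (a r) \<le> 1 / 2" by (simp_all add: \<rho>_def pos_divide_le_eq)
  qed
  have "\<exists>x\<in>M. \<forall>T. commutes T x \<longrightarrow> (\<forall>n. commutes T (s n) \<and> T * (\<rho> n *\<^sub>R a n) = (\<rho> n *\<^sub>R a n) * T)"
    by (rule generator_exists) (use rho a in \<open>auto simp: M_closed star_scaleR less_imp_le\<close>)
  then obtain z where z: "z \<in> M" and zT: "\<And>T. commutes T z \<Longrightarrow> (\<forall>n. commutes T (s n) \<and> T * (\<rho> n *\<^sub>R a n) = (\<rho> n *\<^sub>R a n) * T)"
    by blast
  text \<open>\<open>S\<close> commutes with the successive quotients of the tower unitaries, so its conjugates by them all agree.\<close>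
  have A: "?c r S = ?c 0 S" "?c r S * fst (y r) = fst (y r) * ?c r S" "?c r S * u = u * ?c r S" if S: "commutes S z" for S r
  proof -
    have "S * a r = a r * S" for r
    proof -
      have "\<rho> r *\<^sub>R (S * a r) = \<rho> r *\<^sub>R (a r * S)" using zT[OF S] by simp
      then show ?thesis using rho(1)[of r] by simp
    qed
    then have XS: "\<forall>X\<in>snd (y r). S * X = X * S" for r using aX[of S r] zT[OF S] by blast
    note C = c[OF XS]
    show "?c r S * fst (y r) = fst (y r) * ?c r S" "?c r S * u = u * ?c r S" using C[of r] by auto
    show "?c r S = ?c 0 S"
    proof (induction r)
      case (Suc r)
      let ?T = "tow (mm r)" and ?T1 = "tow (mm (Suc r))"
      have "?c (Suc r) S = star ?T1 * (S * (?T1 * star ?T)) * ?T" by (simp add: mult.assoc unit_eqs[OF tow(2)])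
      also have "\<dots> = ?c r S" using C[of r] by (simp add: mult.assoc unit_cancel[OF tow(2)])
      finally show ?case using Suc by simp
    qed simp
  qed
  have B: "?c 0 S * w j = w j * ?c 0 S" if S: "commutes S z" for S j
  proof -
    have "w j * ?c 0 S = ?c 0 S * w j"
    proof (rule commute_n2_limit)
      fix n
      let ?r = "prod_encode (j, n)"
      show "fst (y ?r) \<in> M" "norm (fst (y ?r)) \<le> 1" by (rule x)+
      show "n2 (fst (y ?r) - w j) \<le> (1/2) ^ n" using x(3)[of ?r] by (simp add: J_def)
      show "fst (y ?r) * ?c 0 S = ?c 0 S * fst (y ?r)" using A(2)[OF S, of ?r] by (simp only: A(1)[OF S, of ?r])
    qed (simp_all add: w unit_norm)
    then show ?thesis by simp
  qed
  have st: "?c 0 (star S) = star (?c 0 S)" for S by (simp add: star_mult mult.assoc)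
  have co: "commutes T x" if "T * x = x * T" "star T * x = x * star T" for T x :: "'h bop"
  proof -
    have "star x * T = T * star x" using arg_cong[OF that(2), of star] by (simp add: star_mult)
    then show ?thesis using that(1) by (simp add: commutes_def)
  qed
  have "commutes (?c 0 S) u \<and> (\<forall>j. commutes (?c 0 S) (w j))" if S: "commutes S z" for S
    using A(3)[OF S, of 0] A(3)[OF commutes_star_left[OF S], of 0] B[OF S] B[OF commutes_star_left[OF S]]
    unfolding st by (blast intro: co)
  then show ?thesis using z tow(1,2)[of "mm 0"] by blast
qed

text \<open>If \<open>S\<close> commutes with \<open>x\<close>, its conjugate
  \<open>star T * S * T\<close> lies in the commutant of \<open>M\<close>. As \<open>T\<close> is in
  \<open>M\<close>, undoing the conjugation changes nothing there, so \<open>S\<close> itself lies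
  in the commutant.\<close>

theorem single_generator:
  fixes w :: "nat \<Rightarrow> 'h bop"
  assumes nb: "\<F> \<noteq> bot" and li: "\<And>j. linked \<F> (K j) (w j)" and w: "\<And>j. w j \<in> M" "\<And>j. unit (w j)"
    and gen: "\<And>S. commutes S u \<Longrightarrow> (\<And>j. commutes S (w j)) \<Longrightarrow> S \<in> comm M"
  shows "\<exists>x\<in>M. \<forall>S. commutes S x \<longrightarrow> S \<in> comm M"
proof -
  obtain x T where x: "x \<in> M" and T: "T \<in> M" "unit T"
    and c: "\<And>S. commutes S x \<Longrightarrow> commutes (star T * S * T) u \<and> (\<forall>j. commutes (star T * S * T) (w j))"
    using generated_core[where w = w and K = K, OF nb li w] by blast
  have "S \<in> comm M" if S: "commutes S x" for S
  proof -
    have S': "star T * S * T \<in> comm M" using c[OF S] by (intro gen) auto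
    then have "star T * S * T * star T = star T * (star T * S * T)" using M_star[OF T(1)] unfolding comm_def by blast
    then have "T * (star T * S * T * star T) = T * (star T * (star T * S * T))" by simp
    then have "S = star T * S * T" by (simp add: mult.assoc unit_cancel[OF T(2)] unit_eqs[OF T(2)])
    then show ?thesis using S' by simp
  qed
  then show ?thesis using x by blast
qed

end

section \<open>Operator sets and their lifts\<close>

text \<open>Complex polarisation. Because of it, a form that is real everywhere already belongs to a
  self-adjoint operator, which \<open>op_le\<close> does not demand explicitly.\<close>

lemma quadratic_form_zero:
  assumes q: "\<And>\<xi>. cinner (y \<triangleright> \<xi>) \<xi> = 0"
  shows "y = 0"
proof (rule bop_eqI)
  fix \<xi>
  have "cinner (y \<triangleright> \<xi>) \<eta> = 0" for \<eta>
  proof -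
    have p: "cinner (y \<triangleright> \<xi>) \<zeta> + cinner (y \<triangleright> \<zeta>) \<xi> = 0" for \<zeta>
      using q[of "\<xi> + \<zeta>"] by (simp add: ap_linear cinner_linear q add.commute)
    have "- \<i> * (cinner (y \<triangleright> \<xi>) \<eta> - cinner (y \<triangleright> \<eta>) \<xi>) = 0"
      using p[of "\<i> *\<^sub>C \<eta>"] by (simp add: ap_linear cinner_linear algebra_simps)
    then have "cinner (y \<triangleright> \<xi>) \<eta> = cinner (y \<triangleright> \<eta>) \<xi>" by simp
    then have "2 * cinner (y \<triangleright> \<xi>) \<eta> = 0" using p[of \<eta>] by (simp only: mult_2)
    then show ?thesis by simp
  qed
  then show "y \<triangleright> \<xi> = 0 \<triangleright> \<xi>" by (simp add: cinner_eq_zero_all)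
qed

lemma op_le_iff_form: "op_le (op_of x) (op_of y) \<longleftrightarrow> (\<forall>\<xi>. cinner ((y - x) \<triangleright> \<xi>) \<xi> \<in> \<real>\<^sub>\<ge>\<^sub>0)"
  by (simp add: op_le_def ap.rep_eq minus_bop.rep_eq)

lemma pos_iff_form: "pos z \<longleftrightarrow> (\<forall>\<xi>. cinner (z \<triangleright> \<xi>) \<xi> \<in> \<real>\<^sub>\<ge>\<^sub>0)"
proof
  assume z: "pos z"
  have "cnj (cinner (z \<triangleright> \<xi>) \<xi>) = cinner (z \<triangleright> \<xi>) \<xi>" for \<xi>
    using posD(1)[OF z] cinner_star[of z \<xi> \<xi>] cinner_commute[of \<xi> "z \<triangleright> \<xi>"] by simp
  then show "\<forall>\<xi>. cinner (z \<triangleright> \<xi>) \<xi> \<in> \<real>\<^sub>\<ge>\<^sub>0"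
    using posD(2)[OF z] by (simp add: complex_nonneg_Reals_iff complex_eq_iff)
next
  assume f: "\<forall>\<xi>. cinner (z \<triangleright> \<xi>) \<xi> \<in> \<real>\<^sub>\<ge>\<^sub>0"
  have "star z - z = 0"
  proof (rule quadratic_form_zero)
    fix \<xi>
    have "cinner (star z \<triangleright> \<xi>) \<xi> = cnj (cinner (z \<triangleright> \<xi>) \<xi>)"
      using cinner_star[of "star z" \<xi> \<xi>] cinner_commute[of \<xi> "z \<triangleright> \<xi>"] by simp
    then show "cinner ((star z - z) \<triangleright> \<xi>) \<xi> = 0"
      using f[rule_format, of \<xi>] by (auto simp: ap_linear cinner_linear complex_nonneg_Reals_iff complex_eq_iff)
  qed
  then show "pos z" using f by (simp add: pos_def complex_nonneg_Reals_iff)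
qed

lemma op_le_iff: "op_le (op_of x) (op_of y) \<longleftrightarrow> pos (y - x)"
  by (simp add: op_le_iff_form pos_iff_form)

definition lft :: "'h::complex_hilbert op set \<Rightarrow> 'h bop set" where
  "lft S = {x. op_of x \<in> S}"

lemma op_of_lft: "S \<subseteq> bounded_operators \<Longrightarrow> x \<in> S \<Longrightarrow> \<exists>y\<in>lft S. x = op_of y"
  unfolding lft_def by (metis bop_of_inverse mem_Collect_eq subsetD)

lemma commutant_bounded: "commutant S \<subseteq> bounded_operators"
  by (auto simp: commutant_def)

lemma op_of_mult_eq: "op_of x o\<^sub>L op_of y = op_of z o\<^sub>L op_of w \<longleftrightarrow> x * y = z * w"
  by (simp add: op_of_inject flip: times_bop.rep_eq)

lemma lft_commutant: assumes S: "S \<subseteq> bounded_operators" shows "lft (commutant S) = comm (lft S)"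
proof (intro set_eqI iffI)
  fix T assume T: "T \<in> lft (commutant S)"
  show "T \<in> comm (lft S)" unfolding comm_def
  proof (intro CollectI ballI)
    fix x assume "x \<in> lft S"
    then have "op_of T o\<^sub>L op_of x = op_of x o\<^sub>L op_of T" using T by (simp add: lft_def commutant_def)
    then show "T * x = x * T" by (simp add: op_of_mult_eq)
  qed
next
  fix T assume T: "T \<in> comm (lft S)"
  have "op_of T o\<^sub>L s = s o\<^sub>L op_of T" if s: "s \<in> S" for s
  proof -
    obtain y where y: "y \<in> lft S" "s = op_of y" using op_of_lft[OF S s] by blast
    then show ?thesis using T by (simp add: op_of_mult_eq comm_def)
  qed
  then show "T \<in> lft (commutant S)" using op_of[of T] by (simp add: lft_def commutant_def)
qed

lemma commutant_antimono: "S \<subseteq> T \<Longrightarrow> commutant T \<subseteq> commutant S"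
  by (auto simp: commutant_def)

lemma commutant_vn:
  assumes S: "S \<subseteq> bounded_operators" and sa: "\<And>x. x \<in> lft S \<Longrightarrow> star x \<in> lft S"
  shows "von_neumann_algebra (commutant S)"
  unfolding von_neumann_algebra_def
proof (intro conjI ballI)
  show "commutant S \<subseteq> bounded_operators" by (rule commutant_bounded)
  fix x assume x: "x \<in> commutant S"
  then obtain y where y: "y \<in> lft (commutant S)" "x = op_of y" using op_of_lft[OF commutant_bounded] by blast
  have "star y * s = s * star y" if s: "s \<in> lft S" for s
  proof -
    have "y * star s = star s * y" using y(1) sa[OF s] unfolding lft_commutant[OF S] comm_def by blast
    from arg_cong[OF this, of star] show ?thesis by (simp add: star_mult)
  qed
  then have "star y \<in> lft (commutant S)" unfolding lft_commutant[OF S] comm_def by blast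
  then show "adj x \<in> commutant S" by (simp add: y(2) lft_def flip: op_of_star)
next
  have 1: "T \<subseteq> commutant (commutant T)" if "T \<subseteq> bounded_operators" for T :: "'a op set"
    using that by (auto simp: commutant_def)
  show "commutant (commutant (commutant S)) = commutant S"
    using commutant_antimono[OF 1[OF S]] 1[OF commutant_bounded] by (rule equalityI)
qed

lemma vn_lft: assumes "von_neumann_algebra N" shows "vn (lft N)"
proof
  have N: "N \<subseteq> bounded_operators" "\<And>x. x \<in> N \<Longrightarrow> adj x \<in> N" "commutant (commutant N) = N"
    using assms by (auto simp: von_neumann_algebra_def)
  show "star x \<in> lft N" if "x \<in> lft N" for x using N(2) that by (simp add: lft_def op_of_star)
  have "comm (comm (lft N)) = lft (commutant (commutant N))"
    by (simp add: lft_commutant[OF N(1)] lft_commutant[OF commutant_bounded])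
  then show "comm (comm (lft N)) = lft N" by (simp add: N(3))
qed

text \<open>For every von Neumann algebra \<open>L\<close> that contains \<open>x\<close>, the
  assumption gives an inclusion of the commutant of \<open>L\<close> in that of \<open>N\<close>;
  bicommutants reverse it to \<open>N \<subseteq> L\<close>.\<close>

lemma singly_generatedI:
  assumes vN: "von_neumann_algebra N" and x: "x \<in> lft N" and c: "\<And>S. commutes S x \<Longrightarrow> S \<in> comm (lft N)"
  shows "singly_generated N"
  unfolding singly_generated_def
proof (intro bexI)
  show "op_of x \<in> N" using x by (simp add: lft_def)
  have N: "N \<subseteq> bounded_operators" "commutant (commutant N) = N" using vN by (auto simp: von_neumann_algebra_def)
  show "N = vn_generated {op_of x}"
  proof
    show "vn_generated {op_of x} \<subseteq> N" using vN x by (auto simp: vn_generated_def lft_def)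
    have "N \<subseteq> L" if L: "von_neumann_algebra L" "op_of x \<in> L" for L
    proof -
      have LL: "L \<subseteq> bounded_operators" "commutant (commutant L) = L" "op_of (star x) \<in> L"
        using L by (auto simp: von_neumann_algebra_def op_of_star)
      have "commutant L \<subseteq> commutant N"
      proof
        fix T assume "T \<in> commutant L"
        then obtain S where S: "S \<in> lft (commutant L)" "T = op_of S" using op_of_lft[OF commutant_bounded] by blast
        have "x \<in> lft L" "star x \<in> lft L" using L(2) LL(3) by (simp_all add: lft_def)
        then have "commutes S x" using S(1) unfolding lft_commutant[OF LL(1)] by (simp add: comm_def commutes_def)
        then have "S \<in> lft (commutant N)" unfolding lft_commutant[OF N(1)] by (rule c)
        then show "T \<in> commutant N" by (simp add: S(2) lft_def)
      qed
      from commutant_antimono[OF this] show ?thesis by (simp add: N LL)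
    qed
    then show "N \<subseteq> vn_generated {op_of x}" by (auto simp: vn_generated_def)
  qed
qed

text \<open>The commutant of \<open>{S, star S}\<close> is a von Neumann algebra containing the
  generators, hence it contains \<open>N\<close>.\<close>

lemma vn_generated_comm:
  assumes N: "N = vn_generated (op_of ` X)" and S: "\<And>x. x \<in> X \<Longrightarrow> commutes S x"
  shows "S \<in> comm (lft N)"
proof -
  define F where "F = {op_of S, op_of (star S)}"
  have F: "F \<subseteq> bounded_operators" using op_of by (auto simp: F_def)
  have lF: "lft F = {S, star S}" by (auto simp: lft_def F_def op_of_inject)
  have "von_neumann_algebra (commutant F)" by (rule commutant_vn[OF F]) (auto simp: lF)
  moreover have "op_of ` X \<subseteq> commutant F"
  proof
    fix y assume "y \<in> op_of ` X"
    then obtain x where x: "x \<in> X" "y = op_of x" by blast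
    have "x \<in> comm (lft F)" using S[OF x(1)] commutes_star_left[OF S[OF x(1)]] by (simp add: comm_def lF commutes_def)
    then show "y \<in> commutant F" unfolding lft_commutant[OF F, symmetric] by (simp add: x(2) lft_def)
  qed
  ultimately have "N \<subseteq> commutant F" unfolding N vn_generated_def by blast
  then have "lft N \<subseteq> comm (lft F)" unfolding lft_commutant[OF F, symmetric] by (auto simp: lft_def)
  then show ?thesis by (auto simp: comm_def lF)
qed

text \<open>The uses take \<open>c\<close> to be 1 or -1, so that lower and upper bounds pass to the
  limit alike.\<close>

lemma pos_sot_limit:
  assumes X: "sot X x" and p: "\<And>n. n0 \<le> n \<Longrightarrow> pos (c *\<^sub>R (X n - y))"
  shows "pos (c *\<^sub>R (x - y))"
  unfolding pos_iff_form
proof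
  fix \<xi>
  have "(\<lambda>n. cinner ((c *\<^sub>R (X n - y)) \<triangleright> \<xi>) \<xi>) \<longlonglongrightarrow> cinner ((c *\<^sub>R (x - y)) \<triangleright> \<xi>) \<xi>"
    using X unfolding sot_def ap_linear by (intro tendsto_cinner tendsto_intros) blast
  moreover have "\<forall>\<^sub>F n in sequentially. cinner ((c *\<^sub>R (X n - y)) \<triangleright> \<xi>) \<xi> \<in> \<real>\<^sub>\<ge>\<^sub>0"
    using p unfolding pos_iff_form by (auto simp: eventually_sequentially)
  ultimately show "cinner ((c *\<^sub>R (x - y)) \<triangleright> \<xi>) \<xi> \<in> \<real>\<^sub>\<ge>\<^sub>0"
    by (intro Lim_in_closed_set[OF closed_nonneg_Reals_complex]) auto
qed

text \<open>The strong limit of an increasing sequence is its least upper bound in \<open>N\<close>,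
  so normality for directed sets applies to the range of the sequence.\<close>

lemma normal_sequence:
  assumes vN: "von_neumann_algebra N" and no: "normal_on N \<tau>"
    and X: "\<And>n. X n \<in> lft N" "\<And>n. pos (X n)" "\<And>n. pos (X (Suc n) - X n)" and lim: "sot X x"
  shows "(\<lambda>n. Re (\<tau> (op_of (X n)))) \<longlonglongrightarrow> Re (\<tau> (op_of x))"
proof -
  interpret vn "lft N" by (rule vn_lft[OF vN])
  have N: "N \<subseteq> bounded_operators" using vN by (simp add: von_neumann_algebra_def)
  have nrm: "Re (\<tau> (op_of y)) = (SUP d\<in>D. Re (\<tau> (op_of d)))"
    if D: "D \<subseteq> lft N" "\<And>d. d \<in> D \<Longrightarrow> pos d" "D \<noteq> {}" "\<And>a b. a \<in> D \<Longrightarrow> b \<in> D \<Longrightarrow> \<exists>c\<in>D. pos (c - a) \<and> pos (c - b)"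
      and y: "y \<in> lft N" "\<And>d. d \<in> D \<Longrightarrow> pos (y - d)" "\<And>z. z \<in> lft N \<Longrightarrow> (\<And>d. d \<in> D \<Longrightarrow> pos (z - d)) \<Longrightarrow> pos (z - y)" for D y
  proof -
    have "op_of ` D \<subseteq> {d\<in>N. op_le 0 d}"
      using D(1,2) op_le_iff[of 0] by (auto simp: lft_def zero_bop.rep_eq)
    moreover have "\<forall>a\<in>op_of ` D. \<forall>b\<in>op_of ` D. \<exists>c\<in>op_of ` D. op_le a c \<and> op_le b c"
      using D(4) by (auto simp: op_le_iff)
    moreover have "op_lub_in N (op_of ` D) (op_of y)"
      unfolding op_lub_in_def
    proof (intro conjI ballI impI)
      show "op_of y \<in> N" using y(1) by (simp add: lft_def)
      show "op_le d (op_of y)" if "d \<in> op_of ` D" for d using that y(2) by (auto simp: op_le_iff)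
      fix z assume "z \<in> N" and z: "\<forall>d\<in>op_of ` D. op_le d z"
      then obtain w where w: "w \<in> lft N" "z = op_of w" using op_of_lft[OF N] by blast
      then show "op_le (op_of y) z" using z by (auto simp: op_le_iff intro!: y(3))
    qed
    moreover have "op_of ` D \<noteq> {}" using D(3) by simp
    ultimately have "Re (\<tau> (op_of y)) = (SUP d\<in>op_of ` D. Re (\<tau> d))"
      using no unfolding normal_on_def by blast
    then show ?thesis by (simp add: image_image)
  qed
  \<comment> \<open>Two comparable positive elements form a directed set with the larger one as
    least upper bound, so normality itself yields monotonicity of the trace.\<close>
  have mono: "Re (\<tau> (op_of a)) \<le> Re (\<tau> (op_of b))" if "a \<in> lft N" "b \<in> lft N" "pos a" "pos b" "pos (b - a)" for a b
  proof -
    have "pos (0 :: 'a bop)" by (simp add: pos_def)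
    then have "Re (\<tau> (op_of b)) = (SUP d\<in>{a, b}. Re (\<tau> (op_of d)))"
      by (intro nrm) (use that in auto)
    moreover have "\<dots> = max (Re (\<tau> (op_of a))) (Re (\<tau> (op_of b)))"
      by (simp add: cSup_eq_Max)
    ultimately show ?thesis by linarith
  qed
  have xN: "x \<in> lft N" by (rule M_sot[OF X(1) lim])
  have Xm: "pos (X m - X n)" if "n \<le> m" for n m
    using that
  proof (induction m rule: dec_induct)
    case (step m)
    have "pos (X (Suc m) - X m + (X m - X n))" by (intro pos_add X step)
    then show ?case by simp
  qed (simp add: pos_def)
  have Xx: "pos (x - X n)" for n
    using pos_sot_limit[OF lim, of n 1 "X n"] Xm by simp
  have px: "pos x" using pos_sot_limit[OF lim, of 0 1 0] X(2) by simp
  have "Re (\<tau> (op_of x)) = (SUP d\<in>range X. Re (\<tau> (op_of d)))"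
  proof (rule nrm)
    show "\<exists>c\<in>range X. pos (c - a) \<and> pos (c - b)" if "a \<in> range X" "b \<in> range X" for a b
    proof -
      obtain m n where "a = X m" "b = X n" using \<open>a \<in> range X\<close> \<open>b \<in> range X\<close> by blast
      then show ?thesis using Xm[of m "max m n"] Xm[of n "max m n"] by auto
    qed
    show "pos (z - x)" if z: "z \<in> lft N" "\<And>d. d \<in> range X \<Longrightarrow> pos (z - d)" for z
      using pos_sot_limit[OF lim, of 0 "-1" z] z(2) by simp
  qed (use X xN Xx in auto)
  then have eq: "Re (\<tau> (op_of x)) = (SUP n. Re (\<tau> (op_of (X n))))" by (simp add: image_image)
  have "(\<lambda>n. Re (\<tau> (op_of (X n)))) \<longlonglongrightarrow> (SUP n. Re (\<tau> (op_of (X n))))"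
  proof (rule LIMSEQ_incseq_SUP)
    show "bdd_above (range (\<lambda>n. Re (\<tau> (op_of (X n)))))"
      by (rule bdd_aboveI[of _ "Re (\<tau> (op_of x))"]) (auto intro: mono X xN px Xx)
    show "incseq (\<lambda>n. Re (\<tau> (op_of (X n))))"
      by (rule incseq_SucI) (intro mono X)
  qed
  then show ?thesis by (simp add: eq)
qed

lemma II1_lft:
  assumes "II1_factor N \<tau>"
  shows "II1 (lft N) (\<lambda>x. \<tau> (op_of x))"
proof -
  have vN: "von_neumann_algebra N" and fac: "N \<inter> commutant N = range scalar_op" and tr: "faithful_normal_tracial_state N \<tau>"
    using assms by (auto simp: II1_factor_def factor_def)
  have N: "N \<subseteq> bounded_operators" using vN by (simp add: von_neumann_algebra_def)
  interpret vn "lft N" by (rule vn_lft[OF vN])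
  show ?thesis
  proof unfold_locales
    fix x y assume "x \<in> lft N" "y \<in> lft N"
    then show "\<tau> (op_of (x + y)) = \<tau> (op_of x) + \<tau> (op_of y)" "\<tau> (op_of (x * y)) = \<tau> (op_of (y * x))"
      using tr by (auto simp: faithful_normal_tracial_state_def lft_def plus_bop.rep_eq times_bop.rep_eq)
  next
    fix x assume "x \<in> lft N"
    then show "\<tau> (op_of (cop a * x)) = a * \<tau> (op_of x)" "\<tau> (op_of (star x * x)) \<in> \<real>\<^sub>\<ge>\<^sub>0"
      "\<tau> (op_of (star x * x)) = 0 \<Longrightarrow> x = 0" for a
      using tr op_of_inject[of x 0] by (auto simp: faithful_normal_tracial_state_def lft_def cop.rep_eq times_bop.rep_eq op_of_star zero_bop.rep_eq)
  next
    show "\<tau> (op_of 1) = 1" using tr by (simp add: faithful_normal_tracial_state_def one_bop.rep_eq)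
  next
    fix X x assume "\<And>n. X n \<in> lft N" "\<And>n. pos (X n)" "\<And>n. pos (X (Suc n) - X n)" "sot X x"
    then show "(\<lambda>n. Re (\<tau> (op_of (X n)))) \<longlonglongrightarrow> Re (\<tau> (op_of x))"
      using tr by (intro normal_sequence[OF vN]) (auto simp: faithful_normal_tracial_state_def)
  next
    fix x assume x: "x \<in> lft N" and c: "\<And>y. y \<in> lft N \<Longrightarrow> x * y = y * x"
    have "x \<in> lft (commutant N)" unfolding lft_commutant[OF N] using c by (simp add: comm_def)
    then have "op_of x \<in> range scalar_op" using x unfolding fac[symmetric] by (simp add: lft_def)
    then obtain a where "op_of x = op_of (cop a)" by (auto simp: cop.rep_eq)
    then show "\<exists>a. x = cop a" by (auto simp: op_of_inject)
  qed
qed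

section \<open>The ultrapower\<close>

text \<open>Compactness of the ball gives a cluster point, and along an ultrafilter a cluster point
  is a limit.\<close>

lemma ultrafilter_bounded_limit:
  fixes f :: "nat \<Rightarrow> complex"
  assumes U: "free_ultrafilter U" and B: "\<And>n. norm (f n) \<le> B"
  shows "\<exists>l. (f \<longlongrightarrow> l) U"
proof -
  have nb: "U \<noteq> bot" and ult: "eventually P U \<or> eventually (\<lambda>n. \<not> P n) U" for P
    using U by (auto simp: free_ultrafilter_def)
  have "eventually (\<lambda>z. z \<in> cball 0 B) (filtermap f U)" by (simp add: eventually_filtermap B)
  moreover have "filtermap f U \<noteq> bot" using nb by (simp add: filtermap_bot_iff)
  ultimately obtain l where l: "inf (nhds l) (filtermap f U) \<noteq> bot"
    using compact_cball[of "0::complex" B] unfolding compact_filter by blast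
  have "(f \<longlongrightarrow> l) U"
  proof (rule topological_tendstoI)
    fix S assume S: "open S" "l \<in> S"
    show "eventually (\<lambda>n. f n \<in> S) U"
    proof (rule ccontr)
      assume "\<not> eventually (\<lambda>n. f n \<in> S) U"
      then have "eventually (\<lambda>n. f n \<notin> S) U" using ult by blast
      then have "eventually (\<lambda>z. z \<notin> S) (filtermap f U)" by (simp add: eventually_filtermap)
      moreover have "eventually (\<lambda>z. z \<in> S) (nhds l)" using S by (rule eventually_nhds_in_open)
      ultimately have "eventually (\<lambda>z. False) (inf (nhds l) (filtermap f U))"
        unfolding eventually_inf by blast
      then show False using l by (simp add: eventually_False)
    qed
  qed
  then show ?thesis by blast
qed

text \<open>The operations of the ultrapower are unions over representatives; once all
  representatives yield the same class, the union is that class.\<close>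

lemma UN_const: "a \<in> A \<Longrightarrow> (\<And>x. x \<in> A \<Longrightarrow> F x = c) \<Longrightarrow> (\<Union>x\<in>A. F x) = c"
  by auto

locale ultra =
  fixes N :: "'h::complex_hilbert op set" and \<tau> :: "'h op \<Rightarrow> complex" and U :: "nat filter"
  assumes II1N: "II1_factor N \<tau>" and fu: "free_ultrafilter U"
begin

sublocale II1 "lft N" "\<lambda>x. \<tau> (op_of x)" by (rule II1_lft[OF II1N])
sublocale up: tracial_ultrapower N \<tau> U .

lemma N_bounded: "N \<subseteq> bounded_operators"
  using II1N by (simp add: II1_factor_def factor_def von_neumann_algebra_def)

lemma U_nb: "U \<noteq> bot" using fu by (simp add: free_ultrafilter_def)

section \<open>Bounded sequences modulo 2-norm null sequences\<close>

definition bs :: "(nat \<Rightarrow> 'h bop) set" where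
  "bs = {x. (\<forall>n. x n \<in> lft N) \<and> (\<exists>B. \<forall>n. norm (x n) \<le> B)}"

definition nz :: "(nat \<Rightarrow> 'h bop) \<Rightarrow> bool" where
  "nz x \<longleftrightarrow> ((\<lambda>n. n2 (x n)) \<longlongrightarrow> 0) U"

definition cl :: "(nat \<Rightarrow> 'h bop) \<Rightarrow> (nat \<Rightarrow> 'h op) set" where
  "cl x = up.up_class (\<lambda>n. op_of (x n))"

lemma bsD: "x \<in> bs \<Longrightarrow> x n \<in> lft N" "x \<in> bs \<Longrightarrow> \<exists>B\<ge>0. \<forall>n. norm (x n) \<le> B"
proof -
  show "x \<in> bs \<Longrightarrow> x n \<in> lft N" by (simp add: bs_def)
  assume "x \<in> bs"
  then obtain B where B: "\<And>n. norm (x n) \<le> B" by (auto simp: bs_def)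
  moreover have "0 \<le> B" by (rule order_trans[OF norm_ge_zero B])
  ultimately show "\<exists>B\<ge>0. \<forall>n. norm (x n) \<le> B" by blast
qed

lemma bsI: "(\<And>n. x n \<in> lft N) \<Longrightarrow> (\<And>n. norm (x n) \<le> B) \<Longrightarrow> x \<in> bs"
  by (auto simp: bs_def)

lemma bs_const: "a \<in> lft N \<Longrightarrow> (\<lambda>n. a) \<in> bs" by (rule bsI) auto

lemma bs_star: assumes x: "x \<in> bs" shows "(\<lambda>n. star (x n)) \<in> bs"
proof -
  obtain B where "\<And>n. norm (x n) \<le> B" using bsD(2)[OF x] by blast
  then show ?thesis by (intro bsI[of _ B] M_closed bsD(1)[OF x]) simp
qed

lemma bs_mult: assumes x: "x \<in> bs" and y: "y \<in> bs" shows "(\<lambda>n. x n * y n) \<in> bs"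
proof -
  obtain B C where B: "0 \<le> B" "\<And>n. norm (x n) \<le> B" and C: "\<And>n. norm (y n) \<le> C"
    using bsD(2)[OF x] bsD(2)[OF y] by blast
  show ?thesis
    by (intro bsI[of _ "B * C"] M_closed bsD(1)[OF x] bsD(1)[OF y] order_trans[OF norm_mult_ineq] mult_mono B C) auto
qed

lemma bs_diff: assumes x: "x \<in> bs" and y: "y \<in> bs" shows "(\<lambda>n. x n - y n) \<in> bs"
proof -
  obtain B C where B: "\<And>n. norm (x n) \<le> B" and C: "\<And>n. norm (y n) \<le> C"
    using bsD(2)[OF x] bsD(2)[OF y] by blast
  show ?thesis
    by (intro bsI[of _ "B + C"] M_closed bsD(1)[OF x] bsD(1)[OF y] order_trans[OF norm_triangle_ineq4] add_mono B C)
qed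

lemma bs_power: "x \<in> bs \<Longrightarrow> (\<lambda>n. x n ^ m) \<in> bs"
  by (induction m) (auto intro: bs_const bs_mult M_one)

lemma bs_unit: "(\<And>n. v n \<in> lft N) \<Longrightarrow> (\<And>n. unit (v n)) \<Longrightarrow> v \<in> bs"
  by (rule bsI[of _ 1]) (auto intro: unit_norm)

lemma nzI: "(\<And>n. n2 (x n) \<le> g n) \<Longrightarrow> (g \<longlongrightarrow> 0) U \<Longrightarrow> nz x"
  unfolding nz_def by (rule Lim_null_comparison[of _ g]) auto

lemma nz_zero: "nz (\<lambda>n. x n - x n)" by (simp add: nz_def)

lemma nz_commute: "x \<in> bs \<Longrightarrow> y \<in> bs \<Longrightarrow> nz (\<lambda>n. x n - y n) \<Longrightarrow> nz (\<lambda>n. y n - x n)"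
  unfolding nz_def by (simp add: n2_minus_commute[OF bsD(1) bsD(1)])

lemma nz_trans:
  assumes x: "x \<in> bs" and y: "y \<in> bs" and z: "z \<in> bs" and xy: "nz (\<lambda>n. x n - y n)" and yz: "nz (\<lambda>n. y n - z n)"
  shows "nz (\<lambda>n. x n - z n)"
proof (rule nzI)
  show "n2 (x n - z n) \<le> n2 (x n - y n) + n2 (y n - z n)" for n by (intro n2_dist_triangle bsD x y z)
  show "((\<lambda>n. n2 (x n - y n) + n2 (y n - z n)) \<longlongrightarrow> 0) U"
    using tendsto_add[OF xy[unfolded nz_def] yz[unfolded nz_def]] by simp
qed

lemma nz_star: "x \<in> bs \<Longrightarrow> y \<in> bs \<Longrightarrow> nz (\<lambda>n. x n - y n) \<Longrightarrow> nz (\<lambda>n. star (x n) - star (y n))"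
  unfolding nz_def by (simp add: n2_star[OF M_diff[OF bsD(1) bsD(1)]] flip: star_diff)

lemma nz_diff:
  assumes x: "x \<in> bs" "x' \<in> bs" and y: "y \<in> bs" "y' \<in> bs" and xx: "nz (\<lambda>n. x n - x' n)" and yy: "nz (\<lambda>n. y n - y' n)"
  shows "nz (\<lambda>n. (x n - y n) - (x' n - y' n))"
proof (rule nzI)
  fix n
  have "x n - y n - (x' n - y' n) = (x n - x' n) - (y n - y' n)" by simp
  then show "n2 (x n - y n - (x' n - y' n)) \<le> n2 (x n - x' n) + n2 (y n - y' n)"
    by (simp only:) (intro n2_triangle_diff M_closed bsD x y)
next
  show "((\<lambda>n. n2 (x n - x' n) + n2 (y n - y' n)) \<longlongrightarrow> 0) U"
    using tendsto_add[OF xx[unfolded nz_def] yy[unfolded nz_def]] by simp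
qed

lemma nz_mult:
  assumes x: "x \<in> bs" "x' \<in> bs" and y: "y \<in> bs" "y' \<in> bs" and xx: "nz (\<lambda>n. x n - x' n)" and yy: "nz (\<lambda>n. y n - y' n)"
  shows "nz (\<lambda>n. x n * y n - x' n * y' n)"
proof -
  obtain B C where B: "\<And>n. norm (x n) \<le> B" and C: "\<And>n. norm (y' n) \<le> C"
    using bsD(2)[OF x(1)] bsD(2)[OF y(2)] by blast
  note m = bsD(1)[OF x(1)] bsD(1)[OF x(2)] bsD(1)[OF y(1)] bsD(1)[OF y(2)]
  show ?thesis
  proof (rule nzI)
    fix n
    have "x n * y n - x' n * y' n = x n * (y n - y' n) + (x n - x' n) * y' n" by (simp add: algebra_simps)
    then have "n2 (x n * y n - x' n * y' n) \<le> n2 (x n * (y n - y' n)) + n2 ((x n - x' n) * y' n)"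
      by (simp only:) (intro n2_triangle M_closed m)
    also have "\<dots> \<le> norm (x n) * n2 (y n - y' n) + n2 (x n - x' n) * norm (y' n)"
      by (intro add_mono n2_mult_left n2_mult_right M_closed m)
    also have "\<dots> \<le> B * n2 (y n - y' n) + n2 (x n - x' n) * C"
      by (intro add_mono mult_right_mono mult_left_mono B C n2_nonneg)
    finally show "n2 (x n * y n - x' n * y' n) \<le> B * n2 (y n - y' n) + n2 (x n - x' n) * C" .
  next
    have "((\<lambda>n. B * n2 (y n - y' n) + n2 (x n - x' n) * C) \<longlongrightarrow> B * 0 + 0 * C) U"
      using xx yy unfolding nz_def by (intro tendsto_intros)
    then show "((\<lambda>n. B * n2 (y n - y' n) + n2 (x n - x' n) * C) \<longlongrightarrow> 0) U" by simp
  qed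
qed

section \<open>Identification with the classes of the ultrapower\<close>

lemma norm2_eq: "x \<in> lft N \<Longrightarrow> norm2 \<tau> (op_of x) = n2 x"
  using tr_star_mult_nonneg[of x] by (simp add: norm2_def n2_def tr_def op_of_star times_bop.rep_eq)

lemma bounded_seqs_iff: "X \<in> bounded_seqs N \<longleftrightarrow> (\<exists>x\<in>bs. X = (\<lambda>n. op_of (x n)))"
proof
  assume X: "X \<in> bounded_seqs N"
  have XN: "X n \<in> N" for n using X by (auto simp: bounded_seqs_def)
  obtain B where B: "norm (X n) \<le> B" for n using X by (auto simp: bounded_seqs_def bounded_iff)
  have eq: "op_of (bop_of (X n)) = X n" for n using XN N_bounded by (auto intro: bop_of_inverse)
  have "(\<lambda>n. bop_of (X n)) \<in> bs"
    by (rule bsI[of _ B]) (simp_all add: lft_def eq XN norm_bop.rep_eq B)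
  then show "\<exists>x\<in>bs. X = (\<lambda>n. op_of (x n))" by (intro bexI[of _ "\<lambda>n. bop_of (X n)"]) (simp_all add: eq)
next
  assume "\<exists>x\<in>bs. X = (\<lambda>n. op_of (x n))"
  then obtain x where x: "x \<in> bs" "X = (\<lambda>n. op_of (x n))" by blast
  obtain B where "\<And>n. norm (x n) \<le> B" using bsD(2)[OF x(1)] by blast
  then show "X \<in> bounded_seqs N" using bsD(1)[OF x(1)]
    by (auto simp: bounded_seqs_def x(2) lft_def bounded_iff norm_bop.rep_eq)
qed

lemma up_rel_iff:
  assumes "x \<in> bs" "y \<in> bs"
  shows "((\<lambda>n. op_of (x n)), (\<lambda>n. op_of (y n))) \<in> up.up_rel \<longleftrightarrow> nz (\<lambda>n. x n - y n)"
proof -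
  have "(\<lambda>n. op_of (x n)) \<in> bounded_seqs N" "(\<lambda>n. op_of (y n)) \<in> bounded_seqs N"
    using assms bounded_seqs_iff by blast+
  moreover have "norm2 \<tau> (op_of (x n) - op_of (y n)) = n2 (x n - y n)" for n
    using norm2_eq[OF M_diff[OF bsD(1)[OF assms(1), of n] bsD(1)[OF assms(2), of n]]] by (simp add: minus_bop.rep_eq)
  ultimately show ?thesis by (simp add: up.up_rel_def nz_def)
qed

lemma mem_cl:
  assumes x: "x \<in> bs"
  shows "X \<in> cl x \<longleftrightarrow> (\<exists>y\<in>bs. X = (\<lambda>n. op_of (y n)) \<and> nz (\<lambda>n. x n - y n))"
proof
  assume "X \<in> cl x"
  then have r: "((\<lambda>n. op_of (x n)), X) \<in> up.up_rel" by (simp add: cl_def up.up_class_def)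
  then have "X \<in> bounded_seqs N" by (simp add: up.up_rel_def)
  then obtain y where y: "y \<in> bs" "X = (\<lambda>n. op_of (y n))" using bounded_seqs_iff by blast
  show "\<exists>y\<in>bs. X = (\<lambda>n. op_of (y n)) \<and> nz (\<lambda>n. x n - y n)"
    using r y(1) unfolding y(2) up_rel_iff[OF x y(1)] by blast
next
  assume "\<exists>y\<in>bs. X = (\<lambda>n. op_of (y n)) \<and> nz (\<lambda>n. x n - y n)"
  then show "X \<in> cl x" using up_rel_iff[OF x] by (auto simp: cl_def up.up_class_def)
qed

lemma self_mem_cl: "x \<in> bs \<Longrightarrow> (\<lambda>n. op_of (x n)) \<in> cl x"
  using mem_cl nz_zero by blast

lemma cl_eq_iff:
  assumes x: "x \<in> bs" and y: "y \<in> bs"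
  shows "cl x = cl y \<longleftrightarrow> nz (\<lambda>n. x n - y n)"
proof
  assume "cl x = cl y"
  then have "(\<lambda>n. op_of (y n)) \<in> cl x" using self_mem_cl[OF y] by simp
  then show "nz (\<lambda>n. x n - y n)" using up_rel_iff[OF x y] by (simp add: cl_def up.up_class_def)
next
  assume xy: "nz (\<lambda>n. x n - y n)"
  have "nz (\<lambda>n. x n - z n) \<longleftrightarrow> nz (\<lambda>n. y n - z n)" if "z \<in> bs" for z
    using nz_trans[OF x y that xy] nz_trans[OF y x that nz_commute[OF x y xy]] by blast
  then show "cl x = cl y" by (intro set_eqI) (auto simp: mem_cl[OF x] mem_cl[OF y])
qed

lemma up_carrierE: assumes "X \<in> up.up_carrier" obtains x where "x \<in> bs" "X = cl x"
proof -
  obtain Y where "Y \<in> bounded_seqs N" "X = up.up_class Y"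
    using assms by (auto simp: up.up_carrier_def up.up_class_def quotient_def)
  then show ?thesis using that bounded_seqs_iff by (auto simp: cl_def)
qed

lemma up_embed_cl: "up.up_embed (op_of a) = cl (\<lambda>n. a)"
  by (simp add: up.up_embed_def cl_def)

lemma up_adj_cl: assumes x: "x \<in> bs" shows "up.up_adj (cl x) = cl (\<lambda>n. star (x n))"
  unfolding up.up_adj_def
proof (rule UN_const[OF self_mem_cl[OF x]])
  fix X assume "X \<in> cl x"
  then obtain y where y: "y \<in> bs" "X = (\<lambda>n. op_of (y n))" "nz (\<lambda>n. x n - y n)" using mem_cl[OF x] by blast
  have "up.up_class (\<lambda>n. adj (X n)) = cl (\<lambda>n. star (y n))" by (simp add: y(2) cl_def op_of_star)
  also have "\<dots> = cl (\<lambda>n. star (x n))"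
    using nz_star[OF x y(1,3)] cl_eq_iff[OF bs_star[OF x] bs_star[OF y(1)]] by simp
  finally show "up.up_class (\<lambda>n. adj (X n)) = cl (\<lambda>n. star (x n))" .
qed

lemma up_mult_cl: assumes x: "x \<in> bs" and y: "y \<in> bs" shows "up.up_mult (cl x) (cl y) = cl (\<lambda>n. x n * y n)"
  unfolding up.up_mult_def
proof (rule UN_const[OF self_mem_cl[OF x]], rule UN_const[OF self_mem_cl[OF y]])
  fix X Y assume "X \<in> cl x" "Y \<in> cl y"
  then obtain x' y' where x': "x' \<in> bs" "X = (\<lambda>n. op_of (x' n))" "nz (\<lambda>n. x n - x' n)"
    and y': "y' \<in> bs" "Y = (\<lambda>n. op_of (y' n))" "nz (\<lambda>n. y n - y' n)" using mem_cl[OF x] mem_cl[OF y] by blast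
  have "up.up_class (\<lambda>n. X n o\<^sub>L Y n) = cl (\<lambda>n. x' n * y' n)" by (simp add: x'(2) y'(2) cl_def times_bop.rep_eq)
  also have "\<dots> = cl (\<lambda>n. x n * y n)"
    using nz_mult[OF x x'(1) y y'(1) x'(3) y'(3)] cl_eq_iff[OF bs_mult[OF x y] bs_mult[OF x'(1) y'(1)]] by simp
  finally show "up.up_class (\<lambda>n. X n o\<^sub>L Y n) = cl (\<lambda>n. x n * y n)" .
qed

lemma up_diff_cl: assumes x: "x \<in> bs" and y: "y \<in> bs" shows "up.up_diff (cl x) (cl y) = cl (\<lambda>n. x n - y n)"
  unfolding up.up_diff_def
proof (rule UN_const[OF self_mem_cl[OF x]], rule UN_const[OF self_mem_cl[OF y]])
  fix X Y assume "X \<in> cl x" "Y \<in> cl y"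
  then obtain x' y' where x': "x' \<in> bs" "X = (\<lambda>n. op_of (x' n))" "nz (\<lambda>n. x n - x' n)"
    and y': "y' \<in> bs" "Y = (\<lambda>n. op_of (y' n))" "nz (\<lambda>n. y n - y' n)" using mem_cl[OF x] mem_cl[OF y] by blast
  have "up.up_class (\<lambda>n. X n - Y n) = cl (\<lambda>n. x' n - y' n)" by (simp add: x'(2) y'(2) cl_def minus_bop.rep_eq)
  also have "\<dots> = cl (\<lambda>n. x n - y n)"
    using nz_diff[OF x x'(1) y y'(1) x'(3) y'(3)] cl_eq_iff[OF bs_diff[OF x y] bs_diff[OF x'(1) y'(1)]] by simp
  finally show "up.up_class (\<lambda>n. X n - Y n) = cl (\<lambda>n. x n - y n)" .
qed

lemma up_power_cl: "x \<in> bs \<Longrightarrow> up.up_power (cl x) m = cl (\<lambda>n. x n ^ m)"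
  by (induction m) (simp_all add: up_embed_cl[of 1, unfolded one_bop.rep_eq] up_mult_cl bs_power)

lemma tau_le_n2: assumes x: "x \<in> lft N" shows "cmod (\<tau> (op_of x)) \<le> 2 * n2 x"
proof -
  have t: "\<bar>tr y\<bar> \<le> n2 y" if "y \<in> lft N" for y using tr_cauchy_schwarz[OF M_one that] by simp
  have "tr (cop (- \<i>) * x) = Im (\<tau> (op_of x))" using tau_cop[OF x, of "- \<i>"] by (simp add: tr_def)
  moreover have "n2 (cop (- \<i>) * x) = n2 x" using n2_cop[OF x, of "- \<i>"] by simp
  ultimately have "\<bar>Im (\<tau> (op_of x))\<bar> \<le> n2 x" using t[of "cop (- \<i>) * x"] x by (simp add: M_closed)
  moreover have "\<bar>Re (\<tau> (op_of x))\<bar> \<le> n2 x" using t[OF x] by (simp add: tr_def)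
  ultimately show ?thesis using cmod_le[of "\<tau> (op_of x)"] by linarith
qed

text \<open>\<open>up_trace\<close> is a definite description. The ultrafilter provides a limit
  along one representative, 2-norm null sequences do not change it, and limits along
  \<open>U\<close> are unique, so the description denotes this limit.\<close>

lemma up_trace_zero:
  assumes x: "x \<in> bs" and tr0: "up.up_trace (cl x) = 0"
  shows "((\<lambda>n. \<tau> (op_of (x n))) \<longlongrightarrow> 0) U"
proof -
  obtain B where B: "\<And>n. norm (x n) \<le> B" using bsD(2)[OF x] by blast
  have "cmod (\<tau> (op_of (x n))) \<le> 2 * B" for n
    using tau_le_n2[OF bsD(1)[OF x, of n]] n2_le_norm[OF bsD(1)[OF x, of n]] B[of n] by linarith
  from ultrafilter_bounded_limit[of U "\<lambda>n. \<tau> (op_of (x n))", OF fu this] obtain l where l: "((\<lambda>n. \<tau> (op_of (x n))) \<longlongrightarrow> l) U" by blast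
  have all: "\<forall>X\<in>cl x. ((\<lambda>n. \<tau> (X n)) \<longlongrightarrow> l) U"
  proof
    fix X assume "X \<in> cl x"
    then obtain y where y: "y \<in> bs" "X = (\<lambda>n. op_of (y n))" "nz (\<lambda>n. x n - y n)" using mem_cl[OF x] by blast
    have "((\<lambda>n. \<tau> (op_of (y n)) - \<tau> (op_of (x n))) \<longlongrightarrow> 0) U"
    proof (rule Lim_null_comparison)
      have yx: "\<tau> (op_of (y n)) = \<tau> (op_of (x n)) + \<tau> (op_of (y n - x n))" for n
        using tau_add[OF bsD(1)[OF x, of n] M_diff[OF bsD(1)[OF y(1), of n] bsD(1)[OF x, of n]]] by simp
      show "\<forall>\<^sub>F n in U. norm (\<tau> (op_of (y n)) - \<tau> (op_of (x n))) \<le> 2 * n2 (y n - x n)"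
        unfolding yx using tau_le_n2[OF M_diff[OF bsD(1)[OF y(1)] bsD(1)[OF x]]] by simp
      show "((\<lambda>n. 2 * n2 (y n - x n)) \<longlongrightarrow> 0) U"
        using tendsto_mult_left[OF nz_commute[OF x y(1,3), unfolded nz_def], of 2] by simp
    qed
    from tendsto_add[OF this l] show "((\<lambda>n. \<tau> (X n)) \<longlongrightarrow> l) U" by (simp add: y(2))
  qed
  have "up.up_trace (cl x) = l"
    unfolding up.up_trace_def
  proof (rule the_equality)
    show "\<forall>X\<in>cl x. ((\<lambda>n. \<tau> (X n)) \<longlongrightarrow> l) U" by (rule all)
    fix l' assume l': "\<forall>X\<in>cl x. ((\<lambda>n. \<tau> (X n)) \<longlongrightarrow> l') U"
    have "((\<lambda>n. \<tau> (op_of (x n))) \<longlongrightarrow> l') U" by (rule bspec[OF l' self_mem_cl[OF x]])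
    then show "l' = l" using l by (rule tendsto_unique[OF U_nb])
  qed
  then show ?thesis using l tr0 by simp
qed

text \<open>A representative of a unitary is unitary only asymptotically.
  \<open>unitary_lift\<close> replaces each term by a unitary whose 2-norm distance is at most
  \<open>n2 (star (x n) * x n - 1)\<close>, a null sequence along \<open>U\<close>.\<close>

lemma up_unitary_lift:
  assumes "up.up_unitary X"
  obtains v where "\<And>n. v n \<in> lft N" "\<And>n. unit (v n)" "X = cl v"
proof -
  obtain x where x: "x \<in> bs" "X = cl x" using assms up_carrierE unfolding up.up_unitary_def by blast
  have sx: "(\<lambda>n. star (x n) * x n) \<in> bs" by (intro bs_mult bs_star x)
  have "cl (\<lambda>n. star (x n) * x n) = cl (\<lambda>n. 1)"
    using assms unfolding up.up_unitary_def x(2) up_adj_cl[OF x(1)] up_mult_cl[OF bs_star[OF x(1)] x(1)]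
    by (simp add: up_embed_cl[of 1, unfolded one_bop.rep_eq])
  then have nz1: "nz (\<lambda>n. star (x n) * x n - 1)" using cl_eq_iff[OF sx bs_const[OF M_one]] by simp
  have "\<forall>n. \<exists>v. v \<in> lft N \<and> unit v \<and> n2 (x n - v) \<le> n2 (star (x n) * x n - 1)"
    using unitary_lift[OF bsD(1)[OF x(1)]] by blast
  then obtain v where v0: "\<forall>n. v n \<in> lft N \<and> unit (v n) \<and> n2 (x n - v n) \<le> n2 (star (x n) * x n - 1)"
    by (rule exE[OF choice])
  then have v: "\<And>n. v n \<in> lft N" "\<And>n. unit (v n)" by auto
  have "nz (\<lambda>n. x n - v n)" by (rule nzI[OF _ nz1[unfolded nz_def]]) (use v0 in blast)
  then have "X = cl v" using cl_eq_iff[OF x(1) bs_unit[OF v]] x(2) by simp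
  then show ?thesis using that v by blast
qed

lemma up_haar_limit:
  assumes v: "\<And>n. v n \<in> lft N" "\<And>n. unit (v n)" and h: "up.up_haar (cl v)" and m: "1 \<le> m"
  shows "((\<lambda>n. \<tau> (op_of (v n ^ m))) \<longlongrightarrow> 0) U"
proof (rule up_trace_zero)
  show "(\<lambda>n. v n ^ m) \<in> bs" by (intro bs_power bs_unit v)
  have "up.up_trace (up.up_int_power (cl v) (int m)) = 0" using h m by (simp add: up.up_haar_def)
  then show "up.up_trace (cl (\<lambda>n. v n ^ m)) = 0" by (simp add: up.up_int_power_def up_power_cl[OF bs_unit[OF v]])
qed

lemma up_commutator_limit:
  assumes v: "v \<in> bs" "w \<in> bs" and c: "up.up_commutator (cl v) (cl w) = up.up_embed 0"
  shows "((\<lambda>n. n2 (v n * w n - w n * v n)) \<longlongrightarrow> 0) U"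
proof -
  have "cl (\<lambda>n. v n * w n - w n * v n) = cl (\<lambda>n. 0)"
    using c by (simp add: up.up_commutator_def up_mult_cl v up_diff_cl bs_mult up_embed_cl[of 0, unfolded zero_bop.rep_eq])
  then have "nz (\<lambda>n. v n * w n - w n * v n - 0)"
    by (subst (asm) cl_eq_iff) (intro bs_diff bs_mult v bs_const M_zero)+
  then show ?thesis by (simp add: nz_def)
qed

lemma haar_connected_lift:
  assumes a: "a \<in> lft N" "unit a" and b: "b \<in> lft N" "unit b" and c: "up.haar_connected (op_of a) (op_of b)"
  shows "\<exists>k v. (\<forall>l\<le>Suc k. (\<forall>n. v l n \<in> lft N \<and> unit (v l n)) \<and> (\<forall>m\<ge>1. ((\<lambda>n. \<tau> (op_of (v l n ^ m))) \<longlongrightarrow> 0) U)) \<and>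
    v 0 = (\<lambda>n. a) \<and> v (Suc k) = (\<lambda>n. b) \<and>
    (\<forall>l<Suc k. ((\<lambda>n. n2 (v l n * v (Suc l) n - v (Suc l) n * v l n)) \<longlongrightarrow> 0) U)"
proof -
  obtain k' w where k': "0 < k'" and w: "w 0 = up.up_embed (op_of a)" "w k' = up.up_embed (op_of b)"
    "\<And>i. i \<le> k' \<Longrightarrow> up.up_haar (w i)" "\<And>i. i < k' \<Longrightarrow> up.up_commutator (w i) (w (Suc i)) = up.up_embed 0"
    using c unfolding up.haar_connected_def by blast
  obtain k where k: "k' = Suc k" using k' gr0_implies_Suc by blast
  have "\<forall>i. \<exists>v. i \<le> Suc k \<longrightarrow> (\<forall>n. v n \<in> lft N \<and> unit (v n)) \<and> w i = cl v"
  proof (intro allI)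
    fix i
    show "\<exists>v. i \<le> Suc k \<longrightarrow> (\<forall>n. v n \<in> lft N \<and> unit (v n)) \<and> w i = cl v"
    proof (cases "i \<le> Suc k")
      case True
      then have "up.up_unitary (w i)" using w(3)[of i] by (simp add: up.up_haar_def k)
      then obtain v where "\<And>n. v n \<in> lft N" "\<And>n. unit (v n)" "w i = cl v" by (rule up_unitary_lift) blast
      then show ?thesis by blast
    qed simp
  qed
  then obtain v' where v': "\<forall>i. i \<le> Suc k \<longrightarrow> (\<forall>n. v' i n \<in> lft N \<and> unit (v' i n)) \<and> w i = cl (v' i)" by (rule exE[OF choice])
  \<comment> \<open>The lifts at the two ends are exchanged for the constant sequences, so the chain
    starts exactly at \<open>a\<close> and ends exactly at \<open>b\<close>.\<close>
  define v where "v i = (if i = 0 then (\<lambda>n. a) else if i = Suc k then (\<lambda>n. b) else v' i)" for i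
  have v: "v i n \<in> lft N" "unit (v i n)" and wv: "w i = cl (v i)" if "i \<le> Suc k" for i n
    using v' that a b w(1,2) by (auto simp: v_def k up_embed_cl)
  have vb: "v i \<in> bs" if "i \<le> Suc k" for i by (intro bs_unit v that)
  have "((\<lambda>n. \<tau> (op_of (v l n ^ m))) \<longlongrightarrow> 0) U" if l: "l \<le> Suc k" and m: "1 \<le> m" for l m
    by (rule up_haar_limit[OF v(1)[OF l] v(2)[OF l] _ m]) (use w(3)[of l] wv[OF l] l k in simp)
  moreover have "((\<lambda>n. n2 (v l n * v (Suc l) n - v (Suc l) n * v l n)) \<longlongrightarrow> 0) U" if l: "l < Suc k" for l
  proof (rule up_commutator_limit[OF vb vb])
    show "up.up_commutator (cl (v l)) (cl (v (Suc l))) = up.up_embed 0"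
      using w(4)[of l] wv[of l] wv[of "Suc l"] l k by simp
  qed (use l in simp_all)
  moreover have "v 0 = (\<lambda>n. a)" "v (Suc k) = (\<lambda>n. b)" by (simp_all add: v_def)
  ultimately show ?thesis using v by (intro exI[of _ k] exI[of _ v]) blast
qed

text \<open>All chains are taken from \<open>a 0\<close>, which becomes the fixed Haar unitary, to
  the remaining generators \<open>a (Suc j)\<close>.\<close>

lemma singly_generated_of_connected:
  fixes a :: "nat \<Rightarrow> 'h bop"
  assumes a: "\<And>i. a i \<in> lft N" "\<And>i. unit (a i)" and gen: "N = vn_generated (range (\<lambda>i. op_of (a i)))"
    and con: "\<And>i j. i \<noteq> j \<Longrightarrow> up.haar_connected (op_of (a i)) (op_of (a j))"
  shows "singly_generated N"
proof -
  have hl: "\<forall>j. \<exists>k v. (\<forall>l\<le>Suc k. (\<forall>n. v l n \<in> lft N \<and> unit (v l n)) \<and> (\<forall>m\<ge>1. ((\<lambda>n. \<tau> (op_of (v l n ^ m))) \<longlongrightarrow> 0) U)) \<and>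
    v 0 = (\<lambda>n. a 0) \<and> v (Suc k) = (\<lambda>n. a (Suc j)) \<and>
    (\<forall>l<Suc k. ((\<lambda>n. n2 (v l n * v (Suc l) n - v (Suc l) n * v l n)) \<longlongrightarrow> 0) U)"
    by (intro allI haar_connected_lift a con) simp
  interpret h: haar "lft N" "\<lambda>x. \<tau> (op_of x)" "a 0"
  proof
    fix m :: nat assume m: "1 \<le> m"
    \<comment> \<open>The Haar property of \<open>a 0\<close> is read off the start of a chain: a
      constant sequence of moments that tends to 0 along a proper filter is 0.\<close>
    obtain k v where "\<forall>l\<le>Suc k. (\<forall>n. v l n \<in> lft N \<and> unit (v l n)) \<and> (\<forall>m\<ge>1. ((\<lambda>n. \<tau> (op_of (v l n ^ m))) \<longlongrightarrow> 0) U)"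
      "v 0 = (\<lambda>n. a 0)" using hl by blast
    then have "((\<lambda>n. \<tau> (op_of (v 0 n ^ m))) \<longlongrightarrow> 0) U" using m by blast
    then have "((\<lambda>n. \<tau> (op_of (a 0 ^ m))) \<longlongrightarrow> 0) U" using \<open>v 0 = (\<lambda>n. a 0)\<close> by simp
    then show "\<tau> (op_of (a 0 ^ m)) = 0" using U_nb by (simp add: tendsto_const_iff)
  qed (rule a)+
  have "\<forall>j. \<exists>k. h.linked U k (a (Suc j))"
    using hl unfolding h.linked_def h.asymp_haar_def by blast
  then obtain K where K: "\<forall>j. h.linked U (K j) (a (Suc j))" by (rule exE[OF choice])
  have "\<exists>x\<in>lft N. \<forall>S. commutes S x \<longrightarrow> S \<in> comm (lft N)"
  proof (rule h.single_generator[where w = "\<lambda>j. a (Suc j)" and K = K, OF U_nb])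
    show "h.linked U (K j) (a (Suc j))" for j using K by blast
    fix S assume S: "commutes S (a 0)" "\<And>j. commutes S (a (Suc j))"
    have "commutes S (a i)" for i using S by (cases i) auto
    then show "S \<in> comm (lft N)"
      using vn_generated_comm[of N "range a" S] gen by (auto simp: image_image)
  qed (rule a)+
  then show ?thesis using II1N by (auto simp: II1_factor_def factor_def intro: singly_generatedI)
qed

end

theorem theorem1:
  fixes M :: "'h::complex_hilbert op set"
    and \<tau> :: "'h op \<Rightarrow> complex"
    and U :: "nat filter"
    and u :: "nat \<Rightarrow> 'h op"
  assumes "II1_factor M \<tau>"
    and "free_ultrafilter U"
    and "\<And>i. u i \<in> M \<and> unitary_op (u i)"
    and "M = vn_generated (range u)"
    and "\<And>i j. i \<noteq> j \<Longrightarrow> tracial_ultrapower.haar_connected M \<tau> U (u i) (u j)"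
  shows "singly_generated M"
  proof -
  interpret ultra M \<tau> U by standard (fact assms)+
  have "\<forall>i. \<exists>a. a \<in> lft M \<and> u i = op_of a" using op_of_lft[OF N_bounded] assms(3) by blast
  then obtain a where a: "\<forall>i. a i \<in> lft M \<and> u i = op_of (a i)" by (rule exE[OF choice])
  then have ua: "u = (\<lambda>i. op_of (a i))" by auto
  have "unit (a i)" for i
    using assms(3)[of i] by (simp add: ua unitary_op_def unit_def flip: op_of_star times_bop.rep_eq one_bop.rep_eq) (simp add: op_of_inject)
  then show ?thesis using a assms(4,5) unfolding ua by (intro singly_generated_of_connected) auto
qed

end
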